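(* Let $k$ be a field, let $\mathcal{C},\mathcal{D}$ be finite strict tensor categories over $k$, let $F:\mathcal{C}\to\mathcal{D}$ be an exact $k$-linear strict monoidal functor, and let $\mathsf{U}=(U,\rho^U),\mathsf{V}=(V,\rho^V)\in\mathcal{Z}(F)$. For $f\in C^n_{\mathrm{DY}}(F)$ and $g\in C^m_{\mathrm{DY}}(F;\mathsf{U},\mathsf{V})$, the components of $f\triangleright g:=\xi^{-1}\bigl(f\circ\xi(g)\bigr)\in C^{n+m}_{\mathrm{DY}}(F;\mathsf{U},\mathsf{V})$ are $$(f\triangleright g)_{X_1,\dots,X_m,Y_1,\dots,Y_n}=(-1)^{mn}\bigl(\mathrm{id}_{F(X_1)\otimes\cdots\otimes F(X_m)}\otimes\rho^V_{Y_1\otimes\cdots\otimes Y_n}\bigr)\bigl(g_{X_1,\dots,X_m}\otimes f_{Y_1,\dots,Y_n}\bigr).$$ This endows $C^\bullet_{\mathrm{DY}}(F;\mathsf{U},\mathsf{V})$ with a structure of graded $C^\bullet_{\mathrm{DY}}(F)$-module, which descends to a structure of graded $H^\bullet_{\mathrm{DY}}(F)$-module on $H^\bullet_{\mathrm{DY}}(F;\mathsf{U},\mathsf{V})$.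
   Context: A tensor category over $k$ is a $k$-linear abelian rigid monoidal category with $k$-bilinear tensor product whose unit $\mathbf{1}$ is simple with $\mathrm{End}(\mathbf{1})\cong k$. It is finite if it is equivalent, as a $k$-linear category, to finite-dimensional modules over a finite-dimensional $k$-algebra. The left dual ${}^\vee X$ comes with $\widetilde{\mathrm{ev}}_X:X\otimes{}^\vee X\to\mathbf{1}$ and $\widetilde{\mathrm{coev}}_X:\mathbf{1}\to{}^\vee X\otimes X$. Centralizer. A half-braiding relative to $F$ on $V\in\mathcal{D}$ is a natural isomorphism $\rho^V_X:V\otimes F(X)\to F(X)\otimes V$ ($X\in\mathcal{C}$) with $\rho^V_{X\otimes Y}=(\mathrm{id}_{F(X)}\otimes\rho^V_Y)(\rho^V_X\otimes\mathrm{id}_{F(Y)})$. $\mathcal{Z}(F)$ is the tensor category of pairs $\mathsf{V}=(V,\rho^V)$, with morphisms those of $\mathcal{D}$ commuting with half-braidings, and $\rho^{V\otimes W}=(\rho^V\otimes\mathrm{id}_W)(\mathrm{id}_V\otimes\rho^W)$. The left dual is ${}^\vee\mathsf{V}=({}^\vee V,\rho^{{}^\vee V})$, where $\rho^{{}^\vee V}$ is the unique half-braiding making $\widetilde{\mathrm{ev}}_V$ and $\widetilde{\mathrm{coev}}_V$ morphisms in $\mathcal{Z}(F)$. DY complex. $C^n_{\mathrm{DY}}(F;\mathsf{U},\mathsf{V})$ is the space of natural transformations $f_{X_1,\dots,X_n}:U\otimes F(X_1)\otimes\cdots\otimes F(X_n)\to F(X_1)\otimes\cdots\otimes F(X_n)\otimes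 V$ (for $n=0$: $\mathrm{Hom}_{\mathcal{D}}(U,V)$), with $$\delta^n(f)_{X_0,\dots,X_n}=(\mathrm{id}_{F(X_0)}\otimes f_{X_1,\dots,X_n})(\rho^U_{X_0}\otimes\mathrm{id})+\sum_{i=1}^n(-1)^if_{X_0,\dots,X_{i-1}\otimes X_i,\dots,X_n}+(-1)^{n+1}(\mathrm{id}\otimes\rho^V_{X_n})(f_{X_0,\dots,X_{n-1}}\otimes\mathrm{id}_{F(X_n)}).$$ $H^n_{\mathrm{DY}}$ denotes cohomology, $C^\bullet_{\mathrm{DY}}=\bigoplus_nC^n_{\mathrm{DY}}$, $H^\bullet_{\mathrm{DY}}=\bigoplus_nH^n_{\mathrm{DY}}$; omitted coefficients mean $\mathsf{U}=\mathsf{V}=\mathbf{1}$. Product. For $f\in C^n_{\mathrm{DY}}(F;\mathsf{V},\mathsf{W})$ and $g\in C^m_{\mathrm{DY}}(F;\mathsf{U},\mathsf{V})$, $f\circ g\in C^{n+m}_{\mathrm{DY}}(F;\mathsf{U},\mathsf{W})$ is $$(f\circ g)_{X_1,\dots,X_m,Y_1,\dots,Y_n}=(-1)^{nm}(\mathrm{id}_{F(X_1)\otimes\cdots\otimes F(X_m)}\otimes f_{Y_1,\dots,Y_n})(g_{X_1,\dots,X_m}\otimes\mathrm{id}_{F(Y_1)\otimes\cdots\otimes F(Y_n)}).$$ With it, $C^\bullet_{\mathrm{DY}}(F)$ and $H^\bullet_{\mathrm{DY}}(F)$ are graded associative algebras. Isomorphism $\xi$. $\xi:C^n_{\mathrm{DY}}(F;\mathsf{U},\mathsf{V})\to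 C^n_{\mathrm{DY}}(F;\mathsf{U}\otimes{}^\vee\mathsf{V},\mathbf{1})$ is the isomorphism of complexes $$\xi(g)_{X_1,\dots,X_n}=(\mathrm{id}_{F(X_1)\otimes\cdots\otimes F(X_n)}\otimes\widetilde{\mathrm{ev}}_V)(g_{X_1,\dots,X_n}\otimes\mathrm{id}_{{}^\vee V})(\mathrm{id}_U\otimes\rho^{{}^\vee V}_{X_1\otimes\cdots\otimes X_n}).$$
   Formalization: The printed component formula fails in general (f need not commute with ρ^V). Proved instead: (f▷g)_{X,Y} = (-1)^{mn}(id⊗f_Y⊗id_V)(id⊗ρ^V_Y)(g_X⊗id), with f after ρ^V; the printed formula is asserted only when (f_Y⊗id_V)ρ^V_Y = ρ^V_Y(id_V⊗f_Y). *)

theory Defs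
  imports "HOL-Algebra.Module" "HOL-Algebra.QuotRing"
begin

section \<open>Linear algebra\<close>

text \<open>
  The record \<^typ>\<open>('k, 'v) module\<close> of HOL-Algebra carries ring operations; where only a module is
  meant, the fields \<^const>\<open>mult\<close> and \<^const>\<open>one\<close> are irrelevant. Vector spaces are modules over a field.
\<close>

definition with_action :: "('k, 'v, 'z) module_scheme \<Rightarrow> ('a \<Rightarrow> 'v \<Rightarrow> 'v) \<Rightarrow> ('a, 'v) module" where
  "with_action M act = \<lparr>carrier = carrier M, mult = mult M, one = one M, zero = zero M, add = add M, smult = act\<rparr>"

definition finite_dimensional :: "('k, 'y) ring_scheme \<Rightarrow> ('k, 'v, 'z) module_scheme \<Rightarrow> bool" where
  "finite_dimensional K M \<longleftrightarrow> module K M \<and>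
     (\<exists>S. finite S \<and> S \<subseteq> carrier M \<and>
       (\<forall>x\<in>carrier M. \<exists>a\<in>S \<rightarrow> carrier K. x = (\<Oplus>\<^bsub>M\<^esub>s\<in>S. a s \<odot>\<^bsub>M\<^esub> s)))"

text \<open>The locale \<^locale>\<open>algebra\<close> of HOL-Algebra is restricted to commutative algebras.\<close>

definition assoc_algebra :: "('k, 'y) ring_scheme \<Rightarrow> ('k, 'a, 'z) module_scheme \<Rightarrow> bool" where
  "assoc_algebra K A \<longleftrightarrow> module K A \<and> ring A \<and>
     (\<forall>c\<in>carrier K. \<forall>x\<in>carrier A. \<forall>y\<in>carrier A.
        (c \<odot>\<^bsub>A\<^esub> x) \<otimes>\<^bsub>A\<^esub> y = c \<odot>\<^bsub>A\<^esub> (x \<otimes>\<^bsub>A\<^esub> y) \<and> x \<otimes>\<^bsub>A\<^esub> (c \<odot>\<^bsub>A\<^esub> y) = c \<odot>\<^bsub>A\<^esub> (x \<otimes>\<^bsub>A\<^esub> y))"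

text \<open>The locale \<^locale>\<open>module\<close> requires commutative scalars; here the scalars form any ring.\<close>

definition left_module :: "('a, 'y) ring_scheme \<Rightarrow> ('a, 'v, 'z) module_scheme \<Rightarrow> bool" where
  "left_module A M \<longleftrightarrow> ring A \<and> abelian_group M \<and>
     (\<forall>a\<in>carrier A. \<forall>x\<in>carrier M. a \<odot>\<^bsub>M\<^esub> x \<in> carrier M) \<and>
     (\<forall>a\<in>carrier A. \<forall>b\<in>carrier A. \<forall>x\<in>carrier M.
        (a \<oplus>\<^bsub>A\<^esub> b) \<odot>\<^bsub>M\<^esub> x = a \<odot>\<^bsub>M\<^esub> x \<oplus>\<^bsub>M\<^esub> b \<odot>\<^bsub>M\<^esub> x \<and>
        (a \<otimes>\<^bsub>A\<^esub> b) \<odot>\<^bsub>M\<^esub> x = a \<odot>\<^bsub>M\<^esub> (b \<odot>\<^bsub>M\<^esub> x)) \<and>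
     (\<forall>a\<in>carrier A. \<forall>x\<in>carrier M. \<forall>y\<in>carrier M.
        a \<odot>\<^bsub>M\<^esub> (x \<oplus>\<^bsub>M\<^esub> y) = a \<odot>\<^bsub>M\<^esub> x \<oplus>\<^bsub>M\<^esub> a \<odot>\<^bsub>M\<^esub> y) \<and>
     (\<forall>x\<in>carrier M. \<one>\<^bsub>A\<^esub> \<odot>\<^bsub>M\<^esub> x = x)"

definition linear_maps ::
  "('a, 'y) ring_scheme \<Rightarrow> ('a, 'v, 'z) module_scheme \<Rightarrow> ('a, 'w, 'u) module_scheme \<Rightarrow> ('v \<Rightarrow> 'w) set" where
  "linear_maps A M N = {f \<in> carrier M \<rightarrow>\<^sub>E carrier N.
     (\<forall>x\<in>carrier M. \<forall>y\<in>carrier M. f (x \<oplus>\<^bsub>M\<^esub> y) = f x \<oplus>\<^bsub>N\<^esub> f y) \<and>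
     (\<forall>a\<in>carrier A. \<forall>x\<in>carrier M. f (a \<odot>\<^bsub>M\<^esub> x) = a \<odot>\<^bsub>N\<^esub> f x)}"

definition quotient_module :: "('k, 'v, 'z) module_scheme \<Rightarrow> 'v set \<Rightarrow> ('k, 'v set) module" where
  "quotient_module M N = \<lparr>carrier = a_rcosets\<^bsub>M\<^esub> N, mult = (\<lambda>_ _. undefined), one = undefined,
     zero = N, add = set_add M, smult = (\<lambda>c X. \<Union>x\<in>X. N +>\<^bsub>M\<^esub> (c \<odot>\<^bsub>M\<^esub> x))\<rparr>"

text \<open>
  The operation induced on cosets, in the style of \<^const>\<open>rcoset_mult\<close>; \<open>N\<close> is the submodule of the target
  by which one divides.
\<close>

definition coset_op ::
  "('k, 'w, 'z) module_scheme \<Rightarrow> 'w set \<Rightarrow> ('u \<Rightarrow> 'v \<Rightarrow> 'w) \<Rightarrow> 'u set \<Rightarrow> 'v set \<Rightarrow> 'w set" where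
  "coset_op M N \<mu> X Y = (\<Union>x\<in>X. \<Union>y\<in>Y. N +>\<^bsub>M\<^esub> \<mu> x y)"

definition alt_sign :: "('a, 'z) ring_scheme \<Rightarrow> nat \<Rightarrow> 'a \<Rightarrow> 'a" where
  "alt_sign M n x = (if even n then x else \<ominus>\<^bsub>M\<^esub> x)"


section \<open>Graded algebras and modules\<close>

definition direct_sum :: "(nat \<Rightarrow> ('k, 'v, 'z) module_scheme) \<Rightarrow> ('k, nat \<Rightarrow> 'v) module" where
  "direct_sum M = \<lparr>carrier = {x. (\<forall>n. x n \<in> carrier (M n)) \<and> finite {n. x n \<noteq> \<zero>\<^bsub>M n\<^esub>}},
     mult = (\<lambda>_ _. undefined), one = undefined,
     zero = (\<lambda>n. \<zero>\<^bsub>M n\<^esub>), add = (\<lambda>x y n. x n \<oplus>\<^bsub>M n\<^esub> y n), smult = (\<lambda>c x n. c \<odot>\<^bsub>M n\<^esub> x n)\<rparr>"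

definition homogeneous :: "(nat \<Rightarrow> ('k, 'v, 'z) module_scheme) \<Rightarrow> nat \<Rightarrow> 'v \<Rightarrow> (nat \<Rightarrow> 'v)" where
  "homogeneous M n x = (\<lambda>p. if p = n then x else \<zero>\<^bsub>M p\<^esub>)"

definition graded_part :: "(nat \<Rightarrow> ('k, 'v, 'z) module_scheme) \<Rightarrow> nat \<Rightarrow> (nat \<Rightarrow> 'v) set" where
  "graded_part M n = homogeneous M n ` carrier (M n)"

text \<open>
  The biadditive extension to direct sums of operations \<open>\<mu> n m\<close> that take degrees \<open>n\<close> and \<open>m\<close>
  to degree \<open>n + m\<close>; \<open>M\<close> is the family of target modules.
\<close>

definition convolution ::
  "(nat \<Rightarrow> ('k, 'w, 'z) module_scheme) \<Rightarrow> (nat \<Rightarrow> nat \<Rightarrow> 'u \<Rightarrow> 'v \<Rightarrow> 'w) \<Rightarrow> (nat \<Rightarrow> 'u) \<Rightarrow> (nat \<Rightarrow> 'v) \<Rightarrow> (nat \<Rightarrow> 'w)" where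
  "convolution M \<mu> x y = (\<lambda>p. \<Oplus>\<^bsub>M p\<^esub>n\<in>{..p}. \<mu> n (p - n) (x n) (y (p - n)))"

definition grading :: "('k, 'y) ring_scheme \<Rightarrow> ('k, 'v, 'z) module_scheme \<Rightarrow> (nat \<Rightarrow> 'v set) \<Rightarrow> bool" where
  "grading K M gr \<longleftrightarrow> (\<forall>n. submodule (gr n) K M) \<and>
     (\<forall>x\<in>carrier M. \<exists>!u. (\<forall>n. u n \<in> gr n) \<and> finite {n. u n \<noteq> \<zero>\<^bsub>M\<^esub>} \<and>
        x = (\<Oplus>\<^bsub>M\<^esub>n\<in>{n. u n \<noteq> \<zero>\<^bsub>M\<^esub>}. u n))"

definition graded_algebra :: "('k, 'y) ring_scheme \<Rightarrow> ('k, 'a, 'z) module_scheme \<Rightarrow> (nat \<Rightarrow> 'a set) \<Rightarrow> bool" where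
  "graded_algebra K A gr \<longleftrightarrow> assoc_algebra K A \<and> grading K A gr \<and> \<one>\<^bsub>A\<^esub> \<in> gr 0 \<and>
     (\<forall>n m. \<forall>a\<in>gr n. \<forall>b\<in>gr m. a \<otimes>\<^bsub>A\<^esub> b \<in> gr (n + m))"

definition graded_module ::
  "('k, 'y) ring_scheme \<Rightarrow> ('k, 'a, 'z) module_scheme \<Rightarrow> (nat \<Rightarrow> 'a set) \<Rightarrow>
   ('k, 'v, 'u) module_scheme \<Rightarrow> (nat \<Rightarrow> 'v set) \<Rightarrow> ('a \<Rightarrow> 'v \<Rightarrow> 'v) \<Rightarrow> bool" where
  "graded_module K A grA M grM act \<longleftrightarrow>
     graded_algebra K A grA \<and> module K M \<and> left_module A (with_action M act) \<and>
     (\<forall>c\<in>carrier K. \<forall>a\<in>carrier A. \<forall>x\<in>carrier M.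
        act (c \<odot>\<^bsub>A\<^esub> a) x = c \<odot>\<^bsub>M\<^esub> act a x \<and> act a (c \<odot>\<^bsub>M\<^esub> x) = c \<odot>\<^bsub>M\<^esub> act a x) \<and>
     grading K M grM \<and> (\<forall>n m. \<forall>a\<in>grA n. \<forall>x\<in>grM m. act a x \<in> grM (n + m))"


section \<open>Linear and abelian categories\<close>

text \<open>
  Hom-sets are not required to be disjoint: every statement about an arrow mentions its source and target.
  Composition is written in the usual order, \<open>g \<cdot> f\<close> being \<open>f\<close> followed by \<open>g\<close>.
\<close>

record ('k, 'o, 'm) lin_cat =
  Obj :: "'o set"
  Hom :: "'o \<Rightarrow> 'o \<Rightarrow> ('k, 'm) module"
  Comp :: "'m \<Rightarrow> 'm \<Rightarrow> 'm"  (infixl "\<cdot>\<index>" 70)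
  Id :: "'o \<Rightarrow> 'm"

abbreviation arr :: "('k, 'o, 'm, 'z) lin_cat_scheme \<Rightarrow> 'o \<Rightarrow> 'o \<Rightarrow> 'm set" where
  "arr C X Y \<equiv> carrier (Hom C X Y)"

locale linear_category =
  fixes K :: "'k ring" and C :: "('k, 'o, 'm, 'z) lin_cat_scheme" (structure)
  assumes field_K: "field K"
    and hom_module: "\<lbrakk>X \<in> Obj C; Y \<in> Obj C\<rbrakk> \<Longrightarrow> module K (Hom C X Y)"
    and id_arr: "X \<in> Obj C \<Longrightarrow> Id C X \<in> arr C X X"
    and comp_arr: "\<lbrakk>X \<in> Obj C; Y \<in> Obj C; Z \<in> Obj C; f \<in> arr C X Y; g \<in> arr C Y Z\<rbrakk> \<Longrightarrow> g \<cdot> f \<in> arr C X Z"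
    and id_left: "\<lbrakk>X \<in> Obj C; Y \<in> Obj C; f \<in> arr C X Y\<rbrakk> \<Longrightarrow> Id C Y \<cdot> f = f"
    and id_right: "\<lbrakk>X \<in> Obj C; Y \<in> Obj C; f \<in> arr C X Y\<rbrakk> \<Longrightarrow> f \<cdot> Id C X = f"
    and comp_assoc: "\<lbrakk>W \<in> Obj C; X \<in> Obj C; Y \<in> Obj C; Z \<in> Obj C;
          f \<in> arr C W X; g \<in> arr C X Y; h \<in> arr C Y Z\<rbrakk> \<Longrightarrow> h \<cdot> g \<cdot> f = h \<cdot> (g \<cdot> f)"
    and comp_add_left: "\<lbrakk>X \<in> Obj C; Y \<in> Obj C; Z \<in> Obj C; f \<in> arr C X Y; g \<in> arr C Y Z; g' \<in> arr C Y Z\<rbrakk>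
          \<Longrightarrow> (g \<oplus>\<^bsub>Hom C Y Z\<^esub> g') \<cdot> f = g \<cdot> f \<oplus>\<^bsub>Hom C X Z\<^esub> g' \<cdot> f"
    and comp_add_right: "\<lbrakk>X \<in> Obj C; Y \<in> Obj C; Z \<in> Obj C; f \<in> arr C X Y; f' \<in> arr C X Y; g \<in> arr C Y Z\<rbrakk>
          \<Longrightarrow> g \<cdot> (f \<oplus>\<^bsub>Hom C X Y\<^esub> f') = g \<cdot> f \<oplus>\<^bsub>Hom C X Z\<^esub> g \<cdot> f'"
    and comp_smult_left: "\<lbrakk>X \<in> Obj C; Y \<in> Obj C; Z \<in> Obj C; c \<in> carrier K; f \<in> arr C X Y; g \<in> arr C Y Z\<rbrakk>
          \<Longrightarrow> (c \<odot>\<^bsub>Hom C Y Z\<^esub> g) \<cdot> f = c \<odot>\<^bsub>Hom C X Z\<^esub> (g \<cdot> f)"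
    and comp_smult_right: "\<lbrakk>X \<in> Obj C; Y \<in> Obj C; Z \<in> Obj C; c \<in> carrier K; f \<in> arr C X Y; g \<in> arr C Y Z\<rbrakk>
          \<Longrightarrow> g \<cdot> (c \<odot>\<^bsub>Hom C X Y\<^esub> f) = c \<odot>\<^bsub>Hom C X Z\<^esub> (g \<cdot> f)"

definition iso_arr :: "('k, 'o, 'm, 'z) lin_cat_scheme \<Rightarrow> 'o \<Rightarrow> 'o \<Rightarrow> 'm \<Rightarrow> bool" where
  "iso_arr C X Y f \<longleftrightarrow> f \<in> arr C X Y \<and> (\<exists>g\<in>arr C Y X. g \<cdot>\<^bsub>C\<^esub> f = Id C X \<and> f \<cdot>\<^bsub>C\<^esub> g = Id C Y)"

definition mono_arr :: "('k, 'o, 'm, 'z) lin_cat_scheme \<Rightarrow> 'o \<Rightarrow> 'o \<Rightarrow> 'm \<Rightarrow> bool" where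
  "mono_arr C X Y f \<longleftrightarrow> f \<in> arr C X Y \<and>
     (\<forall>W\<in>Obj C. \<forall>g\<in>arr C W X. \<forall>h\<in>arr C W X. f \<cdot>\<^bsub>C\<^esub> g = f \<cdot>\<^bsub>C\<^esub> h \<longrightarrow> g = h)"

definition epi_arr :: "('k, 'o, 'm, 'z) lin_cat_scheme \<Rightarrow> 'o \<Rightarrow> 'o \<Rightarrow> 'm \<Rightarrow> bool" where
  "epi_arr C X Y f \<longleftrightarrow> f \<in> arr C X Y \<and>
     (\<forall>W\<in>Obj C. \<forall>g\<in>arr C Y W. \<forall>h\<in>arr C Y W. g \<cdot>\<^bsub>C\<^esub> f = h \<cdot>\<^bsub>C\<^esub> f \<longrightarrow> g = h)"

definition zero_object :: "('k, 'o, 'm, 'z) lin_cat_scheme \<Rightarrow> 'o \<Rightarrow> bool" where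
  "zero_object C Z \<longleftrightarrow> Z \<in> Obj C \<and> (\<forall>X\<in>Obj C. (\<exists>!f. f \<in> arr C X Z) \<and> (\<exists>!f. f \<in> arr C Z X))"

definition is_biproduct :: "('k, 'o, 'm, 'z) lin_cat_scheme \<Rightarrow> 'o \<Rightarrow> 'o \<Rightarrow> 'o \<Rightarrow> bool" where
  "is_biproduct C X Y P \<longleftrightarrow> P \<in> Obj C \<and>
     (\<exists>i\<in>arr C X P. \<exists>j\<in>arr C Y P. \<exists>p\<in>arr C P X. \<exists>q\<in>arr C P Y.
        p \<cdot>\<^bsub>C\<^esub> i = Id C X \<and> q \<cdot>\<^bsub>C\<^esub> j = Id C Y \<and>
        q \<cdot>\<^bsub>C\<^esub> i = \<zero>\<^bsub>Hom C X Y\<^esub> \<and> p \<cdot>\<^bsub>C\<^esub> j = \<zero>\<^bsub>Hom C Y X\<^esub> \<and>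
        i \<cdot>\<^bsub>C\<^esub> p \<oplus>\<^bsub>Hom C P P\<^esub> j \<cdot>\<^bsub>C\<^esub> q = Id C P)"

text \<open>\<open>is_kernel C N X Y n f\<close> says that \<open>n : N \<rightarrow> X\<close> is a kernel of \<open>f : X \<rightarrow> Y\<close>; similarly for
  \<open>is_cokernel C X Y Q f q\<close> with \<open>q : Y \<rightarrow> Q\<close>.\<close>

definition is_kernel :: "('k, 'o, 'm, 'z) lin_cat_scheme \<Rightarrow> 'o \<Rightarrow> 'o \<Rightarrow> 'o \<Rightarrow> 'm \<Rightarrow> 'm \<Rightarrow> bool" where
  "is_kernel C N X Y n f \<longleftrightarrow> n \<in> arr C N X \<and> f \<in> arr C X Y \<and> f \<cdot>\<^bsub>C\<^esub> n = \<zero>\<^bsub>Hom C N Y\<^esub> \<and>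
     (\<forall>W\<in>Obj C. \<forall>g\<in>arr C W X. f \<cdot>\<^bsub>C\<^esub> g = \<zero>\<^bsub>Hom C W Y\<^esub> \<longrightarrow> (\<exists>!u. u \<in> arr C W N \<and> n \<cdot>\<^bsub>C\<^esub> u = g))"

definition is_cokernel :: "('k, 'o, 'm, 'z) lin_cat_scheme \<Rightarrow> 'o \<Rightarrow> 'o \<Rightarrow> 'o \<Rightarrow> 'm \<Rightarrow> 'm \<Rightarrow> bool" where
  "is_cokernel C X Y Q f q \<longleftrightarrow> f \<in> arr C X Y \<and> q \<in> arr C Y Q \<and> q \<cdot>\<^bsub>C\<^esub> f = \<zero>\<^bsub>Hom C X Q\<^esub> \<and>
     (\<forall>W\<in>Obj C. \<forall>g\<in>arr C Y W. g \<cdot>\<^bsub>C\<^esub> f = \<zero>\<^bsub>Hom C X W\<^esub> \<longrightarrow> (\<exists>!u. u \<in> arr C Q W \<and> u \<cdot>\<^bsub>C\<^esub> q = g))"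

locale abelian_category = linear_category +
  assumes ex_zero_object: "\<exists>Z. zero_object C Z"
    and ex_biproduct: "\<lbrakk>X \<in> Obj C; Y \<in> Obj C\<rbrakk> \<Longrightarrow> \<exists>P. is_biproduct C X Y P"
    and ex_kernel: "\<lbrakk>X \<in> Obj C; Y \<in> Obj C; f \<in> arr C X Y\<rbrakk> \<Longrightarrow> \<exists>N\<in>Obj C. \<exists>n. is_kernel C N X Y n f"
    and ex_cokernel: "\<lbrakk>X \<in> Obj C; Y \<in> Obj C; f \<in> arr C X Y\<rbrakk> \<Longrightarrow> \<exists>Q\<in>Obj C. \<exists>q. is_cokernel C X Y Q f q"
    and mono_is_kernel: "\<lbrakk>X \<in> Obj C; Y \<in> Obj C; mono_arr C X Y f\<rbrakk> \<Longrightarrow> \<exists>Z\<in>Obj C. \<exists>g. is_kernel C X Y Z f g"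
    and epi_is_cokernel: "\<lbrakk>X \<in> Obj C; Y \<in> Obj C; epi_arr C X Y f\<rbrakk> \<Longrightarrow> \<exists>W\<in>Obj C. \<exists>g. is_cokernel C W X Y g f"

definition simple_object :: "('k, 'o, 'm, 'z) lin_cat_scheme \<Rightarrow> 'o \<Rightarrow> bool" where
  "simple_object C X \<longleftrightarrow> X \<in> Obj C \<and> \<not> zero_object C X \<and>
     (\<forall>Y\<in>Obj C. \<forall>f. mono_arr C Y X f \<longrightarrow> zero_object C Y \<or> iso_arr C Y X f)"

definition End_algebra :: "('k, 'o, 'm, 'z) lin_cat_scheme \<Rightarrow> 'o \<Rightarrow> ('k, 'm) module" where
  "End_algebra C X = (Hom C X X)\<lparr>mult := Comp C, one := Id C X\<rparr>"

record ('o, 'm, 'p, 'n) func =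
  FO :: "'o \<Rightarrow> 'p"
  FA :: "'m \<Rightarrow> 'n"

locale linear_functor = A: linear_category K C + B: linear_category K D
  for K :: "'k ring" and C :: "('k, 'o, 'm, 'z) lin_cat_scheme" and D :: "('k, 'p, 'n, 'y) lin_cat_scheme" +
  fixes F :: "('o, 'm, 'p, 'n) func"
  assumes F_obj: "X \<in> Obj C \<Longrightarrow> FO F X \<in> Obj D"
    and F_arr: "\<lbrakk>X \<in> Obj C; Y \<in> Obj C; f \<in> arr C X Y\<rbrakk> \<Longrightarrow> FA F f \<in> arr D (FO F X) (FO F Y)"
    and F_id: "X \<in> Obj C \<Longrightarrow> FA F (Id C X) = Id D (FO F X)"
    and F_comp: "\<lbrakk>X \<in> Obj C; Y \<in> Obj C; Z \<in> Obj C; f \<in> arr C X Y; g \<in> arr C Y Z\<rbrakk>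
          \<Longrightarrow> FA F (g \<cdot>\<^bsub>C\<^esub> f) = FA F g \<cdot>\<^bsub>D\<^esub> FA F f"
    and F_add: "\<lbrakk>X \<in> Obj C; Y \<in> Obj C; f \<in> arr C X Y; g \<in> arr C X Y\<rbrakk>
          \<Longrightarrow> FA F (f \<oplus>\<^bsub>Hom C X Y\<^esub> g) = FA F f \<oplus>\<^bsub>Hom D (FO F X) (FO F Y)\<^esub> FA F g"
    and F_smult: "\<lbrakk>X \<in> Obj C; Y \<in> Obj C; c \<in> carrier K; f \<in> arr C X Y\<rbrakk>
          \<Longrightarrow> FA F (c \<odot>\<^bsub>Hom C X Y\<^esub> f) = c \<odot>\<^bsub>Hom D (FO F X) (FO F Y)\<^esub> FA F f"

definition short_exact :: "('k, 'o, 'm, 'z) lin_cat_scheme \<Rightarrow> 'o \<Rightarrow> 'o \<Rightarrow> 'o \<Rightarrow> 'm \<Rightarrow> 'm \<Rightarrow> bool" where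
  "short_exact C X Y Z f g \<longleftrightarrow> is_kernel C X Y Z f g \<and> is_cokernel C X Y Z f g"

definition exact_functor ::
  "('k, 'o, 'm, 'z) lin_cat_scheme \<Rightarrow> ('k, 'p, 'n, 'y) lin_cat_scheme \<Rightarrow> ('o, 'm, 'p, 'n) func \<Rightarrow> bool" where
  "exact_functor C D F \<longleftrightarrow> (\<forall>X\<in>Obj C. \<forall>Y\<in>Obj C. \<forall>Z\<in>Obj C. \<forall>f g.
     short_exact C X Y Z f g \<longrightarrow> short_exact D (FO F X) (FO F Y) (FO F Z) (FA F f) (FA F g))"

definition natural_iso ::
  "('k, 'o, 'm, 'z) lin_cat_scheme \<Rightarrow> ('k, 'p, 'n, 'y) lin_cat_scheme \<Rightarrow>
   ('o, 'm, 'p, 'n) func \<Rightarrow> ('o, 'm, 'p, 'n) func \<Rightarrow> ('o \<Rightarrow> 'n) \<Rightarrow> bool" where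
  "natural_iso C D F G \<eta> \<longleftrightarrow> (\<forall>X\<in>Obj C. iso_arr D (FO F X) (FO G X) (\<eta> X)) \<and>
     (\<forall>X\<in>Obj C. \<forall>Y\<in>Obj C. \<forall>f\<in>arr C X Y. FA G f \<cdot>\<^bsub>D\<^esub> \<eta> X = \<eta> Y \<cdot>\<^bsub>D\<^esub> FA F f)"

definition id_func :: "('o, 'm, 'o, 'm) func" where
  "id_func = \<lparr>FO = (\<lambda>X. X), FA = (\<lambda>f. f)\<rparr>"

definition comp_func :: "('p, 'n, 'q, 'l) func \<Rightarrow> ('o, 'm, 'p, 'n) func \<Rightarrow> ('o, 'm, 'q, 'l) func" where
  "comp_func G F = \<lparr>FO = FO G \<circ> FO F, FA = FA G \<circ> FA F\<rparr>"

definition linearly_equivalent ::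
  "'k ring \<Rightarrow> ('k, 'o, 'm, 'z) lin_cat_scheme \<Rightarrow> ('k, 'p, 'n, 'y) lin_cat_scheme \<Rightarrow> bool" where
  "linearly_equivalent K C D \<longleftrightarrow> (\<exists>F G \<eta> \<epsilon>. linear_functor K C D F \<and> linear_functor K D C G \<and>
     natural_iso C C id_func (comp_func G F) \<eta> \<and> natural_iso D D (comp_func F G) id_func \<epsilon>)"

text \<open>
  Finite-dimensional left modules over a \<open>K\<close>-algebra \<open>A\<close>, with \<open>A\<close>-linear maps. An arrow remembers its
  source and target, since composition needs the carrier of the source.
\<close>

definition fin_dim_module :: "('k, 'y) ring_scheme \<Rightarrow> ('k, 'a, 'z) module_scheme \<Rightarrow> ('a, 'v) module \<Rightarrow> bool" where
  "fin_dim_module K A M \<longleftrightarrow> left_module A M \<and>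
     finite_dimensional K (with_action M (\<lambda>c x. (c \<odot>\<^bsub>A\<^esub> \<one>\<^bsub>A\<^esub>) \<odot>\<^bsub>M\<^esub> x))"

definition fin_dim_modules ::
  "'k ring \<Rightarrow> ('k, 'a) module \<Rightarrow>
   ('k, ('a, 'v) module, ('a, 'v) module \<times> ('a, 'v) module \<times> ('v \<Rightarrow> 'v)) lin_cat" where
  "fin_dim_modules K A = \<lparr>
     Obj = {M. fin_dim_module K A M},
     Hom = (\<lambda>M N. \<lparr>
       carrier = {(M, N, f) | f. f \<in> linear_maps A M N},
       mult = (\<lambda>_ _. undefined), one = undefined,
       zero = (M, N, \<lambda>x\<in>carrier M. \<zero>\<^bsub>N\<^esub>),
       add = (\<lambda>(_, _, f) (_, _, g). (M, N, \<lambda>x\<in>carrier M. f x \<oplus>\<^bsub>N\<^esub> g x)),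
       smult = (\<lambda>c (_, _, f). (M, N, \<lambda>x\<in>carrier M. (c \<odot>\<^bsub>A\<^esub> \<one>\<^bsub>A\<^esub>) \<odot>\<^bsub>N\<^esub> f x))\<rparr>),
     Comp = (\<lambda>(_, P, g) (M, _, f). (M, P, compose (carrier M) g f)),
     Id = (\<lambda>M. (M, M, \<lambda>x\<in>carrier M. x))\<rparr>"

text \<open>
  The algebra and its modules are taken with carriers in \<^typ>\<open>nat \<Rightarrow> 'k\<close>, a type that contains a copy of
  every finite-dimensional vector space over \<open>K\<close>.
\<close>

definition finite_linear_category :: "'k ring \<Rightarrow> ('k, 'o, 'm, 'z) lin_cat_scheme \<Rightarrow> bool" where
  "finite_linear_category K C \<longleftrightarrow>
     (\<exists>A :: ('k, nat \<Rightarrow> 'k) module. assoc_algebra K A \<and> finite_dimensional K A \<and>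
        linearly_equivalent K C
          (fin_dim_modules K A :: ('k, (nat \<Rightarrow> 'k, nat \<Rightarrow> 'k) module, _) lin_cat))"


section \<open>Strict tensor categories\<close>

record ('k, 'o, 'm) mon_cat = "('k, 'o, 'm) lin_cat" +
  TObj :: "'o \<Rightarrow> 'o \<Rightarrow> 'o"  (infixr "\<boxtimes>\<index>" 75)
  TArr :: "'m \<Rightarrow> 'm \<Rightarrow> 'm"  (infixr "\<star>\<index>" 75)
  Unit :: "'o"

text \<open>
  \<open>left_dual C X Y e c\<close> says that \<open>Y\<close> is a left dual of \<open>X\<close> with evaluation \<open>e : X \<boxtimes> Y \<rightarrow> Unit\<close> and
  coevaluation \<open>c : Unit \<rightarrow> Y \<boxtimes> X\<close>, equivalently that \<open>X\<close> is a right dual of \<open>Y\<close>.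
\<close>

definition left_dual :: "('k, 'o, 'm, 'z) mon_cat_scheme \<Rightarrow> 'o \<Rightarrow> 'o \<Rightarrow> 'm \<Rightarrow> 'm \<Rightarrow> bool" where
  "left_dual C X Y e c \<longleftrightarrow> Y \<in> Obj C \<and> e \<in> arr C (X \<boxtimes>\<^bsub>C\<^esub> Y) (Unit C) \<and> c \<in> arr C (Unit C) (Y \<boxtimes>\<^bsub>C\<^esub> X) \<and>
     (e \<star>\<^bsub>C\<^esub> Id C X) \<cdot>\<^bsub>C\<^esub> (Id C X \<star>\<^bsub>C\<^esub> c) = Id C X \<and>
     (Id C Y \<star>\<^bsub>C\<^esub> e) \<cdot>\<^bsub>C\<^esub> (c \<star>\<^bsub>C\<^esub> Id C Y) = Id C Y"

locale strict_tensor_category = abelian_category K C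
  for K :: "'k ring" and C :: "('k, 'o, 'm, 'z) mon_cat_scheme" (structure) +
  assumes unit_obj: "Unit C \<in> Obj C"
    and tens_obj: "\<lbrakk>X \<in> Obj C; Y \<in> Obj C\<rbrakk> \<Longrightarrow> X \<boxtimes> Y \<in> Obj C"
    and tens_obj_assoc: "\<lbrakk>X \<in> Obj C; Y \<in> Obj C; Z \<in> Obj C\<rbrakk> \<Longrightarrow> (X \<boxtimes> Y) \<boxtimes> Z = X \<boxtimes> (Y \<boxtimes> Z)"
    and unit_obj_left: "X \<in> Obj C \<Longrightarrow> Unit C \<boxtimes> X = X"
    and unit_obj_right: "X \<in> Obj C \<Longrightarrow> X \<boxtimes> Unit C = X"
    and tens_arr: "\<lbrakk>X \<in> Obj C; Y \<in> Obj C; X' \<in> Obj C; Y' \<in> Obj C; f \<in> arr C X Y; f' \<in> arr C X' Y'\<rbrakk>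
          \<Longrightarrow> f \<star> f' \<in> arr C (X \<boxtimes> X') (Y \<boxtimes> Y')"
    and tens_id: "\<lbrakk>X \<in> Obj C; Y \<in> Obj C\<rbrakk> \<Longrightarrow> Id C X \<star> Id C Y = Id C (X \<boxtimes> Y)"
    and tens_comp: "\<lbrakk>X \<in> Obj C; Y \<in> Obj C; Z \<in> Obj C; X' \<in> Obj C; Y' \<in> Obj C; Z' \<in> Obj C;
          f \<in> arr C X Y; g \<in> arr C Y Z; f' \<in> arr C X' Y'; g' \<in> arr C Y' Z'\<rbrakk>
          \<Longrightarrow> (g \<cdot> f) \<star> (g' \<cdot> f') = (g \<star> g') \<cdot> (f \<star> f')"
    and tens_arr_assoc: "\<lbrakk>X \<in> Obj C; X' \<in> Obj C; Y \<in> Obj C; Y' \<in> Obj C; Z \<in> Obj C; Z' \<in> Obj C;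
          f \<in> arr C X X'; g \<in> arr C Y Y'; h \<in> arr C Z Z'\<rbrakk> \<Longrightarrow> (f \<star> g) \<star> h = f \<star> (g \<star> h)"
    and unit_arr_left: "\<lbrakk>X \<in> Obj C; Y \<in> Obj C; f \<in> arr C X Y\<rbrakk> \<Longrightarrow> Id C (Unit C) \<star> f = f"
    and unit_arr_right: "\<lbrakk>X \<in> Obj C; Y \<in> Obj C; f \<in> arr C X Y\<rbrakk> \<Longrightarrow> f \<star> Id C (Unit C) = f"
    and tens_add_left: "\<lbrakk>X \<in> Obj C; Y \<in> Obj C; X' \<in> Obj C; Y' \<in> Obj C;
          f \<in> arr C X Y; g \<in> arr C X Y; h \<in> arr C X' Y'\<rbrakk>
          \<Longrightarrow> (f \<oplus>\<^bsub>Hom C X Y\<^esub> g) \<star> h = f \<star> h \<oplus>\<^bsub>Hom C (X \<boxtimes> X') (Y \<boxtimes> Y')\<^esub> g \<star> h"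
    and tens_add_right: "\<lbrakk>X \<in> Obj C; Y \<in> Obj C; X' \<in> Obj C; Y' \<in> Obj C;
          h \<in> arr C X Y; f \<in> arr C X' Y'; g \<in> arr C X' Y'\<rbrakk>
          \<Longrightarrow> h \<star> (f \<oplus>\<^bsub>Hom C X' Y'\<^esub> g) = h \<star> f \<oplus>\<^bsub>Hom C (X \<boxtimes> X') (Y \<boxtimes> Y')\<^esub> h \<star> g"
    and tens_smult_left: "\<lbrakk>X \<in> Obj C; Y \<in> Obj C; X' \<in> Obj C; Y' \<in> Obj C; a \<in> carrier K;
          f \<in> arr C X Y; g \<in> arr C X' Y'\<rbrakk>
          \<Longrightarrow> (a \<odot>\<^bsub>Hom C X Y\<^esub> f) \<star> g = a \<odot>\<^bsub>Hom C (X \<boxtimes> X') (Y \<boxtimes> Y')\<^esub> (f \<star> g)"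
    and tens_smult_right: "\<lbrakk>X \<in> Obj C; Y \<in> Obj C; X' \<in> Obj C; Y' \<in> Obj C; a \<in> carrier K;
          f \<in> arr C X Y; g \<in> arr C X' Y'\<rbrakk>
          \<Longrightarrow> f \<star> (a \<odot>\<^bsub>Hom C X' Y'\<^esub> g) = a \<odot>\<^bsub>Hom C (X \<boxtimes> X') (Y \<boxtimes> Y')\<^esub> (f \<star> g)"
    and ex_left_dual: "X \<in> Obj C \<Longrightarrow> \<exists>Y e c. left_dual C X Y e c"
    and ex_right_dual: "X \<in> Obj C \<Longrightarrow> \<exists>Y\<in>Obj C. \<exists>e c. left_dual C Y X e c"
    and unit_simple: "simple_object C (Unit C)"
    and unit_End: "\<exists>h\<in>ring_iso K (End_algebra C (Unit C)).
          \<forall>a\<in>carrier K. \<forall>b\<in>carrier K. h (a \<otimes>\<^bsub>K\<^esub> b) = a \<odot>\<^bsub>End_algebra C (Unit C)\<^esub> h b"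

locale finite_strict_tensor_category = strict_tensor_category +
  assumes finite_category: "finite_linear_category K C"

locale strict_monoidal_linear_functor = linear_functor K C D F
  for K :: "'k ring" and C :: "('k, 'o, 'm, 'z) mon_cat_scheme" and D :: "('k, 'p, 'n, 'y) mon_cat_scheme"
    and F :: "('o, 'm, 'p, 'n) func" +
  assumes F_unit: "FO F (Unit C) = Unit D"
    and F_tens_obj: "\<lbrakk>X \<in> Obj C; Y \<in> Obj C\<rbrakk> \<Longrightarrow> FO F (X \<boxtimes>\<^bsub>C\<^esub> Y) = FO F X \<boxtimes>\<^bsub>D\<^esub> FO F Y"
    and F_tens_arr: "\<lbrakk>X \<in> Obj C; Y \<in> Obj C; X' \<in> Obj C; Y' \<in> Obj C; f \<in> arr C X Y; f' \<in> arr C X' Y'\<rbrakk>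
          \<Longrightarrow> FA F (f \<star>\<^bsub>C\<^esub> f') = FA F f \<star>\<^bsub>D\<^esub> FA F f'"

definition tens_list :: "('k, 'o, 'm, 'z) mon_cat_scheme \<Rightarrow> 'o list \<Rightarrow> 'o" where
  "tens_list C Xs = foldr (TObj C) Xs (Unit C)"

definition tens_arrs :: "('k, 'o, 'm, 'z) mon_cat_scheme \<Rightarrow> 'm list \<Rightarrow> 'm" where
  "tens_arrs C fs = foldr (TArr C) fs (Id C (Unit C))"


section \<open>The centralizer of a functor\<close>

text \<open>Families indexed by objects (or lists of objects) are extensional, so that equality of families is
  equality of their components.\<close>

definition half_braiding ::
  "('k, 'o, 'm) mon_cat \<Rightarrow> ('k, 'p, 'n) mon_cat \<Rightarrow> ('o, 'm, 'p, 'n) func \<Rightarrow> 'p \<Rightarrow> ('o \<Rightarrow> 'n) \<Rightarrow> bool" where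
  "half_braiding C D F V \<rho> \<longleftrightarrow> \<rho> \<in> extensional (Obj C) \<and>
     (\<forall>X\<in>Obj C. iso_arr D (V \<boxtimes>\<^bsub>D\<^esub> FO F X) (FO F X \<boxtimes>\<^bsub>D\<^esub> V) (\<rho> X)) \<and>
     (\<forall>X\<in>Obj C. \<forall>Y\<in>Obj C. \<forall>h\<in>arr C X Y.
        (FA F h \<star>\<^bsub>D\<^esub> Id D V) \<cdot>\<^bsub>D\<^esub> \<rho> X = \<rho> Y \<cdot>\<^bsub>D\<^esub> (Id D V \<star>\<^bsub>D\<^esub> FA F h)) \<and>
     (\<forall>X\<in>Obj C. \<forall>Y\<in>Obj C.
        \<rho> (X \<boxtimes>\<^bsub>C\<^esub> Y) = (Id D (FO F X) \<star>\<^bsub>D\<^esub> \<rho> Y) \<cdot>\<^bsub>D\<^esub> (\<rho> X \<star>\<^bsub>D\<^esub> Id D (FO F Y)))"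

definition centralizer ::
  "('k, 'o, 'm) mon_cat \<Rightarrow> ('k, 'p, 'n) mon_cat \<Rightarrow> ('o, 'm, 'p, 'n) func \<Rightarrow> ('k, 'p \<times> ('o \<Rightarrow> 'n), 'n) mon_cat" where
  "centralizer C D F = \<lparr>
     Obj = {(V, \<rho>). V \<in> Obj D \<and> half_braiding C D F V \<rho>},
     Hom = (\<lambda>(V, \<rho>) (W, \<sigma>). (Hom D V W)\<lparr>carrier := {f \<in> arr D V W. \<forall>X\<in>Obj C.
              (Id D (FO F X) \<star>\<^bsub>D\<^esub> f) \<cdot>\<^bsub>D\<^esub> \<rho> X = \<sigma> X \<cdot>\<^bsub>D\<^esub> (f \<star>\<^bsub>D\<^esub> Id D (FO F X))}\<rparr>),
     Comp = Comp D,
     Id = (\<lambda>(V, \<rho>). Id D V),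
     TObj = (\<lambda>(V, \<rho>) (W, \<sigma>). (V \<boxtimes>\<^bsub>D\<^esub> W, \<lambda>X\<in>Obj C. (\<rho> X \<star>\<^bsub>D\<^esub> Id D W) \<cdot>\<^bsub>D\<^esub> (Id D V \<star>\<^bsub>D\<^esub> \<sigma> X))),
     TArr = TArr D,
     Unit = (Unit D, \<lambda>X\<in>Obj C. Id D (FO F X))\<rparr>"

text \<open>The left dual in the centralizer carried by a left dual \<open>W\<close> of \<open>fst V\<close> with evaluation \<open>e\<close> and
  coevaluation \<open>c\<close>.\<close>

definition centralizer_left_dual ::
  "('k, 'o, 'm) mon_cat \<Rightarrow> ('k, 'p, 'n) mon_cat \<Rightarrow> ('o, 'm, 'p, 'n) func \<Rightarrow>
   'p \<times> ('o \<Rightarrow> 'n) \<Rightarrow> 'p \<Rightarrow> 'n \<Rightarrow> 'n \<Rightarrow> 'p \<times> ('o \<Rightarrow> 'n)" where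
  "centralizer_left_dual C D F V W e c = (let Z = centralizer C D F in
     (W, THE \<rho>. (W, \<rho>) \<in> Obj Z \<and>
        e \<in> arr Z (V \<boxtimes>\<^bsub>Z\<^esub> (W, \<rho>)) (Unit Z) \<and> c \<in> arr Z (Unit Z) ((W, \<rho>) \<boxtimes>\<^bsub>Z\<^esub> V)))"


section \<open>The Davydov-Yetter complex\<close>

definition tuples :: "('k, 'o, 'm, 'z) lin_cat_scheme \<Rightarrow> nat \<Rightarrow> 'o list set" where
  "tuples C n = {Xs. length Xs = n \<and> set Xs \<subseteq> Obj C}"

abbreviation tens_F :: "('k, 'p, 'n) mon_cat \<Rightarrow> ('o, 'm, 'p, 'n) func \<Rightarrow> 'o list \<Rightarrow> 'p" where
  "tens_F D F Xs \<equiv> tens_list D (map (FO F) Xs)"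

text \<open>The Hom-space containing the component at \<open>Xs\<close> of a cochain; for the empty list this is
  \<open>Hom D (fst U) (fst V)\<close> because \<open>D\<close> is strict.\<close>

definition component_space ::
  "('k, 'p, 'n) mon_cat \<Rightarrow> ('o, 'm, 'p, 'n) func \<Rightarrow> 'p \<times> ('o \<Rightarrow> 'n) \<Rightarrow> 'p \<times> ('o \<Rightarrow> 'n) \<Rightarrow> 'o list \<Rightarrow> ('k, 'n) module" where
  "component_space D F U V Xs = Hom D (fst U \<boxtimes>\<^bsub>D\<^esub> tens_F D F Xs) (tens_F D F Xs \<boxtimes>\<^bsub>D\<^esub> fst V)"

definition DY_cochains ::
  "('k, 'o, 'm) mon_cat \<Rightarrow> ('k, 'p, 'n) mon_cat \<Rightarrow> ('o, 'm, 'p, 'n) func \<Rightarrow>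
   'p \<times> ('o \<Rightarrow> 'n) \<Rightarrow> 'p \<times> ('o \<Rightarrow> 'n) \<Rightarrow> nat \<Rightarrow> ('k, 'o list \<Rightarrow> 'n) module" where
  "DY_cochains C D F U V n = \<lparr>
     carrier = {f \<in> (\<Pi>\<^sub>E Xs\<in>tuples C n. carrier (component_space D F U V Xs)).
       \<forall>Xs\<in>tuples C n. \<forall>Ys\<in>tuples C n. \<forall>hs. length hs = n \<and> (\<forall>i<n. hs ! i \<in> arr C (Xs ! i) (Ys ! i)) \<longrightarrow>
         (tens_arrs D (map (FA F) hs) \<star>\<^bsub>D\<^esub> Id D (fst V)) \<cdot>\<^bsub>D\<^esub> f Xs =
         f Ys \<cdot>\<^bsub>D\<^esub> (Id D (fst U) \<star>\<^bsub>D\<^esub> tens_arrs D (map (FA F) hs))},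
     mult = (\<lambda>_ _. undefined), one = undefined,
     zero = (\<lambda>Xs\<in>tuples C n. \<zero>\<^bsub>component_space D F U V Xs\<^esub>),
     add = (\<lambda>f g. \<lambda>Xs\<in>tuples C n. f Xs \<oplus>\<^bsub>component_space D F U V Xs\<^esub> g Xs),
     smult = (\<lambda>a f. \<lambda>Xs\<in>tuples C n. a \<odot>\<^bsub>component_space D F U V Xs\<^esub> f Xs)\<rparr>"

text \<open>The list \<open>Xs = [X\<^sub>0, \<dots>, X\<^sub>n]\<close> has its first entry in position 0.\<close>

definition DY_differential ::
  "('k, 'o, 'm) mon_cat \<Rightarrow> ('k, 'p, 'n) mon_cat \<Rightarrow> ('o, 'm, 'p, 'n) func \<Rightarrow>
   'p \<times> ('o \<Rightarrow> 'n) \<Rightarrow> 'p \<times> ('o \<Rightarrow> 'n) \<Rightarrow> nat \<Rightarrow> ('o list \<Rightarrow> 'n) \<Rightarrow> ('o list \<Rightarrow> 'n)" where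
  "DY_differential C D F U V n f = (\<lambda>Xs\<in>tuples C (n + 1). let M = component_space D F U V Xs in
     (Id D (FO F (hd Xs)) \<star>\<^bsub>D\<^esub> f (tl Xs)) \<cdot>\<^bsub>D\<^esub> (snd U (hd Xs) \<star>\<^bsub>D\<^esub> Id D (tens_F D F (tl Xs)))
     \<oplus>\<^bsub>M\<^esub> (\<Oplus>\<^bsub>M\<^esub>i\<in>{1..n}. alt_sign M i (f (take (i - 1) Xs @ (Xs ! (i - 1) \<boxtimes>\<^bsub>C\<^esub> Xs ! i) # drop (i + 1) Xs)))
     \<oplus>\<^bsub>M\<^esub> alt_sign M (n + 1)
       ((Id D (tens_F D F (butlast Xs)) \<star>\<^bsub>D\<^esub> snd V (last Xs)) \<cdot>\<^bsub>D\<^esub> (f (butlast Xs) \<star>\<^bsub>D\<^esub> Id D (FO F (last Xs)))))"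

definition DY_cocycles ::
  "('k, 'o, 'm) mon_cat \<Rightarrow> ('k, 'p, 'n) mon_cat \<Rightarrow> ('o, 'm, 'p, 'n) func \<Rightarrow>
   'p \<times> ('o \<Rightarrow> 'n) \<Rightarrow> 'p \<times> ('o \<Rightarrow> 'n) \<Rightarrow> nat \<Rightarrow> ('o list \<Rightarrow> 'n) set" where
  "DY_cocycles C D F U V n =
     {f \<in> carrier (DY_cochains C D F U V n). DY_differential C D F U V n f = \<zero>\<^bsub>DY_cochains C D F U V (n + 1)\<^esub>}"

definition DY_coboundaries ::
  "('k, 'o, 'm) mon_cat \<Rightarrow> ('k, 'p, 'n) mon_cat \<Rightarrow> ('o, 'm, 'p, 'n) func \<Rightarrow>
   'p \<times> ('o \<Rightarrow> 'n) \<Rightarrow> 'p \<times> ('o \<Rightarrow> 'n) \<Rightarrow> nat \<Rightarrow> ('o list \<Rightarrow> 'n) set" where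
  "DY_coboundaries C D F U V n = (case n of
     0 \<Rightarrow> {\<zero>\<^bsub>DY_cochains C D F U V 0\<^esub>}
   | Suc m \<Rightarrow> DY_differential C D F U V m ` carrier (DY_cochains C D F U V m))"

definition DY_cohomology ::
  "('k, 'o, 'm) mon_cat \<Rightarrow> ('k, 'p, 'n) mon_cat \<Rightarrow> ('o, 'm, 'p, 'n) func \<Rightarrow>
   'p \<times> ('o \<Rightarrow> 'n) \<Rightarrow> 'p \<times> ('o \<Rightarrow> 'n) \<Rightarrow> nat \<Rightarrow> ('k, ('o list \<Rightarrow> 'n) set) module" where
  "DY_cohomology C D F U V n = quotient_module
     ((DY_cochains C D F U V n)\<lparr>carrier := DY_cocycles C D F U V n\<rparr>) (DY_coboundaries C D F U V n)"

definition DY_class ::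
  "('k, 'o, 'm) mon_cat \<Rightarrow> ('k, 'p, 'n) mon_cat \<Rightarrow> ('o, 'm, 'p, 'n) func \<Rightarrow>
   'p \<times> ('o \<Rightarrow> 'n) \<Rightarrow> 'p \<times> ('o \<Rightarrow> 'n) \<Rightarrow> nat \<Rightarrow> ('o list \<Rightarrow> 'n) \<Rightarrow> ('o list \<Rightarrow> 'n) set" where
  "DY_class C D F U V n f = DY_coboundaries C D F U V n +>\<^bsub>DY_cochains C D F U V n\<^esub> f"

text \<open>The product of \<open>f\<close> of degree \<open>n\<close> and \<open>g\<close> of degree \<open>m\<close>, with \<open>g\<close> starting at \<open>U\<close> and \<open>f\<close> ending
  at \<open>W\<close>. The middle coefficient object does not enter the formula.\<close>

definition DY_product ::
  "('k, 'o, 'm) mon_cat \<Rightarrow> ('k, 'p, 'n) mon_cat \<Rightarrow> ('o, 'm, 'p, 'n) func \<Rightarrow>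
   'p \<times> ('o \<Rightarrow> 'n) \<Rightarrow> 'p \<times> ('o \<Rightarrow> 'n) \<Rightarrow> nat \<Rightarrow> nat \<Rightarrow> ('o list \<Rightarrow> 'n) \<Rightarrow> ('o list \<Rightarrow> 'n) \<Rightarrow> ('o list \<Rightarrow> 'n)" where
  "DY_product C D F U W n m f g = (\<lambda>Zs\<in>tuples C (n + m).
     let Xs = take m Zs; Ys = drop m Zs in alt_sign (component_space D F U W Zs) (n * m)
       ((Id D (tens_F D F Xs) \<star>\<^bsub>D\<^esub> f Ys) \<cdot>\<^bsub>D\<^esub> (g Xs \<star>\<^bsub>D\<^esub> Id D (tens_F D F Ys))))"

definition DY_algebra ::
  "('k, 'o, 'm) mon_cat \<Rightarrow> ('k, 'p, 'n) mon_cat \<Rightarrow> ('o, 'm, 'p, 'n) func \<Rightarrow> ('k, nat \<Rightarrow> 'o list \<Rightarrow> 'n) module" where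
  "DY_algebra C D F = (let I = Unit (centralizer C D F); M = DY_cochains C D F I I in
     (direct_sum M)\<lparr>mult := convolution M (DY_product C D F I I),
       one := homogeneous M 0 (\<lambda>Xs\<in>tuples C 0. Id D (Unit D))\<rparr>)"

definition DY_cohomology_algebra ::
  "('k, 'o, 'm) mon_cat \<Rightarrow> ('k, 'p, 'n) mon_cat \<Rightarrow> ('o, 'm, 'p, 'n) func \<Rightarrow>
   ('k, nat \<Rightarrow> ('o list \<Rightarrow> 'n) set) module" where
  "DY_cohomology_algebra C D F = (let I = Unit (centralizer C D F); H = DY_cohomology C D F I I in
     (direct_sum H)\<lparr>mult := convolution H (\<lambda>n m. coset_op (DY_cochains C D F I I (n + m))
           (DY_coboundaries C D F I I (n + m)) (DY_product C D F I I n m)),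
       one := homogeneous H 0 (DY_class C D F I I 0 (\<lambda>Xs\<in>tuples C 0. Id D (Unit D)))\<rparr>)"


section \<open>The action\<close>

text \<open>In the following definitions \<open>(W, e, c)\<close> is a chosen left dual of \<open>fst V\<close> in \<open>D\<close>.\<close>

definition DY_xi ::
  "('k, 'o, 'm) mon_cat \<Rightarrow> ('k, 'p, 'n) mon_cat \<Rightarrow> ('o, 'm, 'p, 'n) func \<Rightarrow>
   'p \<times> ('o \<Rightarrow> 'n) \<Rightarrow> 'p \<times> ('o \<Rightarrow> 'n) \<Rightarrow> 'p \<Rightarrow> 'n \<Rightarrow> 'n \<Rightarrow> nat \<Rightarrow> ('o list \<Rightarrow> 'n) \<Rightarrow> ('o list \<Rightarrow> 'n)" where
  "DY_xi C D F U V W e c n g = (\<lambda>Xs\<in>tuples C n.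
     (Id D (tens_F D F Xs) \<star>\<^bsub>D\<^esub> e) \<cdot>\<^bsub>D\<^esub> (g Xs \<star>\<^bsub>D\<^esub> Id D W) \<cdot>\<^bsub>D\<^esub>
     (Id D (fst U) \<star>\<^bsub>D\<^esub> snd (centralizer_left_dual C D F V W e c) (tens_list C Xs)))"

text \<open>
  The action is \<open>\<xi>\<^sup>-\<^sup>1 (f \<circ> \<xi> g)\<close>. In its components \<open>f\<close> is applied \<^emph>\<open>after\<close> the half-braiding
  \<open>\<rho>\<close> of \<open>V\<close>: up to sign they are
  \<open>(id \<otimes> f\<^sub>Y \<otimes> id\<^sub>V) (id \<otimes> \<rho>\<^sub>Y) (g\<^sub>X \<otimes> id)\<close>.
  Since \<open>f\<^sub>Y\<close> need not be the image under \<open>F\<close> of an arrow of \<open>C\<close>, naturality of \<open>\<rho>\<close> does not allow one to move it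
  past \<open>\<rho>\<^sub>Y\<close>, and \<open>(id \<otimes> \<rho>\<^sub>Y) (g\<^sub>X \<otimes> f\<^sub>Y)\<close> is the same arrow only when
  \<open>f\<^sub>Y\<close> and \<open>\<rho>\<^sub>Y\<close> commute. For example, let \<open>F\<close> be the forgetful functor
  from representations of a group \<open>G\<close> to vector spaces, let \<open>V\<close> be one-dimensional with \<open>\<rho>\<^sub>Y (v \<otimes> y) = s y \<otimes> v\<close>
  for some \<open>s\<close> in \<open>G\<close>, let \<open>f\<^sub>Y (y) = t y\<close> with \<open>t\<close> in \<open>G\<close>, and let \<open>g = id\<^sub>V\<close> be of degree 0. Then the dual
  half-braiding is given by the inverse of \<open>s\<close>, and the action sends \<open>v \<otimes> y\<close> to \<open>t s y \<otimes> v\<close>, not to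
  \<open>s t y \<otimes> v\<close>.
\<close>

definition DY_action ::
  "('k, 'o, 'm) mon_cat \<Rightarrow> ('k, 'p, 'n) mon_cat \<Rightarrow> ('o, 'm, 'p, 'n) func \<Rightarrow>
   'p \<times> ('o \<Rightarrow> 'n) \<Rightarrow> 'p \<times> ('o \<Rightarrow> 'n) \<Rightarrow> 'p \<Rightarrow> 'n \<Rightarrow> 'n \<Rightarrow>
   nat \<Rightarrow> nat \<Rightarrow> ('o list \<Rightarrow> 'n) \<Rightarrow> ('o list \<Rightarrow> 'n) \<Rightarrow> ('o list \<Rightarrow> 'n)" where
  "DY_action C D F U V W e c n m f g = (let Z = centralizer C D F in
     the_inv_into (carrier (DY_cochains C D F U V (n + m))) (DY_xi C D F U V W e c (n + m))
       (DY_product C D F (U \<boxtimes>\<^bsub>Z\<^esub> centralizer_left_dual C D F V W e c) (Unit Z) n m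
          f (DY_xi C D F U V W e c m g)))"

definition DY_cohomology_action ::
  "('k, 'o, 'm) mon_cat \<Rightarrow> ('k, 'p, 'n) mon_cat \<Rightarrow> ('o, 'm, 'p, 'n) func \<Rightarrow>
   'p \<times> ('o \<Rightarrow> 'n) \<Rightarrow> 'p \<times> ('o \<Rightarrow> 'n) \<Rightarrow> 'p \<Rightarrow> 'n \<Rightarrow> 'n \<Rightarrow>
   nat \<Rightarrow> nat \<Rightarrow> ('o list \<Rightarrow> 'n) set \<Rightarrow> ('o list \<Rightarrow> 'n) set \<Rightarrow> ('o list \<Rightarrow> 'n) set" where
  "DY_cohomology_action C D F U V W e c n m = coset_op (DY_cochains C D F U V (n + m))
     (DY_coboundaries C D F U V (n + m)) (DY_action C D F U V W e c n m)"

end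

theory Submission
  imports Defs
begin

text \<open>
  Think of objects of \<open>D\<close> as vertical strands. A component of a cochain with coefficients in \<open>U\<close>, \<open>V\<close> is an arrow
  \<open>U \<otimes> A \<rightarrow> A \<otimes> V\<close> with \<open>A = F(X\<^sub>1) \<otimes> \<dots> \<otimes> F(X\<^sub>n)\<close>: a strand crosses the strands \<open>A\<close> and turns from \<open>U\<close> into \<open>V\<close>.
  Half-braidings are crossings as well. A crossing over \<open>A\<close> and one over \<open>B\<close> stack to a crossing over \<open>A \<otimes> B\<close>, and
  stacking is associative (\<open>stack_assoc\<close>). Multiplicativity of a half-braiding, the two outer terms of the
  differential, the product of cochains and the action are all stacks: a cochain \<open>f\<close> with trivial
  coefficients acts on the strand \<open>V\<close> by its twist \<open>(f\<^sub>Y \<otimes> id\<^sub>V) \<rho>\<^sub>Y\<close>, and the explicit form of \<open>f \<triangleright> g\<close> is, up to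
  sign, the twist of \<open>f\<close> stacked on \<open>g\<close>.

  Associativity of stacking therefore gives the laws of a module (\<open>cup_assoc\<close>), the cosimplicial identities
  for the terms of the differential (\<open>coface_coface\<close>), and the compatibility of the action with these terms
  (\<open>cup_coface_low\<close>, \<open>cup_coface_high\<close>). Moreover the last coface of \<open>g\<close> and the first coface of \<open>f\<close> give the same
  arrow (\<open>cup_coface_between\<close>), so they cancel and the Leibniz rule holds (\<open>cup_leibniz\<close>). With the Leibniz rule
  the action descends to cohomology (\<open>cohomology_act_class\<close>). The algebra is the case in which both
  coefficients are the unit.

  It remains to recognize this action as \<open>\<xi>\<^sup>-\<^sup>1 (f \<circ> \<xi> g)\<close>. The map \<open>\<xi>\<close> bends the outgoing strand \<open>V\<close> down to an
  incoming strand of its left dual. The half-braiding of the dual is the inverse of the transposed half-braiding of \<open>V\<close>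
  (\<open>centralizer_left_dual_eq\<close>), so the evaluation absorbs the crossings of \<open>V\<close> and of its dual
  with the arguments of \<open>f\<close> (\<open>bend_stack\<close>), and what remains is \<open>f \<circ> \<xi> g\<close>. As bending is reversible and half-braidings are
  invertible, \<open>\<xi>\<close> is injective (\<open>xi_inj\<close>), which determines the action.
\<close>

section \<open>Graded modules from bilinear families\<close>

lemma (in abelian_monoid) finsum_closedI:
  "(\<And>i. i \<in> I \<Longrightarrow> f i \<in> carrier G) \<Longrightarrow> finsum G f I \<in> carrier G"
  by (intro finsum_closed) auto

lemma (in abelian_monoid) finsum_congI:
  "\<lbrakk>\<And>i. i \<in> I \<Longrightarrow> f i = g i; \<And>i. i \<in> I \<Longrightarrow> g i \<in> carrier G\<rbrakk> \<Longrightarrow> finsum G f I = finsum G g I"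
  by (intro finsum_cong') auto

lemma (in abelian_monoid) finsum_Sigma:
  assumes "finite I" "\<And>i. i \<in> I \<Longrightarrow> finite (J i)"
    and "\<And>i j. \<lbrakk>i \<in> I; j \<in> J i\<rbrakk> \<Longrightarrow> f i j \<in> carrier G"
  shows "(\<Oplus>i\<in>I. \<Oplus>j\<in>J i. f i j) = (\<Oplus>p\<in>Sigma I J. f (fst p) (snd p))"
  using assms
proof (induction I rule: finite_induct)
  case (insert x F)
  have split: "Sigma (insert x F) J = Pair x ` J x \<union> Sigma F J" by auto
  have "(\<Oplus>p\<in>Sigma (insert x F) J. f (fst p) (snd p)) =
        (\<Oplus>p\<in>Pair x ` J x. f (fst p) (snd p)) \<oplus> (\<Oplus>p\<in>Sigma F J. f (fst p) (snd p))"
    unfolding split by (rule finsum_Un_disjoint) (use insert in auto)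
  also have "(\<Oplus>p\<in>Pair x ` J x. f (fst p) (snd p)) = (\<Oplus>j\<in>J x. f x j)"
    by (subst finsum_reindex) (use insert in \<open>auto simp: inj_on_def\<close>)
  also have "(\<Oplus>p\<in>Sigma F J. f (fst p) (snd p)) = (\<Oplus>i\<in>F. \<Oplus>j\<in>J i. f i j)"
    using insert by simp
  also have "(\<Oplus>j\<in>J x. f x j) \<oplus> (\<Oplus>i\<in>F. \<Oplus>j\<in>J i. f i j) = (\<Oplus>i\<in>insert x F. \<Oplus>j\<in>J i. f i j)"
    using insert by (subst finsum_insert) (auto intro!: finsum_closedI)
  finally show ?case by simp
qed simp

lemma (in abelian_monoid) finsum_bij:
  assumes "bij_betw h A B" and "\<And>b. b \<in> B \<Longrightarrow> f b \<in> carrier G"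
  shows "(\<Oplus>b\<in>B. f b) = (\<Oplus>a\<in>A. f (h a))"
  using assms finsum_reindex[of f h A] by (auto simp: bij_betw_def)

text \<open>Both sides run over the triples \<open>(i, j, k)\<close> with \<open>i + j + k = p\<close>.\<close>

lemma (in abelian_monoid) finsum_triples:
  fixes f :: "nat \<Rightarrow> nat \<Rightarrow> nat \<Rightarrow> 'a"
  assumes "\<And>i j k. i + j + k = p \<Longrightarrow> f i j k \<in> carrier G"
  shows "(\<Oplus>n\<in>{..p}. \<Oplus>i\<in>{..n}. f i (n - i) (p - n)) = (\<Oplus>i\<in>{..p}. \<Oplus>j\<in>{..p - i}. f i j (p - i - j))"
proof -
  have "(\<Oplus>n\<in>{..p}. \<Oplus>i\<in>{..n}. f i (n - i) (p - n)) =
        (\<Oplus>q\<in>Sigma {..p} (\<lambda>n. {..n}). f (snd q) (fst q - snd q) (p - fst q))"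
    by (rule finsum_Sigma) (use assms in auto)
  also have "\<dots> = (\<Oplus>q\<in>Sigma {..p} (\<lambda>i. {..p - i}). f (fst q) (snd q) (p - fst q - snd q))"
  proof (subst finsum_bij)
    show "bij_betw (\<lambda>(i, j). (i + j, i)) (Sigma {..p} (\<lambda>i. {..p - i})) (Sigma {..p} (\<lambda>n. {..n}))"
      by (rule bij_betw_byWitness[where f' = "\<lambda>(n, i). (i, n - i)"]) auto
  qed (use assms in \<open>auto intro!: finsum_congI simp: split_beta\<close>)
  also have "\<dots> = (\<Oplus>i\<in>{..p}. \<Oplus>j\<in>{..p - i}. f i j (p - i - j))"
    by (rule finsum_Sigma[symmetric]) (use assms in auto)
  finally show ?thesis .
qed

text \<open>These lemmas carry facts about a direct sum over to the algebra record that extends it.\<close>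

lemma module_cong:
  fixes M N :: "('k, 'v) module"
  assumes "carrier M = carrier N" "zero M = zero N" "add M = add N" "smult M = smult N"
  shows "module K M \<longleftrightarrow> module K N"
  unfolding module_def module_axioms_def abelian_group_def abelian_monoid_def abelian_group_axioms_def assms ..

lemma finsum_ring_cong:
  fixes M N :: "('k, 'v) module"
  assumes "carrier M = carrier N" "zero M = zero N" "add M = add N"
  shows "finsum M = finsum N"
  unfolding finsum_def assms ..

lemma submodule_cong:
  fixes M N :: "('k, 'v) module"
  assumes "carrier M = carrier N" "zero M = zero N" "add M = add N" "smult M = smult N"
  shows "submodule H K M \<longleftrightarrow> submodule H K N"
  unfolding submodule_def submodule_axioms_def assms ..

lemma grading_cong:
  fixes M N :: "('k, 'v) module"
  assumes "carrier M = carrier N" "zero M = zero N" "add M = add N" "smult M = smult N"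
  shows "grading K M gr \<longleftrightarrow> grading K N gr"
  unfolding grading_def assms submodule_cong[OF assms] finsum_ring_cong[OF assms(1-3)] ..

locale module_family =
  fixes K :: "'k ring" and M :: "nat \<Rightarrow> ('k, 'v) module"
  assumes modules: "module K (M n)"

sublocale module_family \<subseteq> comp: module K "M n" for n
  by (rule modules)

context module_family
begin

lemma direct_sum_abelian_group: "abelian_group (direct_sum M)"
proof (rule abelian_groupI)
  fix x y assume "x \<in> carrier (direct_sum M)" "y \<in> carrier (direct_sum M)"
  then have "finite ({n. x n \<noteq> \<zero>\<^bsub>M n\<^esub>} \<union> {n. y n \<noteq> \<zero>\<^bsub>M n\<^esub>})" by (auto simp: direct_sum_def)
  then have "finite {n. x n \<oplus>\<^bsub>M n\<^esub> y n \<noteq> \<zero>\<^bsub>M n\<^esub>}"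
    by (rule rev_finite_subset) auto
  then show "x \<oplus>\<^bsub>direct_sum M\<^esub> y \<in> carrier (direct_sum M)"
    using \<open>x \<in> _\<close> \<open>y \<in> _\<close> by (auto simp: direct_sum_def)
next
  fix x assume x: "x \<in> carrier (direct_sum M)"
  have "{n. \<ominus>\<^bsub>M n\<^esub> x n \<noteq> \<zero>\<^bsub>M n\<^esub>} = {n. x n \<noteq> \<zero>\<^bsub>M n\<^esub>}"
    using x by (auto simp: direct_sum_def)
  with x show "\<exists>y\<in>carrier (direct_sum M). y \<oplus>\<^bsub>direct_sum M\<^esub> x = \<zero>\<^bsub>direct_sum M\<^esub>"
    by (intro bexI[of _ "\<lambda>n. \<ominus>\<^bsub>M n\<^esub> x n"]) (auto simp: direct_sum_def comp.M.l_neg)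
qed (auto simp: direct_sum_def comp.M.a_ac intro!: ext)

lemma direct_sum_module: "module K (direct_sum M)"
proof (rule moduleI)
  show "abelian_group (direct_sum M)" by (rule direct_sum_abelian_group)
  fix a x assume "a \<in> carrier K" "x \<in> carrier (direct_sum M)"
  then show "a \<odot>\<^bsub>direct_sum M\<^esub> x \<in> carrier (direct_sum M)"
    by (auto simp: direct_sum_def elim!: rev_finite_subset)
qed (auto simp: direct_sum_def comp.smult_l_distr comp.smult_r_distr comp.smult_assoc1 intro: comp.R.is_cring)

lemma direct_sum_finsum:
  assumes "finite S" "\<And>s. s \<in> S \<Longrightarrow> u s \<in> carrier (direct_sum M)"
  shows "(\<Oplus>\<^bsub>direct_sum M\<^esub>s\<in>S. u s) p = (\<Oplus>\<^bsub>M p\<^esub>s\<in>S. u s p)"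
  using assms
proof (induction S rule: finite_induct)
  case empty
  interpret S: abelian_group "direct_sum M" by (rule direct_sum_abelian_group)
  show ?case unfolding S.finsum_empty comp.M.finsum_empty by (simp add: direct_sum_def)
next
  case (insert s S)
  interpret S: abelian_group "direct_sum M" by (rule direct_sum_abelian_group)
  have comp: "u t p \<in> carrier (M p)" if "t \<in> insert s S" for t
    using insert(4)[OF that] by (auto simp: direct_sum_def)
  have "(\<Oplus>\<^bsub>direct_sum M\<^esub>t\<in>insert s S. u t) = u s \<oplus>\<^bsub>direct_sum M\<^esub> (\<Oplus>\<^bsub>direct_sum M\<^esub>t\<in>S. u t)"
    using insert by (intro S.finsum_insert) auto
  then have "(\<Oplus>\<^bsub>direct_sum M\<^esub>t\<in>insert s S. u t) p = u s p \<oplus>\<^bsub>M p\<^esub> (\<Oplus>\<^bsub>direct_sum M\<^esub>t\<in>S. u t) p"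
    by (simp add: direct_sum_def)
  also have "(\<Oplus>\<^bsub>direct_sum M\<^esub>t\<in>S. u t) p = (\<Oplus>\<^bsub>M p\<^esub>t\<in>S. u t p)"
    using insert by auto
  also have "u s p \<oplus>\<^bsub>M p\<^esub> \<dots> = (\<Oplus>\<^bsub>M p\<^esub>t\<in>insert s S. u t p)"
    using insert(1,2) comp by (intro comp.M.finsum_insert[symmetric]) auto
  finally show ?case .
qed

lemma homogeneous_carrier: "x \<in> carrier (M n) \<Longrightarrow> homogeneous M n x \<in> carrier (direct_sum M)"
  by (auto simp: homogeneous_def direct_sum_def)

lemma graded_part_submodule: "submodule (graded_part M n) K (direct_sum M)"
proof -
  interpret S: module K "direct_sum M" by (rule direct_sum_module)
  have ops: "\<zero>\<^bsub>direct_sum M\<^esub> = homogeneous M n \<zero>\<^bsub>M n\<^esub>"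
    "\<lbrakk>x \<in> carrier (M n); y \<in> carrier (M n)\<rbrakk> \<Longrightarrow>
      homogeneous M n x \<oplus>\<^bsub>direct_sum M\<^esub> homogeneous M n y = homogeneous M n (x \<oplus>\<^bsub>M n\<^esub> y)"
    "a \<in> carrier K \<Longrightarrow> a \<odot>\<^bsub>direct_sum M\<^esub> homogeneous M n x = homogeneous M n (a \<odot>\<^bsub>M n\<^esub> x)"
    for x y a by (auto simp: direct_sum_def homogeneous_def)
  show ?thesis
  proof (rule S.submoduleI)
    fix x assume "x \<in> graded_part M n"
    then obtain y where y: "y \<in> carrier (M n)" "x = homogeneous M n y" by (auto simp: graded_part_def)
    have "homogeneous M n (\<ominus>\<^bsub>M n\<^esub> y) \<oplus>\<^bsub>direct_sum M\<^esub> homogeneous M n y = \<zero>\<^bsub>direct_sum M\<^esub>"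
      using y by (simp add: ops comp.M.l_neg)
    then have "\<ominus>\<^bsub>direct_sum M\<^esub> x = homogeneous M n (\<ominus>\<^bsub>M n\<^esub> y)"
      using y homogeneous_carrier by (intro S.minus_equality) auto
    then show "\<ominus>\<^bsub>direct_sum M\<^esub> x \<in> graded_part M n" using y by (auto simp: graded_part_def)
  qed (auto simp: graded_part_def ops homogeneous_carrier)
qed

text \<open>The homogeneous components of \<open>x\<close> are its entries, put back in their degrees.\<close>

lemma direct_sum_grading: "grading K (direct_sum M) (graded_part M)"
  unfolding grading_def
proof (intro conjI allI ballI)
  show "submodule (graded_part M n) K (direct_sum M)" for n by (rule graded_part_submodule)
next
  interpret S: module K "direct_sum M" by (rule direct_sum_module)
  let ?P = "\<lambda>x u. (\<forall>n. u n \<in> graded_part M n) \<and> finite {n. u n \<noteq> \<zero>\<^bsub>direct_sum M\<^esub>} \<and>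
        x = (\<Oplus>\<^bsub>direct_sum M\<^esub>n\<in>{n. u n \<noteq> \<zero>\<^bsub>direct_sum M\<^esub>}. u n)"
  have zero_iff: "homogeneous M n y = \<zero>\<^bsub>direct_sum M\<^esub> \<longleftrightarrow> y = \<zero>\<^bsub>M n\<^esub>" for n y
    by (auto simp: homogeneous_def direct_sum_def fun_eq_iff)
  have entry: "(\<Oplus>\<^bsub>direct_sum M\<^esub>n\<in>S. homogeneous M n (y n)) p = (if p \<in> S then y p else \<zero>\<^bsub>M p\<^esub>)"
    if "finite S" "\<And>n. y n \<in> carrier (M n)" for S y p
  proof -
    have "(\<Oplus>\<^bsub>direct_sum M\<^esub>n\<in>S. homogeneous M n (y n)) p = (\<Oplus>\<^bsub>M p\<^esub>n\<in>S. homogeneous M n (y n) p)"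
      using that by (intro direct_sum_finsum) (auto intro: homogeneous_carrier)
    also have "\<dots> = (\<Oplus>\<^bsub>M p\<^esub>n\<in>S. if p = n then y p else \<zero>\<^bsub>M p\<^esub>)"
      using that by (intro comp.M.finsum_congI) (auto simp: homogeneous_def)
    also have "\<dots> = (if p \<in> S then y p else \<zero>\<^bsub>M p\<^esub>)"
    proof (cases "p \<in> S")
      case True
      then show ?thesis using that comp.M.finsum_singleton[of p S "\<lambda>_. y p"] by simp
    next
      case False
      then have "(\<Oplus>\<^bsub>M p\<^esub>n\<in>S. if p = n then y p else \<zero>\<^bsub>M p\<^esub>) = (\<Oplus>\<^bsub>M p\<^esub>n\<in>S. \<zero>\<^bsub>M p\<^esub>)"
        by (intro comp.M.finsum_congI) auto
      with False show ?thesis by (simp add: comp.M.finsum_zero)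
    qed
    finally show ?thesis .
  qed
  fix x assume x: "x \<in> carrier (direct_sum M)"
  show "\<exists>!u. ?P x u"
  proof (rule ex1I)
    have nonzero: "{n. homogeneous M n (x n) \<noteq> \<zero>\<^bsub>direct_sum M\<^esub>} = {n. x n \<noteq> \<zero>\<^bsub>M n\<^esub>}"
      by (simp add: zero_iff)
    show "?P x (\<lambda>n. homogeneous M n (x n))"
    proof (intro conjI allI)
      have "\<And>n. x n \<in> carrier (M n)" and fin: "finite {n. x n \<noteq> \<zero>\<^bsub>M n\<^esub>}"
        using x by (auto simp: direct_sum_def)
      then show "homogeneous M n (x n) \<in> graded_part M n" for n by (auto simp: graded_part_def)
      show "finite {n. homogeneous M n (x n) \<noteq> \<zero>\<^bsub>direct_sum M\<^esub>}" unfolding nonzero by (rule fin)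
      show "x = (\<Oplus>\<^bsub>direct_sum M\<^esub>n\<in>{n. homogeneous M n (x n) \<noteq> \<zero>\<^bsub>direct_sum M\<^esub>}. homogeneous M n (x n))"
        unfolding nonzero using \<open>\<And>n. x n \<in> carrier (M n)\<close> fin by (auto simp: entry fun_eq_iff)
    qed
  next
    fix u assume u: "?P x u"
    then have "\<forall>n. \<exists>y. y \<in> carrier (M n) \<and> u n = homogeneous M n y" by (auto simp: graded_part_def)
    then obtain y where y: "\<And>n. y n \<in> carrier (M n)" "\<And>n. u n = homogeneous M n (y n)" by metis
    have "x p = y p" for p
      using u y entry[of "{n. u n \<noteq> \<zero>\<^bsub>direct_sum M\<^esub>}" y p] by (auto simp: zero_iff)
    then show "u = (\<lambda>n. homogeneous M n (x n))" using y by auto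
  qed
qed

end

text \<open>The case \<open>M = A\<close> is the product of a graded algebra, the general case its action on a module; each law of
  the convolution is thus proved once for both.\<close>

locale bilinear_family = A: module_family K A + M: module_family K M
  for K :: "'k ring" and A :: "nat \<Rightarrow> ('k, 'a) module" and M :: "nat \<Rightarrow> ('k, 'v) module" +
  fixes act :: "nat \<Rightarrow> nat \<Rightarrow> 'a \<Rightarrow> 'v \<Rightarrow> 'v"
  assumes act_closed: "\<lbrakk>a \<in> carrier (A n); x \<in> carrier (M m)\<rbrakk> \<Longrightarrow> act n m a x \<in> carrier (M (n + m))"
    and act_add_left: "\<lbrakk>a \<in> carrier (A n); b \<in> carrier (A n); x \<in> carrier (M m)\<rbrakk> \<Longrightarrow>
      act n m (a \<oplus>\<^bsub>A n\<^esub> b) x = act n m a x \<oplus>\<^bsub>M (n + m)\<^esub> act n m b x"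
    and act_add_right: "\<lbrakk>a \<in> carrier (A n); x \<in> carrier (M m); y \<in> carrier (M m)\<rbrakk> \<Longrightarrow>
      act n m a (x \<oplus>\<^bsub>M m\<^esub> y) = act n m a x \<oplus>\<^bsub>M (n + m)\<^esub> act n m a y"
    and act_smult_left: "\<lbrakk>c \<in> carrier K; a \<in> carrier (A n); x \<in> carrier (M m)\<rbrakk> \<Longrightarrow>
      act n m (c \<odot>\<^bsub>A n\<^esub> a) x = c \<odot>\<^bsub>M (n + m)\<^esub> act n m a x"
    and act_smult_right: "\<lbrakk>c \<in> carrier K; a \<in> carrier (A n); x \<in> carrier (M m)\<rbrakk> \<Longrightarrow>
      act n m a (c \<odot>\<^bsub>M m\<^esub> x) = c \<odot>\<^bsub>M (n + m)\<^esub> act n m a x"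
begin

lemma act_zero_left: "x \<in> carrier (M m) \<Longrightarrow> act n m \<zero>\<^bsub>A n\<^esub> x = \<zero>\<^bsub>M (n + m)\<^esub>"
  using act_smult_left[of "\<zero>\<^bsub>K\<^esub>" "\<zero>\<^bsub>A n\<^esub>" n x m] act_closed[of "\<zero>\<^bsub>A n\<^esub>" n x m] by simp

lemma act_zero_right: "a \<in> carrier (A n) \<Longrightarrow> act n m a \<zero>\<^bsub>M m\<^esub> = \<zero>\<^bsub>M (n + m)\<^esub>"
  using act_smult_right[of "\<zero>\<^bsub>K\<^esub>" a n "\<zero>\<^bsub>M m\<^esub>" m] act_closed[of a n "\<zero>\<^bsub>M m\<^esub>" m] by simp

lemma act_neg_left: "\<lbrakk>a \<in> carrier (A n); x \<in> carrier (M m)\<rbrakk> \<Longrightarrow>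
    act n m (\<ominus>\<^bsub>A n\<^esub> a) x = \<ominus>\<^bsub>M (n + m)\<^esub> act n m a x"
  using act_smult_left[of "\<ominus>\<^bsub>K\<^esub> \<one>\<^bsub>K\<^esub>" a n x m] act_closed[of a n x m]
  by (simp add: A.comp.smult_l_minus M.comp.smult_l_minus)

lemma act_neg_right: "\<lbrakk>a \<in> carrier (A n); x \<in> carrier (M m)\<rbrakk> \<Longrightarrow>
    act n m a (\<ominus>\<^bsub>M m\<^esub> x) = \<ominus>\<^bsub>M (n + m)\<^esub> act n m a x"
  using act_smult_right[of "\<ominus>\<^bsub>K\<^esub> \<one>\<^bsub>K\<^esub>" a n x m] act_closed[of a n x m]
  by (simp add: M.comp.smult_l_minus)

lemma act_finsum_left:
  assumes "finite I" "\<And>i. i \<in> I \<Longrightarrow> f i \<in> carrier (A n)" "x \<in> carrier (M m)"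
  shows "act n m (\<Oplus>\<^bsub>A n\<^esub>i\<in>I. f i) x = (\<Oplus>\<^bsub>M (n + m)\<^esub>i\<in>I. act n m (f i) x)"
  using assms(1,2)
proof (induction I rule: finite_induct)
  case empty
  show ?case using assms(3) by (simp add: act_zero_left)
next
  case (insert i I)
  then show ?case using assms(3)
    by (subst A.comp.M.finsum_insert, simp, simp, fastforce, simp, subst M.comp.M.finsum_insert)
      (auto simp: act_add_left act_closed intro!: A.comp.M.finsum_closedI)
qed

lemma act_finsum_right:
  assumes "finite I" "\<And>i. i \<in> I \<Longrightarrow> f i \<in> carrier (M m)" "a \<in> carrier (A n)"
  shows "act n m a (\<Oplus>\<^bsub>M m\<^esub>i\<in>I. f i) = (\<Oplus>\<^bsub>M (n + m)\<^esub>i\<in>I. act n m a (f i))"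
  using assms(1,2)
proof (induction I rule: finite_induct)
  case empty
  show ?case using assms(3) by (simp add: act_zero_right)
next
  case (insert i I)
  then show ?case using assms(3)
    by (subst M.comp.M.finsum_insert, simp, simp, fastforce, simp, subst M.comp.M.finsum_insert)
      (auto simp: act_add_right act_closed intro!: M.comp.M.finsum_closedI)
qed

lemma act_entry_closed:
  assumes "a \<in> carrier (direct_sum A)" "x \<in> carrier (direct_sum M)" "n \<le> p"
  shows "act n (p - n) (a n) (x (p - n)) \<in> carrier (M p)"
  using act_closed[of "a n" n "x (p - n)" "p - n"] assms by (auto simp: direct_sum_def)

lemma convolution_entry_closed:
  assumes "a \<in> carrier (direct_sum A)" "x \<in> carrier (direct_sum M)"
  shows "convolution M act a x p \<in> carrier (M p)"
  unfolding convolution_def using assms by (auto intro!: M.comp.M.finsum_closedI act_entry_closed)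

lemma convolution_closed:
  assumes a: "a \<in> carrier (direct_sum A)" and x: "x \<in> carrier (direct_sum M)"
  shows "convolution M act a x \<in> carrier (direct_sum M)"
proof -
  let ?I = "{n. a n \<noteq> \<zero>\<^bsub>A n\<^esub>}" and ?J = "{n. x n \<noteq> \<zero>\<^bsub>M n\<^esub>}"
  have "convolution M act a x p = \<zero>\<^bsub>M p\<^esub>" if p: "p \<notin> (\<lambda>(i, j). i + j) ` (?I \<times> ?J)" for p
  proof -
    have "act n (p - n) (a n) (x (p - n)) = \<zero>\<^bsub>M p\<^esub>" if "n \<le> p" for n
    proof -
      have "a n = \<zero>\<^bsub>A n\<^esub> \<or> x (p - n) = \<zero>\<^bsub>M (p - n)\<^esub>"
        using p that by (force simp: image_iff)
      then show ?thesis
        using that a x act_zero_left[of "x (p - n)" "p - n" n] act_zero_right[of "a n" n "p - n"]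
        by (auto simp: direct_sum_def)
    qed
    then have "convolution M act a x p = (\<Oplus>\<^bsub>M p\<^esub>n\<in>{..p}. \<zero>\<^bsub>M p\<^esub>)"
      unfolding convolution_def by (intro M.comp.M.finsum_congI) auto
    then show ?thesis by (simp add: M.comp.M.finsum_zero)
  qed
  then have "{p. convolution M act a x p \<noteq> \<zero>\<^bsub>M p\<^esub>} \<subseteq> (\<lambda>(i, j). i + j) ` (?I \<times> ?J)" by blast
  moreover have "finite ((\<lambda>(i, j). i + j) ` (?I \<times> ?J))" using a x by (auto simp: direct_sum_def)
  ultimately have "finite {p. convolution M act a x p \<noteq> \<zero>\<^bsub>M p\<^esub>}" by (rule finite_subset)
  then show ?thesis using convolution_entry_closed[OF a x] by (simp add: direct_sum_def)
qed

lemma convolution_add_left: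
  assumes "a \<in> carrier (direct_sum A)" "b \<in> carrier (direct_sum A)" "x \<in> carrier (direct_sum M)"
  shows "convolution M act (a \<oplus>\<^bsub>direct_sum A\<^esub> b) x =
    convolution M act a x \<oplus>\<^bsub>direct_sum M\<^esub> convolution M act b x"
proof
  fix p
  have "act n (p - n) (a n \<oplus>\<^bsub>A n\<^esub> b n) (x (p - n)) =
      act n (p - n) (a n) (x (p - n)) \<oplus>\<^bsub>M p\<^esub> act n (p - n) (b n) (x (p - n))" if "n \<le> p" for n
    using act_add_left[of "a n" n "b n" "x (p - n)" "p - n"] assms that by (simp add: direct_sum_def)
  then have "convolution M act (a \<oplus>\<^bsub>direct_sum A\<^esub> b) x p =
      (\<Oplus>\<^bsub>M p\<^esub>n\<in>{..p}. act n (p - n) (a n) (x (p - n)) \<oplus>\<^bsub>M p\<^esub> act n (p - n) (b n) (x (p - n)))"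
    unfolding convolution_def using assms act_entry_closed
    by (intro M.comp.M.finsum_congI) (auto simp: direct_sum_def)
  also have "\<dots> = convolution M act a x p \<oplus>\<^bsub>M p\<^esub> convolution M act b x p"
    unfolding convolution_def using assms act_entry_closed by (intro M.comp.M.finsum_addf) auto
  finally show "convolution M act (a \<oplus>\<^bsub>direct_sum A\<^esub> b) x p =
      (convolution M act a x \<oplus>\<^bsub>direct_sum M\<^esub> convolution M act b x) p" by (simp add: direct_sum_def)
qed

lemma convolution_add_right:
  assumes "a \<in> carrier (direct_sum A)" "x \<in> carrier (direct_sum M)" "y \<in> carrier (direct_sum M)"
  shows "convolution M act a (x \<oplus>\<^bsub>direct_sum M\<^esub> y) =
    convolution M act a x \<oplus>\<^bsub>direct_sum M\<^esub> convolution M act a y"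
proof
  fix p
  have "act n (p - n) (a n) (x (p - n) \<oplus>\<^bsub>M (p - n)\<^esub> y (p - n)) =
      act n (p - n) (a n) (x (p - n)) \<oplus>\<^bsub>M p\<^esub> act n (p - n) (a n) (y (p - n))" if "n \<le> p" for n
    using act_add_right[of "a n" n "x (p - n)" "p - n" "y (p - n)"] assms that by (simp add: direct_sum_def)
  then have "convolution M act a (x \<oplus>\<^bsub>direct_sum M\<^esub> y) p =
      (\<Oplus>\<^bsub>M p\<^esub>n\<in>{..p}. act n (p - n) (a n) (x (p - n)) \<oplus>\<^bsub>M p\<^esub> act n (p - n) (a n) (y (p - n)))"
    unfolding convolution_def using assms act_entry_closed
    by (intro M.comp.M.finsum_congI) (auto simp: direct_sum_def)
  also have "\<dots> = convolution M act a x p \<oplus>\<^bsub>M p\<^esub> convolution M act a y p"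
    unfolding convolution_def using assms act_entry_closed by (intro M.comp.M.finsum_addf) auto
  finally show "convolution M act a (x \<oplus>\<^bsub>direct_sum M\<^esub> y) p =
      (convolution M act a x \<oplus>\<^bsub>direct_sum M\<^esub> convolution M act a y) p" by (simp add: direct_sum_def)
qed

lemma convolution_smult:
  assumes "c \<in> carrier K" "a \<in> carrier (direct_sum A)" "x \<in> carrier (direct_sum M)"
  shows "convolution M act (c \<odot>\<^bsub>direct_sum A\<^esub> a) x = c \<odot>\<^bsub>direct_sum M\<^esub> convolution M act a x"
    and "convolution M act a (c \<odot>\<^bsub>direct_sum M\<^esub> x) = c \<odot>\<^bsub>direct_sum M\<^esub> convolution M act a x"
proof -
  have scale: "c \<odot>\<^bsub>M p\<^esub> convolution M act a x p =
      (\<Oplus>\<^bsub>M p\<^esub>n\<in>{..p}. c \<odot>\<^bsub>M p\<^esub> act n (p - n) (a n) (x (p - n)))" for p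
    unfolding convolution_def using assms act_entry_closed by (intro M.comp.finsum_smult_ldistr) auto
  have entries: "act n (p - n) (c \<odot>\<^bsub>A n\<^esub> a n) (x (p - n)) = c \<odot>\<^bsub>M p\<^esub> act n (p - n) (a n) (x (p - n))"
    "act n (p - n) (a n) (c \<odot>\<^bsub>M (p - n)\<^esub> x (p - n)) = c \<odot>\<^bsub>M p\<^esub> act n (p - n) (a n) (x (p - n))"
    if "n \<le> p" for n p
    using act_smult_left[of c "a n" n "x (p - n)" "p - n"] act_smult_right[of c "a n" n "x (p - n)" "p - n"]
      assms that by (simp_all add: direct_sum_def)
  show "convolution M act (c \<odot>\<^bsub>direct_sum A\<^esub> a) x = c \<odot>\<^bsub>direct_sum M\<^esub> convolution M act a x"
  proof
    fix p
    have "convolution M act (c \<odot>\<^bsub>direct_sum A\<^esub> a) x p = c \<odot>\<^bsub>M p\<^esub> convolution M act a x p"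
      unfolding scale unfolding convolution_def using assms act_entry_closed entries
      by (intro M.comp.M.finsum_congI) (auto simp: direct_sum_def)
    then show "convolution M act (c \<odot>\<^bsub>direct_sum A\<^esub> a) x p = (c \<odot>\<^bsub>direct_sum M\<^esub> convolution M act a x) p"
      by (simp add: direct_sum_def)
  qed
  show "convolution M act a (c \<odot>\<^bsub>direct_sum M\<^esub> x) = c \<odot>\<^bsub>direct_sum M\<^esub> convolution M act a x"
  proof
    fix p
    have "convolution M act a (c \<odot>\<^bsub>direct_sum M\<^esub> x) p = c \<odot>\<^bsub>M p\<^esub> convolution M act a x p"
      unfolding scale unfolding convolution_def using assms act_entry_closed entries
      by (intro M.comp.M.finsum_congI) (auto simp: direct_sum_def)
    then show "convolution M act a (c \<odot>\<^bsub>direct_sum M\<^esub> x) p = (c \<odot>\<^bsub>direct_sum M\<^esub> convolution M act a x) p"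
      by (simp add: direct_sum_def)
  qed
qed

lemma convolution_homogeneous_left:
  assumes "a \<in> carrier (A n)" "x \<in> carrier (direct_sum M)"
  shows "convolution M act (homogeneous A n a) x p =
    (if n \<le> p then act n (p - n) a (x (p - n)) else \<zero>\<^bsub>M p\<^esub>)"
proof -
  have ent: "act q (p - q) (homogeneous A n a q) (x (p - q)) =
      (if n = q then act n (p - n) a (x (p - n)) else \<zero>\<^bsub>M p\<^esub>)" if "q \<le> p" for q
    using that assms act_zero_left[of "x (p - q)" "p - q" q] by (auto simp: homogeneous_def direct_sum_def)
  have cl: "act n (p - n) a (x (p - n)) \<in> carrier (M p)" if "n \<le> p"
    using that assms act_closed[of a n "x (p - n)" "p - n"] by (auto simp: direct_sum_def)
  have "convolution M act (homogeneous A n a) x p =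
      (\<Oplus>\<^bsub>M p\<^esub>q\<in>{..p}. if n = q then act n (p - n) a (x (p - n)) else \<zero>\<^bsub>M p\<^esub>)"
    unfolding convolution_def using ent cl by (intro M.comp.M.finsum_congI) auto
  also have "\<dots> = (if n \<le> p then act n (p - n) a (x (p - n)) else \<zero>\<^bsub>M p\<^esub>)"
  proof (cases "n \<le> p")
    case True
    then show ?thesis
      using cl M.comp.M.finsum_singleton[of n "{..p}" "\<lambda>_. act n (p - n) a (x (p - n))" p] by simp
  next
    case False
    then have "(\<Oplus>\<^bsub>M p\<^esub>q\<in>{..p}. if n = q then act n (p - n) a (x (p - n)) else \<zero>\<^bsub>M p\<^esub>) = (\<Oplus>\<^bsub>M p\<^esub>q\<in>{..p}. \<zero>\<^bsub>M p\<^esub>)"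
      by (intro M.comp.M.finsum_congI) auto
    with False show ?thesis by (simp add: M.comp.M.finsum_zero)
  qed
  finally show ?thesis .
qed

lemma convolution_homogeneous:
  assumes "a \<in> carrier (A n)" "x \<in> carrier (M m)"
  shows "convolution M act (homogeneous A n a) (homogeneous M m x) = homogeneous M (n + m) (act n m a x)"
proof
  fix p
  show "convolution M act (homogeneous A n a) (homogeneous M m x) p = homogeneous M (n + m) (act n m a x) p"
  proof (cases "n \<le> p")
    case True
    then obtain q where "p = n + q" using le_Suc_ex by blast
    then show ?thesis using assms act_zero_right[of a n q]
      unfolding convolution_homogeneous_left[OF assms(1) M.homogeneous_carrier[OF assms(2)]]
      by (auto simp: homogeneous_def)
  qed (use assms in \<open>simp add: convolution_homogeneous_left M.homogeneous_carrier, simp add: homogeneous_def\<close>)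
qed

lemma convolution_graded_part:
  assumes "a \<in> graded_part A n" "x \<in> graded_part M m"
  shows "convolution M act a x \<in> graded_part M (n + m)"
  using assms by (auto simp: graded_part_def convolution_homogeneous act_closed)

end

lemma abelian_group_cong:
  assumes "abelian_group M" "carrier N = carrier M" "zero N = zero M" "add N = add M"
  shows "abelian_group N"
proof -
  interpret abelian_group M by fact
  show ?thesis
    by (rule abelian_groupI) (auto simp: assms(2-4) a_ac intro: bexI[of _ "\<ominus>\<^bsub>M\<^esub> _"] l_neg)
qed

locale graded_action = mul: bilinear_family K A A mul + act: bilinear_family K A M act
  for K :: "'k ring" and A :: "nat \<Rightarrow> ('k, 'a) module" and M :: "nat \<Rightarrow> ('k, 'v) module" and mul act +
  fixes unit :: 'a
  assumes act_assoc: "\<lbrakk>a \<in> carrier (A n); b \<in> carrier (A m); x \<in> carrier (M l)\<rbrakk> \<Longrightarrow>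
      act (n + m) l (mul n m a b) x = act n (m + l) a (act m l b x)"
    and unit_closed: "unit \<in> carrier (A 0)"
    and act_unit: "x \<in> carrier (M m) \<Longrightarrow> act 0 m unit x = x"
begin

text \<open>By biadditivity both sides are sums over the degrees \<open>(i, j, k)\<close> of \<open>a\<close>, \<open>b\<close> and \<open>x\<close>.\<close>

lemma convolution_assoc:
  assumes a: "a \<in> carrier (direct_sum A)" and b: "b \<in> carrier (direct_sum A)" and x: "x \<in> carrier (direct_sum M)"
  shows "convolution M act (convolution A mul a b) x = convolution M act a (convolution M act b x)"
proof
  fix p
  define f where "f i j k = act (i + j) k (mul i j (a i) (b j)) (x k)" for i j k
  have ent: "a i \<in> carrier (A i)" "b i \<in> carrier (A i)" "x i \<in> carrier (M i)" for i
    using a b x by (auto simp: direct_sum_def)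
  have fc: "f i j k \<in> carrier (M p)" if "i + j + k = p" for i j k
    unfolding f_def that[symmetric] by (intro act.act_closed mul.act_closed ent)
  have "convolution M act (convolution A mul a b) x p = (\<Oplus>\<^bsub>M p\<^esub>n\<in>{..p}. \<Oplus>\<^bsub>M p\<^esub>i\<in>{..n}. f i (n - i) (p - n))"
    unfolding convolution_def[of M]
  proof (rule act.M.comp.M.finsum_congI)
    fix n assume n: "n \<in> {..p}"
    have "act n (p - n) (convolution A mul a b n) (x (p - n)) =
        (\<Oplus>\<^bsub>M (n + (p - n))\<^esub>i\<in>{..n}. act n (p - n) (mul i (n - i) (a i) (b (n - i))) (x (p - n)))"
      unfolding convolution_def using mul.act_entry_closed[OF a b]
      by (intro act.act_finsum_left) (auto intro: ent)
    also have "\<dots> = (\<Oplus>\<^bsub>M p\<^esub>i\<in>{..n}. f i (n - i) (p - n))"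
    proof -
      have "act n (p - n) (mul i (n - i) (a i) (b (n - i))) (x (p - n)) = f i (n - i) (p - n)" if "i \<le> n" for i
        using that by (simp add: f_def)
      then show ?thesis using n by (simp, intro act.M.comp.M.finsum_congI) (auto intro: fc)
    qed
    finally show "act n (p - n) (convolution A mul a b n) (x (p - n)) = (\<Oplus>\<^bsub>M p\<^esub>i\<in>{..n}. f i (n - i) (p - n))" .
  qed (auto intro!: act.M.comp.M.finsum_closedI fc)
  also have "\<dots> = (\<Oplus>\<^bsub>M p\<^esub>i\<in>{..p}. \<Oplus>\<^bsub>M p\<^esub>j\<in>{..p - i}. f i j (p - i - j))"
    by (rule act.M.comp.M.finsum_triples) (rule fc)
  also have "\<dots> = convolution M act a (convolution M act b x) p"
    unfolding convolution_def[of M act a]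
  proof (rule act.M.comp.M.finsum_congI)
    fix i assume i: "i \<in> {..p}"
    have "act i (p - i) (a i) (convolution M act b x (p - i)) =
        (\<Oplus>\<^bsub>M (i + (p - i))\<^esub>j\<in>{..p - i}. act i (p - i) (a i) (act j (p - i - j) (b j) (x (p - i - j))))"
      unfolding convolution_def by (intro act.act_finsum_right) (auto intro: ent act.act_entry_closed[OF b x] simp del: diff_diff_left)
    also have "\<dots> = (\<Oplus>\<^bsub>M p\<^esub>j\<in>{..p - i}. f i j (p - i - j))"
    proof -
      have "act i (p - i) (a i) (act j (p - i - j) (b j) (x (p - i - j))) = f i j (p - i - j)" if "j \<le> p - i" for j
        unfolding f_def using that act_assoc[OF ent(1) ent(2) ent(3), of i j "p - i - j"] le_add_diff_inverse[OF that]
        by simp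
      then show ?thesis using i by (simp, intro act.M.comp.M.finsum_congI) (auto intro: fc)
    qed
    finally show "(\<Oplus>\<^bsub>M p\<^esub>j\<in>{..p - i}. f i j (p - i - j)) = act i (p - i) (a i) (convolution M act b x (p - i))" ..
    show "act i (p - i) (a i) (convolution M act b x (p - i)) \<in> carrier (M p)"
      using i act.act_closed[OF ent(1) act.convolution_entry_closed[OF b x], of i "p - i"] by simp
  qed
  finally show "convolution M act (convolution A mul a b) x p = convolution M act a (convolution M act b x) p" .
qed

lemma convolution_unit:
  assumes "x \<in> carrier (direct_sum M)"
  shows "convolution M act (homogeneous A 0 unit) x = x"
  using assms act_unit by (auto simp: fun_eq_iff act.convolution_homogeneous_left unit_closed direct_sum_def)

end

text \<open>The algebras of cochains and of cohomology classes both have this form.\<close>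

definition direct_sum_algebra ::
  "(nat \<Rightarrow> ('k, 'a) module) \<Rightarrow> (nat \<Rightarrow> nat \<Rightarrow> 'a \<Rightarrow> 'a \<Rightarrow> 'a) \<Rightarrow> 'a \<Rightarrow> ('k, nat \<Rightarrow> 'a) module" where
  "direct_sum_algebra A mul unit = (direct_sum A)\<lparr>mult := convolution A mul, one := homogeneous A 0 unit\<rparr>"

lemma direct_sum_algebra_sel [simp]:
  "carrier (direct_sum_algebra A mul unit) = carrier (direct_sum A)"
  "zero (direct_sum_algebra A mul unit) = zero (direct_sum A)"
  "add (direct_sum_algebra A mul unit) = add (direct_sum A)"
  "smult (direct_sum_algebra A mul unit) = smult (direct_sum A)"
  "mult (direct_sum_algebra A mul unit) = convolution A mul"
  "one (direct_sum_algebra A mul unit) = homogeneous A 0 unit"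
  by (simp_all add: direct_sum_algebra_def)

locale graded_algebra_family = graded_action K A A mul mul unit
  for K :: "'k ring" and A :: "nat \<Rightarrow> ('k, 'a) module" and mul unit +
  assumes mul_unit: "a \<in> carrier (A n) \<Longrightarrow> mul n 0 a unit = a"
begin

lemma convolution_unit_right:
  assumes "a \<in> carrier (direct_sum A)"
  shows "convolution A mul a (homogeneous A 0 unit) = a"
proof
  fix p
  have ent: "a n \<in> carrier (A n)" for n using assms by (auto simp: direct_sum_def)
  have entry: "mul n (p - n) (a n) (homogeneous A 0 unit (p - n)) = (if p = n then a p else \<zero>\<^bsub>A p\<^esub>)" if "n \<le> p" for n
    using that mul_unit[OF ent] mul.act_zero_right[OF ent, of n "p - n"] by (auto simp: homogeneous_def)
  then have "convolution A mul a (homogeneous A 0 unit) p = (\<Oplus>\<^bsub>A p\<^esub>n\<in>{..p}. if p = n then a p else \<zero>\<^bsub>A p\<^esub>)"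
    unfolding convolution_def using ent by (intro mul.A.comp.M.finsum_congI) auto
  also have "\<dots> = a p"
    using mul.A.comp.M.finsum_singleton[of p "{..p}" "\<lambda>_. a p" p] ent by simp
  finally show "convolution A mul a (homogeneous A 0 unit) p = a p" .
qed

lemma direct_sum_algebra_module: "module K (direct_sum_algebra A mul unit)"
  using mul.A.direct_sum_module by (subst module_cong[where N = "direct_sum A"]) auto

lemma direct_sum_algebra_ring: "ring (direct_sum_algebra A mul unit)"
proof (rule ringI)
  show "abelian_group (direct_sum_algebra A mul unit)"
    using direct_sum_algebra_module by (simp add: module_def)
  show "Group.monoid (direct_sum_algebra A mul unit)"
    by unfold_locales (auto simp: mul.convolution_closed convolution_assoc convolution_unit convolution_unit_right
        mul.A.homogeneous_carrier unit_closed)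
qed (auto simp: mul.convolution_add_left mul.convolution_add_right)

lemma direct_sum_graded_algebra: "graded_algebra K (direct_sum_algebra A mul unit) (graded_part A)"
  unfolding graded_algebra_def assoc_algebra_def
proof (intro conjI)
  show "grading K (direct_sum_algebra A mul unit) (graded_part A)"
    using mul.A.direct_sum_grading by (subst grading_cong[where N = "direct_sum A"]) auto
qed (auto simp: direct_sum_algebra_ring direct_sum_algebra_module mul.convolution_smult unit_closed
    mul.convolution_graded_part, simp add: graded_part_def unit_closed)

text \<open>The laws hold degree by degree, hence for the biadditive extension to direct sums.\<close>

theorem direct_sum_graded_module:
  assumes "graded_action K A M mul act unit"
  shows "graded_module K (direct_sum_algebra A mul unit) (graded_part A)
    (direct_sum M) (graded_part M) (convolution M act)"
proof -
  interpret mod: graded_action K A M mul act unit by (rule assms)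
  have "abelian_group (with_action (direct_sum M) (convolution M act))"
    by (rule abelian_group_cong[OF mod.act.M.direct_sum_abelian_group]) (simp_all add: with_action_def)
  then have "left_module (direct_sum_algebra A mul unit) (with_action (direct_sum M) (convolution M act))"
    unfolding left_module_def
    by (simp add: direct_sum_algebra_ring with_action_def mod.act.convolution_closed mod.act.convolution_add_left
        mod.act.convolution_add_right mod.convolution_assoc mod.convolution_unit)
  then show ?thesis
    unfolding graded_module_def
    by (simp add: direct_sum_graded_algebra mod.act.M.direct_sum_module mod.act.M.direct_sum_grading
        mod.act.convolution_smult mod.act.convolution_graded_part)
qed

end

section \<open>Cohomology of a differential graded module\<close>

context
  fixes K :: "'k ring" and M :: "('k, 'v) module" and N
  assumes M: "module K M" and N: "submodule N K M"
begin

interpretation M: module K M by (rule M)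

lemma submodule_abelian_subgroup: "abelian_subgroup N M"
  using N by (intro abelian_subgroupI3 additive_subgroupI) (auto simp: submodule_def M.abelian_group_axioms)

interpretation N: abelian_subgroup N M by (rule submodule_abelian_subgroup)

lemma coset_eq_iff:
  assumes "x \<in> carrier M" "y \<in> carrier M"
  shows "N +>\<^bsub>M\<^esub> x = N +>\<^bsub>M\<^esub> y \<longleftrightarrow> (\<exists>b\<in>N. x = b \<oplus>\<^bsub>M\<^esub> y)"
proof -
  have "x \<in> N +>\<^bsub>M\<^esub> y \<longleftrightarrow> (\<exists>b\<in>N. x = b \<oplus>\<^bsub>M\<^esub> y)" by (auto simp: a_r_coset_def')
  moreover have "N +>\<^bsub>M\<^esub> x = N +>\<^bsub>M\<^esub> y" if "x \<in> N +>\<^bsub>M\<^esub> y"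
    using M.a_repr_independence[OF that assms(2) N.a_subgroup] by (rule sym)
  moreover have "x \<in> N +>\<^bsub>M\<^esub> x" using assms(1) by (rule N.a_rcos_self)
  ultimately show ?thesis by blast
qed

lemma quotient_carrier: "carrier (quotient_module M N) = (\<lambda>x. N +>\<^bsub>M\<^esub> x) ` carrier M"
  by (auto simp: quotient_module_def A_RCOSETS_def')

lemma quotient_add: "\<lbrakk>x \<in> carrier M; y \<in> carrier M\<rbrakk> \<Longrightarrow>
    (N +>\<^bsub>M\<^esub> x) \<oplus>\<^bsub>quotient_module M N\<^esub> (N +>\<^bsub>M\<^esub> y) = N +>\<^bsub>M\<^esub> (x \<oplus>\<^bsub>M\<^esub> y)"
  by (simp add: quotient_module_def N.a_rcos_sum)

lemma quotient_zero: "\<zero>\<^bsub>quotient_module M N\<^esub> = N +>\<^bsub>M\<^esub> \<zero>\<^bsub>M\<^esub>"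
  using N.a_subset by (simp add: quotient_module_def)

lemma quotient_smult:
  assumes c: "c \<in> carrier K" and x: "x \<in> carrier M"
  shows "c \<odot>\<^bsub>quotient_module M N\<^esub> (N +>\<^bsub>M\<^esub> x) = N +>\<^bsub>M\<^esub> (c \<odot>\<^bsub>M\<^esub> x)"
proof -
  have "N +>\<^bsub>M\<^esub> (c \<odot>\<^bsub>M\<^esub> y) = N +>\<^bsub>M\<^esub> (c \<odot>\<^bsub>M\<^esub> x)" if y: "y \<in> N +>\<^bsub>M\<^esub> x" for y
  proof -
    obtain b where b: "b \<in> N" "y = b \<oplus>\<^bsub>M\<^esub> x" using y by (auto simp: a_r_coset_def')
    then have "b \<in> carrier M" using N.a_subset by auto
    with b have "c \<odot>\<^bsub>M\<^esub> y = c \<odot>\<^bsub>M\<^esub> b \<oplus>\<^bsub>M\<^esub> c \<odot>\<^bsub>M\<^esub> x" using c x by (simp add: M.smult_r_distr)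
    moreover have "c \<odot>\<^bsub>M\<^esub> b \<in> N" using submodule.smult_closed[OF N] b c by blast
    ultimately have "\<exists>b\<in>N. c \<odot>\<^bsub>M\<^esub> y = b \<oplus>\<^bsub>M\<^esub> c \<odot>\<^bsub>M\<^esub> x" by blast
    moreover have "y \<in> carrier M" using b(2) \<open>b \<in> carrier M\<close> x by simp
    ultimately show ?thesis using c x by (intro iffD2[OF coset_eq_iff] M.smult_closed)
  qed
  moreover have "x \<in> N +>\<^bsub>M\<^esub> x" using x by (rule N.a_rcos_self)
  ultimately have "(\<Union>y\<in>N +>\<^bsub>M\<^esub> x. N +>\<^bsub>M\<^esub> (c \<odot>\<^bsub>M\<^esub> y)) = N +>\<^bsub>M\<^esub> (c \<odot>\<^bsub>M\<^esub> x)" by blast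
  then show ?thesis by (simp add: quotient_module_def)
qed

lemma quotient_cases:
  assumes "X \<in> carrier (quotient_module M N)"
  obtains x where "x \<in> carrier M" "X = N +>\<^bsub>M\<^esub> x"
  using assms unfolding quotient_carrier by blast

lemma quotient_closed: "x \<in> carrier M \<Longrightarrow> N +>\<^bsub>M\<^esub> x \<in> carrier (quotient_module M N)"
  unfolding quotient_carrier by blast

lemma quotient_is_module: "module K (quotient_module M N)"
proof (rule moduleI)
  show "cring K" by (rule M.R.is_cring)
  show "abelian_group (quotient_module M N)"
  proof (rule abelian_groupI)
    show "\<zero>\<^bsub>quotient_module M N\<^esub> \<in> carrier (quotient_module M N)"
      unfolding quotient_zero by (rule quotient_closed) simp
  next
    fix X assume "X \<in> carrier (quotient_module M N)"
    then obtain x where x: "x \<in> carrier M" "X = N +>\<^bsub>M\<^esub> x" by (rule quotient_cases)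
    then show "\<zero>\<^bsub>quotient_module M N\<^esub> \<oplus>\<^bsub>quotient_module M N\<^esub> X = X"
      by (simp only: quotient_zero quotient_add M.zero_closed M.l_zero)
    have "(N +>\<^bsub>M\<^esub> (\<ominus>\<^bsub>M\<^esub> x)) \<oplus>\<^bsub>quotient_module M N\<^esub> X = \<zero>\<^bsub>quotient_module M N\<^esub>"
      using x by (simp only: quotient_zero quotient_add M.a_inv_closed M.l_neg)
    then show "\<exists>Y\<in>carrier (quotient_module M N). Y \<oplus>\<^bsub>quotient_module M N\<^esub> X = \<zero>\<^bsub>quotient_module M N\<^esub>"
      using x quotient_closed[of "\<ominus>\<^bsub>M\<^esub> x"] by blast
    fix Y assume "Y \<in> carrier (quotient_module M N)"
    then obtain y where y: "y \<in> carrier M" "Y = N +>\<^bsub>M\<^esub> y" by (rule quotient_cases)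
    show "X \<oplus>\<^bsub>quotient_module M N\<^esub> Y \<in> carrier (quotient_module M N)"
      using x y by (simp only: quotient_add quotient_closed M.a_closed)
    show "X \<oplus>\<^bsub>quotient_module M N\<^esub> Y = Y \<oplus>\<^bsub>quotient_module M N\<^esub> X"
      using x y M.a_comm[of x y] by (simp only: quotient_add)
    fix Z assume "Z \<in> carrier (quotient_module M N)"
    then obtain z where z: "z \<in> carrier M" "Z = N +>\<^bsub>M\<^esub> z" by (rule quotient_cases)
    show "X \<oplus>\<^bsub>quotient_module M N\<^esub> Y \<oplus>\<^bsub>quotient_module M N\<^esub> Z = X \<oplus>\<^bsub>quotient_module M N\<^esub> (Y \<oplus>\<^bsub>quotient_module M N\<^esub> Z)"
      using x y z by (simp only: quotient_add M.a_closed M.a_assoc)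
  qed
next
  fix a X assume a: "a \<in> carrier K" and "X \<in> carrier (quotient_module M N)"
  then obtain x where x: "x \<in> carrier M" "X = N +>\<^bsub>M\<^esub> x" by (elim quotient_cases)
  show "a \<odot>\<^bsub>quotient_module M N\<^esub> X \<in> carrier (quotient_module M N)"
    using a x by (simp only: quotient_smult quotient_closed M.smult_closed)
  fix b assume b: "b \<in> carrier K"
  show "(a \<oplus>\<^bsub>K\<^esub> b) \<odot>\<^bsub>quotient_module M N\<^esub> X =
      a \<odot>\<^bsub>quotient_module M N\<^esub> X \<oplus>\<^bsub>quotient_module M N\<^esub> b \<odot>\<^bsub>quotient_module M N\<^esub> X"
    using a b x by (simp only: quotient_smult quotient_add M.R.a_closed M.smult_closed M.smult_l_distr)
  show "(a \<otimes>\<^bsub>K\<^esub> b) \<odot>\<^bsub>quotient_module M N\<^esub> X = a \<odot>\<^bsub>quotient_module M N\<^esub> (b \<odot>\<^bsub>quotient_module M N\<^esub> X)"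
    using a b x by (simp only: quotient_smult M.R.m_closed M.smult_closed M.smult_assoc1)
next
  fix X assume "X \<in> carrier (quotient_module M N)"
  then obtain x where "x \<in> carrier M" "X = N +>\<^bsub>M\<^esub> x" by (elim quotient_cases)
  then show "\<one>\<^bsub>K\<^esub> \<odot>\<^bsub>quotient_module M N\<^esub> X = X"
    by (simp only: quotient_smult M.R.one_closed M.smult_one)
next
  fix a X Y
  assume a: "a \<in> carrier K" and "X \<in> carrier (quotient_module M N)" "Y \<in> carrier (quotient_module M N)"
  then obtain x y where "x \<in> carrier M" "X = N +>\<^bsub>M\<^esub> x" "y \<in> carrier M" "Y = N +>\<^bsub>M\<^esub> y"
    by (elim quotient_cases)
  then show "a \<odot>\<^bsub>quotient_module M N\<^esub> (X \<oplus>\<^bsub>quotient_module M N\<^esub> Y) =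
      a \<odot>\<^bsub>quotient_module M N\<^esub> X \<oplus>\<^bsub>quotient_module M N\<^esub> a \<odot>\<^bsub>quotient_module M N\<^esub> Y"
    using a by (simp only: quotient_smult quotient_add M.a_closed M.smult_closed M.smult_r_distr)
qed

end

lemma (in module) alt_sign_closed [simp]: "x \<in> carrier M \<Longrightarrow> alt_sign M n x \<in> carrier M"
  by (simp add: alt_sign_def)

locale cochain_complex = module_family K M for K :: "'k ring" and M :: "nat \<Rightarrow> ('k, 'v) module" +
  fixes d :: "nat \<Rightarrow> 'v \<Rightarrow> 'v"
  assumes d_closed: "x \<in> carrier (M n) \<Longrightarrow> d n x \<in> carrier (M (n + 1))"
    and d_add: "\<lbrakk>x \<in> carrier (M n); y \<in> carrier (M n)\<rbrakk> \<Longrightarrow> d n (x \<oplus>\<^bsub>M n\<^esub> y) = d n x \<oplus>\<^bsub>M (n + 1)\<^esub> d n y"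
    and d_smult: "\<lbrakk>c \<in> carrier K; x \<in> carrier (M n)\<rbrakk> \<Longrightarrow> d n (c \<odot>\<^bsub>M n\<^esub> x) = c \<odot>\<^bsub>M (n + 1)\<^esub> d n x"
    and d_d: "x \<in> carrier (M n) \<Longrightarrow> d (n + 1) (d n x) = \<zero>\<^bsub>M (n + 2)\<^esub>"
begin

text \<open>Cocycles, coboundaries and cohomology of any complex, in the form in which they are defined for
  Davydov-Yetter cochains.\<close>

definition cocycles where "cocycles n = {x \<in> carrier (M n). d n x = \<zero>\<^bsub>M (n + 1)\<^esub>}"

definition coboundaries where
  "coboundaries n = (case n of 0 \<Rightarrow> {\<zero>\<^bsub>M 0\<^esub>} | Suc m \<Rightarrow> d m ` carrier (M m))"

definition cohomology where
  "cohomology n = quotient_module ((M n)\<lparr>carrier := cocycles n\<rparr>) (coboundaries n)"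

definition cohomology_class where "cohomology_class n x = coboundaries n +>\<^bsub>M n\<^esub> x"

lemma d_zero: "d n \<zero>\<^bsub>M n\<^esub> = \<zero>\<^bsub>M (n + 1)\<^esub>"
  using d_smult[of "\<zero>\<^bsub>K\<^esub>" "\<zero>\<^bsub>M n\<^esub>" n] d_closed[of "\<zero>\<^bsub>M n\<^esub>" n] by simp

lemma d_neg: "x \<in> carrier (M n) \<Longrightarrow> d n (\<ominus>\<^bsub>M n\<^esub> x) = \<ominus>\<^bsub>M (n + 1)\<^esub> d n x"
  using d_smult[of "\<ominus>\<^bsub>K\<^esub> \<one>\<^bsub>K\<^esub>" x n] d_closed[of x n] by (simp add: comp.smult_l_minus)

lemma cocycles_submodule: "submodule (cocycles n) K (M n)"
  by (rule comp.submoduleI) (auto simp: cocycles_def d_zero d_neg d_add d_smult)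

lemma coboundaries_submodule: "submodule (coboundaries n) K (M n)"
proof (cases n)
  case (Suc m)
  then have cob: "coboundaries n = d m ` carrier (M m)" by (simp add: coboundaries_def)
  show ?thesis unfolding cob
  proof (rule comp.submoduleI)
    show "\<zero>\<^bsub>M n\<^esub> \<in> d m ` carrier (M m)" using d_zero[of m] Suc by (intro image_eqI[of _ _ "\<zero>\<^bsub>M m\<^esub>"]) auto
  next
    fix x assume "x \<in> d m ` carrier (M m)"
    then obtain y where "y \<in> carrier (M m)" "x = d m y" by blast
    then show "\<ominus>\<^bsub>M n\<^esub> x \<in> d m ` carrier (M m)"
      using d_neg[of y m] Suc by (intro image_eqI[of _ _ "\<ominus>\<^bsub>M m\<^esub> y"]) auto
  next
    fix x x' assume "x \<in> d m ` carrier (M m)" "x' \<in> d m ` carrier (M m)"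
    then obtain y y' where "y \<in> carrier (M m)" "x = d m y" "y' \<in> carrier (M m)" "x' = d m y'" by blast
    then show "x \<oplus>\<^bsub>M n\<^esub> x' \<in> d m ` carrier (M m)"
      using d_add[of y m y'] Suc by (intro image_eqI[of _ _ "y \<oplus>\<^bsub>M m\<^esub> y'"]) auto
  next
    fix c x assume "c \<in> carrier K" "x \<in> d m ` carrier (M m)"
    then obtain y where "c \<in> carrier K" "y \<in> carrier (M m)" "x = d m y" by blast
    then show "c \<odot>\<^bsub>M n\<^esub> x \<in> d m ` carrier (M m)"
      using d_smult[of c y m] Suc by (intro image_eqI[of _ _ "c \<odot>\<^bsub>M m\<^esub> y"]) auto
  qed (use Suc d_closed in auto)
qed (auto intro!: comp.submoduleI simp: coboundaries_def)

lemma coboundaries_subset: "coboundaries n \<subseteq> cocycles n"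
  using d_closed d_d by (cases n) (auto simp: cocycles_def coboundaries_def d_zero[simplified])

lemma cocycles_carrier: "x \<in> cocycles n \<Longrightarrow> x \<in> carrier (M n)"
  by (simp add: cocycles_def)

lemma coboundaries_carrier: "x \<in> coboundaries n \<Longrightarrow> x \<in> carrier (M n)"
  using coboundaries_subset cocycles_carrier by blast

lemma cocycles_module: "module K ((M n)\<lparr>carrier := cocycles n\<rparr>)"
  by (rule submodule.submodule_is_module[OF cocycles_submodule modules])

lemma coboundaries_submodule_cocycles: "submodule (coboundaries n) K ((M n)\<lparr>carrier := cocycles n\<rparr>)"
proof -
  interpret Z: module K "(M n)\<lparr>carrier := cocycles n\<rparr>" by (rule cocycles_module)
  note cob = coboundaries_submodule[of n]
  have neg: "\<ominus>\<^bsub>(M n)\<lparr>carrier := cocycles n\<rparr>\<^esub> x = \<ominus>\<^bsub>M n\<^esub> x" if "x \<in> coboundaries n" for x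
  proof (rule Z.minus_equality)
    have "x \<in> cocycles n" "\<ominus>\<^bsub>M n\<^esub> x \<in> cocycles n"
      using that coboundaries_subset comp.submoduleE(3)[OF cob] by blast+
    then show "x \<in> carrier ((M n)\<lparr>carrier := cocycles n\<rparr>)" "\<ominus>\<^bsub>M n\<^esub> x \<in> carrier ((M n)\<lparr>carrier := cocycles n\<rparr>)"
      by simp_all
    show "\<ominus>\<^bsub>M n\<^esub> x \<oplus>\<^bsub>(M n)\<lparr>carrier := cocycles n\<rparr>\<^esub> x = \<zero>\<^bsub>(M n)\<lparr>carrier := cocycles n\<rparr>\<^esub>"
      using \<open>x \<in> cocycles n\<close> by (simp add: cocycles_carrier comp.M.l_neg)
  qed
  have "\<zero>\<^bsub>M n\<^esub> \<in> coboundaries n"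
    using subgroup.one_closed[OF submodule.axioms(1)[OF cob]] by simp
  then show ?thesis
    using coboundaries_subset comp.submoduleE(3,4,5)[OF cob]
    by (intro Z.submoduleI) (auto simp: neg)
qed

lemma coset_cocycles: "coboundaries n +>\<^bsub>(M n)\<lparr>carrier := cocycles n\<rparr>\<^esub> x = cohomology_class n x"
  by (simp add: cohomology_class_def a_r_coset_def')

lemma cohomology_module: "module K (cohomology n)"
  unfolding cohomology_def by (rule quotient_is_module[OF cocycles_module coboundaries_submodule_cocycles])

lemma cohomology_carrier: "carrier (cohomology n) = cohomology_class n ` cocycles n"
  unfolding cohomology_def quotient_carrier[OF cocycles_module coboundaries_submodule_cocycles] coset_cocycles by simp

lemma cohomology_add: "\<lbrakk>x \<in> cocycles n; y \<in> cocycles n\<rbrakk> \<Longrightarrow>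
    cohomology_class n x \<oplus>\<^bsub>cohomology n\<^esub> cohomology_class n y = cohomology_class n (x \<oplus>\<^bsub>M n\<^esub> y)"
  using quotient_add[OF cocycles_module coboundaries_submodule_cocycles, of x n y]
  by (simp add: cohomology_def coset_cocycles)

lemma cohomology_smult: "\<lbrakk>c \<in> carrier K; x \<in> cocycles n\<rbrakk> \<Longrightarrow>
    c \<odot>\<^bsub>cohomology n\<^esub> cohomology_class n x = cohomology_class n (c \<odot>\<^bsub>M n\<^esub> x)"
  using quotient_smult[OF cocycles_module coboundaries_submodule_cocycles, of c x n]
  by (simp add: cohomology_def coset_cocycles)

lemma cohomology_class_eq_iff:
  "\<lbrakk>x \<in> carrier (M n); y \<in> carrier (M n)\<rbrakk> \<Longrightarrow>
    cohomology_class n x = cohomology_class n y \<longleftrightarrow> (\<exists>b\<in>coboundaries n. x = b \<oplus>\<^bsub>M n\<^esub> y)"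
  unfolding cohomology_class_def by (rule coset_eq_iff[OF modules coboundaries_submodule])

lemma cohomology_class_elem: "y \<in> cohomology_class n x \<longleftrightarrow> (\<exists>b\<in>coboundaries n. y = b \<oplus>\<^bsub>M n\<^esub> x)"
  by (auto simp: cohomology_class_def a_r_coset_def')

lemma coboundaries_closed:
  "\<zero>\<^bsub>M n\<^esub> \<in> coboundaries n"
  "\<lbrakk>x \<in> coboundaries n; y \<in> coboundaries n\<rbrakk> \<Longrightarrow> x \<oplus>\<^bsub>M n\<^esub> y \<in> coboundaries n"
  "x \<in> coboundaries n \<Longrightarrow> alt_sign (M n) k x \<in> coboundaries n"
  using subgroup.one_closed[OF submodule.axioms(1)[OF coboundaries_submodule[of n]]]
    comp.submoduleE(3,5)[OF coboundaries_submodule[of n]] by (auto simp: alt_sign_def)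

end

text \<open>The Leibniz rule makes the action descend to cohomology.\<close>

locale dg_action = A: cochain_complex K A dA + M: cochain_complex K M dM + bilinear_family K A M act
  for K :: "'k ring" and A :: "nat \<Rightarrow> ('k, 'a) module" and dA
    and M :: "nat \<Rightarrow> ('k, 'v) module" and dM and act +
  assumes leibniz: "\<lbrakk>a \<in> carrier (A n); x \<in> carrier (M m)\<rbrakk> \<Longrightarrow>
      dM (n + m) (act n m a x) = act (n + 1) m (dA n a) x \<oplus>\<^bsub>M (n + m + 1)\<^esub>
        alt_sign (M (n + m + 1)) n (act n (m + 1) a (dM m x))"
begin

definition cohomology_act where
  "cohomology_act n m = coset_op (M (n + m)) (M.coboundaries (n + m)) (act n m)"

lemma act_cocycles:
  assumes "a \<in> A.cocycles n" "x \<in> M.cocycles m"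
  shows "act n m a x \<in> M.cocycles (n + m)"
  using assms leibniz[of a n x m] act_zero_left[of x m "n + 1"] act_zero_right[of a n "m + 1"]
  by (simp add: A.cocycles_def M.cocycles_def act_closed alt_sign_def)

text \<open>In \<open>d (b' x) = (d b') x \<plusminus> b' (d x)\<close> the second term vanishes for a cocycle \<open>x\<close>.\<close>

lemma act_coboundary_left:
  assumes b: "b \<in> A.coboundaries n" and x: "x \<in> M.cocycles m"
  shows "act n m b x \<in> M.coboundaries (n + m)"
proof (cases n)
  case 0
  then show ?thesis using b x act_zero_left[of x m 0] M.coboundaries_closed(1)[of m]
    by (simp add: A.coboundaries_def M.cocycles_carrier)
next
  case (Suc k)
  then obtain b' where b': "b' \<in> carrier (A k)" "b = dA k b'" using b by (auto simp: A.coboundaries_def)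
  have "act n m b x = dM (k + m) (act k m b' x)"
    using leibniz[OF b'(1), of x m] x b' Suc act_zero_right[of b' k "m + 1"] act_closed[of b n x m]
      A.d_closed[of b' k]
    by (simp add: M.cocycles_def alt_sign_def)
  then show ?thesis using Suc act_closed[OF b'(1), of x m] x by (auto simp: M.coboundaries_def M.cocycles_carrier)
qed

lemma act_coboundary_right:
  assumes a: "a \<in> A.cocycles n" and b: "b \<in> M.coboundaries m"
  shows "act n m a b \<in> M.coboundaries (n + m)"
proof (cases m)
  case 0
  then show ?thesis using a b act_zero_right[of a n 0] M.coboundaries_closed(1)[of n]
    by (simp add: M.coboundaries_def[of 0] A.cocycles_carrier)
next
  case (Suc k)
  then obtain b' where b': "b' \<in> carrier (M k)" "b = dM k b'" using b by (auto simp: M.coboundaries_def)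
  have ca: "a \<in> carrier (A n)" using a by (rule A.cocycles_carrier)
  have cl: "act n m a b \<in> carrier (M (n + m))" using act_closed[OF ca, of b m] b' M.d_closed[of b' k] Suc by simp
  have "dM (n + k) (act n k a b') = alt_sign (M (n + m)) n (act n m a b)"
    using leibniz[OF ca b'(1)] a b' Suc act_zero_left[of b' k "n + 1"] cl by (simp add: A.cocycles_def)
  then have "act n m a b = alt_sign (M (n + m)) n (dM (n + k) (act n k a b'))"
    using cl by (simp add: alt_sign_def)
  moreover have "dM (n + k) (act n k a b') \<in> M.coboundaries (n + m)"
    using Suc act_closed[OF ca b'(1)] by (auto simp: M.coboundaries_def)
  ultimately show ?thesis using M.coboundaries_closed(3) by metis
qed

text \<open>Changing the representatives to \<open>b + a\<close> and \<open>x' = b' + x\<close> changes the value by \<open>b x'\<close> and \<open>a b'\<close>. Both are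
  coboundaries, the first because \<open>x'\<close> is again a cocycle by \<open>d d = 0\<close>.\<close>

lemma cohomology_act_class:
  assumes a: "a \<in> A.cocycles n" and x: "x \<in> M.cocycles m"
  shows "cohomology_act n m (A.cohomology_class n a) (M.cohomology_class m x) = M.cohomology_class (n + m) (act n m a x)"
proof -
  have "M.cohomology_class (n + m) (act n m a' x') = M.cohomology_class (n + m) (act n m a x)"
    if "a' \<in> A.cohomology_class n a" "x' \<in> M.cohomology_class m x" for a' x'
  proof -
    obtain b b' where b: "b \<in> A.coboundaries n" "a' = b \<oplus>\<^bsub>A n\<^esub> a" "b' \<in> M.coboundaries m" "x' = b' \<oplus>\<^bsub>M m\<^esub> x"
      using \<open>a' \<in> _\<close> \<open>x' \<in> _\<close> unfolding A.cohomology_class_elem M.cohomology_class_elem by blast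
    note car = A.coboundaries_carrier[OF b(1)] M.coboundaries_carrier[OF b(3)]
      A.cocycles_carrier[OF a] M.cocycles_carrier[OF x]
    have x'z: "x' \<in> M.cocycles m"
      using b x M.coboundaries_subset M.comp.submoduleE(5)[OF M.cocycles_submodule] by blast
    have x'c: "x' \<in> carrier (M m)" using x'z by (rule M.cocycles_carrier)
    have "act n m a' x' = act n m b x' \<oplus>\<^bsub>M (n + m)\<^esub> act n m a x'"
      unfolding b(2) by (rule act_add_left[OF car(1,3) x'c])
    also have "act n m a x' = act n m a b' \<oplus>\<^bsub>M (n + m)\<^esub> act n m a x"
      unfolding b(4) by (rule act_add_right[OF car(3,2,4)])
    also have "act n m b x' \<oplus>\<^bsub>M (n + m)\<^esub> (act n m a b' \<oplus>\<^bsub>M (n + m)\<^esub> act n m a x) =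
        (act n m b x' \<oplus>\<^bsub>M (n + m)\<^esub> act n m a b') \<oplus>\<^bsub>M (n + m)\<^esub> act n m a x"
      by (rule M.comp.M.a_assoc[symmetric]) (rule act_closed[OF car(1) x'c] act_closed[OF car(3,2)] act_closed[OF car(3,4)])+
    finally have sum: "act n m a' x' = (act n m b x' \<oplus>\<^bsub>M (n + m)\<^esub> act n m a b') \<oplus>\<^bsub>M (n + m)\<^esub> act n m a x" .
    have cob: "act n m b x' \<oplus>\<^bsub>M (n + m)\<^esub> act n m a b' \<in> M.coboundaries (n + m)"
      by (rule M.coboundaries_closed(2)[OF act_coboundary_left[OF b(1) x'z] act_coboundary_right[OF a b(3)]])
    have "act n m a' x' \<in> carrier (M (n + m))"
      unfolding sum by (rule M.comp.M.a_closed[OF M.coboundaries_carrier[OF cob] act_closed[OF car(3,4)]])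
    then show ?thesis
      using cob sum by (subst M.cohomology_class_eq_iff[OF _ act_closed[OF car(3,4)]]) blast+
  qed
  moreover have "a \<in> A.cohomology_class n a" "x \<in> M.cohomology_class m x"
    using a x A.coboundaries_closed(1)[of n] M.coboundaries_closed(1)[of m] A.cocycles_carrier M.cocycles_carrier
    by (force simp: A.cohomology_class_elem M.cohomology_class_elem)+
  ultimately show ?thesis
    unfolding cohomology_act_def coset_op_def M.cohomology_class_def[symmetric] by blast
qed

lemma cohomology_bilinear: "bilinear_family K A.cohomology M.cohomology cohomology_act"
proof (intro bilinear_family.intro module_family.intro bilinear_family_axioms.intro)
  show "module K (A.cohomology n)" "module K (M.cohomology n)" for n
    by (rule A.cohomology_module, rule M.cohomology_module)
qed (auto simp: A.cohomology_carrier M.cohomology_carrier cohomology_act_class act_cocycles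
    A.cohomology_add M.cohomology_add A.cohomology_smult M.cohomology_smult
    act_add_left act_add_right act_smult_left act_smult_right A.cocycles_carrier M.cocycles_carrier
    A.comp.submoduleE(4,5)[OF A.cocycles_submodule] M.comp.submoduleE(4,5)[OF M.cocycles_submodule])

end

text \<open>The reason is \<open>d 1 = d (1 \<cdot> 1) = d 1 + d 1\<close>.\<close>

lemma dg_unit_cocycle:
  assumes "dg_action K A dA A dA mul" "graded_algebra_family K A mul unit"
  shows "dA 0 unit = \<zero>\<^bsub>A 1\<^esub>"
proof -
  interpret mul: dg_action K A dA A dA mul by (rule assms(1))
  interpret alg: graded_algebra_family K A mul unit by (rule assms(2))
  note u = alg.unit_closed
  have du: "dA 0 unit \<in> carrier (A 1)" using mul.A.d_closed[OF u] by simp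
  have "dA 0 unit = dA 0 unit \<oplus>\<^bsub>A 1\<^esub> dA 0 unit"
    using mul.leibniz[OF u u] alg.mul_unit[OF u] alg.mul_unit[OF du] alg.act_unit[OF du] by (simp add: alt_sign_def)
  then show ?thesis using mul.A.comp.M.add.l_cancel_one'[OF du du] by simp
qed

text \<open>Each law holds for classes because it holds for representing cocycles.\<close>

lemma cohomology_graded_action:
  assumes "dg_action K A dA A dA mul" "dg_action K A dA M dM act" "graded_action K A M mul act unit"
    and unit: "dA 0 unit = \<zero>\<^bsub>A 1\<^esub>"
  shows "graded_action K (cochain_complex.cohomology A dA) (cochain_complex.cohomology M dM)
    (dg_action.cohomology_act A dA mul) (dg_action.cohomology_act M dM act) (cochain_complex.cohomology_class A dA 0 unit)"
proof -
  interpret mul: dg_action K A dA A dA mul by fact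
  interpret act: dg_action K A dA M dM act by fact
  interpret graded_action K A M mul act unit by fact
  have unit_cocycle: "unit \<in> mul.A.cocycles 0" using unit unit_closed by (simp add: mul.A.cocycles_def)
  have assoc: "act.cohomology_act (n + m) l (mul.cohomology_act n m a b) x =
      act.cohomology_act n (m + l) a (act.cohomology_act m l b x)"
    if a: "a \<in> carrier (mul.A.cohomology n)" and b: "b \<in> carrier (mul.A.cohomology m)"
      and x: "x \<in> carrier (act.M.cohomology l)" for a n b m x l
  proof -
    obtain a' b' x' where cl: "a = mul.A.cohomology_class n a'" "b = mul.A.cohomology_class m b'"
        "x = act.M.cohomology_class l x'"
      and z: "a' \<in> mul.A.cocycles n" "b' \<in> mul.A.cocycles m" "x' \<in> act.M.cocycles l"
      using a b x unfolding mul.A.cohomology_carrier act.M.cohomology_carrier by blast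
    have "act (n + m) l (mul n m a' b') x' = act n (m + l) a' (act m l b' x')"
      using z by (intro act_assoc mul.A.cocycles_carrier act.M.cocycles_carrier)
    then show ?thesis
      unfolding cl mul.cohomology_act_class[OF z(1,2)] act.cohomology_act_class[OF z(2,3)]
        act.cohomology_act_class[OF mul.act_cocycles[OF z(1,2)] z(3)]
        act.cohomology_act_class[OF z(1) act.act_cocycles[OF z(2,3)]]
      by (simp only: add.assoc)
  qed
  have left_unit: "act.cohomology_act 0 m (mul.A.cohomology_class 0 unit) x = x"
    if x: "x \<in> carrier (act.M.cohomology m)" for x m
  proof -
    obtain x' where cl: "x = act.M.cohomology_class m x'" and z: "x' \<in> act.M.cocycles m"
      using x unfolding act.M.cohomology_carrier by blast
    show ?thesis
      unfolding cl act.cohomology_act_class[OF unit_cocycle z] act_unit[OF act.M.cocycles_carrier[OF z]]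
      by (simp only: add_0_left)
  qed
  show ?thesis
    by (intro graded_action.intro graded_action_axioms.intro mul.cohomology_bilinear act.cohomology_bilinear
        assoc left_unit) (use unit_cocycle in \<open>auto simp: mul.A.cohomology_carrier\<close>)
qed

lemma cohomology_graded_algebra_family:
  assumes "dg_action K A dA A dA mul" "graded_algebra_family K A mul unit"
    and unit: "dA 0 unit = \<zero>\<^bsub>A 1\<^esub>"
  shows "graded_algebra_family K (cochain_complex.cohomology A dA)
    (dg_action.cohomology_act A dA mul) (cochain_complex.cohomology_class A dA 0 unit)"
proof -
  interpret mul: dg_action K A dA A dA mul by (rule assms(1))
  interpret alg: graded_algebra_family K A mul unit by (rule assms(2))
  have unit_cocycle: "unit \<in> mul.A.cocycles 0" using unit alg.unit_closed by (simp add: mul.A.cocycles_def)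
  have "mul.cohomology_act n 0 a (mul.A.cohomology_class 0 unit) = a" if a: "a \<in> carrier (mul.A.cohomology n)" for a n
  proof -
    obtain x where x: "x \<in> mul.A.cocycles n" "a = mul.A.cohomology_class n x"
      using a unfolding mul.A.cohomology_carrier by blast
    have "mul n 0 x unit = x" by (rule alg.mul_unit[OF mul.A.cocycles_carrier[OF x(1)]])
    then show ?thesis unfolding x(2) mul.cohomology_act_class[OF x(1) unit_cocycle] by (simp only: add_0_right)
  qed
  then have "graded_algebra_family_axioms mul.A.cohomology mul.cohomology_act (mul.A.cohomology_class 0 unit)"
    by (rule graded_algebra_family_axioms.intro)
  with cohomology_graded_action[OF assms(1,1) alg.graded_action_axioms unit] show ?thesis
    by (rule graded_algebra_family.intro)
qed

text \<open>The Davydov-Yetter operations agree with more convenient formulas on carriers; the structure is transferred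
  along this agreement.\<close>

lemma cochain_complex_cong:
  assumes "cochain_complex K M d" and eq: "\<And>n x. x \<in> carrier (M n) \<Longrightarrow> d' n x = d n x"
  shows "cochain_complex K M d'"
proof -
  interpret cochain_complex K M d by fact
  show ?thesis
  proof
    fix n x y c assume x: "x \<in> carrier (M n)"
    show "d' n x \<in> carrier (M (n + 1))" "d' (n + 1) (d' n x) = \<zero>\<^bsub>M (n + 2)\<^esub>"
      using d_closed[OF x] d_d[OF x] by (simp_all add: eq x)
    show "d' n (x \<oplus>\<^bsub>M n\<^esub> y) = d' n x \<oplus>\<^bsub>M (n + 1)\<^esub> d' n y" if "y \<in> carrier (M n)"
      using d_add[OF x that] by (simp add: eq x that)
    show "d' n (c \<odot>\<^bsub>M n\<^esub> x) = c \<odot>\<^bsub>M (n + 1)\<^esub> d' n x" if "c \<in> carrier K"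
      using d_smult[OF that x] by (simp add: eq x that)
  qed
qed

lemma bilinear_family_cong:
  assumes "bilinear_family K A M act"
    and eq: "\<And>n m a x. \<lbrakk>a \<in> carrier (A n); x \<in> carrier (M m)\<rbrakk> \<Longrightarrow> act' n m a x = act n m a x"
  shows "bilinear_family K A M act'"
proof -
  interpret bilinear_family K A M act by fact
  show ?thesis
    by (intro bilinear_family.intro A.module_family_axioms M.module_family_axioms bilinear_family_axioms.intro)
      (simp_all add: eq act_closed act_add_left act_add_right act_smult_left act_smult_right)
qed

lemma dg_action_cong:
  assumes dg: "dg_action K A dA M dM act"
    and A: "\<And>n a. a \<in> carrier (A n) \<Longrightarrow> dA' n a = dA n a" and M: "\<And>n x. x \<in> carrier (M n) \<Longrightarrow> dM' n x = dM n x"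
    and eq: "\<And>n m a x. \<lbrakk>a \<in> carrier (A n); x \<in> carrier (M m)\<rbrakk> \<Longrightarrow> act' n m a x = act n m a x"
  shows "dg_action K A dA' M dM' act'"
proof -
  interpret dg_action K A dA M dM act by fact
  show ?thesis
  proof (intro dg_action.intro dg_action_axioms.intro)
    show "cochain_complex K A dA'" by (rule cochain_complex_cong[OF A.cochain_complex_axioms A])
    show "cochain_complex K M dM'" by (rule cochain_complex_cong[OF M.cochain_complex_axioms M])
    show "bilinear_family K A M act'" by (rule bilinear_family_cong[OF bilinear_family_axioms eq])
    fix a n x m assume a: "a \<in> carrier (A n)" and x: "x \<in> carrier (M m)"
    show "dM' (n + m) (act' n m a x) = act' (n + 1) m (dA' n a) x \<oplus>\<^bsub>M (n + m + 1)\<^esub>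
        alt_sign (M (n + m + 1)) n (act' n (m + 1) a (dM' m x))"
      unfolding eq[OF a x] A[OF a] M[OF x] M[OF act_closed[OF a x]] eq[OF A.d_closed[OF a] x] eq[OF a M.d_closed[OF x]]
      by (rule leibniz[OF a x])
  qed
qed

lemma graded_action_cong:
  assumes "graded_action K A M mul act unit"
    and mul: "\<And>n m a b. \<lbrakk>a \<in> carrier (A n); b \<in> carrier (A m)\<rbrakk> \<Longrightarrow> mul' n m a b = mul n m a b"
    and act: "\<And>n m a x. \<lbrakk>a \<in> carrier (A n); x \<in> carrier (M m)\<rbrakk> \<Longrightarrow> act' n m a x = act n m a x"
  shows "graded_action K A M mul' act' unit"
proof -
  interpret graded_action K A M mul act unit by fact
  show ?thesis
  proof (intro graded_action.intro graded_action_axioms.intro unit_closed)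
    show "bilinear_family K A A mul'" by (rule bilinear_family_cong[OF mul.bilinear_family_axioms mul])
    show "bilinear_family K A M act'" by (rule bilinear_family_cong[OF act.bilinear_family_axioms act])
    fix n m l a b x assume a: "a \<in> carrier (A n)" and b: "b \<in> carrier (A m)" and x: "x \<in> carrier (M l)"
    show "act' (n + m) l (mul' n m a b) x = act' n (m + l) a (act' m l b x)"
      unfolding mul[OF a b] act[OF b x] act[OF mul.act_closed[OF a b] x] act[OF a act.act_closed[OF b x]]
      by (rule act_assoc[OF a b x])
  next
    fix x m assume x: "x \<in> carrier (M m)"
    show "act' 0 m unit x = x" unfolding act[OF unit_closed x] by (rule act_unit[OF x])
  qed
qed

section \<open>Semi-cosimplicial modules and cup products\<close>

context module
begin

lemma alt_sign_alt_sign: "x \<in> carrier M \<Longrightarrow> alt_sign M i (alt_sign M j x) = alt_sign M (i + j) x"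
  by (auto simp: alt_sign_def)

lemma alt_sign_add: "\<lbrakk>x \<in> carrier M; y \<in> carrier M\<rbrakk> \<Longrightarrow>
    alt_sign M i (x \<oplus>\<^bsub>M\<^esub> y) = alt_sign M i x \<oplus>\<^bsub>M\<^esub> alt_sign M i y"
  by (simp add: alt_sign_def M.minus_add)

lemma alt_sign_smult: "\<lbrakk>c \<in> carrier R; x \<in> carrier M\<rbrakk> \<Longrightarrow>
    c \<odot>\<^bsub>M\<^esub> alt_sign M i x = alt_sign M i (c \<odot>\<^bsub>M\<^esub> x)"
  by (simp add: alt_sign_def smult_r_minus)

lemma alt_sign_zero [simp]: "alt_sign M i \<zero>\<^bsub>M\<^esub> = \<zero>\<^bsub>M\<^esub>"
  by (simp add: alt_sign_def)

lemma alt_sign_finsum: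
  assumes "finite I" "\<And>i. i \<in> I \<Longrightarrow> f i \<in> carrier M"
  shows "alt_sign M k (\<Oplus>\<^bsub>M\<^esub>i\<in>I. f i) = (\<Oplus>\<^bsub>M\<^esub>i\<in>I. alt_sign M k (f i))"
  using assms
proof (induction I rule: finite_induct)
  case (insert i I)
  then show ?case by (simp add: Pi_def alt_sign_add M.finsum_closedI)
qed simp

text \<open>In this form a sign passes through every linear operation.\<close>

lemma alt_sign_as_scalar:
  "x \<in> carrier M \<Longrightarrow> alt_sign M k x = (if even k then \<one> else \<ominus> \<one>) \<odot>\<^bsub>M\<^esub> x"
  by (simp add: alt_sign_def smult_l_minus)

lemma alt_sign_parity: "even i = even j \<Longrightarrow> alt_sign M i x = alt_sign M j x"
  by (simp add: alt_sign_def)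

lemma alt_sign_cancel:
  assumes "x \<in> carrier M" "even i \<noteq> even j"
  shows "alt_sign M i x \<oplus>\<^bsub>M\<^esub> alt_sign M j x = \<zero>\<^bsub>M\<^esub>"
  using assms by (auto simp: alt_sign_def M.l_neg M.r_neg)

end

locale semi_cosimplicial = module_family K M for K :: "'k ring" and M :: "nat \<Rightarrow> ('k, 'v) module" +
  fixes face :: "nat \<Rightarrow> nat \<Rightarrow> 'v \<Rightarrow> 'v"
  assumes face_closed: "\<lbrakk>x \<in> carrier (M n); i \<le> n + 1\<rbrakk> \<Longrightarrow> face n i x \<in> carrier (M (n + 1))"
    and face_add: "\<lbrakk>x \<in> carrier (M n); y \<in> carrier (M n); i \<le> n + 1\<rbrakk> \<Longrightarrow>
      face n i (x \<oplus>\<^bsub>M n\<^esub> y) = face n i x \<oplus>\<^bsub>M (n + 1)\<^esub> face n i y"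
    and face_smult: "\<lbrakk>c \<in> carrier K; x \<in> carrier (M n); i \<le> n + 1\<rbrakk> \<Longrightarrow>
      face n i (c \<odot>\<^bsub>M n\<^esub> x) = c \<odot>\<^bsub>M (n + 1)\<^esub> face n i x"
    and face_face: "\<lbrakk>x \<in> carrier (M n); i < j; j \<le> n + 2\<rbrakk> \<Longrightarrow>
      face (n + 1) j (face n i x) = face (n + 1) i (face n (j - 1) x)"
begin

definition diff where "diff n x = (\<Oplus>\<^bsub>M (n + 1)\<^esub>i\<in>{..n + 1}. alt_sign (M (n + 1)) i (face n i x))"

lemma face_zero: "i \<le> n + 1 \<Longrightarrow> face n i \<zero>\<^bsub>M n\<^esub> = \<zero>\<^bsub>M (n + 1)\<^esub>"
  using face_smult[of "\<zero>\<^bsub>K\<^esub>" "\<zero>\<^bsub>M n\<^esub>" n i] face_closed[of "\<zero>\<^bsub>M n\<^esub>" n i] by simp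

lemma face_alt_sign:
  assumes "x \<in> carrier (M n)" "i \<le> n + 1"
  shows "face n i (alt_sign (M n) k x) = alt_sign (M (n + 1)) k (face n i x)"
  using assms face_smult[of "\<ominus>\<^bsub>K\<^esub> \<one>\<^bsub>K\<^esub>" x n i] face_closed[OF assms]
  by (simp add: alt_sign_def comp.smult_l_minus)

lemma face_finsum:
  assumes "finite I" "\<And>s. s \<in> I \<Longrightarrow> f s \<in> carrier (M n)" "i \<le> n + 1"
  shows "face n i (\<Oplus>\<^bsub>M n\<^esub>s\<in>I. f s) = (\<Oplus>\<^bsub>M (n + 1)\<^esub>s\<in>I. face n i (f s))"
  using assms(1,2)
proof (induction I rule: finite_induct)
  case empty
  show ?case using assms(3) by (simp add: face_zero[simplified])
next
  case (insert s I)
  have "(\<Oplus>\<^bsub>M n\<^esub>s\<in>insert s I. f s) = f s \<oplus>\<^bsub>M n\<^esub> (\<Oplus>\<^bsub>M n\<^esub>s\<in>I. f s)"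
    using insert by (intro comp.M.finsum_insert) auto
  moreover have "(\<Oplus>\<^bsub>M (n + 1)\<^esub>s\<in>insert s I. face n i (f s)) =
      face n i (f s) \<oplus>\<^bsub>M (n + 1)\<^esub> (\<Oplus>\<^bsub>M (n + 1)\<^esub>s\<in>I. face n i (f s))"
    using insert face_closed assms(3) by (intro comp.M.finsum_insert) auto
  moreover have "(\<Oplus>\<^bsub>M n\<^esub>s\<in>I. f s) \<in> carrier (M n)" using insert by (intro comp.M.finsum_closedI) auto
  ultimately show ?case using insert assms(3) by (simp add: face_add[simplified])
qed

lemma diff_closed: "x \<in> carrier (M n) \<Longrightarrow> diff n x \<in> carrier (M (n + 1))"
  unfolding diff_def by (intro comp.M.finsum_closedI comp.alt_sign_closed face_closed) auto

lemma diff_add: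
  assumes "x \<in> carrier (M n)" "y \<in> carrier (M n)"
  shows "diff n (x \<oplus>\<^bsub>M n\<^esub> y) = diff n x \<oplus>\<^bsub>M (n + 1)\<^esub> diff n y"
proof -
  have "diff n (x \<oplus>\<^bsub>M n\<^esub> y) = (\<Oplus>\<^bsub>M (n + 1)\<^esub>i\<in>{..n + 1}.
      alt_sign (M (n + 1)) i (face n i x) \<oplus>\<^bsub>M (n + 1)\<^esub> alt_sign (M (n + 1)) i (face n i y))"
    unfolding diff_def using assms
    by (intro comp.M.finsum_congI) (auto simp: face_add[simplified] comp.alt_sign_add face_closed[simplified])
  also have "\<dots> = diff n x \<oplus>\<^bsub>M (n + 1)\<^esub> diff n y"
    unfolding diff_def using assms by (intro comp.M.finsum_addf) (auto simp: face_closed[simplified])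
  finally show ?thesis .
qed

lemma diff_smult:
  assumes "c \<in> carrier K" "x \<in> carrier (M n)"
  shows "diff n (c \<odot>\<^bsub>M n\<^esub> x) = c \<odot>\<^bsub>M (n + 1)\<^esub> diff n x"
proof -
  have "c \<odot>\<^bsub>M (n + 1)\<^esub> diff n x =
      (\<Oplus>\<^bsub>M (n + 1)\<^esub>i\<in>{..n + 1}. c \<odot>\<^bsub>M (n + 1)\<^esub> alt_sign (M (n + 1)) i (face n i x))"
    unfolding diff_def using assms by (intro comp.finsum_smult_ldistr) (auto simp: face_closed[simplified])
  also have "\<dots> = diff n (c \<odot>\<^bsub>M n\<^esub> x)"
    unfolding diff_def using assms
    by (intro comp.M.finsum_congI) (auto simp: face_smult[simplified] comp.alt_sign_smult face_closed[simplified])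
  finally show ?thesis ..
qed

text \<open>The terms of the double sum cancel in pairs: the pair \<open>(j, i)\<close> with \<open>i < j\<close> against \<open>(i, j - 1)\<close>.\<close>

lemma diff_diff:
  assumes x: "x \<in> carrier (M n)"
  shows "diff (n + 1) (diff n x) = \<zero>\<^bsub>M (n + 2)\<^esub>"
proof -
  let ?N = "M (n + 2)"
  have N: "?N = M (n + 1 + 1)" by simp
  define g where "g j i = face (n + 1) j (face n i x)" for j i
  have gc: "g j i \<in> carrier ?N" if "j \<le> n + 2" "i \<le> n + 1" for j i
    unfolding g_def N using that x by (intro face_closed) auto
  have "alt_sign ?N j (face (n + 1) j (diff n x)) = (\<Oplus>\<^bsub>?N\<^esub>i\<in>{..n + 1}. alt_sign ?N (j + i) (g j i))"
    if j: "j \<le> n + 2" for j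
  proof -
    have "face (n + 1) j (diff n x) = (\<Oplus>\<^bsub>?N\<^esub>i\<in>{..n + 1}. face (n + 1) j (alt_sign (M (n + 1)) i (face n i x)))"
      unfolding diff_def N using x j by (intro face_finsum) (auto simp: face_closed[simplified])
    also have "\<dots> = (\<Oplus>\<^bsub>?N\<^esub>i\<in>{..n + 1}. alt_sign ?N i (g j i))"
      using x j gc face_alt_sign[of "face n _ x" "n + 1" j]
      by (intro comp.M.finsum_congI) (auto simp: g_def face_closed[simplified])
    finally have "alt_sign ?N j (face (n + 1) j (diff n x)) = alt_sign ?N j (\<Oplus>\<^bsub>?N\<^esub>i\<in>{..n + 1}. alt_sign ?N i (g j i))"
      by simp
    also have "\<dots> = (\<Oplus>\<^bsub>?N\<^esub>i\<in>{..n + 1}. alt_sign ?N j (alt_sign ?N i (g j i)))"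
      using gc j by (intro comp.alt_sign_finsum) auto
    also have "\<dots> = (\<Oplus>\<^bsub>?N\<^esub>i\<in>{..n + 1}. alt_sign ?N (j + i) (g j i))"
      using gc j by (intro comp.M.finsum_congI) (auto simp: comp.alt_sign_alt_sign)
    finally show ?thesis .
  qed
  then have "diff (n + 1) (diff n x) = (\<Oplus>\<^bsub>?N\<^esub>j\<in>{..n + 2}. \<Oplus>\<^bsub>?N\<^esub>i\<in>{..n + 1}. alt_sign ?N (j + i) (g j i))"
    unfolding diff_def[of "n + 1"] using gc
    by (simp, intro comp.M.finsum_congI comp.M.finsum_closedI) auto
  also have "\<dots> = (\<Oplus>\<^bsub>?N\<^esub>p\<in>{..n + 2} \<times> {..n + 1}. alt_sign ?N (fst p + snd p) (g (fst p) (snd p)))"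
    using gc by (intro comp.M.finsum_Sigma) auto
  also have "\<dots> = \<zero>\<^bsub>?N\<^esub>"
  proof -
    let ?t = "\<lambda>p. alt_sign ?N (fst p + snd p) (g (fst p) (snd p))"
    let ?P = "{p \<in> {..n + 2} \<times> {..n + 1}. snd p < fst p}" and ?Q = "{p \<in> {..n + 2} \<times> {..n + 1}. fst p \<le> snd p}"
    have tc: "?t p \<in> carrier ?N" if "p \<in> {..n + 2} \<times> {..n + 1}" for p using that gc by auto
    have "{..n + 2} \<times> {..n + 1} = ?P \<union> ?Q" by auto
    then have "(\<Oplus>\<^bsub>?N\<^esub>p\<in>{..n + 2} \<times> {..n + 1}. ?t p) = (\<Oplus>\<^bsub>?N\<^esub>p\<in>?P \<union> ?Q. ?t p)" by simp
    also have "\<dots> = (\<Oplus>\<^bsub>?N\<^esub>p\<in>?P. ?t p) \<oplus>\<^bsub>?N\<^esub> (\<Oplus>\<^bsub>?N\<^esub>p\<in>?Q. ?t p)"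
      using tc by (intro comp.M.finsum_Un_disjoint) auto
    also have "(\<Oplus>\<^bsub>?N\<^esub>p\<in>?Q. ?t p) = (\<Oplus>\<^bsub>?N\<^esub>p\<in>?P. ?t (snd p, fst p - 1))"
    proof (rule comp.M.finsum_bij)
      show "bij_betw (\<lambda>p. (snd p, fst p - 1)) ?P ?Q"
        by (rule bij_betw_byWitness[where f' = "\<lambda>p. (Suc (snd p), fst p)"]) auto
    qed (use tc in auto)
    also have "\<dots> = (\<Oplus>\<^bsub>?N\<^esub>p\<in>?P. alt_sign ?N 1 (?t p))"
    proof (rule comp.M.finsum_congI)
      fix p assume p: "p \<in> ?P"
      then have "g (fst p) (snd p) = g (snd p) (fst p - 1)"
        unfolding g_def using x by (intro face_face) auto
      then show "?t (snd p, fst p - 1) = alt_sign ?N 1 (?t p)"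
        using p gc[of "fst p" "snd p"] by (auto simp: comp.alt_sign_alt_sign intro!: comp.alt_sign_parity)
      show "alt_sign ?N 1 (?t p) \<in> carrier ?N" using p by (intro comp.alt_sign_closed[OF tc]) auto
    qed
    also have "\<dots> = alt_sign ?N 1 (\<Oplus>\<^bsub>?N\<^esub>p\<in>?P. ?t p)"
      using tc by (intro comp.alt_sign_finsum[symmetric]) auto
    also have "(\<Oplus>\<^bsub>?N\<^esub>p\<in>?P. ?t p) \<oplus>\<^bsub>?N\<^esub> \<dots> = \<zero>\<^bsub>?N\<^esub>"
    proof -
      have "(\<Oplus>\<^bsub>?N\<^esub>p\<in>?P. ?t p) \<in> carrier ?N" using tc by (intro comp.M.finsum_closedI) auto
      then show ?thesis by (simp add: alt_sign_def comp.M.r_neg)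
    qed
    finally show ?thesis .
  qed
  finally show ?thesis .
qed

lemma diff_cochain_complex: "cochain_complex K M diff"
proof
  show "diff n x \<in> carrier (M (n + 1))" if "x \<in> carrier (M n)" for n x
    using that by (rule diff_closed)
  show "diff n (x \<oplus>\<^bsub>M n\<^esub> y) = diff n x \<oplus>\<^bsub>M (n + 1)\<^esub> diff n y" if "x \<in> carrier (M n)" "y \<in> carrier (M n)" for n x y
    using that by (rule diff_add)
  show "diff n (c \<odot>\<^bsub>M n\<^esub> x) = c \<odot>\<^bsub>M (n + 1)\<^esub> diff n x" if "c \<in> carrier K" "x \<in> carrier (M n)" for n c x
    using that by (rule diff_smult)
  show "diff (n + 1) (diff n x) = \<zero>\<^bsub>M (n + 2)\<^esub>" if "x \<in> carrier (M n)" for n x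
    using that by (rule diff_diff)
qed

end

lemma (in bilinear_family) act_alt_sign:
  assumes "a \<in> carrier (A n)" "x \<in> carrier (M m)"
  shows "act n m (alt_sign (A n) k a) x = alt_sign (M (n + m)) k (act n m a x)"
    and "act n m a (alt_sign (M m) k x) = alt_sign (M (n + m)) k (act n m a x)"
  using assms by (auto simp: alt_sign_def act_neg_left act_neg_right)

text \<open>The faces of a product are the products with the faces of \<open>x\<close> except the last and with the faces of \<open>a\<close> except
  the first. The two exceptional faces give equal products.\<close>

locale cup_family = A: semi_cosimplicial K A faceA + M: semi_cosimplicial K M faceM + cup: bilinear_family K A M cup
  for K :: "'k ring" and A :: "nat \<Rightarrow> ('k, 'a) module" and faceA
    and M :: "nat \<Rightarrow> ('k, 'v) module" and faceM and cup +
  assumes cup_face_low: "\<lbrakk>a \<in> carrier (A n); x \<in> carrier (M m); i \<le> m\<rbrakk> \<Longrightarrow>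
      faceM (n + m) i (cup n m a x) = cup n (m + 1) a (faceM m i x)"
    and cup_face_high: "\<lbrakk>a \<in> carrier (A n); x \<in> carrier (M m); 1 \<le> j; j \<le> n + 1\<rbrakk> \<Longrightarrow>
      faceM (n + m) (m + j) (cup n m a x) = cup (n + 1) m (faceA n j a) x"
    and cup_face_middle: "\<lbrakk>a \<in> carrier (A n); x \<in> carrier (M m)\<rbrakk> \<Longrightarrow>
      cup (n + 1) m (faceA n 0 a) x = cup n (m + 1) a (faceM m (m + 1) x)"
begin

definition signed_cup where "signed_cup n m a x = alt_sign (M (n + m)) (n * m) (cup n m a x)"

text \<open>The two sides differ by the terms of the last face of \<open>x\<close> and the first face of \<open>a\<close>, which are equal up to
  opposite signs.\<close>

lemma cup_leibniz:
  assumes a: "a \<in> carrier (A n)" and x: "x \<in> carrier (M m)"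
  shows "M.diff (n + m) (cup n m a x) =
    alt_sign (M (n + m + 1)) m (cup (n + 1) m (A.diff n a) x) \<oplus>\<^bsub>M (n + m + 1)\<^esub> cup n (m + 1) a (M.diff m x)"
proof -
  let ?N = "M (n + m + 1)"
  note [simp] = a x
  define l where "l i = cup n (m + 1) a (faceM m i x)" for i
  define h where "h j = cup (n + 1) m (faceA n j a) x" for j
  have lc: "l i \<in> carrier ?N" if "i \<le> m + 1" for i
    using cup.act_closed[OF a M.face_closed[OF x that]] by (simp add: l_def)
  have hc: "h j \<in> carrier ?N" if "j \<le> n + 1" for j
    using cup.act_closed[OF A.face_closed[OF a that] x] by (simp add: h_def)
  let ?L = "\<Oplus>\<^bsub>?N\<^esub>i\<in>{..m}. alt_sign ?N i (l i)" and ?H = "\<Oplus>\<^bsub>?N\<^esub>j\<in>{1..n + 1}. alt_sign ?N j (h j)"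
  have Lc: "?L \<in> carrier ?N" and Hc: "?H \<in> carrier ?N"
    using lc hc by (auto intro!: M.comp.M.finsum_closedI)
  have total: "M.diff (n + m) (cup n m a x) = ?L \<oplus>\<^bsub>?N\<^esub> alt_sign ?N m ?H"
  proof -
    have split: "{..n + m + 1} = {..m} \<union> (\<lambda>j. m + j) ` {1..n + 1}"
    proof (intro equalityI subsetI)
      fix i assume "i \<in> {..n + m + 1}"
      then show "i \<in> {..m} \<union> (\<lambda>j. m + j) ` {1..n + 1}"
        by (cases "i \<le> m") (auto intro!: image_eqI[of _ _ "i - m"])
    qed auto
    have low: "faceM (n + m) i (cup n m a x) = l i" if "i \<le> m" for i
      using that unfolding l_def by (intro cup_face_low) auto
    have high: "faceM (n + m) (m + j) (cup n m a x) = h j" if "1 \<le> j" "j \<le> n + 1" for j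
      using that unfolding h_def by (intro cup_face_high) auto
    have fc: "alt_sign ?N i (faceM (n + m) i (cup n m a x)) \<in> carrier ?N" if "i \<le> n + m + 1" for i
      using that by (intro M.comp.alt_sign_closed M.face_closed cup.act_closed) auto
    have "M.diff (n + m) (cup n m a x) =
        (\<Oplus>\<^bsub>?N\<^esub>i\<in>{..m}. alt_sign ?N i (faceM (n + m) i (cup n m a x))) \<oplus>\<^bsub>?N\<^esub>
        (\<Oplus>\<^bsub>?N\<^esub>i\<in>(\<lambda>j. m + j) ` {1..n + 1}. alt_sign ?N i (faceM (n + m) i (cup n m a x)))"
      unfolding M.diff_def split using fc by (intro M.comp.M.finsum_Un_disjoint) auto
    also have "(\<Oplus>\<^bsub>?N\<^esub>i\<in>{..m}. alt_sign ?N i (faceM (n + m) i (cup n m a x))) = ?L"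
      using low lc by (intro M.comp.M.finsum_congI) auto
    also have "(\<Oplus>\<^bsub>?N\<^esub>i\<in>(\<lambda>j. m + j) ` {1..n + 1}. alt_sign ?N i (faceM (n + m) i (cup n m a x))) =
        (\<Oplus>\<^bsub>?N\<^esub>j\<in>{1..n + 1}. alt_sign ?N (m + j) (faceM (n + m) (m + j) (cup n m a x)))"
      using fc by (intro M.comp.M.finsum_reindex) (auto simp: inj_on_def)
    also have "\<dots> = (\<Oplus>\<^bsub>?N\<^esub>j\<in>{1..n + 1}. alt_sign ?N m (alt_sign ?N j (h j)))"
      using high hc by (intro M.comp.M.finsum_congI) (auto simp: M.comp.alt_sign_alt_sign)
    also have "\<dots> = alt_sign ?N m ?H"
      using hc by (intro M.comp.alt_sign_finsum[symmetric]) auto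
    finally show ?thesis .
  qed
  have right: "cup n (m + 1) a (M.diff m x) = ?L \<oplus>\<^bsub>?N\<^esub> alt_sign ?N (m + 1) (l (m + 1))"
  proof -
    have "cup n (m + 1) a (M.diff m x) =
        (\<Oplus>\<^bsub>?N\<^esub>i\<in>{..m + 1}. cup n (m + 1) a (alt_sign (M (m + 1)) i (faceM m i x)))"
      unfolding M.diff_def using cup.act_finsum_right[of "{..m + 1}" "\<lambda>i. alt_sign (M (m + 1)) i (faceM m i x)" "m + 1" a n]
        M.face_closed[OF x] by simp
    also have "\<dots> = (\<Oplus>\<^bsub>?N\<^esub>i\<in>{..m + 1}. alt_sign ?N i (l i))"
      using lc cup.act_alt_sign(2)[OF a M.face_closed[OF x]]
      by (intro M.comp.M.finsum_congI) (auto simp: l_def)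
    also have "{..m + 1} = insert (m + 1) {..m}" by auto
    also have "(\<Oplus>\<^bsub>?N\<^esub>i\<in>insert (m + 1) {..m}. alt_sign ?N i (l i)) = alt_sign ?N (m + 1) (l (m + 1)) \<oplus>\<^bsub>?N\<^esub> ?L"
      using lc by (intro M.comp.M.finsum_insert) auto
    finally show ?thesis using lc[of "m + 1"] Lc by (simp add: M.comp.M.a_comm)
  qed
  have left: "cup (n + 1) m (A.diff n a) x = h 0 \<oplus>\<^bsub>?N\<^esub> ?H"
  proof -
    have "cup (n + 1) m (A.diff n a) x =
        (\<Oplus>\<^bsub>?N\<^esub>i\<in>{..n + 1}. cup (n + 1) m (alt_sign (A (n + 1)) i (faceA n i a)) x)"
      unfolding A.diff_def using cup.act_finsum_left[of "{..n + 1}" "\<lambda>i. alt_sign (A (n + 1)) i (faceA n i a)" "n + 1" x m]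
        A.face_closed[OF a] by simp
    also have "\<dots> = (\<Oplus>\<^bsub>?N\<^esub>i\<in>{..n + 1}. alt_sign ?N i (h i))"
      using hc cup.act_alt_sign(1)[OF A.face_closed[OF a] x]
      by (intro M.comp.M.finsum_congI) (auto simp: h_def)
    also have "{..n + 1} = insert 0 {1..n + 1}" by auto
    also have "(\<Oplus>\<^bsub>?N\<^esub>i\<in>insert 0 {1..n + 1}. alt_sign ?N i (h i)) = alt_sign ?N 0 (h 0) \<oplus>\<^bsub>?N\<^esub> ?H"
      using hc by (intro M.comp.M.finsum_insert) auto
    finally show ?thesis by (simp add: alt_sign_def)
  qed
  have middle: "h 0 = l (m + 1)" unfolding h_def l_def by (rule cup_face_middle) auto
  let ?T = "l (m + 1)"
  have Tc: "?T \<in> carrier ?N" by (intro lc) simp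
  have "alt_sign ?N m (h 0 \<oplus>\<^bsub>?N\<^esub> ?H) \<oplus>\<^bsub>?N\<^esub> (?L \<oplus>\<^bsub>?N\<^esub> alt_sign ?N (m + 1) ?T) =
      (?L \<oplus>\<^bsub>?N\<^esub> alt_sign ?N m ?H) \<oplus>\<^bsub>?N\<^esub> (alt_sign ?N m ?T \<oplus>\<^bsub>?N\<^esub> alt_sign ?N (m + 1) ?T)"
  proof -
    have swap: "\<And>t h l t'. \<lbrakk>t \<in> carrier ?N; h \<in> carrier ?N; l \<in> carrier ?N; t' \<in> carrier ?N\<rbrakk> \<Longrightarrow>
        (t \<oplus>\<^bsub>?N\<^esub> h) \<oplus>\<^bsub>?N\<^esub> (l \<oplus>\<^bsub>?N\<^esub> t') = (l \<oplus>\<^bsub>?N\<^esub> h) \<oplus>\<^bsub>?N\<^esub> (t \<oplus>\<^bsub>?N\<^esub> t')"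
      by (simp add: M.comp.M.a_ac)
    then show ?thesis
      unfolding middle M.comp.alt_sign_add[OF Tc Hc] using Tc Hc Lc by (intro swap M.comp.alt_sign_closed) auto
  qed
  also have "\<dots> = ?L \<oplus>\<^bsub>?N\<^esub> alt_sign ?N m ?H"
  proof -
    have cancel: "alt_sign ?N m ?T \<oplus>\<^bsub>?N\<^esub> alt_sign ?N (m + 1) ?T = \<zero>\<^bsub>?N\<^esub>"
      by (rule M.comp.alt_sign_cancel[OF Tc]) simp
    show ?thesis unfolding cancel using Lc Hc by (intro M.comp.M.r_zero M.comp.M.a_closed M.comp.alt_sign_closed)
  qed
  finally show ?thesis unfolding total left right by simp
qed

lemma signed_cup_bilinear: "bilinear_family K A M signed_cup"
proof (intro bilinear_family.intro bilinear_family_axioms.intro A.module_family_axioms M.module_family_axioms)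
qed (simp_all add: signed_cup_def cup.act_closed cup.act_add_left cup.act_add_right cup.act_smult_left
    cup.act_smult_right M.comp.alt_sign_add M.comp.alt_sign_smult)

lemma signed_cup_leibniz:
  assumes a: "a \<in> carrier (A n)" and x: "x \<in> carrier (M m)"
  shows "M.diff (n + m) (signed_cup n m a x) = signed_cup (n + 1) m (A.diff n a) x \<oplus>\<^bsub>M (n + m + 1)\<^esub>
    alt_sign (M (n + m + 1)) n (signed_cup n (m + 1) a (M.diff m x))"
proof -
  let ?N = "M (n + m + 1)"
  interpret dM: cochain_complex K M M.diff by (rule M.diff_cochain_complex)
  have c1: "cup (n + 1) m (A.diff n a) x \<in> carrier ?N" and c2: "cup n (m + 1) a (M.diff m x) \<in> carrier ?N"
    using cup.act_closed[OF A.diff_closed[OF a] x] cup.act_closed[OF a M.diff_closed[OF x]] by simp_all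
  have "M.diff (n + m) (signed_cup n m a x) = alt_sign ?N (n * m) (M.diff (n + m) (cup n m a x))"
    using dM.d_neg[OF cup.act_closed[OF a x]] by (simp add: signed_cup_def alt_sign_def)
  also have "\<dots> = alt_sign ?N (n * m + m) (cup (n + 1) m (A.diff n a) x) \<oplus>\<^bsub>?N\<^esub> alt_sign ?N (n * m) (cup n (m + 1) a (M.diff m x))"
    unfolding cup_leibniz[OF a x] using c1 c2 by (simp add: M.comp.alt_sign_add M.comp.alt_sign_alt_sign)
  also have "alt_sign ?N (n * m) (cup n (m + 1) a (M.diff m x)) =
      alt_sign ?N n (alt_sign ?N (n * (m + 1)) (cup n (m + 1) a (M.diff m x)))"
    unfolding M.comp.alt_sign_alt_sign[OF c2] by (rule M.comp.alt_sign_parity) auto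
  finally show ?thesis by (simp add: signed_cup_def add.commute)
qed

lemma signed_cup_dg_action: "dg_action K A A.diff M M.diff signed_cup"
  by (intro dg_action.intro dg_action_axioms.intro A.diff_cochain_complex M.diff_cochain_complex
      signed_cup_bilinear signed_cup_leibniz)

end

text \<open>The signs \<open>(-1)\<^sup>n\<^sup>m\<close> are compatible with composition, since \<open>(n + m) l + n m = n (m + l) + m l\<close>.\<close>

lemma signed_cup_graded_action:
  assumes "cup_family K A faceA A faceA cupA" "cup_family K A faceA M faceM cup"
    and assoc: "\<And>n m l a b x. \<lbrakk>a \<in> carrier (A n); b \<in> carrier (A m); x \<in> carrier (M l)\<rbrakk> \<Longrightarrow>
      cup (n + m) l (cupA n m a b) x = cup n (m + l) a (cup m l b x)"
    and unit: "unit \<in> carrier (A 0)" "\<And>m x. x \<in> carrier (M m) \<Longrightarrow> cup 0 m unit x = x"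
  shows "graded_action K A M (cup_family.signed_cup A cupA) (cup_family.signed_cup M cup) unit"
proof -
  interpret mul: cup_family K A faceA A faceA cupA by (rule assms(1))
  interpret act: cup_family K A faceA M faceM cup by (rule assms(2))
  have "act.signed_cup (n + m) l (mul.signed_cup n m a b) x = act.signed_cup n (m + l) a (act.signed_cup m l b x)"
    if a: "a \<in> carrier (A n)" and b: "b \<in> carrier (A m)" and x: "x \<in> carrier (M l)" for n m l a b x
  proof -
    have ab: "cupA n m a b \<in> carrier (A (n + m))" and bx: "cup m l b x \<in> carrier (M (m + l))"
      using mul.cup.act_closed[OF a b] act.cup.act_closed[OF b x] .
    have abx: "cup n (m + l) a (cup m l b x) \<in> carrier (M (n + m + l))"
      using act.cup.act_closed[OF a bx] by (simp add: add.assoc)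
    have "act.signed_cup (n + m) l (mul.signed_cup n m a b) x =
        alt_sign (M (n + m + l)) ((n + m) * l + n * m) (cup n (m + l) a (cup m l b x))"
      unfolding act.signed_cup_def mul.signed_cup_def act.cup.act_alt_sign(1)[OF ab x] assoc[OF a b x]
      by (rule act.M.comp.alt_sign_alt_sign[OF abx])
    also have "\<dots> = alt_sign (M (n + (m + l))) (n * (m + l) + m * l) (cup n (m + l) a (cup m l b x))"
      by (simp add: algebra_simps)
    also have "\<dots> = act.signed_cup n (m + l) a (act.signed_cup m l b x)"
      unfolding act.signed_cup_def act.cup.act_alt_sign(2)[OF a bx]
      using abx by (intro act.M.comp.alt_sign_alt_sign[symmetric]) (simp add: add.assoc)
    finally show ?thesis .
  qed
  then show ?thesis
    using unit by (intro graded_action.intro graded_action_axioms.intro mul.signed_cup_bilinear act.signed_cup_bilinear)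
      (simp_all add: act.signed_cup_def alt_sign_def)
qed

section \<open>Typed arrows of a strict monoidal category\<close>

text \<open>Hom-sets need not be disjoint, so arrows are stored together with source and target. Composability then
  becomes an equation between objects, which rewriting decides by normalizing tensor products.\<close>

datatype ('o, 'm) arrow = Arrow (src: 'o) (mor: 'm) (tgt: 'o)

context strict_tensor_category
begin

definition typed :: "('o, 'm) arrow \<Rightarrow> bool" where
  "typed f \<longleftrightarrow> src f \<in> Obj C \<and> tgt f \<in> Obj C \<and> mor f \<in> arr C (src f) (tgt f)"

definition seq :: "('o, 'm) arrow \<Rightarrow> ('o, 'm) arrow \<Rightarrow> ('o, 'm) arrow"  (infixr "\<bullet>" 65) where
  "g \<bullet> f = Arrow (src f) (mor g \<cdot> mor f) (tgt g)"

definition par :: "('o, 'm) arrow \<Rightarrow> ('o, 'm) arrow \<Rightarrow> ('o, 'm) arrow"  (infixr "\<parallel>" 75) where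
  "f \<parallel> g = Arrow (src f \<boxtimes> src g) (mor f \<star> mor g) (tgt f \<boxtimes> tgt g)"

definition ident :: "'o \<Rightarrow> ('o, 'm) arrow"  ("\<iota>") where
  "\<iota> X = Arrow X (Id C X) X"

lemma seq_sel [simp]: "src (g \<bullet> f) = src f" "tgt (g \<bullet> f) = tgt g" "mor (g \<bullet> f) = mor g \<cdot> mor f"
  and par_sel [simp]: "src (f \<parallel> g) = src f \<boxtimes> src g" "tgt (f \<parallel> g) = tgt f \<boxtimes> tgt g" "mor (f \<parallel> g) = mor f \<star> mor g"
  and ident_sel [simp]: "src (\<iota> X) = X" "tgt (\<iota> X) = X" "mor (\<iota> X) = Id C X"
  by (simp_all add: seq_def par_def ident_def)

lemma typed_src: "typed f \<Longrightarrow> src f \<in> Obj C"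
  and typed_tgt: "typed f \<Longrightarrow> tgt f \<in> Obj C"
  and typed_mor: "typed f \<Longrightarrow> mor f \<in> arr C (src f) (tgt f)"
  by (simp_all add: typed_def)

lemma typed_Arrow: "typed (Arrow X f Y) \<longleftrightarrow> X \<in> Obj C \<and> Y \<in> Obj C \<and> f \<in> arr C X Y"
  by (simp add: typed_def)

lemma arrow_eqI: "\<lbrakk>mor f = mor g; src f = src g; tgt f = tgt g\<rbrakk> \<Longrightarrow> f = g"
  by (rule arrow.expand) simp

lemma typed_seq [simp]: "\<lbrakk>typed g; typed f; tgt f = src g\<rbrakk> \<Longrightarrow> typed (g \<bullet> f)"
  using comp_arr[of "src f" "src g" "tgt g" "mor f" "mor g"] by (simp add: typed_def)

lemma typed_par [simp]: "\<lbrakk>typed f; typed g\<rbrakk> \<Longrightarrow> typed (f \<parallel> g)"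
  by (simp add: typed_def tens_arr tens_obj)

lemma typed_ident [simp]: "X \<in> Obj C \<Longrightarrow> typed (\<iota> X)"
  by (simp add: typed_def id_arr)

lemma seq_assoc: "\<lbrakk>typed h; typed g; typed f; tgt f = src g; tgt g = src h\<rbrakk> \<Longrightarrow> (h \<bullet> g) \<bullet> f = h \<bullet> g \<bullet> f"
  using comp_assoc[of "src f" "src g" "src h" "tgt h" "mor f" "mor g" "mor h"]
  by (intro arrow_eqI) (simp_all add: typed_def)

lemma seq_ident_left: "\<lbrakk>typed f; tgt f = X\<rbrakk> \<Longrightarrow> \<iota> X \<bullet> f = f"
  using id_left[of "src f" "tgt f" "mor f"] by (intro arrow_eqI) (simp_all add: typed_def)

lemma seq_ident_right: "\<lbrakk>typed f; src f = X\<rbrakk> \<Longrightarrow> f \<bullet> \<iota> X = f"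
  using id_right[of "src f" "tgt f" "mor f"] by (intro arrow_eqI) (simp_all add: typed_def)

lemma par_assoc: "\<lbrakk>typed f; typed g; typed h\<rbrakk> \<Longrightarrow> (f \<parallel> g) \<parallel> h = f \<parallel> g \<parallel> h"
  using tens_arr_assoc[of "src f" "tgt f" "src g" "tgt g" "src h" "tgt h" "mor f" "mor g" "mor h"]
  by (intro arrow_eqI) (simp_all add: typed_def tens_obj_assoc)

lemma par_ident: "\<lbrakk>X \<in> Obj C; Y \<in> Obj C\<rbrakk> \<Longrightarrow> \<iota> X \<parallel> \<iota> Y = \<iota> (X \<boxtimes> Y)"
  by (intro arrow_eqI) (simp_all add: tens_id)

lemma par_ident_left: "\<lbrakk>X \<in> Obj C; Y \<in> Obj C; typed f\<rbrakk> \<Longrightarrow> \<iota> X \<parallel> \<iota> Y \<parallel> f = \<iota> (X \<boxtimes> Y) \<parallel> f"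
  by (simp add: par_ident par_assoc[symmetric])

lemma par_unit_left: "typed f \<Longrightarrow> \<iota> (Unit C) \<parallel> f = f"
  using unit_arr_left[of "src f" "tgt f" "mor f"] by (intro arrow_eqI) (simp_all add: typed_def unit_obj_left)

lemma par_unit_right: "typed f \<Longrightarrow> f \<parallel> \<iota> (Unit C) = f"
  using unit_arr_right[of "src f" "tgt f" "mor f"] by (intro arrow_eqI) (simp_all add: typed_def unit_obj_right)

lemma par_seq:
  "\<lbrakk>typed g; typed f; typed g'; typed f'; tgt f = src g; tgt f' = src g'\<rbrakk> \<Longrightarrow>
    (g \<bullet> f) \<parallel> (g' \<bullet> f') = (g \<parallel> g') \<bullet> (f \<parallel> f')"
  using tens_comp[of "src f" "src g" "tgt g" "src f'" "src g'" "tgt g'" "mor f" "mor g" "mor f'" "mor g'"]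
  by (intro arrow_eqI) (simp_all add: typed_def)

declare typed_src [simp] typed_tgt [simp]

lemma whisker_left: "\<lbrakk>X \<in> Obj C; typed g; typed f; tgt f = src g\<rbrakk> \<Longrightarrow> \<iota> X \<parallel> (g \<bullet> f) = (\<iota> X \<parallel> g) \<bullet> (\<iota> X \<parallel> f)"
  using par_seq[of "\<iota> X" "\<iota> X" g f] by (simp add: seq_ident_left)

lemma whisker_right: "\<lbrakk>X \<in> Obj C; typed g; typed f; tgt f = src g\<rbrakk> \<Longrightarrow> (g \<bullet> f) \<parallel> \<iota> X = (g \<parallel> \<iota> X) \<bullet> (f \<parallel> \<iota> X)"
  using par_seq[of g f "\<iota> X" "\<iota> X"] by (simp add: seq_ident_left)

lemma par_as_seq: "\<lbrakk>typed f; typed g\<rbrakk> \<Longrightarrow> f \<parallel> g = (f \<parallel> \<iota> (tgt g)) \<bullet> (\<iota> (src f) \<parallel> g)"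
  and par_as_seq': "\<lbrakk>typed f; typed g\<rbrakk> \<Longrightarrow> f \<parallel> g = (\<iota> (tgt f) \<parallel> g) \<bullet> (f \<parallel> \<iota> (src g))"
  by (simp_all add: par_seq[symmetric] seq_ident_left seq_ident_right)

text \<open>The interchange law, in the form in which two boxes slide past each other.\<close>

lemma slide: "\<lbrakk>typed f; typed g\<rbrakk> \<Longrightarrow>
    (f \<parallel> \<iota> (tgt g)) \<bullet> (\<iota> (src f) \<parallel> g) = (\<iota> (tgt f) \<parallel> g) \<bullet> (f \<parallel> \<iota> (src g))"
  using par_as_seq[of f g] par_as_seq'[of f g] by simp

text \<open>Rewriting with these rules turns a string diagram into a composite of layers, each with one box between
  identities; two diagrams that differ only by regrouping acquire the same normal form. Sliding boxes past
  each other is left to explicit uses of \<open>slide\<close>.\<close>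

lemmas diagram = seq_assoc seq_ident_left seq_ident_right par_assoc par_ident par_ident_left
  par_unit_left par_unit_right whisker_left whisker_right
  tens_obj_assoc unit_obj_left unit_obj_right tens_obj unit_obj

definition plus :: "('o, 'm) arrow \<Rightarrow> ('o, 'm) arrow \<Rightarrow> ('o, 'm) arrow"  (infixl "\<boxplus>" 60) where
  "f \<boxplus> g = Arrow (src f) (mor f \<oplus>\<^bsub>Hom C (src f) (tgt f)\<^esub> mor g) (tgt f)"

definition scale :: "'k \<Rightarrow> ('o, 'm) arrow \<Rightarrow> ('o, 'm) arrow"  (infixr "\<boxdot>" 70) where
  "a \<boxdot> f = Arrow (src f) (a \<odot>\<^bsub>Hom C (src f) (tgt f)\<^esub> mor f) (tgt f)"

definition zero_arrow :: "'o \<Rightarrow> 'o \<Rightarrow> ('o, 'm) arrow" where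
  "zero_arrow X Y = Arrow X \<zero>\<^bsub>Hom C X Y\<^esub> Y"

lemma linear_sel [simp]:
  "src (f \<boxplus> g) = src f" "tgt (f \<boxplus> g) = tgt f" "mor (f \<boxplus> g) = mor f \<oplus>\<^bsub>Hom C (src f) (tgt f)\<^esub> mor g"
  "src (a \<boxdot> f) = src f" "tgt (a \<boxdot> f) = tgt f" "mor (a \<boxdot> f) = a \<odot>\<^bsub>Hom C (src f) (tgt f)\<^esub> mor f"
  "src (zero_arrow X Y) = X" "tgt (zero_arrow X Y) = Y" "mor (zero_arrow X Y) = \<zero>\<^bsub>Hom C X Y\<^esub>"
  by (simp_all add: plus_def scale_def zero_arrow_def)

lemma plus_typed [simp]:
  assumes "typed f" "typed g" "src f = src g" "tgt f = tgt g"
  shows "typed (f \<boxplus> g)"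
proof -
  interpret module K "Hom C (src g) (tgt g)" using assms by (intro hom_module) auto
  show ?thesis unfolding typed_def[of "f \<boxplus> g"] using assms typed_mor[of f] typed_mor[of g] by simp
qed

lemma scale_typed [simp]:
  assumes "typed f" "a \<in> carrier K"
  shows "typed (a \<boxdot> f)"
proof -
  interpret module K "Hom C (src f) (tgt f)" using assms by (intro hom_module) auto
  show ?thesis unfolding typed_def[of "a \<boxdot> f"] using assms typed_mor[of f] by simp
qed

lemma zero_arrow_typed [simp]:
  assumes "X \<in> Obj C" "Y \<in> Obj C"
  shows "typed (zero_arrow X Y)"
proof -
  interpret module K "Hom C X Y" using assms by (intro hom_module) auto
  show ?thesis unfolding typed_def using assms by simp
qed

text \<open>Zero arrows are multiples, so the rules for scalars imply those for zero.\<close>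

lemma scale_zero:
  assumes "typed f"
  shows "\<zero>\<^bsub>K\<^esub> \<boxdot> f = zero_arrow (src f) (tgt f)"
proof -
  interpret module K "Hom C (src f) (tgt f)" using assms by (intro hom_module) auto
  show ?thesis using assms typed_mor[of f] by (intro arrow_eqI) simp_all
qed

lemma plus_seq:
  assumes "typed g" "typed g'" "typed f" "src g' = src g" "tgt g' = tgt g" "tgt f = src g"
  shows "(g \<boxplus> g') \<bullet> f = (g \<bullet> f) \<boxplus> (g' \<bullet> f)"
  using assms comp_add_left[of "src f" "src g" "tgt g" "mor f" "mor g" "mor g'"] typed_mor[of f] typed_mor[of g] typed_mor[of g']
  by (intro arrow_eqI) simp_all

lemma seq_plus:
  assumes "typed g" "typed f" "typed f'" "src f' = src f" "tgt f' = tgt f" "tgt f = src g"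
  shows "g \<bullet> (f \<boxplus> f') = (g \<bullet> f) \<boxplus> (g \<bullet> f')"
  using assms comp_add_right[of "src f" "src g" "tgt g" "mor f" "mor f'" "mor g"] typed_mor[of g] typed_mor[of f] typed_mor[of f']
  by (intro arrow_eqI) simp_all

lemma scale_seq:
  assumes "typed g" "typed f" "tgt f = src g" "a \<in> carrier K"
  shows "(a \<boxdot> g) \<bullet> f = a \<boxdot> (g \<bullet> f)" "g \<bullet> (a \<boxdot> f) = a \<boxdot> (g \<bullet> f)"
  using assms comp_smult_left[of "src f" "src g" "tgt g" a "mor f" "mor g"]
    comp_smult_right[of "src f" "src g" "tgt g" a "mor f" "mor g"] typed_mor[of g] typed_mor[of f]
  by (auto intro!: arrow_eqI)

lemma plus_par:
  assumes "typed f" "typed f'" "typed g" "src f' = src f" "tgt f' = tgt f"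
  shows "(f \<boxplus> f') \<parallel> g = (f \<parallel> g) \<boxplus> (f' \<parallel> g)" "g \<parallel> (f \<boxplus> f') = (g \<parallel> f) \<boxplus> (g \<parallel> f')"
  using assms tens_add_left[of "src f" "tgt f" "src g" "tgt g" "mor f" "mor f'" "mor g"]
    tens_add_right[of "src g" "tgt g" "src f" "tgt f" "mor g" "mor f" "mor f'"] typed_mor[of f] typed_mor[of f'] typed_mor[of g]
  by (auto intro!: arrow_eqI)

lemma scale_par:
  assumes "typed f" "typed g" "a \<in> carrier K"
  shows "(a \<boxdot> f) \<parallel> g = a \<boxdot> (f \<parallel> g)" "f \<parallel> (a \<boxdot> g) = a \<boxdot> (f \<parallel> g)"
  using assms tens_smult_left[of "src f" "tgt f" "src g" "tgt g" a "mor f" "mor g"]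
    tens_smult_right[of "src f" "tgt f" "src g" "tgt g" a "mor f" "mor g"] typed_mor[of f] typed_mor[of g]
  by (auto intro!: arrow_eqI)

lemmas linear = plus_seq seq_plus scale_seq plus_par scale_par

lemma zero_scalar [simp]: "\<zero>\<^bsub>K\<^esub> \<in> carrier K"
  using field_K by (simp add: cring.cring_simprules(2) field.axioms(1) domain.axioms(1))

lemma seq_zero: "\<lbrakk>typed g; src g = Y; X \<in> Obj C\<rbrakk> \<Longrightarrow> g \<bullet> zero_arrow X Y = zero_arrow X (tgt g)"
  and zero_seq: "\<lbrakk>typed f; tgt f = X; Y \<in> Obj C\<rbrakk> \<Longrightarrow> zero_arrow X Y \<bullet> f = zero_arrow (src f) Y"
  using scale_zero[of "zero_arrow X Y"] scale_zero[of "g \<bullet> zero_arrow X Y"] scale_zero[of "zero_arrow X Y \<bullet> f"]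
    scale_seq(2)[of g "zero_arrow X Y" "\<zero>\<^bsub>K\<^esub>"] scale_seq(1)[of "zero_arrow X Y" f "\<zero>\<^bsub>K\<^esub>"]
  by auto

text \<open>The form of \<^const>\<open>left_dual\<close> for typed arrows.\<close>

definition dual_pair :: "'o \<Rightarrow> 'o \<Rightarrow> ('o, 'm) arrow \<Rightarrow> ('o, 'm) arrow \<Rightarrow> bool" where
  "dual_pair X Y e c \<longleftrightarrow> X \<in> Obj C \<and> Y \<in> Obj C \<and> typed e \<and> typed c \<and>
     src e = X \<boxtimes> Y \<and> tgt e = Unit C \<and> src c = Unit C \<and> tgt c = Y \<boxtimes> X \<and>
     (e \<parallel> \<iota> X) \<bullet> (\<iota> X \<parallel> c) = \<iota> X \<and> (\<iota> Y \<parallel> e) \<bullet> (c \<parallel> \<iota> Y) = \<iota> Y"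

lemma left_dual_dual_pair:
  assumes "left_dual C X Y e c" "X \<in> Obj C"
  shows "dual_pair X Y (Arrow (X \<boxtimes> Y) e (Unit C)) (Arrow (Unit C) c (Y \<boxtimes> X))"
  using assms unfolding left_dual_def dual_pair_def
  by (simp add: typed_Arrow tens_obj unit_obj) (intro conjI arrow_eqI; simp add: unit_obj_left unit_obj_right)

context
  fixes V W e c
  assumes dual: "dual_pair V W e c"
begin

lemma dual_simps: "V \<in> Obj C" "W \<in> Obj C" "typed e" "typed c"
  "src e = V \<boxtimes> W" "tgt e = Unit C" "src c = Unit C" "tgt c = W \<boxtimes> V"
  using dual by (simp_all add: dual_pair_def)

lemma zigzag: "(e \<parallel> \<iota> V) \<bullet> (\<iota> V \<parallel> c) = \<iota> V" "(\<iota> W \<parallel> e) \<bullet> (c \<parallel> \<iota> W) = \<iota> W"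
  using dual by (simp_all add: dual_pair_def)

text \<open>A strand \<open>W\<close> bent by \<open>e\<close> is bent back by \<open>c\<close>, according to the second zigzag identity.\<close>

lemma bend_inject:
  assumes p: "typed p" "tgt p = W \<boxtimes> F" and q: "typed q" "tgt q = W \<boxtimes> F" and F: "F \<in> Obj C"
    and src: "src p = src q"
    and eq: "(e \<parallel> \<iota> F) \<bullet> (\<iota> V \<parallel> p) = (e \<parallel> \<iota> F) \<bullet> (\<iota> V \<parallel> q)"
  shows "p = q"
proof -
  have unbend: "r = (\<iota> W \<parallel> ((e \<parallel> \<iota> F) \<bullet> (\<iota> V \<parallel> r))) \<bullet> (c \<parallel> \<iota> (src r))"
    if r: "typed r" "tgt r = W \<boxtimes> F" for r
  proof -
    note [simp] = dual_simps r F
    have "r = (((\<iota> W \<parallel> e) \<bullet> (c \<parallel> \<iota> W)) \<parallel> \<iota> F) \<bullet> r"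
      unfolding zigzag by (simp add: diagram)
    also have "\<dots> = (\<iota> W \<parallel> e \<parallel> \<iota> F) \<bullet> ((c \<parallel> \<iota> (tgt r)) \<bullet> (\<iota> (src c) \<parallel> r))"
      by (simp add: diagram)
    also have "\<dots> = (\<iota> W \<parallel> e \<parallel> \<iota> F) \<bullet> ((\<iota> (tgt c) \<parallel> r) \<bullet> (c \<parallel> \<iota> (src r)))"
      using slide[of c r] by simp
    also have "\<dots> = (\<iota> W \<parallel> ((e \<parallel> \<iota> F) \<bullet> (\<iota> V \<parallel> r))) \<bullet> (c \<parallel> \<iota> (src r))"
      by (simp add: diagram)
    finally show ?thesis .
  qed
  show ?thesis using unbend[OF p] unbend[OF q] unfolding eq src by simp
qed

end

end

section \<open>Stacking crossings\<close>

context strict_tensor_category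
begin

text \<open>The strand \<open>U\<close> passes from the left of \<open>A\<close> to its right and becomes \<open>V\<close>.\<close>

definition crossing :: "'o \<Rightarrow> 'o \<Rightarrow> 'o \<Rightarrow> ('o, 'm) arrow \<Rightarrow> bool" where
  "crossing U A V f \<longleftrightarrow> U \<in> Obj C \<and> A \<in> Obj C \<and> V \<in> Obj C \<and> typed f \<and> src f = U \<boxtimes> A \<and> tgt f = A \<boxtimes> V"

lemma crossingD:
  assumes "crossing U A V f"
  shows "U \<in> Obj C" "A \<in> Obj C" "V \<in> Obj C" "typed f" "src f = U \<boxtimes> A" "tgt f = A \<boxtimes> V"
  using assms by (simp_all add: crossing_def)

text \<open>The strand crosses first \<open>A\<close> and then \<open>B\<close>: \<open>U A B \<rightarrow> A V B \<rightarrow> A B W\<close>.\<close>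

definition stack :: "'o \<Rightarrow> 'o \<Rightarrow> ('o, 'm) arrow \<Rightarrow> ('o, 'm) arrow \<Rightarrow> ('o, 'm) arrow" where
  "stack A B t g = (\<iota> A \<parallel> t) \<bullet> (g \<parallel> \<iota> B)"

lemma crossing_stack:
  assumes "crossing U A V g" "crossing V B W t"
  shows "crossing U (A \<boxtimes> B) W (stack A B t g)"
  using assms by (simp add: crossing_def stack_def diagram)

text \<open>Both sides consist of the same three layers.\<close>

lemma stack_assoc:
  assumes "crossing U A V g" "crossing V B W t" "crossing W B' X s"
  shows "stack (A \<boxtimes> B) B' s (stack A B t g) = stack A (B \<boxtimes> B') (stack B B' s t) g"
  using assms by (simp add: crossing_def stack_def diagram)

lemma stack_natural:
  assumes g: "crossing U A V g" and g': "crossing U A' V g'" and t: "crossing V B W t" and t': "crossing V B' W t'"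
    and q: "typed q" "src q = A" "tgt q = A'" and p: "typed p" "src p = B" "tgt p = B'"
    and nat_g: "(q \<parallel> \<iota> V) \<bullet> g = g' \<bullet> (\<iota> U \<parallel> q)" and nat_t: "(p \<parallel> \<iota> W) \<bullet> t = t' \<bullet> (\<iota> V \<parallel> p)"
  shows "((q \<parallel> p) \<parallel> \<iota> W) \<bullet> stack A B t g = stack A' B' t' g' \<bullet> (\<iota> U \<parallel> (q \<parallel> p))"
proof -
  note [simp] = crossingD[OF g] crossingD[OF g'] crossingD[OF t] crossingD[OF t'] q p
  have "((q \<parallel> p) \<parallel> \<iota> W) \<bullet> stack A B t g = (q \<parallel> \<iota> (B' \<boxtimes> W)) \<bullet> (\<iota> A \<parallel> ((p \<parallel> \<iota> W) \<bullet> t)) \<bullet> (g \<parallel> \<iota> B)"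
    by (simp add: stack_def diagram par_as_seq[of q "p \<parallel> \<iota> W"])
  also have "\<dots> = ((q \<parallel> \<iota> (tgt t')) \<bullet> (\<iota> (src q) \<parallel> t')) \<bullet> ((\<iota> (tgt g) \<parallel> p) \<bullet> (g \<parallel> \<iota> (src p)))"
    unfolding nat_t by (simp add: diagram)
  also have "\<dots> = ((\<iota> (tgt q) \<parallel> t') \<bullet> (q \<parallel> \<iota> (src t'))) \<bullet> ((g \<parallel> \<iota> (tgt p)) \<bullet> (\<iota> (src g) \<parallel> p))"
    by (simp only: slide[OF q(1) \<open>typed t'\<close>] slide[OF \<open>typed g\<close> p(1)])
  also have "\<dots> = (\<iota> A' \<parallel> t') \<bullet> (((q \<parallel> \<iota> V) \<bullet> g) \<parallel> \<iota> B') \<bullet> (\<iota> (U \<boxtimes> A) \<parallel> p)"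
    by (simp add: diagram)
  also have "\<dots> = stack A' B' t' g' \<bullet> (\<iota> U \<parallel> (q \<parallel> p))"
    unfolding nat_g by (simp add: stack_def diagram par_as_seq[of q p])
  finally show ?thesis .
qed

text \<open>The crossings \<open>f\<close> and \<open>f'\<close> of the unit object are endomorphisms of \<open>A\<close> and \<open>B\<close>. The identity holds because \<open>f\<close>
  slides past \<open>b'\<close>.\<close>

lemma twist_stack:
  assumes b: "crossing V A V b" and b': "crossing V B V b'"
    and f: "crossing (Unit C) A (Unit C) f" and f': "crossing (Unit C) B (Unit C) f'"
  shows "(stack A B f' f \<parallel> \<iota> V) \<bullet> stack A B b' b = stack A B ((f' \<parallel> \<iota> V) \<bullet> b') ((f \<parallel> \<iota> V) \<bullet> b)"
proof -
  have [simp]: "src f = A" "tgt f = A" "src f' = B" "tgt f' = B"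
    using crossingD[OF f] crossingD[OF f'] by (simp_all add: unit_obj_left unit_obj_right)
  note [simp] = crossingD(1-4)[OF f] crossingD(1-4)[OF f'] crossingD[OF b] crossingD[OF b']
  have "(stack A B f' f \<parallel> \<iota> V) \<bullet> stack A B b' b =
      (\<iota> A \<parallel> f' \<parallel> \<iota> V) \<bullet> ((f \<parallel> \<iota> (tgt b')) \<bullet> (\<iota> (src f) \<parallel> b')) \<bullet> (b \<parallel> \<iota> B)"
    by (simp add: stack_def diagram)
  also have "\<dots> = (\<iota> A \<parallel> f' \<parallel> \<iota> V) \<bullet> ((\<iota> (tgt f) \<parallel> b') \<bullet> (f \<parallel> \<iota> (src b'))) \<bullet> (b \<parallel> \<iota> B)"
    by (simp only: slide[OF \<open>typed f\<close> \<open>typed b'\<close>])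
  also have "\<dots> = stack A B ((f' \<parallel> \<iota> V) \<bullet> b') ((f \<parallel> \<iota> V) \<bullet> b)"
    by (simp add: stack_def diagram)
  finally show ?thesis .
qed

lemma stack_plus:
  assumes "crossing U A V g" "crossing U A V g'" "crossing V B W t" "crossing V B W t'"
  shows "stack A B (t \<boxplus> t') g = stack A B t g \<boxplus> stack A B t' g"
    and "stack A B t (g \<boxplus> g') = stack A B t g \<boxplus> stack A B t g'"
  using assms by (simp_all add: crossing_def stack_def linear tens_obj tens_obj_assoc)

lemma stack_scale:
  assumes "crossing U A V g" "crossing V B W t" "a \<in> carrier K"
  shows "stack A B (a \<boxdot> t) g = a \<boxdot> stack A B t g"
    and "stack A B t (a \<boxdot> g) = a \<boxdot> stack A B t g"
  using assms by (simp_all add: crossing_def stack_def linear tens_obj tens_obj_assoc)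

end

section \<open>Transposing a crossing along a duality\<close>

context strict_tensor_category
begin

context
  fixes V W e c
  assumes dual: "dual_pair V W e c"
begin

text \<open>Here the outgoing strand \<open>V\<close> is bent, and straightened again by the first zigzag identity.\<close>

lemma bend_inject_right:
  assumes p: "typed p" "tgt p = A \<boxtimes> V" and q: "typed q" "tgt q = A \<boxtimes> V" and A: "A \<in> Obj C"
    and src: "src p = src q"
    and eq: "(\<iota> A \<parallel> e) \<bullet> (p \<parallel> \<iota> W) = (\<iota> A \<parallel> e) \<bullet> (q \<parallel> \<iota> W)"
  shows "p = q"
proof -
  have unbend: "r = (((\<iota> A \<parallel> e) \<bullet> (r \<parallel> \<iota> W)) \<parallel> \<iota> V) \<bullet> (\<iota> (src r) \<parallel> c)"
    if r: "typed r" "tgt r = A \<boxtimes> V" for r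
  proof -
    note [simp] = dual_simps[OF dual] r A
    have "r = (\<iota> A \<parallel> ((e \<parallel> \<iota> V) \<bullet> (\<iota> V \<parallel> c))) \<bullet> r"
      unfolding zigzag(1)[OF dual] by (simp add: diagram)
    also have "\<dots> = (\<iota> A \<parallel> e \<parallel> \<iota> V) \<bullet> ((\<iota> (tgt r) \<parallel> c) \<bullet> (r \<parallel> \<iota> (src c)))"
      by (simp add: diagram)
    also have "\<dots> = (\<iota> A \<parallel> e \<parallel> \<iota> V) \<bullet> ((r \<parallel> \<iota> (tgt c)) \<bullet> (\<iota> (src r) \<parallel> c))"
      using slide[of r c] by simp
    also have "\<dots> = (((\<iota> A \<parallel> e) \<bullet> (r \<parallel> \<iota> W)) \<parallel> \<iota> V) \<bullet> (\<iota> (src r) \<parallel> c)"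
      by (simp add: diagram)
    finally show ?thesis .
  qed
  show ?thesis using unbend[OF p] unbend[OF q] unfolding eq src by simp
qed

text \<open>The transpose of a crossing \<open>b\<close> of \<open>V\<close> over \<open>A\<close> lets \<open>W\<close> pass \<open>A\<close> in the opposite direction.\<close>

definition transpose :: "'o \<Rightarrow> ('o, 'm) arrow \<Rightarrow> ('o, 'm) arrow" where
  "transpose A b = (\<iota> (W \<boxtimes> A) \<parallel> e) \<bullet> (\<iota> W \<parallel> b \<parallel> \<iota> W) \<bullet> (c \<parallel> \<iota> (A \<boxtimes> W))"

lemma transpose_typed:
  assumes "crossing V A V b"
  shows "typed (transpose A b)" "src (transpose A b) = A \<boxtimes> W" "tgt (transpose A b) = W \<boxtimes> A"
  using crossingD[OF assms] dual_simps[OF dual] by (simp_all add: transpose_def diagram)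

text \<open>Sliding \<open>e\<close> to the top leaves the zigzag of \<open>V\<close>, which is straightened. The same happens with \<open>c\<close> in
  \<open>transpose_cobend\<close>.\<close>

lemma transpose_bend:
  assumes b: "crossing V A V b"
  shows "(e \<parallel> \<iota> A) \<bullet> (\<iota> V \<parallel> transpose A b) = (\<iota> A \<parallel> e) \<bullet> (b \<parallel> \<iota> W)"
proof -
  note [simp] = dual_simps[OF dual] crossingD[OF b]
  have "(e \<parallel> \<iota> A) \<bullet> (\<iota> V \<parallel> transpose A b) =
      ((e \<parallel> \<iota> (tgt (\<iota> A \<parallel> e))) \<bullet> (\<iota> (src e) \<parallel> (\<iota> A \<parallel> e))) \<bullet> (\<iota> (V \<boxtimes> W) \<parallel> b \<parallel> \<iota> W) \<bullet> (\<iota> V \<parallel> c \<parallel> \<iota> (A \<boxtimes> W))"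
    by (simp add: transpose_def diagram)
  also have "\<dots> = (\<iota> (tgt e) \<parallel> (\<iota> A \<parallel> e)) \<bullet> ((e \<parallel> \<iota> (tgt (b \<parallel> \<iota> W))) \<bullet> (\<iota> (src e) \<parallel> (b \<parallel> \<iota> W))) \<bullet> (\<iota> V \<parallel> c \<parallel> \<iota> (A \<boxtimes> W))"
    by (subst slide) (simp_all add: diagram)
  also have "\<dots> = (\<iota> A \<parallel> e) \<bullet> (b \<parallel> \<iota> W) \<bullet> (((e \<parallel> \<iota> V) \<bullet> (\<iota> V \<parallel> c)) \<parallel> \<iota> (A \<boxtimes> W))"
    by (subst slide) (simp_all add: diagram)
  also have "\<dots> = (\<iota> A \<parallel> e) \<bullet> (b \<parallel> \<iota> W)"
    unfolding zigzag(1)[OF dual] by (simp add: diagram)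
  finally show ?thesis .
qed

lemma transpose_cobend:
  assumes b: "crossing V A V b"
  shows "(transpose A b \<parallel> \<iota> V) \<bullet> (\<iota> A \<parallel> c) = (\<iota> W \<parallel> b) \<bullet> (c \<parallel> \<iota> A)"
proof -
  note [simp] = dual_simps[OF dual] crossingD[OF b]
  have "(transpose A b \<parallel> \<iota> V) \<bullet> (\<iota> A \<parallel> c) =
      (\<iota> (W \<boxtimes> A) \<parallel> e \<parallel> \<iota> V) \<bullet> (\<iota> W \<parallel> b \<parallel> \<iota> (W \<boxtimes> V)) \<bullet> ((c \<parallel> \<iota> (tgt (\<iota> A \<parallel> c))) \<bullet> (\<iota> (src c) \<parallel> (\<iota> A \<parallel> c)))"
    by (simp add: transpose_def diagram)
  also have "\<dots> = (\<iota> (W \<boxtimes> A) \<parallel> e \<parallel> \<iota> V) \<bullet> (\<iota> W \<parallel> ((b \<parallel> \<iota> (tgt c)) \<bullet> (\<iota> (src b) \<parallel> c))) \<bullet> (c \<parallel> \<iota> A)"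
    by (subst slide) (simp_all add: diagram)
  also have "\<dots> = (\<iota> (W \<boxtimes> A) \<parallel> ((e \<parallel> \<iota> V) \<bullet> (\<iota> V \<parallel> c))) \<bullet> (\<iota> W \<parallel> b) \<bullet> (c \<parallel> \<iota> A)"
    by (subst slide) (simp_all add: diagram)
  also have "\<dots> = (\<iota> W \<parallel> b) \<bullet> (c \<parallel> \<iota> A)"
    unfolding zigzag(1)[OF dual] by (simp add: diagram)
  finally show ?thesis .
qed

text \<open>After bending \<open>W\<close>, the transposes turn into \<open>b\<close> and \<open>b'\<close> by \<open>transpose_bend\<close>, and the naturality of these applies.\<close>

lemma transpose_natural:
  assumes b: "crossing V A V b" and b': "crossing V A' V b'" and h: "typed h" "src h = A" "tgt h = A'"
    and nat: "(h \<parallel> \<iota> V) \<bullet> b = b' \<bullet> (\<iota> V \<parallel> h)"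
  shows "(\<iota> W \<parallel> h) \<bullet> transpose A b = transpose A' b' \<bullet> (h \<parallel> \<iota> W)"
proof (rule bend_inject[OF dual, where F = A'])
  note [simp] = dual_simps[OF dual] crossingD[OF b] crossingD[OF b'] transpose_typed[OF b] transpose_typed[OF b'] h
  have "(e \<parallel> \<iota> A') \<bullet> (\<iota> V \<parallel> ((\<iota> W \<parallel> h) \<bullet> transpose A b)) =
      ((e \<parallel> \<iota> (tgt h)) \<bullet> (\<iota> (src e) \<parallel> h)) \<bullet> (\<iota> V \<parallel> transpose A b)"
    by (simp add: diagram)
  also have "\<dots> = h \<bullet> ((e \<parallel> \<iota> A) \<bullet> (\<iota> V \<parallel> transpose A b))"
    by (subst slide) (simp_all add: diagram)
  also have "\<dots> = ((h \<parallel> \<iota> (tgt e)) \<bullet> (\<iota> (src h) \<parallel> e)) \<bullet> (b \<parallel> \<iota> W)"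
    unfolding transpose_bend[OF b] by (simp add: diagram)
  also have "\<dots> = (\<iota> A' \<parallel> e) \<bullet> (((h \<parallel> \<iota> V) \<bullet> b) \<parallel> \<iota> W)"
    by (subst slide) (simp_all add: diagram)
  also have "\<dots> = ((\<iota> A' \<parallel> e) \<bullet> (b' \<parallel> \<iota> W)) \<bullet> (\<iota> V \<parallel> h \<parallel> \<iota> W)"
    unfolding nat by (simp add: diagram)
  also have "\<dots> = (e \<parallel> \<iota> A') \<bullet> (\<iota> V \<parallel> (transpose A' b' \<bullet> (h \<parallel> \<iota> W)))"
    unfolding transpose_bend[OF b', symmetric] by (simp add: diagram)
  finally show "(e \<parallel> \<iota> A') \<bullet> (\<iota> V \<parallel> ((\<iota> W \<parallel> h) \<bullet> transpose A b)) =
      (e \<parallel> \<iota> A') \<bullet> (\<iota> V \<parallel> (transpose A' b' \<bullet> (h \<parallel> \<iota> W)))" .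
qed (use dual_simps[OF dual] crossingD[OF b] crossingD[OF b'] transpose_typed[OF b] transpose_typed[OF b'] h in \<open>simp_all add: diagram\<close>)

lemma transpose_stack:
  assumes b: "crossing V A V b" and b': "crossing V B V b'"
  shows "transpose (A \<boxtimes> B) (stack A B b' b) = (transpose A b \<parallel> \<iota> B) \<bullet> (\<iota> A \<parallel> transpose B b')"
proof (rule bend_inject[OF dual, where F = "A \<boxtimes> B"])
  have s: "crossing V (A \<boxtimes> B) V (stack A B b' b)"
    using b b' by (simp add: crossing_def stack_def diagram)
  note [simp] = dual_simps[OF dual] crossingD[OF b] crossingD[OF b'] transpose_typed[OF b] transpose_typed[OF b'] transpose_typed[OF s]
  have "(e \<parallel> \<iota> (A \<boxtimes> B)) \<bullet> (\<iota> V \<parallel> ((transpose A b \<parallel> \<iota> B) \<bullet> (\<iota> A \<parallel> transpose B b'))) =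
      (((e \<parallel> \<iota> A) \<bullet> (\<iota> V \<parallel> transpose A b)) \<parallel> \<iota> B) \<bullet> (\<iota> (V \<boxtimes> A) \<parallel> transpose B b')"
    by (simp add: diagram)
  also have "\<dots> = (\<iota> A \<parallel> e \<parallel> \<iota> B) \<bullet> ((b \<parallel> \<iota> (tgt (transpose B b'))) \<bullet> (\<iota> (src b) \<parallel> transpose B b'))"
    unfolding transpose_bend[OF b] by (simp add: diagram)
  also have "\<dots> = (\<iota> A \<parallel> ((e \<parallel> \<iota> B) \<bullet> (\<iota> V \<parallel> transpose B b'))) \<bullet> (b \<parallel> \<iota> (B \<boxtimes> W))"
    by (subst slide) (simp_all add: diagram)
  also have "\<dots> = (\<iota> (A \<boxtimes> B) \<parallel> e) \<bullet> (stack A B b' b \<parallel> \<iota> W)"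
    unfolding transpose_bend[OF b'] by (simp add: stack_def diagram)
  finally show "(e \<parallel> \<iota> (A \<boxtimes> B)) \<bullet> (\<iota> V \<parallel> transpose (A \<boxtimes> B) (stack A B b' b)) =
      (e \<parallel> \<iota> (A \<boxtimes> B)) \<bullet> (\<iota> V \<parallel> ((transpose A b \<parallel> \<iota> B) \<bullet> (\<iota> A \<parallel> transpose B b')))"
    unfolding transpose_bend[OF s] by simp
  show "typed (transpose (A \<boxtimes> B) (stack A B b' b))" "tgt (transpose (A \<boxtimes> B) (stack A B b' b)) = W \<boxtimes> A \<boxtimes> B"
    by simp_all
qed (use dual_simps[OF dual] crossingD[OF b] crossingD[OF b'] transpose_typed[OF b] transpose_typed[OF b'] in
    \<open>simp_all add: diagram transpose_def\<close>)

lemma transpose_ident: "transpose (Unit C) (\<iota> V) = \<iota> W"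
  using zigzag(2)[OF dual] dual_simps[OF dual] by (simp add: transpose_def diagram)

lemma inverse_transpose_bend:
  assumes b: "crossing V A V b" and s: "typed s" "src s = W \<boxtimes> A" "tgt s = A \<boxtimes> W"
    and inv: "transpose A b \<bullet> s = \<iota> (W \<boxtimes> A)"
  shows "(\<iota> A \<parallel> e) \<bullet> (b \<parallel> \<iota> W) \<bullet> (\<iota> V \<parallel> s) = e \<parallel> \<iota> A"
proof -
  note [simp] = dual_simps[OF dual] crossingD[OF b] s transpose_typed[OF b]
  have "(\<iota> A \<parallel> e) \<bullet> (b \<parallel> \<iota> W) \<bullet> (\<iota> V \<parallel> s) = ((\<iota> A \<parallel> e) \<bullet> (b \<parallel> \<iota> W)) \<bullet> (\<iota> V \<parallel> s)"
    by (simp add: diagram)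
  also have "\<dots> = (e \<parallel> \<iota> A) \<bullet> (\<iota> V \<parallel> (transpose A b \<bullet> s))"
    unfolding transpose_bend[OF b, symmetric] by (simp add: diagram)
  also have "\<dots> = e \<parallel> \<iota> A" unfolding inv by (simp add: diagram)
  finally show ?thesis .
qed

lemma inverse_transpose_cobend:
  assumes b: "crossing V A V b" and s: "typed s" "src s = W \<boxtimes> A" "tgt s = A \<boxtimes> W"
    and inv: "s \<bullet> transpose A b = \<iota> (A \<boxtimes> W)"
  shows "(s \<parallel> \<iota> V) \<bullet> (\<iota> W \<parallel> b) \<bullet> (c \<parallel> \<iota> A) = \<iota> A \<parallel> c"
proof -
  note [simp] = dual_simps[OF dual] crossingD[OF b] s transpose_typed[OF b]
  have "(s \<parallel> \<iota> V) \<bullet> (\<iota> W \<parallel> b) \<bullet> (c \<parallel> \<iota> A) = ((s \<bullet> transpose A b) \<parallel> \<iota> V) \<bullet> (\<iota> A \<parallel> c)"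
    unfolding transpose_cobend[OF b, symmetric] by (simp add: diagram)
  also have "\<dots> = \<iota> A \<parallel> c" unfolding inv by (simp add: diagram)
  finally show ?thesis .
qed

text \<open>Compatibility with the coevaluation alone makes \<open>s\<close> a left inverse; this is the uniqueness of the dual
  half-braiding.\<close>

lemma cobend_inverse_transpose:
  assumes b: "crossing V A V b" and s: "typed s" "src s = W \<boxtimes> A" "tgt s = A \<boxtimes> W"
    and cobend: "(s \<parallel> \<iota> V) \<bullet> (\<iota> W \<parallel> b) \<bullet> (c \<parallel> \<iota> A) = \<iota> A \<parallel> c"
  shows "s \<bullet> transpose A b = \<iota> (A \<boxtimes> W)"
proof -
  note [simp] = dual_simps[OF dual] crossingD[OF b] s
  have "s \<bullet> transpose A b =
      ((s \<parallel> \<iota> (tgt e)) \<bullet> (\<iota> (src s) \<parallel> e)) \<bullet> (\<iota> W \<parallel> b \<parallel> \<iota> W) \<bullet> (c \<parallel> \<iota> (A \<boxtimes> W))"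
    by (simp add: transpose_def diagram)
  also have "\<dots> = (\<iota> (A \<boxtimes> W) \<parallel> e) \<bullet> (((s \<parallel> \<iota> V) \<bullet> (\<iota> W \<parallel> b) \<bullet> (c \<parallel> \<iota> A)) \<parallel> \<iota> W)"
    by (subst slide) (simp_all add: diagram)
  also have "\<dots> = \<iota> A \<parallel> ((\<iota> W \<parallel> e) \<bullet> (c \<parallel> \<iota> W))"
    unfolding cobend by (simp add: diagram)
  also have "\<dots> = \<iota> (A \<boxtimes> W)" unfolding zigzag(2)[OF dual] by (simp add: diagram)
  finally show ?thesis .
qed

text \<open>When \<open>f\<close> has slid past \<open>e\<close> and \<open>s'\<close> past \<open>g\<close>, the crossings \<open>b\<close> and \<open>s'\<close> meet below \<open>e\<close> and are absorbed, which
  sets \<open>f\<close> free.\<close>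

lemma bend_stack:
  assumes g: "crossing U A V g" and b: "crossing V B V b" and f: "typed f" "src f = B" "tgt f = B"
    and s: "crossing W A W s" and s': "crossing W B W s'"
    and ev: "(\<iota> B \<parallel> e) \<bullet> (b \<parallel> \<iota> W) \<bullet> (\<iota> V \<parallel> s') = e \<parallel> \<iota> B"
  shows "(\<iota> (A \<boxtimes> B) \<parallel> e) \<bullet> (stack A B ((f \<parallel> \<iota> V) \<bullet> b) g \<parallel> \<iota> W) \<bullet> (\<iota> U \<parallel> stack A B s' s) =
    (\<iota> A \<parallel> f) \<bullet> (((\<iota> A \<parallel> e) \<bullet> (g \<parallel> \<iota> W) \<bullet> (\<iota> U \<parallel> s)) \<parallel> \<iota> B)"
proof -
  note [simp] = dual_simps[OF dual] crossingD[OF g] crossingD[OF b] crossingD[OF s] crossingD[OF s'] f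
  have "(\<iota> (A \<boxtimes> B) \<parallel> e) \<bullet> (stack A B ((f \<parallel> \<iota> V) \<bullet> b) g \<parallel> \<iota> W) \<bullet> (\<iota> U \<parallel> stack A B s' s) =
      (\<iota> A \<parallel> ((\<iota> (tgt f) \<parallel> e) \<bullet> (f \<parallel> \<iota> (src e)))) \<bullet> (\<iota> A \<parallel> b \<parallel> \<iota> W) \<bullet>
      ((g \<parallel> \<iota> (tgt s')) \<bullet> (\<iota> (src g) \<parallel> s')) \<bullet> (\<iota> U \<parallel> s \<parallel> \<iota> B)"
    by (simp add: stack_def diagram)
  also have "\<dots> = (\<iota> A \<parallel> ((f \<parallel> \<iota> (tgt e)) \<bullet> (\<iota> (src f) \<parallel> e))) \<bullet> (\<iota> A \<parallel> b \<parallel> \<iota> W) \<bullet>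
      ((\<iota> (tgt g) \<parallel> s') \<bullet> (g \<parallel> \<iota> (src s'))) \<bullet> (\<iota> U \<parallel> s \<parallel> \<iota> B)"
    by (simp only: slide[OF f(1) dual_simps(3)[OF dual]] slide[OF \<open>typed g\<close> \<open>typed s'\<close>])
  also have "\<dots> = (\<iota> A \<parallel> f) \<bullet> (\<iota> A \<parallel> ((\<iota> B \<parallel> e) \<bullet> (b \<parallel> \<iota> W) \<bullet> (\<iota> V \<parallel> s'))) \<bullet> (g \<parallel> \<iota> (W \<boxtimes> B)) \<bullet> (\<iota> U \<parallel> s \<parallel> \<iota> B)"
    by (simp add: diagram)
  also have "\<dots> = (\<iota> A \<parallel> f) \<bullet> (((\<iota> A \<parallel> e) \<bullet> (g \<parallel> \<iota> W) \<bullet> (\<iota> U \<parallel> s)) \<parallel> \<iota> B)"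
    unfolding ev by (simp add: diagram)
  finally show ?thesis .
qed

end

text \<open>If crossings \<open>\<tau>\<^sub>P\<close> and \<open>\<tau>\<^sub>Q\<close> are compatible with a duality between \<open>Q\<close> and \<open>P\<close>, bending \<open>\<tau>\<^sub>Q\<close> inverts \<open>\<tau>\<^sub>P\<close>.\<close>

lemma crossing_inverse:
  assumes dual: "dual_pair Q P e c" and W: "W \<in> Obj C"
    and tP: "typed tP" "src tP = P \<boxtimes> W" "tgt tP = W \<boxtimes> P" and tQ: "typed tQ" "src tQ = Q \<boxtimes> W" "tgt tQ = W \<boxtimes> Q"
    and ev: "(\<iota> W \<parallel> e) \<bullet> (tQ \<parallel> \<iota> P) \<bullet> (\<iota> Q \<parallel> tP) = e \<parallel> \<iota> W"
    and coev: "(tP \<parallel> \<iota> Q) \<bullet> (\<iota> P \<parallel> tQ) \<bullet> (c \<parallel> \<iota> W) = \<iota> W \<parallel> c"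
  defines "s \<equiv> (\<iota> (P \<boxtimes> W) \<parallel> e) \<bullet> (\<iota> P \<parallel> tQ \<parallel> \<iota> P) \<bullet> (c \<parallel> \<iota> (W \<boxtimes> P))"
  shows "s \<bullet> tP = \<iota> (P \<boxtimes> W)" "tP \<bullet> s = \<iota> (W \<boxtimes> P)"
proof -
  note [simp] = dual_simps[OF dual] W tP tQ
  have "s \<bullet> tP = (\<iota> (P \<boxtimes> W) \<parallel> e) \<bullet> (\<iota> P \<parallel> tQ \<parallel> \<iota> P) \<bullet> ((c \<parallel> \<iota> (tgt tP)) \<bullet> (\<iota> (src c) \<parallel> tP))"
    by (simp add: s_def diagram)
  also have "\<dots> = (\<iota> (P \<boxtimes> W) \<parallel> e) \<bullet> (\<iota> P \<parallel> tQ \<parallel> \<iota> P) \<bullet> ((\<iota> (tgt c) \<parallel> tP) \<bullet> (c \<parallel> \<iota> (src tP)))"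
    by (simp only: slide[OF \<open>typed c\<close> tP(1)])
  also have "\<dots> = (\<iota> P \<parallel> ((\<iota> W \<parallel> e) \<bullet> (tQ \<parallel> \<iota> P) \<bullet> (\<iota> Q \<parallel> tP))) \<bullet> (c \<parallel> \<iota> (P \<boxtimes> W))"
    by (simp add: diagram)
  also have "\<dots> = ((\<iota> P \<parallel> e) \<bullet> (c \<parallel> \<iota> P)) \<parallel> \<iota> W"
    unfolding ev by (simp add: diagram)
  also have "\<dots> = \<iota> (P \<boxtimes> W)" unfolding zigzag(2)[OF dual] by (simp add: diagram)
  finally show "s \<bullet> tP = \<iota> (P \<boxtimes> W)" .
  have "tP \<bullet> s = ((tP \<parallel> \<iota> (tgt e)) \<bullet> (\<iota> (src tP) \<parallel> e)) \<bullet> (\<iota> P \<parallel> tQ \<parallel> \<iota> P) \<bullet> (c \<parallel> \<iota> (W \<boxtimes> P))"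
    by (simp add: s_def diagram)
  also have "\<dots> = ((\<iota> (tgt tP) \<parallel> e) \<bullet> (tP \<parallel> \<iota> (src e))) \<bullet> (\<iota> P \<parallel> tQ \<parallel> \<iota> P) \<bullet> (c \<parallel> \<iota> (W \<boxtimes> P))"
    by (simp only: slide[OF tP(1) \<open>typed e\<close>])
  also have "\<dots> = (\<iota> (W \<boxtimes> P) \<parallel> e) \<bullet> (((tP \<parallel> \<iota> Q) \<bullet> (\<iota> P \<parallel> tQ) \<bullet> (c \<parallel> \<iota> W)) \<parallel> \<iota> P)"
    by (simp add: diagram)
  also have "\<dots> = \<iota> W \<parallel> ((\<iota> P \<parallel> e) \<bullet> (c \<parallel> \<iota> P))"
    unfolding coev by (simp add: diagram)
  also have "\<dots> = \<iota> (W \<boxtimes> P)" unfolding zigzag(2)[OF dual] by (simp add: diagram)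
  finally show "tP \<bullet> s = \<iota> (W \<boxtimes> P)" .
qed

end

section \<open>Half-braidings on tuples of objects\<close>

text \<open>The category \<open>C\<close> enters through a theorem and not through the import of a locale, so that the notation for
  diagrams always refers to \<open>D\<close>.\<close>

locale monoidal_setting = D: strict_tensor_category K D + F: strict_monoidal_linear_functor K C D F
  for K :: "'k ring" and C :: "('k, 'o, 'm) mon_cat" and D :: "('k, 'p, 'n) mon_cat"
    and F :: "('o, 'm, 'p, 'n) func" +
  assumes C_tensor: "strict_tensor_category K C"
begin

notation D.seq (infixr "\<bullet>" 65)
notation D.par (infixr "\<parallel>" 75)
notation D.ident ("\<iota>")

lemmas C_tens_obj = strict_tensor_category.tens_obj[OF C_tensor]
  and C_unit_obj = strict_tensor_category.unit_obj[OF C_tensor]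
  and C_tens_obj_assoc = strict_tensor_category.tens_obj_assoc[OF C_tensor]
  and C_unit_obj_left = strict_tensor_category.unit_obj_left[OF C_tensor]
  and C_unit_obj_right = strict_tensor_category.unit_obj_right[OF C_tensor]
  and C_tens_arr = strict_tensor_category.tens_arr[OF C_tensor]

definition \<Phi> :: "'o list \<Rightarrow> 'p" where "\<Phi> Xs = tens_F D F Xs"

abbreviation \<C> where "\<C> \<equiv> DY_cochains C D F"

abbreviation \<I> where "\<I> \<equiv> Unit (centralizer C D F)"

lemma tens_list_simps [simp]: "tens_list B [] = Unit B" "tens_list B (X # Xs) = X \<boxtimes>\<^bsub>B\<^esub> tens_list B Xs"
  by (simp_all add: tens_list_def)

lemma tens_arrs_simps [simp]: "tens_arrs B [] = Id B (Unit B)" "tens_arrs B (f # fs) = f \<star>\<^bsub>B\<^esub> tens_arrs B fs"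
  by (simp_all add: tens_arrs_def)

lemma tens_list_obj [simp]: "set Xs \<subseteq> Obj C \<Longrightarrow> tens_list C Xs \<in> Obj C"
  by (induction Xs) (auto simp: C_unit_obj C_tens_obj)

lemma tens_list_append: "\<lbrakk>set Xs \<subseteq> Obj C; set Ys \<subseteq> Obj C\<rbrakk> \<Longrightarrow>
    tens_list C (Xs @ Ys) = tens_list C Xs \<boxtimes>\<^bsub>C\<^esub> tens_list C Ys"
  by (induction Xs) (auto simp: C_unit_obj_left C_tens_obj_assoc)

lemma \<Phi>_simps [simp]: "\<Phi> [] = Unit D" "\<Phi> (X # Xs) = FO F X \<boxtimes>\<^bsub>D\<^esub> \<Phi> Xs"
  by (simp_all add: \<Phi>_def)

lemma \<Phi>_obj [simp]: "set Xs \<subseteq> Obj C \<Longrightarrow> \<Phi> Xs \<in> Obj D"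
  by (induction Xs) (auto simp: D.unit_obj D.tens_obj F.F_obj)

lemma \<Phi>_append [simp]: "\<lbrakk>set Xs \<subseteq> Obj C; set Ys \<subseteq> Obj C\<rbrakk> \<Longrightarrow> \<Phi> (Xs @ Ys) = \<Phi> Xs \<boxtimes>\<^bsub>D\<^esub> \<Phi> Ys"
  by (induction Xs) (auto simp: D.unit_obj_left D.tens_obj_assoc F.F_obj)

lemma F_tens_list: "set Xs \<subseteq> Obj C \<Longrightarrow> FO F (tens_list C Xs) = \<Phi> Xs"
  by (induction Xs) (auto simp: F.F_unit F.F_tens_obj)

definition arrows :: "'m list \<Rightarrow> 'o list \<Rightarrow> 'o list \<Rightarrow> bool" where
  "arrows hs Xs Ys \<longleftrightarrow> length hs = length Xs \<and> length Ys = length Xs \<and> set Xs \<subseteq> Obj C \<and> set Ys \<subseteq> Obj C \<and>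
     (\<forall>i<length Xs. hs ! i \<in> arr C (Xs ! i) (Ys ! i))"

lemma arrows_Nil: "arrows hs [] Ys \<longleftrightarrow> hs = [] \<and> Ys = []"
  by (auto simp: arrows_def)

lemma arrows_Cons: "arrows (h # hs) (X # Xs) (Y # Ys) \<longleftrightarrow>
    X \<in> Obj C \<and> Y \<in> Obj C \<and> h \<in> arr C X Y \<and> arrows hs Xs Ys"
  by (auto simp: arrows_def All_less_Suc2)

lemma arrows_cases:
  assumes "arrows hs (X # Xs) Ys"
  obtains h hs' Y Ys' where "hs = h # hs'" "Ys = Y # Ys'" "X \<in> Obj C" "Y \<in> Obj C" "h \<in> arr C X Y" "arrows hs' Xs Ys'"
  using assms by (cases hs; cases Ys) (auto simp: arrows_Cons, auto simp: arrows_def)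

lemma arrows_take: "arrows hs Xs Ys \<Longrightarrow> arrows (take k hs) (take k Xs) (take k Ys)"
  by (auto simp: arrows_def dest: in_set_takeD)

lemma arrows_drop: "arrows hs Xs Ys \<Longrightarrow> arrows (drop k hs) (drop k Xs) (drop k Ys)"
  by (auto simp: arrows_def dest: in_set_dropD)

definition F_arrows :: "'m list \<Rightarrow> 'o list \<Rightarrow> 'o list \<Rightarrow> ('p, 'n) arrow" where
  "F_arrows hs Xs Ys = Arrow (\<Phi> Xs) (tens_arrs D (map (FA F) hs)) (\<Phi> Ys)"

lemma F_arrows_sel [simp]: "src (F_arrows hs Xs Ys) = \<Phi> Xs" "tgt (F_arrows hs Xs Ys) = \<Phi> Ys"
  "mor (F_arrows hs Xs Ys) = tens_arrs D (map (FA F) hs)"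
  by (simp_all add: F_arrows_def)

lemma F_arrows_Nil: "F_arrows [] [] [] = \<iota> (Unit D)"
  by (simp add: F_arrows_def D.ident_def)

lemma F_arrow_typed: "\<lbrakk>X \<in> Obj C; Y \<in> Obj C; h \<in> arr C X Y\<rbrakk> \<Longrightarrow> D.typed (Arrow (FO F X) (FA F h) (FO F Y))"
  by (simp add: D.typed_Arrow F.F_obj F.F_arr)

lemma F_arrows_Cons: "F_arrows (h # hs) (X # Xs) (Y # Ys) = Arrow (FO F X) (FA F h) (FO F Y) \<parallel> F_arrows hs Xs Ys"
  by (simp add: F_arrows_def D.par_def)

lemma F_arrows_typed: "arrows hs Xs Ys \<Longrightarrow> D.typed (F_arrows hs Xs Ys)"
proof (induction Xs arbitrary: hs Ys)
  case Nil
  then show ?case by (simp add: arrows_Nil F_arrows_Nil D.unit_obj)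
next
  case (Cons X Xs)
  then show ?case by (auto elim!: arrows_cases simp: F_arrows_Cons F_arrow_typed)
qed

lemma F_arrows_append:
  assumes "arrows hs Xs Ys" "arrows hs' Xs' Ys'"
  shows "F_arrows (hs @ hs') (Xs @ Xs') (Ys @ Ys') = F_arrows hs Xs Ys \<parallel> F_arrows hs' Xs' Ys'"
  using assms(1)
proof (induction Xs arbitrary: hs Ys)
  case Nil
  then show ?case using F_arrows_typed[OF assms(2)] by (simp add: arrows_Nil F_arrows_Nil D.par_unit_left)
next
  case (Cons X Xs)
  then show ?case
    using F_arrows_typed[OF assms(2)]
    by (auto elim!: arrows_cases simp: F_arrows_Cons F_arrow_typed F_arrows_typed D.par_assoc)
qed

text \<open>Half-braidings are natural with respect to arrows \<open>F h\<close>; a tensor product of arrows \<open>F h\<^sub>i\<close> is of this form.\<close>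

lemma tens_arrs_F:
  "arrows hs Xs Ys \<Longrightarrow> tens_arrs C hs \<in> arr C (tens_list C Xs) (tens_list C Ys) \<and>
    FA F (tens_arrs C hs) = tens_arrs D (map (FA F) hs)"
proof (induction Xs arbitrary: hs Ys)
  case Nil
  then show ?case by (simp add: arrows_Nil F.F_id F.F_unit C_unit_obj F.A.id_arr)
next
  case (Cons X Xs)
  from Cons.prems obtain h hs' Y Ys' where
    *: "hs = h # hs'" "Ys = Y # Ys'" "X \<in> Obj C" "Y \<in> Obj C" "h \<in> arr C X Y" "arrows hs' Xs Ys'"
    by (rule arrows_cases)
  have "set Xs \<subseteq> Obj C" "set Ys' \<subseteq> Obj C" using *(6) by (auto simp: arrows_def)
  then show ?case
    using * Cons.IH[OF *(6)] F.F_tens_arr[of X Y "tens_list C Xs" "tens_list C Ys'" h "tens_arrs C hs'"]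
      C_tens_arr[of X Y "tens_list C Xs" "tens_list C Ys'" h "tens_arrs C hs'"]
    by simp
qed

definition braid :: "'p \<times> ('o \<Rightarrow> 'n) \<Rightarrow> 'o list \<Rightarrow> ('p, 'n) arrow" where
  "braid V Xs = Arrow (fst V \<boxtimes>\<^bsub>D\<^esub> \<Phi> Xs) (snd V (tens_list C Xs)) (\<Phi> Xs \<boxtimes>\<^bsub>D\<^esub> fst V)"

lemma braid_sel [simp]: "src (braid V Xs) = fst V \<boxtimes>\<^bsub>D\<^esub> \<Phi> Xs" "tgt (braid V Xs) = \<Phi> Xs \<boxtimes>\<^bsub>D\<^esub> fst V"
  "mor (braid V Xs) = snd V (tens_list C Xs)"
  by (simp_all add: braid_def)

abbreviation central :: "'p \<times> ('o \<Rightarrow> 'n) \<Rightarrow> bool" where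
  "central V \<equiv> V \<in> Obj (centralizer C D F)"

lemma central_iff: "central V \<longleftrightarrow> fst V \<in> Obj D \<and> half_braiding C D F (fst V) (snd V)"
  by (auto simp: centralizer_def)

lemma central_obj [simp]: "central V \<Longrightarrow> fst V \<in> Obj D"
  by (simp add: central_iff)

lemma half_braiding_arr:
  assumes "half_braiding C D F V \<rho>" "X \<in> Obj C"
  shows "\<rho> X \<in> arr D (V \<boxtimes>\<^bsub>D\<^esub> FO F X) (FO F X \<boxtimes>\<^bsub>D\<^esub> V)"
  using assms by (simp add: half_braiding_def iso_arr_def)

lemma braid_typed [simp]: "\<lbrakk>central V; set Xs \<subseteq> Obj C\<rbrakk> \<Longrightarrow> D.typed (braid V Xs)"
  using half_braiding_arr[of "fst V" "snd V" "tens_list C Xs"]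
  by (simp add: central_iff braid_def D.typed_Arrow D.tens_obj F_tens_list)

lemma braid_append:
  assumes "central V" "set Xs \<subseteq> Obj C" "set Ys \<subseteq> Obj C"
  shows "braid V (Xs @ Ys) = (\<iota> (\<Phi> Xs) \<parallel> braid V Ys) \<bullet> (braid V Xs \<parallel> \<iota> (\<Phi> Ys))"
  using assms
  by (intro D.arrow_eqI)
    (simp_all add: central_iff half_braiding_def tens_list_append F_tens_list D.tens_obj_assoc)

text \<open>An invertible idempotent is an identity.\<close>

lemma braid_Nil:
  assumes V: "central V"
  shows "braid V [] = \<iota> (fst V)"
proof -
  let ?b = "braid V []"
  have b: "D.typed ?b" "src ?b = fst V" "tgt ?b = fst V"
    using V by (simp_all add: D.unit_obj_left D.unit_obj_right)
  have idem: "?b = ?b \<bullet> ?b"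
    using braid_append[OF V, of "[]" "[]"] b(1) by (simp add: D.diagram)
  have "iso_arr D (fst V) (fst V) (mor ?b)"
    using V by (simp add: central_iff half_braiding_def C_unit_obj F.F_unit D.unit_obj_left D.unit_obj_right
        del: braid_sel) (metis C_unit_obj D.unit_obj_left D.unit_obj_right F.F_unit braid_sel(3) tens_list_simps(1))
  then obtain g where g: "g \<in> arr D (fst V) (fst V)" "g \<cdot>\<^bsub>D\<^esub> mor ?b = Id D (fst V)"
    by (auto simp: iso_arr_def)
  define g' where "g' = Arrow (fst V) g (fst V)"
  have g': "D.typed g'" "src g' = fst V" "tgt g' = fst V" "g' \<bullet> ?b = \<iota> (fst V)"
    using V g b by (auto simp: g'_def D.typed_Arrow intro!: D.arrow_eqI)
  have "?b = (g' \<bullet> ?b) \<bullet> ?b" using b g'(4) by (simp add: D.seq_ident_left)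
  also have "\<dots> = g' \<bullet> ?b \<bullet> ?b" using b g'(1-3) by (intro D.seq_assoc) auto
  also have "\<dots> = g' \<bullet> ?b" unfolding idem[symmetric] ..
  finally show ?thesis using g'(4) by simp
qed

lemma braid_natural:
  assumes V: "central V" and h: "arrows hs Xs Ys"
  shows "(F_arrows hs Xs Ys \<parallel> \<iota> (fst V)) \<bullet> braid V Xs = braid V Ys \<bullet> (\<iota> (fst V) \<parallel> F_arrows hs Xs Ys)"
proof (rule D.arrow_eqI)
  have objs: "tens_list C Xs \<in> Obj C" "tens_list C Ys \<in> Obj C" using h by (auto simp: arrows_def)
  have "\<forall>X\<in>Obj C. \<forall>Y\<in>Obj C. \<forall>h\<in>arr C X Y. (FA F h \<star>\<^bsub>D\<^esub> Id D (fst V)) \<cdot>\<^bsub>D\<^esub> snd V X = snd V Y \<cdot>\<^bsub>D\<^esub> (Id D (fst V) \<star>\<^bsub>D\<^esub> FA F h)"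
    using V by (simp add: central_iff half_braiding_def)
  then have "(FA F (tens_arrs C hs) \<star>\<^bsub>D\<^esub> Id D (fst V)) \<cdot>\<^bsub>D\<^esub> snd V (tens_list C Xs) =
      snd V (tens_list C Ys) \<cdot>\<^bsub>D\<^esub> (Id D (fst V) \<star>\<^bsub>D\<^esub> FA F (tens_arrs C hs))"
    using objs tens_arrs_F[OF h] by blast
  then show "mor ((F_arrows hs Xs Ys \<parallel> \<iota> (fst V)) \<bullet> braid V Xs) = mor (braid V Ys \<bullet> (\<iota> (fst V) \<parallel> F_arrows hs Xs Ys))"
    using tens_arrs_F[OF h] by simp
qed simp_all

lemma unit_central: "central \<I>"
proof -
  have obj: "FO F X \<in> Obj D" if "X \<in> Obj C" for X using that by (rule F.F_obj)
  have nat: "(FA F h \<star>\<^bsub>D\<^esub> Id D (Unit D)) \<cdot>\<^bsub>D\<^esub> Id D (FO F X) = Id D (FO F Y) \<cdot>\<^bsub>D\<^esub> (Id D (Unit D) \<star>\<^bsub>D\<^esub> FA F h)"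
    if "X \<in> Obj C" "Y \<in> Obj C" "h \<in> arr C X Y" for X Y h
    using that F.F_arr[OF that] D.unit_arr_left[of "FO F X" "FO F Y" "FA F h"] D.unit_arr_right[of "FO F X" "FO F Y" "FA F h"]
      D.id_left[of "FO F X" "FO F Y" "FA F h"] D.id_right[of "FO F X" "FO F Y" "FA F h"] by (simp add: obj)
  have idem: "Id D X \<cdot>\<^bsub>D\<^esub> Id D X = Id D X" if "X \<in> Obj D" for X
    using that D.id_left[of X X "Id D X"] D.id_arr by simp
  have iso: "iso_arr D (FO F X) (FO F X) (Id D (FO F X))" if "X \<in> Obj C" for X
    unfolding iso_arr_def using obj[OF that] D.id_arr idem by blast
  have "half_braiding C D F (Unit D) (\<lambda>X\<in>Obj C. Id D (FO F X))"
    unfolding half_braiding_def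
    by (simp add: nat iso obj D.unit_obj_left D.unit_obj_right C_tens_obj F.F_tens_obj D.tens_id D.tens_obj idem)
  then show ?thesis by (simp add: centralizer_def D.unit_obj)
qed

lemma unit_fst [simp]: "fst \<I> = Unit D"
  by (simp add: centralizer_def)

lemma braid_unit: "set Xs \<subseteq> Obj C \<Longrightarrow> braid \<I> Xs = \<iota> (\<Phi> Xs)"
  by (intro D.arrow_eqI) (simp_all add: D.unit_obj_left D.unit_obj_right, simp add: centralizer_def F_tens_list)

end

section \<open>The Davydov-Yetter cochains\<close>

context monoidal_setting
begin

notation D.plus (infixl "\<boxplus>" 60)
notation D.scale (infixr "\<boxdot>" 70)

definition cell :: "'p \<times> ('o \<Rightarrow> 'n) \<Rightarrow> 'p \<times> ('o \<Rightarrow> 'n) \<Rightarrow> ('o list \<Rightarrow> 'n) \<Rightarrow> 'o list \<Rightarrow> ('p, 'n) arrow" where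
  "cell U V f Xs = Arrow (fst U \<boxtimes>\<^bsub>D\<^esub> \<Phi> Xs) (f Xs) (\<Phi> Xs \<boxtimes>\<^bsub>D\<^esub> fst V)"

lemma cell_sel [simp]: "src (cell U V f Xs) = fst U \<boxtimes>\<^bsub>D\<^esub> \<Phi> Xs" "tgt (cell U V f Xs) = \<Phi> Xs \<boxtimes>\<^bsub>D\<^esub> fst V"
  "mor (cell U V f Xs) = f Xs"
  by (simp_all add: cell_def)

lemma component_space_eq: "component_space D F U V Xs = Hom D (fst U \<boxtimes>\<^bsub>D\<^esub> \<Phi> Xs) (\<Phi> Xs \<boxtimes>\<^bsub>D\<^esub> fst V)"
  by (simp add: component_space_def \<Phi>_def)

lemma tuples_iff: "Xs \<in> tuples C n \<longleftrightarrow> length Xs = n \<and> set Xs \<subseteq> Obj C"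
  by (simp add: tuples_def)

definition natural :: "'p \<times> ('o \<Rightarrow> 'n) \<Rightarrow> 'p \<times> ('o \<Rightarrow> 'n) \<Rightarrow> nat \<Rightarrow> ('o list \<Rightarrow> 'n) \<Rightarrow> bool" where
  "natural U V n f \<longleftrightarrow> (\<forall>hs Xs Ys. arrows hs Xs Ys \<and> length Xs = n \<longrightarrow>
     (F_arrows hs Xs Ys \<parallel> \<iota> (fst V)) \<bullet> cell U V f Xs = cell U V f Ys \<bullet> (\<iota> (fst U) \<parallel> F_arrows hs Xs Ys))"

lemma cochain_iff:
  assumes "central U" "central V"
  shows "f \<in> carrier (\<C> U V n) \<longleftrightarrow> f \<in> extensional (tuples C n) \<and>
    (\<forall>Xs\<in>tuples C n. D.typed (cell U V f Xs)) \<and> natural U V n f"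
proof -
  have typed: "D.typed (cell U V f Xs) \<longleftrightarrow> f Xs \<in> carrier (component_space D F U V Xs)" if "Xs \<in> tuples C n" for Xs
    using that assms by (simp add: cell_def D.typed_Arrow component_space_eq tuples_iff D.tens_obj)
  have sq: "(F_arrows hs Xs Ys \<parallel> \<iota> (fst V)) \<bullet> cell U V f Xs = cell U V f Ys \<bullet> (\<iota> (fst U) \<parallel> F_arrows hs Xs Ys) \<longleftrightarrow>
      (tens_arrs D (map (FA F) hs) \<star>\<^bsub>D\<^esub> Id D (fst V)) \<cdot>\<^bsub>D\<^esub> f Xs =
      f Ys \<cdot>\<^bsub>D\<^esub> (Id D (fst U) \<star>\<^bsub>D\<^esub> tens_arrs D (map (FA F) hs))" for hs Xs Ys
    by (auto intro!: D.arrow_eqI dest: arg_cong[where f = mor])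
  have nat: "natural U V n f \<longleftrightarrow> (\<forall>Xs\<in>tuples C n. \<forall>Ys\<in>tuples C n. \<forall>hs.
      length hs = n \<and> (\<forall>i<n. hs ! i \<in> arr C (Xs ! i) (Ys ! i)) \<longrightarrow>
         (tens_arrs D (map (FA F) hs) \<star>\<^bsub>D\<^esub> Id D (fst V)) \<cdot>\<^bsub>D\<^esub> f Xs =
         f Ys \<cdot>\<^bsub>D\<^esub> (Id D (fst U) \<star>\<^bsub>D\<^esub> tens_arrs D (map (FA F) hs)))"
    unfolding natural_def sq arrows_def by (intro iffI allI ballI impI) (simp_all add: tuples_iff)
  show ?thesis
    unfolding nat using typed by (auto simp: DY_cochains_def PiE_iff)
qed

context
  fixes U V
  assumes U: "central U" and V: "central V"
begin

lemma cochain_typed: "\<lbrakk>f \<in> carrier (\<C> U V n); length Xs = n; set Xs \<subseteq> Obj C\<rbrakk> \<Longrightarrow> D.typed (cell U V f Xs)"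
  using cochain_iff[OF U V] by (simp add: tuples_iff)

lemma cochain_natural:
  "\<lbrakk>f \<in> carrier (\<C> U V n); arrows hs Xs Ys; length Xs = n\<rbrakk> \<Longrightarrow>
    (F_arrows hs Xs Ys \<parallel> \<iota> (fst V)) \<bullet> cell U V f Xs = cell U V f Ys \<bullet> (\<iota> (fst U) \<parallel> F_arrows hs Xs Ys)"
  using cochain_iff[OF U V] by (simp add: natural_def)

lemma cochain_extensional: "f \<in> carrier (\<C> U V n) \<Longrightarrow> f \<in> extensional (tuples C n)"
  using cochain_iff[OF U V] by simp

lemma cochain_eqI:
  assumes "f \<in> extensional (tuples C n)" "g \<in> extensional (tuples C n)"
    and "\<And>Xs. \<lbrakk>length Xs = n; set Xs \<subseteq> Obj C\<rbrakk> \<Longrightarrow> cell U V f Xs = cell U V g Xs"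
  shows "f = g"
proof (rule extensionalityI[OF assms(1,2)])
  fix Xs assume "Xs \<in> tuples C n"
  then have "mor (cell U V f Xs) = mor (cell U V g Xs)" using assms(3) by (simp add: tuples_iff)
  then show "f Xs = g Xs" by simp
qed

lemma cell_add: "\<lbrakk>length Xs = n; set Xs \<subseteq> Obj C\<rbrakk> \<Longrightarrow>
    cell U V (f \<oplus>\<^bsub>\<C> U V n\<^esub> g) Xs = cell U V f Xs \<boxplus> cell U V g Xs"
  by (intro D.arrow_eqI) (simp_all add: DY_cochains_def tuples_iff component_space_eq)

lemma cell_smult: "\<lbrakk>length Xs = n; set Xs \<subseteq> Obj C\<rbrakk> \<Longrightarrow>
    cell U V (a \<odot>\<^bsub>\<C> U V n\<^esub> f) Xs = a \<boxdot> cell U V f Xs"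
  by (intro D.arrow_eqI) (simp_all add: DY_cochains_def tuples_iff component_space_eq)

lemma cell_zero: "\<lbrakk>length Xs = n; set Xs \<subseteq> Obj C\<rbrakk> \<Longrightarrow>
    cell U V \<zero>\<^bsub>\<C> U V n\<^esub> Xs = D.zero_arrow (fst U \<boxtimes>\<^bsub>D\<^esub> \<Phi> Xs) (\<Phi> Xs \<boxtimes>\<^bsub>D\<^esub> fst V)"
  by (intro D.arrow_eqI) (simp_all add: DY_cochains_def tuples_iff component_space_eq)

lemma cochains_ext [simp]: "f \<oplus>\<^bsub>\<C> U V n\<^esub> g \<in> extensional (tuples C n)" "a \<odot>\<^bsub>\<C> U V n\<^esub> f \<in> extensional (tuples C n)"
  "\<zero>\<^bsub>\<C> U V n\<^esub> \<in> extensional (tuples C n)"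
  by (simp_all add: DY_cochains_def)

lemma component_module: "set Xs \<subseteq> Obj C \<Longrightarrow> module K (component_space D F U V Xs)"
  unfolding component_space_eq using U V by (intro D.hom_module D.tens_obj) simp_all

lemma component_closed: "\<lbrakk>f \<in> carrier (\<C> U V n); Xs \<in> tuples C n\<rbrakk> \<Longrightarrow> f Xs \<in> carrier (component_space D F U V Xs)"
  by (auto simp: DY_cochains_def)

lemma arrows_objs: "arrows hs Xs Ys \<Longrightarrow> set Xs \<subseteq> Obj C \<and> set Ys \<subseteq> Obj C \<and> length Ys = length Xs"
  by (simp add: arrows_def)

lemma cochains_add_closed:
  assumes f: "f \<in> carrier (\<C> U V n)" and g: "g \<in> carrier (\<C> U V n)"
  shows "f \<oplus>\<^bsub>\<C> U V n\<^esub> g \<in> carrier (\<C> U V n)"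
  unfolding cochain_iff[OF U V] natural_def
proof (intro conjI ballI allI impI)
  fix hs Xs Ys assume h: "arrows hs Xs Ys \<and> length Xs = n"
  then have "set Xs \<subseteq> Obj C" "set Ys \<subseteq> Obj C" "length Ys = n" "length Xs = n" using arrows_objs[of hs Xs Ys] by auto
  then show "(F_arrows hs Xs Ys \<parallel> \<iota> (fst V)) \<bullet> cell U V (f \<oplus>\<^bsub>\<C> U V n\<^esub> g) Xs =
      cell U V (f \<oplus>\<^bsub>\<C> U V n\<^esub> g) Ys \<bullet> (\<iota> (fst U) \<parallel> F_arrows hs Xs Ys)"
    using h U V cochain_typed[OF f] cochain_typed[OF g] cochain_natural[OF f] cochain_natural[OF g]
    by (simp add: cell_add D.linear F_arrows_typed)
qed (use cochain_typed[OF f] cochain_typed[OF g] in \<open>simp_all add: tuples_iff cell_add\<close>)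

lemma cochains_smult_closed:
  assumes a: "a \<in> carrier K" and f: "f \<in> carrier (\<C> U V n)"
  shows "a \<odot>\<^bsub>\<C> U V n\<^esub> f \<in> carrier (\<C> U V n)"
  unfolding cochain_iff[OF U V] natural_def
proof (intro conjI ballI allI impI)
  fix hs Xs Ys assume h: "arrows hs Xs Ys \<and> length Xs = n"
  then have "set Xs \<subseteq> Obj C" "set Ys \<subseteq> Obj C" "length Ys = n" "length Xs = n" using arrows_objs[of hs Xs Ys] by auto
  then show "(F_arrows hs Xs Ys \<parallel> \<iota> (fst V)) \<bullet> cell U V (a \<odot>\<^bsub>\<C> U V n\<^esub> f) Xs =
      cell U V (a \<odot>\<^bsub>\<C> U V n\<^esub> f) Ys \<bullet> (\<iota> (fst U) \<parallel> F_arrows hs Xs Ys)"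
    using h U V a cochain_typed[OF f] cochain_natural[OF f] by (simp add: cell_smult D.linear F_arrows_typed)
qed (use a cochain_typed[OF f] in \<open>simp_all add: tuples_iff cell_smult\<close>)

lemma cochains_zero_closed: "\<zero>\<^bsub>\<C> U V n\<^esub> \<in> carrier (\<C> U V n)"
  unfolding cochain_iff[OF U V] natural_def
proof (intro conjI ballI allI impI)
  fix hs Xs Ys assume h: "arrows hs Xs Ys \<and> length Xs = n"
  then have "set Xs \<subseteq> Obj C" "set Ys \<subseteq> Obj C" "length Ys = n" "length Xs = n" using arrows_objs[of hs Xs Ys] by auto
  then show "(F_arrows hs Xs Ys \<parallel> \<iota> (fst V)) \<bullet> cell U V \<zero>\<^bsub>\<C> U V n\<^esub> Xs =
      cell U V \<zero>\<^bsub>\<C> U V n\<^esub> Ys \<bullet> (\<iota> (fst U) \<parallel> F_arrows hs Xs Ys)"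
    using h U V by (simp add: cell_zero D.seq_zero D.zero_seq F_arrows_typed D.tens_obj)
qed (use U V in \<open>simp_all add: tuples_iff cell_zero D.tens_obj\<close>)

lemma cochains_apply:
  assumes "Xs \<in> tuples C n"
  shows "(f \<oplus>\<^bsub>\<C> U V n\<^esub> g) Xs = f Xs \<oplus>\<^bsub>component_space D F U V Xs\<^esub> g Xs"
    "(a \<odot>\<^bsub>\<C> U V n\<^esub> f) Xs = a \<odot>\<^bsub>component_space D F U V Xs\<^esub> f Xs"
    "\<zero>\<^bsub>\<C> U V n\<^esub> Xs = \<zero>\<^bsub>component_space D F U V Xs\<^esub>"
  using assms by (simp_all add: DY_cochains_def)

lemma K_cring: "cring K"
  using D.field_K by (simp add: field.axioms(1) domain.axioms(1))

lemma cochains_module: "module K (\<C> U V n)"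
proof (rule moduleI)
  note [simp] = cochains_add_closed cochains_smult_closed cochains_zero_closed cochains_apply
  have comp: "module K (component_space D F U V Xs)" if "Xs \<in> tuples C n" for Xs
    using that by (intro component_module) (simp add: tuples_iff)
  show "cring K" by (rule K_cring)
  show "abelian_group (\<C> U V n)"
  proof (rule abelian_groupI)
    fix f g h assume f: "f \<in> carrier (\<C> U V n)" and g: "g \<in> carrier (\<C> U V n)" and h: "h \<in> carrier (\<C> U V n)"
    show "f \<oplus>\<^bsub>\<C> U V n\<^esub> g \<oplus>\<^bsub>\<C> U V n\<^esub> h = f \<oplus>\<^bsub>\<C> U V n\<^esub> (g \<oplus>\<^bsub>\<C> U V n\<^esub> h)"
    proof (rule extensionalityI[where A = "tuples C n"])
      fix Xs assume Xs: "Xs \<in> tuples C n"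
      interpret module K "component_space D F U V Xs" by (rule comp[OF Xs])
      show "(f \<oplus>\<^bsub>\<C> U V n\<^esub> g \<oplus>\<^bsub>\<C> U V n\<^esub> h) Xs = (f \<oplus>\<^bsub>\<C> U V n\<^esub> (g \<oplus>\<^bsub>\<C> U V n\<^esub> h)) Xs"
        using Xs component_closed f g h by (simp add: M.a_assoc)
    qed simp_all
  next
    fix f g assume f: "f \<in> carrier (\<C> U V n)" and g: "g \<in> carrier (\<C> U V n)"
    show "f \<oplus>\<^bsub>\<C> U V n\<^esub> g = g \<oplus>\<^bsub>\<C> U V n\<^esub> f"
    proof (rule extensionalityI[where A = "tuples C n"])
      fix Xs assume Xs: "Xs \<in> tuples C n"
      interpret module K "component_space D F U V Xs" by (rule comp[OF Xs])
      show "(f \<oplus>\<^bsub>\<C> U V n\<^esub> g) Xs = (g \<oplus>\<^bsub>\<C> U V n\<^esub> f) Xs"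
        using Xs component_closed f g by (simp add: M.a_comm)
    qed simp_all
  next
    fix f assume f: "f \<in> carrier (\<C> U V n)"
    show "\<zero>\<^bsub>\<C> U V n\<^esub> \<oplus>\<^bsub>\<C> U V n\<^esub> f = f"
    proof (rule extensionalityI[where A = "tuples C n"])
      fix Xs assume Xs: "Xs \<in> tuples C n"
      interpret module K "component_space D F U V Xs" by (rule comp[OF Xs])
      show "(\<zero>\<^bsub>\<C> U V n\<^esub> \<oplus>\<^bsub>\<C> U V n\<^esub> f) Xs = f Xs" using Xs component_closed[OF f] by simp
    qed (simp_all add: cochain_extensional[OF f])
    have neg: "\<ominus>\<^bsub>K\<^esub> \<one>\<^bsub>K\<^esub> \<in> carrier K" using K_cring by (simp add: cring.cring_simprules)
    have "((\<ominus>\<^bsub>K\<^esub> \<one>\<^bsub>K\<^esub>) \<odot>\<^bsub>\<C> U V n\<^esub> f) \<oplus>\<^bsub>\<C> U V n\<^esub> f = \<zero>\<^bsub>\<C> U V n\<^esub>"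
    proof (rule extensionalityI[where A = "tuples C n"])
      fix Xs assume Xs: "Xs \<in> tuples C n"
      interpret module K "component_space D F U V Xs" by (rule comp[OF Xs])
      show "(((\<ominus>\<^bsub>K\<^esub> \<one>\<^bsub>K\<^esub>) \<odot>\<^bsub>\<C> U V n\<^esub> f) \<oplus>\<^bsub>\<C> U V n\<^esub> f) Xs = \<zero>\<^bsub>\<C> U V n\<^esub> Xs"
        using Xs component_closed[OF f] by (simp add: smult_l_minus M.l_neg)
    qed simp_all
    then show "\<exists>g\<in>carrier (\<C> U V n). g \<oplus>\<^bsub>\<C> U V n\<^esub> f = \<zero>\<^bsub>\<C> U V n\<^esub>"
      using cochains_smult_closed[OF neg f] by blast
  qed simp_all
next
  note [simp] = cochains_add_closed cochains_smult_closed cochains_apply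
  have comp: "module K (component_space D F U V Xs)" if "Xs \<in> tuples C n" for Xs
    using that by (intro component_module) (simp add: tuples_iff)
  fix a f assume a: "a \<in> carrier K" and f: "f \<in> carrier (\<C> U V n)"
  show "a \<odot>\<^bsub>\<C> U V n\<^esub> f \<in> carrier (\<C> U V n)" using a f by simp
  fix b assume b: "b \<in> carrier K"
  show "(a \<oplus>\<^bsub>K\<^esub> b) \<odot>\<^bsub>\<C> U V n\<^esub> f = a \<odot>\<^bsub>\<C> U V n\<^esub> f \<oplus>\<^bsub>\<C> U V n\<^esub> b \<odot>\<^bsub>\<C> U V n\<^esub> f"
    "(a \<otimes>\<^bsub>K\<^esub> b) \<odot>\<^bsub>\<C> U V n\<^esub> f = a \<odot>\<^bsub>\<C> U V n\<^esub> (b \<odot>\<^bsub>\<C> U V n\<^esub> f)"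
    by (rule extensionalityI[where A = "tuples C n"];
        simp add: a b component_closed[OF f] module.smult_l_distr[OF comp] module.smult_assoc1[OF comp])+
next
  note [simp] = cochains_add_closed cochains_smult_closed cochains_apply
  have comp: "module K (component_space D F U V Xs)" if "Xs \<in> tuples C n" for Xs
    using that by (intro component_module) (simp add: tuples_iff)
  fix f assume f: "f \<in> carrier (\<C> U V n)"
  show "\<one>\<^bsub>K\<^esub> \<odot>\<^bsub>\<C> U V n\<^esub> f = f"
    by (rule extensionalityI[where A = "tuples C n"])
      (simp_all add: component_closed[OF f] module.smult_one[OF comp] cochain_extensional[OF f])
  fix a g assume a: "a \<in> carrier K" and g: "g \<in> carrier (\<C> U V n)"
  show "a \<odot>\<^bsub>\<C> U V n\<^esub> (f \<oplus>\<^bsub>\<C> U V n\<^esub> g) = a \<odot>\<^bsub>\<C> U V n\<^esub> f \<oplus>\<^bsub>\<C> U V n\<^esub> a \<odot>\<^bsub>\<C> U V n\<^esub> g"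
    by (rule extensionalityI[where A = "tuples C n"])
      (simp_all add: a component_closed[OF f] component_closed[OF g] module.smult_r_distr[OF comp])
qed

lemma cochains_finsum:
  assumes "finite I" "\<And>i. i \<in> I \<Longrightarrow> f i \<in> carrier (\<C> U V n)" "Xs \<in> tuples C n"
  shows "(\<Oplus>\<^bsub>\<C> U V n\<^esub>i\<in>I. f i) Xs = (\<Oplus>\<^bsub>component_space D F U V Xs\<^esub>i\<in>I. f i Xs)"
  using assms(1,2)
proof (induction I rule: finite_induct)
  interpret C: module K "\<C> U V n" by (rule cochains_module)
  interpret S: module K "component_space D F U V Xs"
    using assms(3) by (intro component_module) (simp add: tuples_iff)
  {
    case empty
    then show ?case using cochains_apply(3)[OF assms(3)] by simp
  next
    case (insert i I)
    have "(\<Oplus>\<^bsub>\<C> U V n\<^esub>i\<in>insert i I. f i) = f i \<oplus>\<^bsub>\<C> U V n\<^esub> (\<Oplus>\<^bsub>\<C> U V n\<^esub>i\<in>I. f i)"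
      using insert by (intro C.M.finsum_insert) auto
    moreover have "(\<Oplus>\<^bsub>component_space D F U V Xs\<^esub>i\<in>insert i I. f i Xs) =
        f i Xs \<oplus>\<^bsub>component_space D F U V Xs\<^esub> (\<Oplus>\<^bsub>component_space D F U V Xs\<^esub>i\<in>I. f i Xs)"
      using insert component_closed assms(3) by (intro S.M.finsum_insert) auto
    ultimately show ?case using insert cochains_apply(1)[OF assms(3)] by simp
  }
qed

lemma cochains_alt_sign:
  assumes f: "f \<in> carrier (\<C> U V n)" and Xs: "Xs \<in> tuples C n"
  shows "alt_sign (\<C> U V n) k f Xs = alt_sign (component_space D F U V Xs) k (f Xs)"
proof -
  interpret C: module K "\<C> U V n" by (rule cochains_module)
  interpret S: module K "component_space D F U V Xs"
    using Xs by (intro component_module) (simp add: tuples_iff)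
  have "(\<ominus>\<^bsub>\<C> U V n\<^esub> f) Xs \<oplus>\<^bsub>component_space D F U V Xs\<^esub> f Xs = \<zero>\<^bsub>component_space D F U V Xs\<^esub>"
    using cochains_apply(1)[OF Xs, of "\<ominus>\<^bsub>\<C> U V n\<^esub> f" f] cochains_apply(3)[OF Xs] f by (simp add: C.M.l_neg)
  then have "(\<ominus>\<^bsub>\<C> U V n\<^esub> f) Xs = \<ominus>\<^bsub>component_space D F U V Xs\<^esub> f Xs"
    using f component_closed[OF _ Xs] by (intro S.M.minus_equality[symmetric]) auto
  then show ?thesis by (simp add: alt_sign_def)
qed

end

end

section \<open>Cofaces and the cup product\<close>

context monoidal_setting
begin

text \<open>Positions start at 0: the coface with index \<open>i\<close> merges the entries at positions \<open>i - 1\<close> and \<open>i\<close>.\<close>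

definition merge :: "nat \<Rightarrow> 'o list \<Rightarrow> 'o list" where
  "merge k Xs = take k Xs @ (Xs ! k \<boxtimes>\<^bsub>C\<^esub> Xs ! (k + 1)) # drop (k + 2) Xs"

lemma merge_simps: "merge 0 (X # Y # Zs) = (X \<boxtimes>\<^bsub>C\<^esub> Y) # Zs" "merge (Suc k) (X # Zs) = X # merge k Zs"
  by (simp_all add: merge_def)

lemma merge_append:
  "k + 1 < length Xs \<Longrightarrow> merge k (Xs @ Ys) = merge k Xs @ Ys"
  "merge (length Xs + k) (Xs @ Ys) = Xs @ merge k Ys"
  by (simp_all add: merge_def nth_append)

lemma length_merge: "k + 1 < length Xs \<Longrightarrow> length (merge k Xs) = length Xs - 1"
  by (simp add: merge_def)

lemma set_merge: "\<lbrakk>k + 1 < length Xs; set Xs \<subseteq> Obj C\<rbrakk> \<Longrightarrow> set (merge k Xs) \<subseteq> Obj C"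
  by (auto simp: merge_def dest!: in_set_takeD in_set_dropD intro!: C_tens_obj)

lemma merge_cases:
  assumes "k + 1 < length Xs"
  obtains As X Y Bs where "Xs = As @ [X, Y] @ Bs" "length As = k" "merge k Xs = As @ [X \<boxtimes>\<^bsub>C\<^esub> Y] @ Bs"
proof -
  have "Xs = take k Xs @ [Xs ! k, Xs ! (k + 1)] @ drop (k + 2) Xs"
    using assms id_take_nth_drop[of k Xs] Cons_nth_drop_Suc[of "k + 1" Xs] by simp
  then show thesis using assms that[of "take k Xs" "Xs ! k" "Xs ! (k + 1)" "drop (k + 2) Xs"]
    by (simp add: merge_def)
qed

lemma tens_list_merge: "\<lbrakk>k + 1 < length Xs; set Xs \<subseteq> Obj C\<rbrakk> \<Longrightarrow> tens_list C (merge k Xs) = tens_list C Xs"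
  by (erule merge_cases) (simp add: tens_list_append C_tens_obj_assoc C_tens_obj)

lemma \<Phi>_merge: "\<lbrakk>k + 1 < length Xs; set Xs \<subseteq> Obj C\<rbrakk> \<Longrightarrow> \<Phi> (merge k Xs) = \<Phi> Xs"
  using F_tens_list[of Xs] F_tens_list[of "merge k Xs"] set_merge[of k Xs] tens_list_merge[of k Xs] by simp

lemma braid_merge: "\<lbrakk>k + 1 < length Xs; set Xs \<subseteq> Obj C\<rbrakk> \<Longrightarrow> braid V (merge k Xs) = braid V Xs"
  by (simp add: braid_def \<Phi>_merge tens_list_merge)

lemma merge_merge:
  "\<lbrakk>k < l; l + 1 < length Xs; set Xs \<subseteq> Obj C\<rbrakk> \<Longrightarrow> merge k (merge l Xs) = merge (l - 1) (merge k Xs)"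
proof (induction k arbitrary: l Xs)
  case 0
  then obtain X Y Z Zs where Xs: "Xs = X # Y # Z # Zs"
    by (cases Xs; cases "tl Xs"; cases "tl (tl Xs)") auto
  show ?case
  proof (cases "l = 1")
    case True
    then show ?thesis using 0 Xs by (simp add: merge_simps One_nat_def C_tens_obj_assoc del: One_nat_def) (simp add: merge_simps C_tens_obj_assoc)
  next
    case False
    then obtain l' where "l = Suc (Suc l')" using 0 by (cases l; cases "l - 1") auto
    then show ?thesis using Xs by (simp add: merge_simps)
  qed
next
  case (Suc k)
  then obtain X Zs where Xs: "Xs = X # Zs" by (cases Xs) auto
  obtain l' where l: "l = Suc l'" using Suc.prems by (cases l) auto
  have "merge k (merge l' Zs) = merge (l' - 1) (merge k Zs)" using Suc Xs l by auto
  moreover obtain l'' where "l' = Suc l''" using Suc.prems l by (cases l') auto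
  ultimately show ?case using Xs l by (simp add: merge_simps)
qed

lemma arrows_split:
  assumes "arrows hs (Xs @ Xs') Zs"
  obtains hs1 hs2 Ys Ys' where "hs = hs1 @ hs2" "Zs = Ys @ Ys'" "arrows hs1 Xs Ys" "arrows hs2 Xs' Ys'"
    "length Ys = length Xs" "length Ys' = length Xs'"
proof -
  let ?k = "length Xs"
  have "arrows (take ?k hs) Xs (take ?k Zs)" "arrows (drop ?k hs) Xs' (drop ?k Zs)"
    using arrows_take[OF assms, of ?k] arrows_drop[OF assms, of ?k] by simp_all
  then show thesis
    using that[of "take ?k hs" "drop ?k hs" "take ?k Zs" "drop ?k Zs"] assms by (simp add: arrows_def)
qed

lemma arrows_merge:
  assumes "arrows hs Xs Ys" "k + 1 < length Xs"
  obtains hs' where "arrows hs' (merge k Xs) (merge k Ys)" "F_arrows hs' (merge k Xs) (merge k Ys) = F_arrows hs Xs Ys"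
proof -
  have "\<exists>hs'. arrows hs' (merge k Xs) (merge k Ys) \<and> F_arrows hs' (merge k Xs) (merge k Ys) = F_arrows hs Xs Ys"
    using assms
  proof (induction k arbitrary: hs Xs Ys)
    case 0
    then obtain X X' Xs' where Xs: "Xs = X # X' # Xs'" by (cases Xs; cases "tl Xs") auto
    obtain h h' hs' Y Y' Ys' where *: "hs = h # h' # hs'" "Ys = Y # Y' # Ys'" "X \<in> Obj C" "Y \<in> Obj C"
      "X' \<in> Obj C" "Y' \<in> Obj C" "h \<in> arr C X Y" "h' \<in> arr C X' Y'" "arrows hs' Xs' Ys'"
      using "0.prems"(1) unfolding Xs by (auto elim!: arrows_cases)
    have "F_arrows hs Xs Ys = (Arrow (FO F X) (FA F h) (FO F Y) \<parallel> Arrow (FO F X') (FA F h') (FO F Y')) \<parallel> F_arrows hs' Xs' Ys'"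
      using * Xs by (simp add: F_arrows_Cons F_arrow_typed F_arrows_typed D.par_assoc)
    also have "Arrow (FO F X) (FA F h) (FO F Y) \<parallel> Arrow (FO F X') (FA F h') (FO F Y') =
        Arrow (FO F (X \<boxtimes>\<^bsub>C\<^esub> X')) (FA F (h \<star>\<^bsub>C\<^esub> h')) (FO F (Y \<boxtimes>\<^bsub>C\<^esub> Y'))"
      using * by (intro D.arrow_eqI) (simp_all add: F.F_tens_obj F.F_tens_arr)
    finally have "F_arrows hs Xs Ys = F_arrows ((h \<star>\<^bsub>C\<^esub> h') # hs') ((X \<boxtimes>\<^bsub>C\<^esub> X') # Xs') ((Y \<boxtimes>\<^bsub>C\<^esub> Y') # Ys')"
      by (simp add: F_arrows_Cons)
    moreover have "arrows ((h \<star>\<^bsub>C\<^esub> h') # hs') ((X \<boxtimes>\<^bsub>C\<^esub> X') # Xs') ((Y \<boxtimes>\<^bsub>C\<^esub> Y') # Ys')"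
      using * by (simp add: arrows_Cons C_tens_obj C_tens_arr)
    ultimately show ?case using Xs * by (intro exI[of _ "(h \<star>\<^bsub>C\<^esub> h') # hs'"]) (simp add: merge_simps)
  next
    case (Suc k)
    then obtain X Xs' where Xs: "Xs = X # Xs'" by (cases Xs) auto
    obtain h hs' Y Ys' where *: "hs = h # hs'" "Ys = Y # Ys'" "X \<in> Obj C" "Y \<in> Obj C" "h \<in> arr C X Y" "arrows hs' Xs' Ys'"
      using Suc.prems(1) unfolding Xs by (rule arrows_cases)
    obtain hs'' where "arrows hs'' (merge k Xs') (merge k Ys')" "F_arrows hs'' (merge k Xs') (merge k Ys') = F_arrows hs' Xs' Ys'"
      using Suc.IH[OF *(6)] Suc.prems(2) Xs by auto
    then show ?case using Xs * by (intro exI[of _ "h # hs''"]) (simp add: merge_simps arrows_Cons F_arrows_Cons)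
  qed
  then show thesis using that by blast
qed

lemma \<Phi>_Cons: "\<lbrakk>X \<in> Obj C; set Xs \<subseteq> Obj C\<rbrakk> \<Longrightarrow> \<Phi> (X # Xs) = \<Phi> [X] \<boxtimes>\<^bsub>D\<^esub> \<Phi> Xs"
  using \<Phi>_append[of "[X]" Xs] by simp

lemma crossing_braid: "\<lbrakk>central V; set Xs \<subseteq> Obj C\<rbrakk> \<Longrightarrow> D.crossing (fst V) (\<Phi> Xs) (fst V) (braid V Xs)"
  by (simp add: D.crossing_def)

lemma braid_stack:
  assumes "central V" "set Xs \<subseteq> Obj C" "set Ys \<subseteq> Obj C"
  shows "braid V (Xs @ Ys) = D.stack (\<Phi> Xs) (\<Phi> Ys) (braid V Ys) (braid V Xs)"
  using braid_append[OF assms] by (simp add: D.stack_def)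

lemma natural_stack:
  assumes "D.crossing U (\<Phi> Xs) V g" "D.crossing U (\<Phi> Ys) V g'" "D.crossing V (\<Phi> Xs') W t" "D.crossing V (\<Phi> Ys') W t'"
    and h: "arrows hs Xs Ys" "arrows hs' Xs' Ys'"
    and "(F_arrows hs Xs Ys \<parallel> \<iota> V) \<bullet> g = g' \<bullet> (\<iota> U \<parallel> F_arrows hs Xs Ys)"
    and "(F_arrows hs' Xs' Ys' \<parallel> \<iota> W) \<bullet> t = t' \<bullet> (\<iota> V \<parallel> F_arrows hs' Xs' Ys')"
  shows "(F_arrows (hs @ hs') (Xs @ Xs') (Ys @ Ys') \<parallel> \<iota> W) \<bullet> D.stack (\<Phi> Xs) (\<Phi> Xs') t g =
    D.stack (\<Phi> Ys) (\<Phi> Ys') t' g' \<bullet> (\<iota> U \<parallel> F_arrows (hs @ hs') (Xs @ Xs') (Ys @ Ys'))"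
  unfolding F_arrows_append[OF h]
  by (rule D.stack_natural[OF assms(1-4)]) (use assms F_arrows_typed in simp_all)

text \<open>The terms of the Davydov-Yetter differential.\<close>

definition coface where
  "coface U V n i f = (\<lambda>Zs\<in>tuples C (n + 1).
     if i = 0 then mor (D.stack (\<Phi> [hd Zs]) (\<Phi> (tl Zs)) (cell U V f (tl Zs)) (braid U [hd Zs]))
     else if i \<le> n then f (merge (i - 1) Zs)
     else mor (D.stack (\<Phi> (butlast Zs)) (\<Phi> [last Zs]) (braid V [last Zs]) (cell U V f (butlast Zs))))"

text \<open>This is how a cochain with trivial coefficients acts on the strand \<open>V\<close>.\<close>

definition twist where
  "twist V f Ys = (cell \<I> \<I> f Ys \<parallel> \<iota> (fst V)) \<bullet> braid V Ys"

text \<open>The action without its sign.\<close>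

definition cup where
  "cup U V n m f g = (\<lambda>Zs\<in>tuples C (n + m).
     mor (D.stack (\<Phi> (take m Zs)) (\<Phi> (drop m Zs)) (twist V f (drop m Zs)) (cell U V g (take m Zs))))"

lemma cellI:
  assumes "length Zs = n" "set Zs \<subseteq> Obj C" "D.crossing (fst U) (\<Phi> Zs) (fst V) a" "h Zs = mor a"
  shows "cell U V (\<lambda>Zs\<in>tuples C n. h Zs) Zs = a"
  using assms D.crossingD[OF assms(3)] by (intro D.arrow_eqI) (simp_all add: tuples_iff)

context
  fixes U V
  assumes U: "central U" and V: "central V"
begin

lemma cochainI:
  assumes "f \<in> extensional (tuples C n)"
    and "\<And>Xs. \<lbrakk>length Xs = n; set Xs \<subseteq> Obj C\<rbrakk> \<Longrightarrow> D.crossing (fst U) (\<Phi> Xs) (fst V) (cell U V f Xs)"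
    and "\<And>hs Xs Ys. \<lbrakk>arrows hs Xs Ys; length Xs = n\<rbrakk> \<Longrightarrow>
      (F_arrows hs Xs Ys \<parallel> \<iota> (fst V)) \<bullet> cell U V f Xs = cell U V f Ys \<bullet> (\<iota> (fst U) \<parallel> F_arrows hs Xs Ys)"
  shows "f \<in> carrier (\<C> U V n)"
  unfolding cochain_iff[OF U V] natural_def using assms D.crossingD(4)[OF assms(2)] by (auto simp: tuples_iff)

lemma crossing_cell:
  "\<lbrakk>f \<in> carrier (\<C> U V n); length Xs = n; set Xs \<subseteq> Obj C\<rbrakk> \<Longrightarrow> D.crossing (fst U) (\<Phi> Xs) (fst V) (cell U V f Xs)"
  using cochain_typed[OF U V] U V by (simp add: D.crossing_def)

lemma coface_ext [simp]: "coface U V n i f \<in> extensional (tuples C (n + 1))" "coface U V n i f \<in> extensional (tuples C (Suc n))"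
  by (simp_all add: coface_def)

lemma cup_ext [simp]: "cup U V n m f g \<in> extensional (tuples C (n + m))"
  by (simp add: cup_def)

lemma cell_coface_first:
  assumes f: "f \<in> carrier (\<C> U V n)" and Xs: "length Xs = n" "set Xs \<subseteq> Obj C" and X: "X \<in> Obj C"
  shows "cell U V (coface U V n 0 f) (X # Xs) = D.stack (\<Phi> [X]) (\<Phi> Xs) (cell U V f Xs) (braid U [X])"
proof -
  have "D.crossing (fst U) (\<Phi> (X # Xs)) (fst V) (D.stack (\<Phi> [X]) (\<Phi> Xs) (cell U V f Xs) (braid U [X]))"
    unfolding \<Phi>_Cons[OF X Xs(2)] using X by (intro D.crossing_stack[OF crossing_braid[OF U] crossing_cell[OF f Xs]]) simp
  then show ?thesis unfolding coface_def using Xs X by (intro cellI) simp_all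
qed

lemma cell_coface_middle:
  assumes "k < n" "length Xs = n + 1" "set Xs \<subseteq> Obj C"
  shows "cell U V (coface U V n (Suc k) f) Xs = cell U V f (merge k Xs)"
  using assms by (intro D.arrow_eqI) (simp_all add: coface_def tuples_iff \<Phi>_merge)

lemma cell_coface_last:
  assumes f: "f \<in> carrier (\<C> U V n)" and Xs: "length Xs = n" "set Xs \<subseteq> Obj C" and X: "X \<in> Obj C"
  shows "cell U V (coface U V n (Suc n) f) (Xs @ [X]) = D.stack (\<Phi> Xs) (\<Phi> [X]) (braid V [X]) (cell U V f Xs)"
proof -
  have X1: "set [X] \<subseteq> Obj C" using X by simp
  have "D.crossing (fst U) (\<Phi> (Xs @ [X])) (fst V) (D.stack (\<Phi> Xs) (\<Phi> [X]) (braid V [X]) (cell U V f Xs))"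
    unfolding \<Phi>_append[OF Xs(2) X1] by (rule D.crossing_stack[OF crossing_cell[OF f Xs] crossing_braid[OF V X1]])
  then show ?thesis unfolding coface_def using Xs X by (intro cellI) simp_all
qed

lemma coface_closed:
  assumes f: "f \<in> carrier (\<C> U V n)" and i: "i \<le> n + 1"
  shows "coface U V n i f \<in> carrier (\<C> U V (n + 1))"
proof (rule cochainI)
  have cases: "i = 0 \<or> (\<exists>k<n. i = Suc k) \<or> i = Suc n"
    using i by (cases i) (auto simp: le_less)
  have split: "(\<exists>X Ys. Xs = X # Ys \<and> length Ys = n) \<and> (\<exists>X Ys. Xs = Ys @ [X] \<and> length Ys = n)"
    if "length Xs = n + 1" for Xs :: "'o list"
    using that by (metis Suc_eq_plus1 length_Suc_conv length_Suc_conv_rev)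
  {
    fix Xs assume Xs: "length Xs = n + 1" "set Xs \<subseteq> Obj C"
    from cases consider "i = 0" | k where "i = Suc k" "k < n" | "i = Suc n" by blast
    then show "D.crossing (fst U) (\<Phi> Xs) (fst V) (cell U V (coface U V n i f) Xs)"
    proof cases
      case 1
      obtain X Ys where XY: "Xs = X # Ys" "length Ys = n" using split[OF Xs(1)] by blast
      then have objs: "X \<in> Obj C" "set [X] \<subseteq> Obj C" "set Ys \<subseteq> Obj C" using Xs(2) by auto
      show ?thesis
        unfolding 1 XY(1) cell_coface_first[OF f XY(2) objs(3,1)] \<Phi>_Cons[OF objs(1,3)]
        by (rule D.crossing_stack[OF crossing_braid[OF U objs(2)] crossing_cell[OF f XY(2) objs(3)]])
    next
      case 2
      then show ?thesis using Xs f set_merge[of k Xs] length_merge[of k Xs] crossing_cell[OF f, of "merge k Xs"]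
        by (simp add: cell_coface_middle \<Phi>_merge)
    next
      case 3
      obtain X Ys where XY: "Xs = Ys @ [X]" "length Ys = n" using split[OF Xs(1)] by blast
      then have objs: "X \<in> Obj C" "set [X] \<subseteq> Obj C" "set Ys \<subseteq> Obj C" using Xs(2) by auto
      show ?thesis
        unfolding 3 XY(1) cell_coface_last[OF f XY(2) objs(3,1)] \<Phi>_append[OF objs(3,2)]
        by (rule D.crossing_stack[OF crossing_cell[OF f XY(2) objs(3)] crossing_braid[OF V objs(2)]])
    qed
  next
    fix hs Xs Ys assume h: "arrows hs Xs Ys" "length Xs = n + 1"
    from cases consider "i = 0" | k where "i = Suc k" "k < n" | "i = Suc n" by blast
    then show "(F_arrows hs Xs Ys \<parallel> \<iota> (fst V)) \<bullet> cell U V (coface U V n i f) Xs =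
        cell U V (coface U V n i f) Ys \<bullet> (\<iota> (fst U) \<parallel> F_arrows hs Xs Ys)"
    proof cases
      case 1
      obtain X Xs' where Xs: "Xs = [X] @ Xs'" "length Xs' = n" using split[OF h(2)] by auto
      obtain hs1 hs2 Ys1 Ys2 where s: "hs = hs1 @ hs2" "Ys = Ys1 @ Ys2" "arrows hs1 [X] Ys1" "arrows hs2 Xs' Ys2"
        "length Ys1 = length [X]" "length Ys2 = length Xs'"
        using h(1) unfolding Xs(1) by (rule arrows_split)
      then obtain Y where Y: "Ys1 = [Y]" by (cases Ys1) auto
      have objs: "set [X] \<subseteq> Obj C" "set [Y] \<subseteq> Obj C" "set Xs' \<subseteq> Obj C" "set Ys2 \<subseteq> Obj C"
        using s(3,4) Y by (auto simp: arrows_def)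
      have "(F_arrows (hs1 @ hs2) ([X] @ Xs') ([Y] @ Ys2) \<parallel> \<iota> (fst V)) \<bullet> D.stack (\<Phi> [X]) (\<Phi> Xs') (cell U V f Xs') (braid U [X]) =
          D.stack (\<Phi> [Y]) (\<Phi> Ys2) (cell U V f Ys2) (braid U [Y]) \<bullet> (\<iota> (fst U) \<parallel> F_arrows (hs1 @ hs2) ([X] @ Xs') ([Y] @ Ys2))"
        using objs Xs s Y
        by (intro natural_stack[OF crossing_braid[OF U] crossing_braid[OF U] crossing_cell[OF f] crossing_cell[OF f]]
            braid_natural[OF U] cochain_natural[OF U V f]) simp_all
      then show ?thesis using 1 objs Xs s Y f by (simp add: cell_coface_first)
    next
      case 2
      obtain hs' where hs': "arrows hs' (merge k Xs) (merge k Ys)" "F_arrows hs' (merge k Xs) (merge k Ys) = F_arrows hs Xs Ys"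
        using arrows_merge[OF h(1), of k] h(2) 2 by auto
      have "set Xs \<subseteq> Obj C" "set Ys \<subseteq> Obj C" "length Ys = n + 1" using h by (auto simp: arrows_def)
      then show ?thesis
        using 2 h(2) hs'(2) cochain_natural[OF U V f hs'(1)] length_merge[of k Xs] by (simp add: cell_coface_middle)
    next
      case 3
      obtain X Xs' where Xs: "Xs = Xs' @ [X]" "length Xs' = n" using split[OF h(2)] by auto
      obtain hs1 hs2 Ys1 Ys2 where s: "hs = hs1 @ hs2" "Ys = Ys1 @ Ys2" "arrows hs1 Xs' Ys1" "arrows hs2 [X] Ys2"
        "length Ys1 = length Xs'" "length Ys2 = length [X]"
        using h(1) unfolding Xs(1) by (rule arrows_split)
      then obtain Y where Y: "Ys2 = [Y]" by (cases Ys2) auto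
      have objs: "set [X] \<subseteq> Obj C" "set [Y] \<subseteq> Obj C" "set Xs' \<subseteq> Obj C" "set Ys1 \<subseteq> Obj C"
        using s(3,4) Y by (auto simp: arrows_def)
      have "(F_arrows (hs1 @ hs2) (Xs' @ [X]) (Ys1 @ [Y]) \<parallel> \<iota> (fst V)) \<bullet> D.stack (\<Phi> Xs') (\<Phi> [X]) (braid V [X]) (cell U V f Xs') =
          D.stack (\<Phi> Ys1) (\<Phi> [Y]) (braid V [Y]) (cell U V f Ys1) \<bullet> (\<iota> (fst U) \<parallel> F_arrows (hs1 @ hs2) (Xs' @ [X]) (Ys1 @ [Y]))"
        using objs Xs s Y
        by (intro natural_stack[OF crossing_cell[OF f] crossing_cell[OF f] crossing_braid[OF V] crossing_braid[OF V]]
            braid_natural[OF V] cochain_natural[OF U V f]) simp_all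
      then show ?thesis using 3 objs Xs s Y f by (simp add: cell_coface_last)
    qed
  }
qed simp

end

lemma tuple_Cons:
  assumes "length Zs = n + 1" "set Zs \<subseteq> Obj C"
  obtains X Xs where "Zs = X # Xs" "length Xs = n" "X \<in> Obj C" "set Xs \<subseteq> Obj C"
  using assms by (cases Zs) auto

lemma tuple_snoc:
  assumes "length Zs = n + 1" "set Zs \<subseteq> Obj C"
  obtains X Xs where "Zs = Xs @ [X]" "length Xs = n" "X \<in> Obj C" "set Xs \<subseteq> Obj C"
  using assms by (cases Zs rule: rev_cases) auto

lemma tuple_append:
  assumes "length Zs = n + m" "set Zs \<subseteq> Obj C"
  obtains Xs Ys where "Zs = Xs @ Ys" "length Xs = m" "length Ys = n" "set Xs \<subseteq> Obj C" "set Ys \<subseteq> Obj C"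
proof
  show "Zs = take m Zs @ drop m Zs" by simp
qed (use assms in \<open>auto dest: in_set_takeD in_set_dropD\<close>)

lemma braid_pair:
  assumes "central V" "X \<in> Obj C" "Y \<in> Obj C"
  shows "braid V [X \<boxtimes>\<^bsub>C\<^esub> Y] = D.stack (\<Phi> [X]) (\<Phi> [Y]) (braid V [Y]) (braid V [X])"
    and "\<Phi> [X \<boxtimes>\<^bsub>C\<^esub> Y] = \<Phi> [X] \<boxtimes>\<^bsub>D\<^esub> \<Phi> [Y]"
proof -
  have objs: "set [X] \<subseteq> Obj C" "set [Y] \<subseteq> Obj C" "set [X, Y] \<subseteq> Obj C" using assms by auto
  have "braid V [X \<boxtimes>\<^bsub>C\<^esub> Y] = braid V ([X] @ [Y])"
    using braid_merge[of 0 "[X, Y]" V] objs by (simp add: merge_simps)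
  then show "braid V [X \<boxtimes>\<^bsub>C\<^esub> Y] = D.stack (\<Phi> [X]) (\<Phi> [Y]) (braid V [Y]) (braid V [X])"
    unfolding braid_stack[OF assms(1) objs(1,2)] .
  have "\<Phi> [X \<boxtimes>\<^bsub>C\<^esub> Y] = \<Phi> ([X] @ [Y])"
    using \<Phi>_merge[of 0 "[X, Y]"] objs by (simp only: merge_simps append_Cons append_Nil) simp
  then show "\<Phi> [X \<boxtimes>\<^bsub>C\<^esub> Y] = \<Phi> [X] \<boxtimes>\<^bsub>D\<^esub> \<Phi> [Y]"
    unfolding \<Phi>_append[OF objs(1,2)] .
qed

context
  fixes U V
  assumes U: "central U" and V: "central V"
begin

lemma coface_cases:
  assumes "i \<le> n + 1"
  obtains "i = 0" | k where "i = Suc k" "k < n" | "i = Suc n"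
  using assms by (cases i) (auto simp: le_less)

lemma coface_add:
  assumes f: "f \<in> carrier (\<C> U V n)" and g: "g \<in> carrier (\<C> U V n)" and i: "i \<le> n + 1"
  shows "coface U V n i (f \<oplus>\<^bsub>\<C> U V n\<^esub> g) = coface U V n i f \<oplus>\<^bsub>\<C> U V (n + 1)\<^esub> coface U V n i g"
proof (rule cochain_eqI[OF U V, where n = "n + 1"])
  fix Zs assume Zs: "length Zs = n + 1" "set Zs \<subseteq> Obj C"
  note fg = cochains_add_closed[OF U V f g]
  show "cell U V (coface U V n i (f \<oplus>\<^bsub>\<C> U V n\<^esub> g)) Zs =
      cell U V (coface U V n i f \<oplus>\<^bsub>\<C> U V (n + 1)\<^esub> coface U V n i g) Zs"
    using i
  proof (cases rule: coface_cases)
    case 1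
    obtain X Xs where X: "Zs = X # Xs" "length Xs = n" "X \<in> Obj C" "set Xs \<subseteq> Obj C" using Zs by (rule tuple_Cons)
    have X1: "set [X] \<subseteq> Obj C" using X by simp
    show ?thesis
      unfolding 1 cell_add[OF U V Zs] unfolding X(1) cell_coface_first[OF U V fg X(2,4,3)] cell_coface_first[OF U V f X(2,4,3)]
        cell_coface_first[OF U V g X(2,4,3)] cell_add[OF U V X(2,4)]
      by (rule D.stack_plus(1)[OF crossing_braid[OF U X1] crossing_braid[OF U X1] crossing_cell[OF U V f X(2,4)] crossing_cell[OF U V g X(2,4)]])
  next
    case (2 k)
    then show ?thesis using Zs length_merge[of k Zs] set_merge[of k Zs]
      by (simp add: cell_coface_middle[OF U V] cell_add[OF U V] del: add_Suc_right) 
  next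
    case 3
    obtain X Xs where X: "Zs = Xs @ [X]" "length Xs = n" "X \<in> Obj C" "set Xs \<subseteq> Obj C" using Zs by (rule tuple_snoc)
    have X1: "set [X] \<subseteq> Obj C" using X by simp
    show ?thesis
      unfolding 3 cell_add[OF U V Zs] unfolding X(1) cell_coface_last[OF U V fg X(2,4,3)] cell_coface_last[OF U V f X(2,4,3)]
        cell_coface_last[OF U V g X(2,4,3)] cell_add[OF U V X(2,4)]
      by (rule D.stack_plus(2)[OF crossing_cell[OF U V f X(2,4)] crossing_cell[OF U V g X(2,4)] crossing_braid[OF V X1] crossing_braid[OF V X1]])
  qed
qed (simp_all only: coface_ext[OF U V] cochains_ext[OF U V])

lemma coface_smult:
  assumes a: "a \<in> carrier K" and f: "f \<in> carrier (\<C> U V n)" and i: "i \<le> n + 1"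
  shows "coface U V n i (a \<odot>\<^bsub>\<C> U V n\<^esub> f) = a \<odot>\<^bsub>\<C> U V (n + 1)\<^esub> coface U V n i f"
proof (rule cochain_eqI[OF U V, where n = "n + 1"])
  fix Zs assume Zs: "length Zs = n + 1" "set Zs \<subseteq> Obj C"
  note af = cochains_smult_closed[OF U V a f]
  show "cell U V (coface U V n i (a \<odot>\<^bsub>\<C> U V n\<^esub> f)) Zs = cell U V (a \<odot>\<^bsub>\<C> U V (n + 1)\<^esub> coface U V n i f) Zs"
    using i
  proof (cases rule: coface_cases)
    case 1
    obtain X Xs where X: "Zs = X # Xs" "length Xs = n" "X \<in> Obj C" "set Xs \<subseteq> Obj C" using Zs by (rule tuple_Cons)
    have X1: "set [X] \<subseteq> Obj C" using X by simp
    show ?thesis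
      unfolding 1 cell_smult[OF U V Zs] unfolding X(1) cell_coface_first[OF U V af X(2,4,3)] cell_coface_first[OF U V f X(2,4,3)] cell_smult[OF U V X(2,4)]
      by (rule D.stack_scale(1)[OF crossing_braid[OF U X1] crossing_cell[OF U V f X(2,4)] a])
  next
    case (2 k)
    then show ?thesis using Zs length_merge[of k Zs] set_merge[of k Zs]
      by (simp add: cell_coface_middle[OF U V] cell_smult[OF U V] del: add_Suc_right) 
  next
    case 3
    obtain X Xs where X: "Zs = Xs @ [X]" "length Xs = n" "X \<in> Obj C" "set Xs \<subseteq> Obj C" using Zs by (rule tuple_snoc)
    have X1: "set [X] \<subseteq> Obj C" using X by simp
    show ?thesis
      unfolding 3 cell_smult[OF U V Zs] unfolding X(1) cell_coface_last[OF U V af X(2,4,3)] cell_coface_last[OF U V f X(2,4,3)] cell_smult[OF U V X(2,4)]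
      by (rule D.stack_scale(2)[OF crossing_cell[OF U V f X(2,4)] crossing_braid[OF V X1] a])
  qed
qed (simp_all only: coface_ext[OF U V] cochains_ext[OF U V])

text \<open>Relations between outer cofaces are instances of \<open>stack_assoc\<close>, with multiplicativity of the half-braiding in the
  cases \<open>(0, 1)\<close> and \<open>(n + 1, n + 2)\<close>. An inner and an outer coface concern different entries, and two
  inner cofaces commute by \<open>merge_merge\<close>.\<close>

lemma coface_coface:
  assumes f: "f \<in> carrier (\<C> U V n)" and ij: "i < j" "j \<le> n + 2"
  shows "coface U V (n + 1) j (coface U V n i f) = coface U V (n + 1) i (coface U V n (j - 1) f)"
proof (rule cochain_eqI[OF U V, where n = "n + 1 + 1"])
  fix Zs assume Zs: "length Zs = n + 1 + 1" "set Zs \<subseteq> Obj C"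
  have closed: "coface U V n l f \<in> carrier (\<C> U V (n + 1))" if "l \<le> n + 1" for l
    by (rule coface_closed[OF U V f that])
  have c0: "coface U V n 0 f \<in> carrier (\<C> U V (n + 1))" and cn: "coface U V n (Suc n) f \<in> carrier (\<C> U V (n + 1))"
    by (rule closed, simp)+
  obtain X Xs where X: "Zs = X # Xs" "length Xs = n + 1" "X \<in> Obj C" "set Xs \<subseteq> Obj C" using Zs by (rule tuple_Cons)
  obtain Y Ys where Y: "Zs = Ys @ [Y]" "length Ys = n + 1" "Y \<in> Obj C" "set Ys \<subseteq> Obj C" using Zs by (rule tuple_snoc)
  have X1: "set [X] \<subseteq> Obj C" and Y1: "set [Y] \<subseteq> Obj C" using X Y by auto
  consider (first) "i = 0" "j = 1" | (first_middle) l where "i = 0" "j = Suc (Suc l)" "l < n"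
    | (outer) "i = 0" "j = Suc (n + 1)" | (middle) a b where "i = Suc a" "j = Suc (Suc b)" "a \<le> b" "b < n"
    | (middle_last) a where "i = Suc a" "a < n" "j = Suc (n + 1)" | (last) "i = Suc n" "j = Suc (n + 1)"
  proof (cases "j = Suc (n + 1)")
    case True
    then show thesis using that ij by (cases i) (auto simp: less_Suc_eq)
  next
    case False
    then have "j \<le> n + 1" using ij by simp
    then obtain j' where j: "j = Suc j'" "j' \<le> n" using ij by (cases j) auto
    show thesis
    proof (cases j')
      case 0
      then show ?thesis using that ij j by auto
    next
      case (Suc b)
      then show ?thesis using that ij j by (cases i) auto
    qed
  qed
  then show "cell U V (coface U V (n + 1) j (coface U V n i f)) Zs = cell U V (coface U V (n + 1) i (coface U V n (j - 1) f)) Zs"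
  proof cases
    case first
    obtain X' Xs' where X': "Xs = X' # Xs'" "length Xs' = n" "X' \<in> Obj C" "set Xs' \<subseteq> Obj C" using X(2,4) by (rule tuple_Cons)
    have X'1: "set [X'] \<subseteq> Obj C" and XX': "X \<boxtimes>\<^bsub>C\<^esub> X' \<in> Obj C" using X' X C_tens_obj by auto
    have "cell U V (coface U V (n + 1) (Suc 0) (coface U V n 0 f)) Zs = cell U V (coface U V n 0 f) ((X \<boxtimes>\<^bsub>C\<^esub> X') # Xs')"
      using cell_coface_middle[OF U V, of 0 "n + 1" Zs] Zs X X' by (simp add: merge_simps)
    also have "\<dots> = D.stack (\<Phi> [X] \<boxtimes>\<^bsub>D\<^esub> \<Phi> [X']) (\<Phi> Xs') (cell U V f Xs') (D.stack (\<Phi> [X]) (\<Phi> [X']) (braid U [X']) (braid U [X]))"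
      unfolding cell_coface_first[OF U V f X'(2,4) XX'] braid_pair[OF U X(3) X'(3)] ..
    also have "\<dots> = D.stack (\<Phi> [X]) (\<Phi> [X'] \<boxtimes>\<^bsub>D\<^esub> \<Phi> Xs') (D.stack (\<Phi> [X']) (\<Phi> Xs') (cell U V f Xs') (braid U [X'])) (braid U [X])"
      by (rule D.stack_assoc[OF crossing_braid[OF U X1] crossing_braid[OF U X'1] crossing_cell[OF U V f X'(2,4)]])
    also have "\<dots> = cell U V (coface U V (n + 1) 0 (coface U V n 0 f)) Zs"
      unfolding X(1) cell_coface_first[OF U V c0 X(2,4,3)]
      unfolding X'(1) cell_coface_first[OF U V f X'(2,4,3)] \<Phi>_Cons[OF X'(3,4)] ..
    finally show ?thesis using first by simp
  next
    case first_middle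
    have mrg: "length (merge l Xs) = n" "set (merge l Xs) \<subseteq> Obj C" "\<Phi> (merge l Xs) = \<Phi> Xs"
      using X first_middle length_merge[of l Xs] set_merge[of l Xs] \<Phi>_merge[of l Xs] by auto
    have "cell U V (coface U V (n + 1) j (coface U V n i f)) Zs = cell U V (coface U V n 0 f) (X # merge l Xs)"
      using cell_coface_middle[OF U V, of "Suc l" "n + 1" Zs] Zs X first_middle by (simp add: merge_simps)
    also have "\<dots> = D.stack (\<Phi> [X]) (\<Phi> Xs) (cell U V f (merge l Xs)) (braid U [X])"
      unfolding cell_coface_first[OF U V f mrg(1,2) X(3)] mrg(3) ..
    also have "\<dots> = D.stack (\<Phi> [X]) (\<Phi> Xs) (cell U V (coface U V n (Suc l) f) Xs) (braid U [X])"
      unfolding cell_coface_middle[OF U V first_middle(3) X(2,4)] ..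
    also have "\<dots> = cell U V (coface U V (n + 1) 0 (coface U V n (Suc l) f)) Zs"
      unfolding X(1) using first_middle by (intro cell_coface_first[OF U V closed X(2,4,3), symmetric]) simp
    finally show ?thesis using first_middle by simp
  next
    case outer
    obtain Y' Xs' where X': "Xs = Xs' @ [Y']" "length Xs' = n" "Y' \<in> Obj C" "set Xs' \<subseteq> Obj C" using X(2,4) by (rule tuple_snoc)
    have Zs': "Zs = (X # Xs') @ [Y']" and XXs': "length (X # Xs') = n + 1" "set (X # Xs') \<subseteq> Obj C" and Y'1: "set [Y'] \<subseteq> Obj C"
      using X X' by auto
    have "cell U V (coface U V (n + 1) (Suc (n + 1)) (coface U V n 0 f)) Zs =
        D.stack (\<Phi> [X] \<boxtimes>\<^bsub>D\<^esub> \<Phi> Xs') (\<Phi> [Y']) (braid V [Y']) (D.stack (\<Phi> [X]) (\<Phi> Xs') (cell U V f Xs') (braid U [X]))"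
      unfolding Zs' cell_coface_last[OF U V c0 XXs' X'(3)] cell_coface_first[OF U V f X'(2,4) X(3)] \<Phi>_Cons[OF X(3) X'(4)] ..
    also have "\<dots> = D.stack (\<Phi> [X]) (\<Phi> Xs' \<boxtimes>\<^bsub>D\<^esub> \<Phi> [Y']) (D.stack (\<Phi> Xs') (\<Phi> [Y']) (braid V [Y']) (cell U V f Xs')) (braid U [X])"
      by (rule D.stack_assoc[OF crossing_braid[OF U X1] crossing_cell[OF U V f X'(2,4)] crossing_braid[OF V Y'1]])
    also have "\<dots> = cell U V (coface U V (n + 1) 0 (coface U V n (Suc n) f)) Zs"
      unfolding X(1) cell_coface_first[OF U V cn X(2,4,3)]
      unfolding X'(1) cell_coface_last[OF U V f X'(2,4,3)] \<Phi>_append[OF X'(4) Y'1] ..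
    finally show ?thesis using outer by simp
  next
    case middle
    then show ?thesis
      using Zs cell_coface_middle[OF U V] length_merge[of "Suc b" Zs] length_merge[of a Zs] set_merge[of "Suc b" Zs] set_merge[of a Zs]
        merge_merge[of a "Suc b" Zs] by simp
  next
    case middle_last
    have mrg: "length (merge a Ys) = n" "set (merge a Ys) \<subseteq> Obj C" "\<Phi> (merge a Ys) = \<Phi> Ys" "merge a Zs = merge a Ys @ [Y]"
      using Y middle_last length_merge[of a Ys] set_merge[of a Ys] \<Phi>_merge[of a Ys] merge_append(1)[of a Ys "[Y]"] by auto
    have ca: "coface U V n (Suc a) f \<in> carrier (\<C> U V (n + 1))" using middle_last by (intro closed) simp
    have "cell U V (coface U V (n + 1) (Suc (n + 1)) (coface U V n (Suc a) f)) Zs =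
        D.stack (\<Phi> Ys) (\<Phi> [Y]) (braid V [Y]) (cell U V f (merge a Ys))"
      unfolding Y(1) cell_coface_last[OF U V ca Y(2,4,3)] cell_coface_middle[OF U V middle_last(2) Y(2,4)] ..
    also have "\<dots> = cell U V (coface U V n (Suc n) f) (merge a Zs)"
      unfolding mrg(4) cell_coface_last[OF U V f mrg(1,2) Y(3)] mrg(3) ..
    also have "\<dots> = cell U V (coface U V (n + 1) (Suc a) (coface U V n (Suc n) f)) Zs"
      using middle_last by (intro cell_coface_middle[OF U V _ Zs, symmetric]) simp
    finally show ?thesis using middle_last by simp
  next
    case last
    obtain Y' Xs' where Y': "Ys = Xs' @ [Y']" "length Xs' = n" "Y' \<in> Obj C" "set Xs' \<subseteq> Obj C" using Y(2,4) by (rule tuple_snoc)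
    have Y'1: "set [Y'] \<subseteq> Obj C" and YY: "Y' \<boxtimes>\<^bsub>C\<^esub> Y \<in> Obj C" using Y' Y C_tens_obj by auto
    have mrg: "merge n Zs = Xs' @ [Y' \<boxtimes>\<^bsub>C\<^esub> Y]"
      using merge_append(2)[of Xs' 0 "[Y', Y]"] Y Y' by (simp add: merge_simps)
    have "cell U V (coface U V (n + 1) (Suc n) (coface U V n (Suc n) f)) Zs = cell U V (coface U V n (Suc n) f) (Xs' @ [Y' \<boxtimes>\<^bsub>C\<^esub> Y])"
      unfolding mrg[symmetric] by (rule cell_coface_middle[OF U V _ Zs]) simp
    also have "\<dots> = D.stack (\<Phi> Xs') (\<Phi> [Y'] \<boxtimes>\<^bsub>D\<^esub> \<Phi> [Y]) (D.stack (\<Phi> [Y']) (\<Phi> [Y]) (braid V [Y]) (braid V [Y'])) (cell U V f Xs')"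
      unfolding cell_coface_last[OF U V f Y'(2,4) YY] braid_pair[OF V Y'(3) Y(3)] ..
    also have "\<dots> = D.stack (\<Phi> Xs' \<boxtimes>\<^bsub>D\<^esub> \<Phi> [Y']) (\<Phi> [Y]) (braid V [Y]) (D.stack (\<Phi> Xs') (\<Phi> [Y']) (braid V [Y']) (cell U V f Xs'))"
      by (rule D.stack_assoc[OF crossing_cell[OF U V f Y'(2,4)] crossing_braid[OF V Y'1] crossing_braid[OF V Y1], symmetric])
    also have "\<dots> = cell U V (coface U V (n + 1) (Suc (n + 1)) (coface U V n (Suc n) f)) Zs"
      unfolding Y(1) cell_coface_last[OF U V cn Y(2,4,3)]
      unfolding Y'(1) cell_coface_last[OF U V f Y'(2,4,3)] \<Phi>_append[OF Y'(4) Y'1] ..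
    finally show ?thesis using last by simp
  qed
qed (simp_all only: coface_ext[OF U V])

lemma cochains_semi_cosimplicial: "semi_cosimplicial K (\<C> U V) (coface U V)"
  by (intro semi_cosimplicial.intro module_family.intro semi_cosimplicial_axioms.intro cochains_module[OF U V]
      coface_closed[OF U V] coface_add coface_smult coface_coface)

end

lemma cell_unit_crossing:
  assumes f: "f \<in> carrier (\<C> \<I> \<I> n)" and Ys: "length Ys = n" "set Ys \<subseteq> Obj C"
  shows "D.crossing (Unit D) (\<Phi> Ys) (Unit D) (cell \<I> \<I> f Ys)" "src (cell \<I> \<I> f Ys) = \<Phi> Ys" "tgt (cell \<I> \<I> f Ys) = \<Phi> Ys"
  using crossing_cell[OF unit_central unit_central f Ys] Ys(2) by (simp_all add: D.unit_obj_left D.unit_obj_right)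

lemma crossing_twist:
  assumes V: "central V" and f: "f \<in> carrier (\<C> \<I> \<I> n)" and Ys: "length Ys = n" "set Ys \<subseteq> Obj C"
  shows "D.crossing (fst V) (\<Phi> Ys) (fst V) (twist V f Ys)"
  using D.crossingD(4)[OF cell_unit_crossing(1)[OF f Ys]] cell_unit_crossing(2,3)[OF f Ys] V Ys(2)
  by (simp add: D.crossing_def twist_def D.unit_obj_left D.unit_obj_right)

lemma twist_natural:
  assumes V: "central V" and f: "f \<in> carrier (\<C> \<I> \<I> n)" and h: "arrows hs Xs Ys" "length Xs = n"
  shows "(F_arrows hs Xs Ys \<parallel> \<iota> (fst V)) \<bullet> twist V f Xs = twist V f Ys \<bullet> (\<iota> (fst V) \<parallel> F_arrows hs Xs Ys)"
proof -
  have objs: "length Ys = n" "set Xs \<subseteq> Obj C" "set Ys \<subseteq> Obj C" using h by (auto simp: arrows_def)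
  have src [simp]: "src (cell \<I> \<I> f Xs) = \<Phi> Xs" "tgt (cell \<I> \<I> f Xs) = \<Phi> Xs"
    "src (cell \<I> \<I> f Ys) = \<Phi> Ys" "tgt (cell \<I> \<I> f Ys) = \<Phi> Ys"
    using cell_unit_crossing(2,3)[OF f] objs h by auto
  have [simp]: "D.typed (cell \<I> \<I> f Xs)" "D.typed (cell \<I> \<I> f Ys)"
    using D.crossingD(4)[OF cell_unit_crossing(1)[OF f]] objs h by auto
  note [simp] = V objs F_arrows_typed[OF h(1)]
  have nat: "F_arrows hs Xs Ys \<bullet> cell \<I> \<I> f Xs = cell \<I> \<I> f Ys \<bullet> F_arrows hs Xs Ys"
    using cochain_natural[OF unit_central unit_central f h] by (simp add: D.diagram)
  have "(F_arrows hs Xs Ys \<parallel> \<iota> (fst V)) \<bullet> twist V f Xs = ((F_arrows hs Xs Ys \<bullet> cell \<I> \<I> f Xs) \<parallel> \<iota> (fst V)) \<bullet> braid V Xs"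
    unfolding twist_def by (simp add: D.diagram del: cell_sel)
  also have "\<dots> = (cell \<I> \<I> f Ys \<parallel> \<iota> (fst V)) \<bullet> ((F_arrows hs Xs Ys \<parallel> \<iota> (fst V)) \<bullet> braid V Xs)"
    unfolding nat by (simp add: D.diagram del: cell_sel)
  also have "\<dots> = twist V f Ys \<bullet> (\<iota> (fst V) \<parallel> F_arrows hs Xs Ys)"
    unfolding braid_natural[OF V h(1)] twist_def by (simp add: D.diagram del: cell_sel)
  finally show ?thesis .
qed

lemma twist_unit_object:
  assumes f: "f \<in> carrier (\<C> \<I> \<I> n)" and Ys: "length Ys = n" "set Ys \<subseteq> Obj C"
  shows "twist \<I> f Ys = cell \<I> \<I> f Ys"
  using D.crossingD(4)[OF cell_unit_crossing(1)[OF f Ys]] cell_unit_crossing(2,3)[OF f Ys] Ys(2)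
  by (simp add: twist_def braid_unit D.diagram del: cell_sel)

lemma twist_of_stack:
  assumes V: "central V" and f: "f \<in> carrier (\<C> \<I> \<I> n)" and f': "f' \<in> carrier (\<C> \<I> \<I> m)"
    and Xs: "length Xs = n" "set Xs \<subseteq> Obj C" and Ys: "length Ys = m" "set Ys \<subseteq> Obj C"
    and c: "cell \<I> \<I> h (Xs @ Ys) = D.stack (\<Phi> Xs) (\<Phi> Ys) (cell \<I> \<I> f' Ys) (cell \<I> \<I> f Xs)"
  shows "twist V h (Xs @ Ys) = D.stack (\<Phi> Xs) (\<Phi> Ys) (twist V f' Ys) (twist V f Xs)"
  unfolding twist_def c braid_stack[OF V Xs(2) Ys(2)]
  by (rule D.twist_stack[OF crossing_braid[OF V Xs(2)] crossing_braid[OF V Ys(2)]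
        cell_unit_crossing(1)[OF f Xs] cell_unit_crossing(1)[OF f' Ys]])

text \<open>For trivial coefficients the first coface of \<open>f\<close> is \<open>id \<otimes> f\<close>; the twist adds the crossing of \<open>V\<close> with the new strand.\<close>

lemma twist_coface_first:
  assumes V: "central V" and f: "f \<in> carrier (\<C> \<I> \<I> n)" and Xs: "length Xs = n" "set Xs \<subseteq> Obj C" and X: "X \<in> Obj C"
  shows "twist V (coface \<I> \<I> n 0 f) (X # Xs) = D.stack (\<Phi> [X]) (\<Phi> Xs) (twist V f Xs) (braid V [X])"
proof -
  have X1: "set [X] \<subseteq> Obj C" using X by simp
  have id: "D.crossing (Unit D) (\<Phi> [X]) (Unit D) (\<iota> (\<Phi> [X]))"
    using crossing_braid[OF unit_central X1] unfolding braid_unit[OF X1] by simp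
  have "twist V (coface \<I> \<I> n 0 f) (X # Xs) =
      (D.stack (\<Phi> [X]) (\<Phi> Xs) (cell \<I> \<I> f Xs) (\<iota> (\<Phi> [X])) \<parallel> \<iota> (fst V)) \<bullet> D.stack (\<Phi> [X]) (\<Phi> Xs) (braid V Xs) (braid V [X])"
    unfolding twist_def cell_coface_first[OF unit_central unit_central f Xs X] braid_unit[OF X1]
    using braid_stack[OF V X1 Xs(2)] by simp
  also have "\<dots> = D.stack (\<Phi> [X]) (\<Phi> Xs) (twist V f Xs) ((\<iota> (\<Phi> [X]) \<parallel> \<iota> (fst V)) \<bullet> braid V [X])"
    unfolding twist_def
    by (rule D.twist_stack[OF crossing_braid[OF V X1] crossing_braid[OF V Xs(2)] id cell_unit_crossing(1)[OF f Xs]])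
  also have "(\<iota> (\<Phi> [X]) \<parallel> \<iota> (fst V)) \<bullet> braid V [X] = braid V [X]"
    using V X1 by (simp add: D.diagram del: \<Phi>_simps)
  finally show ?thesis .
qed

lemma twist_coface_last:
  assumes V: "central V" and f: "f \<in> carrier (\<C> \<I> \<I> n)" and Xs: "length Xs = n" "set Xs \<subseteq> Obj C" and X: "X \<in> Obj C"
  shows "twist V (coface \<I> \<I> n (Suc n) f) (Xs @ [X]) = D.stack (\<Phi> Xs) (\<Phi> [X]) (braid V [X]) (twist V f Xs)"
proof -
  have X1: "set [X] \<subseteq> Obj C" using X by simp
  have id: "D.crossing (Unit D) (\<Phi> [X]) (Unit D) (\<iota> (\<Phi> [X]))"
    using crossing_braid[OF unit_central X1] unfolding braid_unit[OF X1] by simp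
  have "twist V (coface \<I> \<I> n (Suc n) f) (Xs @ [X]) =
      (D.stack (\<Phi> Xs) (\<Phi> [X]) (\<iota> (\<Phi> [X])) (cell \<I> \<I> f Xs) \<parallel> \<iota> (fst V)) \<bullet> D.stack (\<Phi> Xs) (\<Phi> [X]) (braid V [X]) (braid V Xs)"
    unfolding twist_def cell_coface_last[OF unit_central unit_central f Xs X] braid_unit[OF X1] braid_stack[OF V Xs(2) X1] ..
  also have "\<dots> = D.stack (\<Phi> Xs) (\<Phi> [X]) ((\<iota> (\<Phi> [X]) \<parallel> \<iota> (fst V)) \<bullet> braid V [X]) (twist V f Xs)"
    unfolding twist_def
    by (rule D.twist_stack[OF crossing_braid[OF V Xs(2)] crossing_braid[OF V X1] cell_unit_crossing(1)[OF f Xs] id])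
  also have "(\<iota> (\<Phi> [X]) \<parallel> \<iota> (fst V)) \<bullet> braid V [X] = braid V [X]"
    using V X1 by (simp add: D.diagram del: \<Phi>_simps)
  finally show ?thesis .
qed

lemma twist_coface_middle:
  assumes "k < n" "length Xs = n + 1" "set Xs \<subseteq> Obj C"
  shows "twist V (coface \<I> \<I> n (Suc k) f) Xs = twist V f (merge k Xs)"
  using assms cell_coface_middle[OF unit_central unit_central assms] braid_merge[of k Xs V] by (simp add: twist_def)

lemma twist_add:
  assumes V: "central V" and f: "f \<in> carrier (\<C> \<I> \<I> n)" and g: "g \<in> carrier (\<C> \<I> \<I> n)"
    and Ys: "length Ys = n" "set Ys \<subseteq> Obj C"
  shows "twist V (f \<oplus>\<^bsub>\<C> \<I> \<I> n\<^esub> g) Ys = twist V f Ys \<boxplus> twist V g Ys"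
  using D.crossingD(4)[OF cell_unit_crossing(1)[OF f Ys]] D.crossingD(4)[OF cell_unit_crossing(1)[OF g Ys]]
    cell_unit_crossing(2,3)[OF f Ys] cell_unit_crossing(2,3)[OF g Ys] V Ys
  by (simp add: twist_def cell_add[OF unit_central unit_central Ys] D.linear del: cell_sel)

lemma twist_smult:
  assumes V: "central V" and f: "f \<in> carrier (\<C> \<I> \<I> n)" and a: "a \<in> carrier K"
    and Ys: "length Ys = n" "set Ys \<subseteq> Obj C"
  shows "twist V (a \<odot>\<^bsub>\<C> \<I> \<I> n\<^esub> f) Ys = a \<boxdot> twist V f Ys"
  using D.crossingD(4)[OF cell_unit_crossing(1)[OF f Ys]] cell_unit_crossing(2,3)[OF f Ys] V Ys a
  by (simp add: twist_def cell_smult[OF unit_central unit_central Ys] D.linear del: cell_sel)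

definition cochain_unit where "cochain_unit = (\<lambda>Xs\<in>tuples C 0. Id D (Unit D))"

lemma tuples_0: "tuples C 0 = {[]}"
  by (auto simp: tuples_def)

lemma cell_cochain_unit: "cell \<I> \<I> cochain_unit [] = \<iota> (Unit D)"
  by (intro D.arrow_eqI) (simp_all add: cochain_unit_def tuples_0 D.unit_obj D.unit_obj_left)

lemma cochain_unit_closed: "cochain_unit \<in> carrier (\<C> \<I> \<I> 0)"
proof (rule cochainI[OF unit_central unit_central])
  show "cochain_unit \<in> extensional (tuples C 0)" by (simp add: cochain_unit_def)
  fix hs Xs Ys assume "arrows hs Xs Ys" "length Xs = 0"
  then have "hs = []" "Xs = []" "Ys = []" by (auto simp: arrows_Nil)
  then show "(F_arrows hs Xs Ys \<parallel> \<iota> (fst \<I>)) \<bullet> cell \<I> \<I> cochain_unit Xs =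
      cell \<I> \<I> cochain_unit Ys \<bullet> (\<iota> (fst \<I>) \<parallel> F_arrows hs Xs Ys)"
    by (simp add: F_arrows_Nil cell_cochain_unit D.diagram)
next
  fix Xs :: "'o list" assume "length Xs = 0"
  then show "D.crossing (fst \<I>) (\<Phi> Xs) (fst \<I>) (cell \<I> \<I> cochain_unit Xs)"
    by (simp add: cell_cochain_unit D.crossing_def D.diagram)
qed

context
  fixes U V
  assumes U: "central U" and V: "central V"
begin

lemma cell_cup:
  assumes f: "f \<in> carrier (\<C> \<I> \<I> n)" and g: "g \<in> carrier (\<C> U V m)"
    and Xs: "length Xs = m" "set Xs \<subseteq> Obj C" and Ys: "length Ys = n" "set Ys \<subseteq> Obj C"
  shows "cell U V (cup U V n m f g) (Xs @ Ys) = D.stack (\<Phi> Xs) (\<Phi> Ys) (twist V f Ys) (cell U V g Xs)"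
proof -
  have "D.crossing (fst U) (\<Phi> (Xs @ Ys)) (fst V) (D.stack (\<Phi> Xs) (\<Phi> Ys) (twist V f Ys) (cell U V g Xs))"
    unfolding \<Phi>_append[OF Xs(2) Ys(2)]
    by (rule D.crossing_stack[OF crossing_cell[OF U V g Xs] crossing_twist[OF V f Ys]])
  then show ?thesis unfolding cup_def using Xs Ys by (intro cellI) simp_all
qed

lemma cup_closed:
  assumes f: "f \<in> carrier (\<C> \<I> \<I> n)" and g: "g \<in> carrier (\<C> U V m)"
  shows "cup U V n m f g \<in> carrier (\<C> U V (n + m))"
proof (rule cochainI[OF U V cup_ext[OF U V]])
  fix Zs assume "length Zs = n + m" "set Zs \<subseteq> Obj C"
  then obtain Xs Ys where Z: "Zs = Xs @ Ys" "length Xs = m" "length Ys = n" "set Xs \<subseteq> Obj C" "set Ys \<subseteq> Obj C"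
    by (rule tuple_append)
  show "D.crossing (fst U) (\<Phi> Zs) (fst V) (cell U V (cup U V n m f g) Zs)"
    unfolding Z(1) cell_cup[OF f g Z(2,4,3,5)] \<Phi>_append[OF Z(4,5)]
    by (rule D.crossing_stack[OF crossing_cell[OF U V g Z(2,4)] crossing_twist[OF V f Z(3,5)]])
next
  fix hs Zs Zs' assume h: "arrows hs Zs Zs'" "length Zs = n + m"
  then have "set Zs \<subseteq> Obj C" by (simp add: arrows_def)
  with h(2) obtain Xs Ys where Z: "Zs = Xs @ Ys" "length Xs = m" "length Ys = n" "set Xs \<subseteq> Obj C" "set Ys \<subseteq> Obj C"
    by (rule tuple_append)
  obtain hs1 hs2 Xs' Ys' where s: "hs = hs1 @ hs2" "Zs' = Xs' @ Ys'" "arrows hs1 Xs Xs'" "arrows hs2 Ys Ys'"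
    "length Xs' = length Xs" "length Ys' = length Ys"
    using h(1) unfolding Z(1) by (rule arrows_split)
  have objs: "length Xs' = m" "set Xs' \<subseteq> Obj C" "length Ys' = n" "set Ys' \<subseteq> Obj C"
    using s Z by (auto simp: arrows_def)
  show "(F_arrows hs Zs Zs' \<parallel> \<iota> (fst V)) \<bullet> cell U V (cup U V n m f g) Zs =
      cell U V (cup U V n m f g) Zs' \<bullet> (\<iota> (fst U) \<parallel> F_arrows hs Zs Zs')"
    unfolding Z(1) s(1,2) cell_cup[OF f g Z(2,4,3,5)] cell_cup[OF f g objs]
    by (rule natural_stack[OF crossing_cell[OF U V g Z(2,4)] crossing_cell[OF U V g objs(1,2)]
          crossing_twist[OF V f Z(3,5)] crossing_twist[OF V f objs(3,4)] s(3,4)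
          cochain_natural[OF U V g s(3) Z(2)] twist_natural[OF V f s(4) Z(3)]])
qed

lemma cup_eqI:
  assumes "h \<in> extensional (tuples C (n + m))" "h' \<in> extensional (tuples C (n + m))"
    and "\<And>Xs Ys. \<lbrakk>length Xs = m; set Xs \<subseteq> Obj C; length Ys = n; set Ys \<subseteq> Obj C\<rbrakk> \<Longrightarrow>
      cell U V h (Xs @ Ys) = cell U V h' (Xs @ Ys)"
  shows "h = h'"
  using assms(1,2)
proof (rule cochain_eqI[OF U V])
  fix Zs assume "length Zs = n + m" "set Zs \<subseteq> Obj C"
  then show "cell U V h Zs = cell U V h' Zs"
    by (rule tuple_append) (use assms(3) in blast)
qed

lemma cup_bilinear: "bilinear_family K (\<C> \<I> \<I>) (\<C> U V) (cup U V)"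
proof (intro bilinear_family.intro module_family.intro bilinear_family_axioms.intro cochains_module[OF U V]
    cochains_module[OF unit_central unit_central] cup_closed)
  fix f n f' g m assume f: "f \<in> carrier (\<C> \<I> \<I> n)" and f': "f' \<in> carrier (\<C> \<I> \<I> n)" and g: "g \<in> carrier (\<C> U V m)"
  note ff' = cochains_add_closed[OF unit_central unit_central f f']
  show "cup U V n m (f \<oplus>\<^bsub>\<C> \<I> \<I> n\<^esub> f') g = cup U V n m f g \<oplus>\<^bsub>\<C> U V (n + m)\<^esub> cup U V n m f' g"
  proof (rule cup_eqI[OF cup_ext[OF U V] cochains_ext(1)[OF U V]])
    fix Xs Ys assume Xs: "length Xs = m" "set Xs \<subseteq> Obj C" and Ys: "length Ys = n" "set Ys \<subseteq> Obj C"
    then have XYs: "length (Xs @ Ys) = n + m" "set (Xs @ Ys) \<subseteq> Obj C" by auto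
    show "cell U V (cup U V n m (f \<oplus>\<^bsub>\<C> \<I> \<I> n\<^esub> f') g) (Xs @ Ys) =
        cell U V (cup U V n m f g \<oplus>\<^bsub>\<C> U V (n + m)\<^esub> cup U V n m f' g) (Xs @ Ys)"
      unfolding cell_add[OF U V XYs] cell_cup[OF ff' g Xs Ys] cell_cup[OF f g Xs Ys] cell_cup[OF f' g Xs Ys]
        twist_add[OF V f f' Ys]
      by (rule D.stack_plus(1)[OF crossing_cell[OF U V g Xs] crossing_cell[OF U V g Xs]
            crossing_twist[OF V f Ys] crossing_twist[OF V f' Ys]])
  qed
next
  fix f n g m g' assume f: "f \<in> carrier (\<C> \<I> \<I> n)" and g: "g \<in> carrier (\<C> U V m)" and g': "g' \<in> carrier (\<C> U V m)"
  note gg' = cochains_add_closed[OF U V g g']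
  show "cup U V n m f (g \<oplus>\<^bsub>\<C> U V m\<^esub> g') = cup U V n m f g \<oplus>\<^bsub>\<C> U V (n + m)\<^esub> cup U V n m f g'"
  proof (rule cup_eqI[OF cup_ext[OF U V] cochains_ext(1)[OF U V]])
    fix Xs Ys assume Xs: "length Xs = m" "set Xs \<subseteq> Obj C" and Ys: "length Ys = n" "set Ys \<subseteq> Obj C"
    then have XYs: "length (Xs @ Ys) = n + m" "set (Xs @ Ys) \<subseteq> Obj C" by auto
    show "cell U V (cup U V n m f (g \<oplus>\<^bsub>\<C> U V m\<^esub> g')) (Xs @ Ys) =
        cell U V (cup U V n m f g \<oplus>\<^bsub>\<C> U V (n + m)\<^esub> cup U V n m f g') (Xs @ Ys)"
      unfolding cell_add[OF U V XYs] cell_cup[OF f gg' Xs Ys] cell_cup[OF f g Xs Ys] cell_cup[OF f g' Xs Ys]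
        cell_add[OF U V Xs]
      by (rule D.stack_plus(2)[OF crossing_cell[OF U V g Xs] crossing_cell[OF U V g' Xs]
            crossing_twist[OF V f Ys] crossing_twist[OF V f Ys]])
  qed
next
  fix a f n g m assume a: "a \<in> carrier K" and f: "f \<in> carrier (\<C> \<I> \<I> n)" and g: "g \<in> carrier (\<C> U V m)"
  note af = cochains_smult_closed[OF unit_central unit_central a f] and ag = cochains_smult_closed[OF U V a g]
  show "cup U V n m (a \<odot>\<^bsub>\<C> \<I> \<I> n\<^esub> f) g = a \<odot>\<^bsub>\<C> U V (n + m)\<^esub> cup U V n m f g"
  proof (rule cup_eqI[OF cup_ext[OF U V] cochains_ext(2)[OF U V]])
    fix Xs Ys assume Xs: "length Xs = m" "set Xs \<subseteq> Obj C" and Ys: "length Ys = n" "set Ys \<subseteq> Obj C"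
    then have XYs: "length (Xs @ Ys) = n + m" "set (Xs @ Ys) \<subseteq> Obj C" by auto
    show "cell U V (cup U V n m (a \<odot>\<^bsub>\<C> \<I> \<I> n\<^esub> f) g) (Xs @ Ys) =
        cell U V (a \<odot>\<^bsub>\<C> U V (n + m)\<^esub> cup U V n m f g) (Xs @ Ys)"
      unfolding cell_smult[OF U V XYs] cell_cup[OF af g Xs Ys] cell_cup[OF f g Xs Ys] twist_smult[OF V f a Ys]
      by (rule D.stack_scale(1)[OF crossing_cell[OF U V g Xs] crossing_twist[OF V f Ys] a])
  qed
  show "cup U V n m f (a \<odot>\<^bsub>\<C> U V m\<^esub> g) = a \<odot>\<^bsub>\<C> U V (n + m)\<^esub> cup U V n m f g"
  proof (rule cup_eqI[OF cup_ext[OF U V] cochains_ext(2)[OF U V]])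
    fix Xs Ys assume Xs: "length Xs = m" "set Xs \<subseteq> Obj C" and Ys: "length Ys = n" "set Ys \<subseteq> Obj C"
    then have XYs: "length (Xs @ Ys) = n + m" "set (Xs @ Ys) \<subseteq> Obj C" by auto
    show "cell U V (cup U V n m f (a \<odot>\<^bsub>\<C> U V m\<^esub> g)) (Xs @ Ys) =
        cell U V (a \<odot>\<^bsub>\<C> U V (n + m)\<^esub> cup U V n m f g) (Xs @ Ys)"
      unfolding cell_smult[OF U V XYs] cell_cup[OF f ag Xs Ys] cell_cup[OF f g Xs Ys] cell_smult[OF U V Xs]
      by (rule D.stack_scale(2)[OF crossing_cell[OF U V g Xs] crossing_twist[OF V f Ys] a])
  qed
qed

lemma cup_coface_low:
  assumes f: "f \<in> carrier (\<C> \<I> \<I> n)" and g: "g \<in> carrier (\<C> U V m)" and i: "i \<le> m"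
  shows "coface U V (n + m) i (cup U V n m f g) = cup U V n (m + 1) f (coface U V m i g)"
proof (rule cup_eqI[where n = n and m = "m + 1"])
  note fg = cup_closed[OF f g]
  have g': "coface U V m i g \<in> carrier (\<C> U V (m + 1))" using i by (intro coface_closed[OF U V g]) simp
  fix Xs Ys assume Xs: "length Xs = m + 1" "set Xs \<subseteq> Obj C" and Ys: "length Ys = n" "set Ys \<subseteq> Obj C"
  show "cell U V (coface U V (n + m) i (cup U V n m f g)) (Xs @ Ys) = cell U V (cup U V n (m + 1) f (coface U V m i g)) (Xs @ Ys)"
  proof (cases i)
    case 0
    obtain X Xs' where X: "Xs = X # Xs'" "length Xs' = m" "X \<in> Obj C" "set Xs' \<subseteq> Obj C" using Xs by (rule tuple_Cons)
    have X1: "set [X] \<subseteq> Obj C" and XYs: "length (Xs' @ Ys) = n + m" "set (Xs' @ Ys) \<subseteq> Obj C" and cons: "Xs @ Ys = X # (Xs' @ Ys)"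
      using X Ys by auto
    have "cell U V (coface U V (n + m) 0 (cup U V n m f g)) (Xs @ Ys) =
        D.stack (\<Phi> [X]) (\<Phi> Xs' \<boxtimes>\<^bsub>D\<^esub> \<Phi> Ys) (D.stack (\<Phi> Xs') (\<Phi> Ys) (twist V f Ys) (cell U V g Xs')) (braid U [X])"
      unfolding cons cell_coface_first[OF U V fg XYs X(3)] cell_cup[OF f g X(2,4) Ys] \<Phi>_append[OF X(4) Ys(2)] ..
    also have "\<dots> = D.stack (\<Phi> [X] \<boxtimes>\<^bsub>D\<^esub> \<Phi> Xs') (\<Phi> Ys) (twist V f Ys) (D.stack (\<Phi> [X]) (\<Phi> Xs') (cell U V g Xs') (braid U [X]))"
      by (rule D.stack_assoc[OF crossing_braid[OF U X1] crossing_cell[OF U V g X(2,4)] crossing_twist[OF V f Ys], symmetric])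
    also have "\<dots> = cell U V (cup U V n (m + 1) f (coface U V m 0 g)) (Xs @ Ys)"
      using cell_cup[OF f g' Xs Ys] unfolding 0 X(1) cell_coface_first[OF U V g X(2,4,3)] \<Phi>_Cons[OF X(3,4)] by simp
    finally show ?thesis using 0 by simp
  next
    case (Suc k)
    then have k: "k < m" "k < n + m" "k + 1 < length Xs" using i Xs by auto
    have XYs: "length (Xs @ Ys) = n + m + 1" "set (Xs @ Ys) \<subseteq> Obj C" using Xs Ys by auto
    have mrg: "length (merge k Xs) = m" "set (merge k Xs) \<subseteq> Obj C"
      using k Xs length_merge[of k Xs] set_merge[of k Xs] by auto
    show ?thesis
      unfolding Suc cell_coface_middle[OF U V k(2) XYs] merge_append(1)[OF k(3)] cell_cup[OF f g mrg Ys]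
      unfolding Suc[symmetric] cell_cup[OF f g' Xs Ys]
      unfolding Suc cell_coface_middle[OF U V k(1) Xs] \<Phi>_merge[OF k(3) Xs(2)] ..
  qed
next
  show "coface U V (n + m) i (cup U V n m f g) \<in> extensional (tuples C (n + (m + 1)))"
    using coface_ext(1)[OF U V, of "n + m"] by (simp add: add.assoc)
qed (rule cup_ext[OF U V])

lemma cup_coface_high:
  assumes f: "f \<in> carrier (\<C> \<I> \<I> n)" and g: "g \<in> carrier (\<C> U V m)" and j: "1 \<le> j" "j \<le> n + 1"
  shows "coface U V (n + m) (m + j) (cup U V n m f g) = cup U V (n + 1) m (coface \<I> \<I> n j f) g"
proof (rule cup_eqI[where n = "n + 1" and m = m])
  note fg = cup_closed[OF f g]
  have f': "coface \<I> \<I> n j f \<in> carrier (\<C> \<I> \<I> (n + 1))" using j by (intro coface_closed[OF unit_central unit_central f])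
  fix Xs Ys assume Xs: "length Xs = m" "set Xs \<subseteq> Obj C" and Ys: "length Ys = n + 1" "set Ys \<subseteq> Obj C"
  show "cell U V (coface U V (n + m) (m + j) (cup U V n m f g)) (Xs @ Ys) = cell U V (cup U V (n + 1) m (coface \<I> \<I> n j f) g) (Xs @ Ys)"
  proof (cases "j = Suc n")
    case True
    obtain Y Ys' where Y: "Ys = Ys' @ [Y]" "length Ys' = n" "Y \<in> Obj C" "set Ys' \<subseteq> Obj C" using Ys by (rule tuple_snoc)
    have Y1: "set [Y] \<subseteq> Obj C" and XYs: "length (Xs @ Ys') = n + m" "set (Xs @ Ys') \<subseteq> Obj C"
      and snoc: "Xs @ Ys = (Xs @ Ys') @ [Y]" and mj: "m + j = Suc (n + m)"
      using Xs Y True by auto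
    have "cell U V (coface U V (n + m) (m + j) (cup U V n m f g)) (Xs @ Ys) =
        D.stack (\<Phi> Xs \<boxtimes>\<^bsub>D\<^esub> \<Phi> Ys') (\<Phi> [Y]) (braid V [Y]) (D.stack (\<Phi> Xs) (\<Phi> Ys') (twist V f Ys') (cell U V g Xs))"
      unfolding mj snoc cell_coface_last[OF U V fg XYs Y(3)] cell_cup[OF f g Xs Y(2,4)] \<Phi>_append[OF Xs(2) Y(4)] ..
    also have "\<dots> = D.stack (\<Phi> Xs) (\<Phi> Ys' \<boxtimes>\<^bsub>D\<^esub> \<Phi> [Y]) (D.stack (\<Phi> Ys') (\<Phi> [Y]) (braid V [Y]) (twist V f Ys')) (cell U V g Xs)"
      by (rule D.stack_assoc[OF crossing_cell[OF U V g Xs] crossing_twist[OF V f Y(2,4)] crossing_braid[OF V Y1]])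
    also have "\<dots> = cell U V (cup U V (n + 1) m (coface \<I> \<I> n j f) g) (Xs @ Ys)"
      unfolding cell_cup[OF f' g Xs Ys] unfolding True Y(1) twist_coface_last[OF V f Y(2,4,3)] \<Phi>_append[OF Y(4) Y1] ..
    finally show ?thesis .
  next
    case False
    then obtain k where k: "j = Suc k" "k < n" using j by (cases j) auto
    then have k': "k + 1 < length Ys" "m + k < n + m" "m + j = Suc (m + k)" using Ys by auto
    have XYs: "length (Xs @ Ys) = n + m + 1" "set (Xs @ Ys) \<subseteq> Obj C" using Xs Ys by auto
    have mrg: "length (merge k Ys) = n" "set (merge k Ys) \<subseteq> Obj C"
      using k' Ys length_merge[of k Ys] set_merge[of k Ys] by auto
    have mrg': "merge (m + k) (Xs @ Ys) = Xs @ merge k Ys" using merge_append(2)[of Xs k Ys] Xs by simp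
    show ?thesis
      unfolding k'(3) cell_coface_middle[OF U V k'(2) XYs] mrg' cell_cup[OF f g Xs mrg] cell_cup[OF f' g Xs Ys]
      unfolding k(1) twist_coface_middle[OF k(2) Ys] \<Phi>_merge[OF k'(1) Ys(2)] ..
  qed
next
  show "coface U V (n + m) (m + j) (cup U V n m f g) \<in> extensional (tuples C (n + 1 + m))"
    using coface_ext(1)[OF U V, of "n + m"] by (simp add: ac_simps)
qed (rule cup_ext[OF U V])

text \<open>On \<open>Xs @ Y # Ys\<close> both sides stack \<open>g\<close>, the half-braiding at \<open>Y\<close> and the twist of \<open>f\<close>; only the brackets differ.\<close>

lemma cup_coface_between:
  assumes f: "f \<in> carrier (\<C> \<I> \<I> n)" and g: "g \<in> carrier (\<C> U V m)"
  shows "cup U V (n + 1) m (coface \<I> \<I> n 0 f) g = cup U V n (m + 1) f (coface U V m (m + 1) g)"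
proof (rule cochain_eqI[OF U V, where n = "n + 1 + m"])
  have f': "coface \<I> \<I> n 0 f \<in> carrier (\<C> \<I> \<I> (n + 1))" by (intro coface_closed[OF unit_central unit_central f]) simp
  have g': "coface U V m (Suc m) g \<in> carrier (\<C> U V (m + 1))" by (intro coface_closed[OF U V g]) simp
  fix Zs assume "length Zs = n + 1 + m" "set Zs \<subseteq> Obj C"
  then obtain Xs Ys' where Z: "Zs = Xs @ Ys'" "length Xs = m" "length Ys' = n + 1" "set Xs \<subseteq> Obj C" "set Ys' \<subseteq> Obj C"
    by (rule tuple_append)
  obtain Y Ys where Y: "Ys' = Y # Ys" "length Ys = n" "Y \<in> Obj C" "set Ys \<subseteq> Obj C" using Z(3,5) by (rule tuple_Cons)
  have Y1: "set [Y] \<subseteq> Obj C" and Zs: "Zs = (Xs @ [Y]) @ Ys" and XY: "length (Xs @ [Y]) = m + 1" "set (Xs @ [Y]) \<subseteq> Obj C"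
    using Y Z by auto
  have "cell U V (cup U V (n + 1) m (coface \<I> \<I> n 0 f) g) Zs =
      D.stack (\<Phi> Xs) (\<Phi> [Y] \<boxtimes>\<^bsub>D\<^esub> \<Phi> Ys) (D.stack (\<Phi> [Y]) (\<Phi> Ys) (twist V f Ys) (braid V [Y])) (cell U V g Xs)"
    unfolding Z(1) cell_cup[OF f' g Z(2,4,3,5)] unfolding Y(1) twist_coface_first[OF V f Y(2,4,3)] \<Phi>_Cons[OF Y(3,4)] ..
  also have "\<dots> = D.stack (\<Phi> Xs \<boxtimes>\<^bsub>D\<^esub> \<Phi> [Y]) (\<Phi> Ys) (twist V f Ys) (D.stack (\<Phi> Xs) (\<Phi> [Y]) (braid V [Y]) (cell U V g Xs))"
    by (rule D.stack_assoc[OF crossing_cell[OF U V g Z(2,4)] crossing_braid[OF V Y1] crossing_twist[OF V f Y(2,4)], symmetric])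
  also have "\<dots> = cell U V (cup U V n (m + 1) f (coface U V m (Suc m) g)) Zs"
    unfolding Zs cell_cup[OF f g' XY Y(2,4)] cell_coface_last[OF U V g Z(2,4) Y(3)] \<Phi>_append[OF Z(4) Y1] ..
  finally show "cell U V (cup U V (n + 1) m (coface \<I> \<I> n 0 f) g) Zs = cell U V (cup U V n (m + 1) f (coface U V m (m + 1) g)) Zs"
    by simp
qed (use cup_ext[OF U V, of n "m + 1"] cup_ext[OF U V, of "n + 1" m] in simp_all)

lemma cup_is_cup_family: "cup_family K (\<C> \<I> \<I>) (coface \<I> \<I>) (\<C> U V) (coface U V) (cup U V)"
  by (intro cup_family.intro cup_family_axioms.intro cochains_semi_cosimplicial[OF unit_central unit_central]
      cochains_semi_cosimplicial[OF U V] cup_bilinear cup_coface_low cup_coface_high cup_coface_between)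

lemma twist_cup:
  assumes f: "f \<in> carrier (\<C> \<I> \<I> n)" and f': "f' \<in> carrier (\<C> \<I> \<I> m)"
    and Xs: "length Xs = m" "set Xs \<subseteq> Obj C" and Ys: "length Ys = n" "set Ys \<subseteq> Obj C"
    and c: "cell \<I> \<I> (cup \<I> \<I> n m f f') (Xs @ Ys) = D.stack (\<Phi> Xs) (\<Phi> Ys) (twist \<I> f Ys) (cell \<I> \<I> f' Xs)"
  shows "twist V (cup \<I> \<I> n m f f') (Xs @ Ys) = D.stack (\<Phi> Xs) (\<Phi> Ys) (twist V f Ys) (twist V f' Xs)"
  by (rule twist_of_stack[OF V f' f Xs Ys c[unfolded twist_unit_object[OF f Ys]]])

lemma cup_unit_left:
  assumes g: "g \<in> carrier (\<C> U V m)"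
  shows "cup U V 0 m cochain_unit g = g"
proof (rule cup_eqI[where n = 0 and m = m])
  fix Xs Ys :: "'o list" assume Xs: "length Xs = m" "set Xs \<subseteq> Obj C" and Ys: "length Ys = 0" "set Ys \<subseteq> Obj C"
  then have Ys0: "Ys = []" by simp
  have "twist V cochain_unit [] = \<iota> (fst V)"
    using V by (simp add: twist_def cell_cochain_unit braid_Nil D.diagram)
  then show "cell U V (cup U V 0 m cochain_unit g) (Xs @ Ys) = cell U V g (Xs @ Ys)"
    unfolding cell_cup[OF cochain_unit_closed g Xs Ys] unfolding Ys0
    using V Xs cochain_typed[OF U V g Xs] by (simp add: D.stack_def D.diagram)
qed (use cup_ext[OF U V, of 0 m] cochain_extensional[OF U V g] in simp_all)

end

text \<open>The twist of a product is the stack of the twists, so this is associativity of stacking.\<close>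

lemma cup_assoc:
  assumes U: "central U" and V: "central V"
    and f: "f \<in> carrier (\<C> \<I> \<I> n)" and f': "f' \<in> carrier (\<C> \<I> \<I> m)" and g: "g \<in> carrier (\<C> U V l)"
  shows "cup U V (n + m) l (cup \<I> \<I> n m f f') g = cup U V n (m + l) f (cup U V m l f' g)"
proof (rule cochain_eqI[OF U V, where n = "n + m + l"])
  note ff' = cup_closed[OF unit_central unit_central f f'] and f'g = cup_closed[OF U V f' g]
  fix Zs assume "length Zs = n + m + l" "set Zs \<subseteq> Obj C"
  then obtain Xs Zs' where X: "Zs = Xs @ Zs'" "length Xs = l" "length Zs' = n + m" "set Xs \<subseteq> Obj C" "set Zs' \<subseteq> Obj C"
    by (rule tuple_append)
  obtain Ys Ws where Y: "Zs' = Ys @ Ws" "length Ys = m" "length Ws = n" "set Ys \<subseteq> Obj C" "set Ws \<subseteq> Obj C"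
    using X(3,5) by (rule tuple_append)
  have XY: "length (Xs @ Ys) = m + l" "set (Xs @ Ys) \<subseteq> Obj C" and Zs: "Zs = (Xs @ Ys) @ Ws" using X Y by auto
  have "cell U V (cup U V (n + m) l (cup \<I> \<I> n m f f') g) Zs =
      D.stack (\<Phi> Xs) (\<Phi> Ys \<boxtimes>\<^bsub>D\<^esub> \<Phi> Ws) (D.stack (\<Phi> Ys) (\<Phi> Ws) (twist V f Ws) (twist V f' Ys)) (cell U V g Xs)"
    unfolding X(1) cell_cup[OF U V ff' g X(2,4,3,5)]
    unfolding Y(1) twist_cup[OF unit_central V f f' Y(2,4,3,5) cell_cup[OF unit_central unit_central f f' Y(2,4,3,5)]]
      \<Phi>_append[OF Y(4,5)] ..
  also have "\<dots> = D.stack (\<Phi> Xs \<boxtimes>\<^bsub>D\<^esub> \<Phi> Ys) (\<Phi> Ws) (twist V f Ws) (D.stack (\<Phi> Xs) (\<Phi> Ys) (twist V f' Ys) (cell U V g Xs))"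
    by (rule D.stack_assoc[OF crossing_cell[OF U V g X(2,4)] crossing_twist[OF V f' Y(2,4)] crossing_twist[OF V f Y(3,5)], symmetric])
  also have "\<dots> = cell U V (cup U V n (m + l) f (cup U V m l f' g)) Zs"
    unfolding Zs cell_cup[OF U V f f'g XY Y(3,5)] cell_cup[OF U V f' g X(2,4) Y(2,4)] \<Phi>_append[OF X(4) Y(4)] ..
  finally show "cell U V (cup U V (n + m) l (cup \<I> \<I> n m f f') g) Zs = cell U V (cup U V n (m + l) f (cup U V m l f' g)) Zs" .
qed (use cup_ext[OF U V, of n "m + l"] cup_ext[OF U V, of "n + m" l] in \<open>simp_all add: add.assoc\<close>)

lemma cup_unit_right:
  assumes f: "f \<in> carrier (\<C> \<I> \<I> n)"
  shows "cup \<I> \<I> n 0 f cochain_unit = f"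
proof (rule cup_eqI[OF unit_central unit_central, where n = n and m = 0])
  fix Xs Ys :: "'o list" assume Xs: "length Xs = 0" "set Xs \<subseteq> Obj C" and Ys: "length Ys = n" "set Ys \<subseteq> Obj C"
  then have Xs0: "Xs = []" by simp
  have "D.typed (cell \<I> \<I> f Ys)" by (rule cochain_typed[OF unit_central unit_central f Ys])
  then show "cell \<I> \<I> (cup \<I> \<I> n 0 f cochain_unit) (Xs @ Ys) = cell \<I> \<I> f (Xs @ Ys)"
    unfolding cell_cup[OF unit_central unit_central f cochain_unit_closed Xs Ys] twist_unit_object[OF f Ys]
    using cell_unit_crossing(2)[OF f Ys] Ys by (simp add: Xs0 D.stack_def cell_cochain_unit D.diagram del: cell_sel)
qed (use cup_ext[OF unit_central unit_central, of n 0] cochain_extensional[OF unit_central unit_central f] in simp_all)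

end

section \<open>The dual half-braiding\<close>

context monoidal_setting
begin

text \<open>The half-braiding at a single object. Uniqueness of the dual is a matter of single objects, and \<open>braid_hb\<close> brings the
  result back to tuples.\<close>

definition hb :: "'p \<times> ('o \<Rightarrow> 'n) \<Rightarrow> 'o \<Rightarrow> ('p, 'n) arrow" where
  "hb V X = Arrow (fst V \<boxtimes>\<^bsub>D\<^esub> FO F X) (snd V X) (FO F X \<boxtimes>\<^bsub>D\<^esub> fst V)"

lemma hb_sel [simp]: "src (hb V X) = fst V \<boxtimes>\<^bsub>D\<^esub> FO F X" "tgt (hb V X) = FO F X \<boxtimes>\<^bsub>D\<^esub> fst V" "mor (hb V X) = snd V X"
  by (simp_all add: hb_def)

lemma braid_hb: "set Xs \<subseteq> Obj C \<Longrightarrow> braid V Xs = hb V (tens_list C Xs)"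
  by (simp add: braid_def hb_def F_tens_list)

lemma hb_crossing: "\<lbrakk>central V; X \<in> Obj C\<rbrakk> \<Longrightarrow> D.crossing (fst V) (FO F X) (fst V) (hb V X)"
  using half_braiding_arr[of "fst V" "snd V" X]
  by (simp add: central_iff D.crossing_def hb_def D.typed_Arrow F.F_obj D.tens_obj)

lemma hb_tens:
  assumes "central V" "X \<in> Obj C" "Y \<in> Obj C"
  shows "hb V (X \<boxtimes>\<^bsub>C\<^esub> Y) = D.stack (FO F X) (FO F Y) (hb V Y) (hb V X)"
  using assms
  by (intro D.arrow_eqI)
    (simp_all add: central_iff half_braiding_def D.stack_def F.F_tens_obj F.F_obj D.tens_obj_assoc)

lemma hb_unit: "central V \<Longrightarrow> hb V (Unit C) = \<iota> (fst V)"
  using braid_Nil[of V] braid_hb[of "[]" V] by simp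

definition F_arrow :: "'o \<Rightarrow> 'm \<Rightarrow> 'o \<Rightarrow> ('p, 'n) arrow" where
  "F_arrow X h Y = Arrow (FO F X) (FA F h) (FO F Y)"

lemma F_arrow_sel [simp]: "src (F_arrow X h Y) = FO F X" "tgt (F_arrow X h Y) = FO F Y" "mor (F_arrow X h Y) = FA F h"
  by (simp_all add: F_arrow_def)

lemma F_arrow_is_typed: "\<lbrakk>X \<in> Obj C; Y \<in> Obj C; h \<in> arr C X Y\<rbrakk> \<Longrightarrow> D.typed (F_arrow X h Y)"
  unfolding F_arrow_def by (rule F_arrow_typed)

lemma hb_natural:
  assumes "central V" "X \<in> Obj C" "Y \<in> Obj C" "h \<in> arr C X Y"
  shows "(F_arrow X h Y \<parallel> \<iota> (fst V)) \<bullet> hb V X = hb V Y \<bullet> (\<iota> (fst V) \<parallel> F_arrow X h Y)"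
  using assms by (intro D.arrow_eqI) (simp_all add: central_iff half_braiding_def)

lemma hb_inverse:
  assumes "central V" "X \<in> Obj C"
  obtains s where "D.typed s" "src s = FO F X \<boxtimes>\<^bsub>D\<^esub> fst V" "tgt s = fst V \<boxtimes>\<^bsub>D\<^esub> FO F X"
    "hb V X \<bullet> s = \<iota> (FO F X \<boxtimes>\<^bsub>D\<^esub> fst V)"
proof -
  obtain g where g: "g \<in> arr D (FO F X \<boxtimes>\<^bsub>D\<^esub> fst V) (fst V \<boxtimes>\<^bsub>D\<^esub> FO F X)"
      "snd V X \<cdot>\<^bsub>D\<^esub> g = Id D (FO F X \<boxtimes>\<^bsub>D\<^esub> fst V)"
    using assms by (auto simp: central_iff half_braiding_def iso_arr_def)
  let ?s = "Arrow (FO F X \<boxtimes>\<^bsub>D\<^esub> fst V) g (fst V \<boxtimes>\<^bsub>D\<^esub> FO F X)"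
  have "D.typed ?s" using assms g(1) by (simp add: D.typed_Arrow F.F_obj D.tens_obj)
  moreover have "hb V X \<bullet> ?s = \<iota> (FO F X \<boxtimes>\<^bsub>D\<^esub> fst V)" using g(2) by (intro D.arrow_eqI) simp_all
  ultimately show thesis using that[of ?s] by simp
qed

lemma F_dual_pair:
  assumes d: "left_dual C Y X a b" and Y: "Y \<in> Obj C"
  shows "D.dual_pair (FO F Y) (FO F X) (F_arrow (Y \<boxtimes>\<^bsub>C\<^esub> X) a (Unit C)) (F_arrow (Unit C) b (X \<boxtimes>\<^bsub>C\<^esub> Y))"
proof -
  have X: "X \<in> Obj C" and a: "a \<in> arr C (Y \<boxtimes>\<^bsub>C\<^esub> X) (Unit C)" and b: "b \<in> arr C (Unit C) (X \<boxtimes>\<^bsub>C\<^esub> Y)"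
    and zig: "(a \<star>\<^bsub>C\<^esub> Id C Y) \<cdot>\<^bsub>C\<^esub> (Id C Y \<star>\<^bsub>C\<^esub> b) = Id C Y" "(Id C X \<star>\<^bsub>C\<^esub> a) \<cdot>\<^bsub>C\<^esub> (b \<star>\<^bsub>C\<^esub> Id C X) = Id C X"
    using d by (auto simp: left_dual_def)
  note objs = X Y C_unit_obj C_tens_obj[OF Y X] C_tens_obj[OF X Y]
  note idX = F.A.id_arr[OF X] and idY = F.A.id_arr[OF Y]
  have aY: "a \<star>\<^bsub>C\<^esub> Id C Y \<in> arr C (Y \<boxtimes>\<^bsub>C\<^esub> X \<boxtimes>\<^bsub>C\<^esub> Y) Y"
    using C_tens_arr[OF objs(4,3) Y Y a idY] X Y by (simp add: C_tens_obj_assoc C_unit_obj_left)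
  have Yb: "Id C Y \<star>\<^bsub>C\<^esub> b \<in> arr C Y (Y \<boxtimes>\<^bsub>C\<^esub> X \<boxtimes>\<^bsub>C\<^esub> Y)"
    using C_tens_arr[OF Y Y objs(3,5) idY b] Y by (simp add: C_unit_obj_right)
  have Xa: "Id C X \<star>\<^bsub>C\<^esub> a \<in> arr C (X \<boxtimes>\<^bsub>C\<^esub> Y \<boxtimes>\<^bsub>C\<^esub> X) X"
    using C_tens_arr[OF X X objs(4,3) idX a] X by (simp add: C_unit_obj_right)
  have bX: "b \<star>\<^bsub>C\<^esub> Id C X \<in> arr C X (X \<boxtimes>\<^bsub>C\<^esub> Y \<boxtimes>\<^bsub>C\<^esub> X)"
    using C_tens_arr[OF objs(3,5) X X b idX] X Y by (simp add: C_tens_obj_assoc C_unit_obj_left)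
  have "(FA F a \<star>\<^bsub>D\<^esub> Id D (FO F Y)) \<cdot>\<^bsub>D\<^esub> (Id D (FO F Y) \<star>\<^bsub>D\<^esub> FA F b) = Id D (FO F Y)"
    using arg_cong[OF zig(1), of "FA F"] F.F_comp[OF Y _ Y Yb aY] X Y
      F.F_tens_arr[OF objs(4,3) Y Y a idY] F.F_tens_arr[OF Y Y objs(3,5) idY b]
    by (simp add: C_tens_obj F.F_id)
  moreover have "(Id D (FO F X) \<star>\<^bsub>D\<^esub> FA F a) \<cdot>\<^bsub>D\<^esub> (FA F b \<star>\<^bsub>D\<^esub> Id D (FO F X)) = Id D (FO F X)"
    using arg_cong[OF zig(2), of "FA F"] F.F_comp[OF X _ X bX Xa] X Y
      F.F_tens_arr[OF X X objs(4,3) idX a] F.F_tens_arr[OF objs(3,5) X X b idX]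
    by (simp add: C_tens_obj F.F_id)
  ultimately show ?thesis
    using F_arrow_is_typed[OF objs(4,3) a] F_arrow_is_typed[OF objs(3,5) b] X Y
    unfolding D.dual_pair_def
    by (auto simp: F.F_obj F.F_tens_obj F.F_unit D.unit_obj_left D.unit_obj_right intro!: D.arrow_eqI)
qed

context
  fixes V W e c
  assumes V: "central V" and dual: "left_dual D (fst V) W e c"
begin

abbreviation ev where "ev \<equiv> Arrow (fst V \<boxtimes>\<^bsub>D\<^esub> W) e (Unit D)"
abbreviation coev where "coev \<equiv> Arrow (Unit D) c (W \<boxtimes>\<^bsub>D\<^esub> fst V)"

lemma ev_dual_pair: "D.dual_pair (fst V) W ev coev"
  using D.left_dual_dual_pair[OF dual] V by simp

lemmas ev_simps = D.dual_simps[OF ev_dual_pair]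

definition transposed where "transposed X = D.transpose W ev coev (FO F X) (hb V X)"

lemma transposed_typed:
  assumes "X \<in> Obj C"
  shows "D.typed (transposed X)" "src (transposed X) = FO F X \<boxtimes>\<^bsub>D\<^esub> W" "tgt (transposed X) = W \<boxtimes>\<^bsub>D\<^esub> FO F X"
  unfolding transposed_def using D.transpose_typed[OF ev_dual_pair hb_crossing[OF V assms]] by auto

lemma transposed_natural:
  assumes "X \<in> Obj C" "Y \<in> Obj C" "h \<in> arr C X Y"
  shows "(\<iota> W \<parallel> F_arrow X h Y) \<bullet> transposed X = transposed Y \<bullet> (F_arrow X h Y \<parallel> \<iota> W)"
  unfolding transposed_def using assms
  by (intro D.transpose_natural[OF ev_dual_pair] hb_crossing[OF V] hb_natural[OF V] F_arrow_is_typed) simp_all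

lemma transposed_tens:
  assumes "X \<in> Obj C" "Y \<in> Obj C"
  shows "transposed (X \<boxtimes>\<^bsub>C\<^esub> Y) = (transposed X \<parallel> \<iota> (FO F Y)) \<bullet> (\<iota> (FO F X) \<parallel> transposed Y)"
  unfolding transposed_def hb_tens[OF V assms] F.F_tens_obj[OF assms]
  by (rule D.transpose_stack[OF ev_dual_pair hb_crossing[OF V assms(1)] hb_crossing[OF V assms(2)]])

lemma transposed_unit: "transposed (Unit C) = \<iota> W"
  unfolding transposed_def hb_unit[OF V] F.F_unit by (rule D.transpose_ident[OF ev_dual_pair])

text \<open>An object \<open>Y\<close> with left dual \<open>X\<close> provides the inverse: bend the transpose at \<open>Y\<close> around. Naturality with
  respect to the evaluation and coevaluation of the pair, and triviality at the unit object, make the two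
  crossings cancel.\<close>

lemma transposed_inverse:
  assumes X: "X \<in> Obj C"
  obtains s where "D.typed s" "src s = W \<boxtimes>\<^bsub>D\<^esub> FO F X" "tgt s = FO F X \<boxtimes>\<^bsub>D\<^esub> W"
    "s \<bullet> transposed X = \<iota> (FO F X \<boxtimes>\<^bsub>D\<^esub> W)" "transposed X \<bullet> s = \<iota> (W \<boxtimes>\<^bsub>D\<^esub> FO F X)"
proof -
  obtain Y a b where Y: "Y \<in> Obj C" and d: "left_dual C Y X a b"
    using strict_tensor_category.ex_right_dual[OF C_tensor X] by blast
  have a: "a \<in> arr C (Y \<boxtimes>\<^bsub>C\<^esub> X) (Unit C)" and b: "b \<in> arr C (Unit C) (X \<boxtimes>\<^bsub>C\<^esub> Y)"
    using d by (auto simp: left_dual_def)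
  let ?a = "F_arrow (Y \<boxtimes>\<^bsub>C\<^esub> X) a (Unit C)" and ?b = "F_arrow (Unit C) b (X \<boxtimes>\<^bsub>C\<^esub> Y)"
  note pair = F_dual_pair[OF d Y]
  note [simp] = transposed_typed[OF X] transposed_typed[OF Y] ev_simps(2) F.F_obj[OF X] F.F_obj[OF Y]
    F_arrow_is_typed[OF C_tens_obj[OF Y X] C_unit_obj a] F_arrow_is_typed[OF C_unit_obj C_tens_obj[OF X Y] b]
    F.F_unit F.F_tens_obj[OF X Y] F.F_tens_obj[OF Y X]
  have eva: "(\<iota> W \<parallel> ?a) \<bullet> (transposed Y \<parallel> \<iota> (FO F X)) \<bullet> (\<iota> (FO F Y) \<parallel> transposed X) = ?a \<parallel> \<iota> W"
    using transposed_natural[OF C_tens_obj[OF Y X] C_unit_obj a]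
    unfolding transposed_tens[OF Y X] transposed_unit by (simp add: D.diagram)
  have coevb: "(transposed X \<parallel> \<iota> (FO F Y)) \<bullet> (\<iota> (FO F X) \<parallel> transposed Y) \<bullet> (?b \<parallel> \<iota> W) = \<iota> W \<parallel> ?b"
    using transposed_natural[OF C_unit_obj C_tens_obj[OF X Y] b]
    unfolding transposed_tens[OF X Y] transposed_unit by (simp add: D.diagram)
  let ?s = "(\<iota> (FO F X \<boxtimes>\<^bsub>D\<^esub> W) \<parallel> ?a) \<bullet> (\<iota> (FO F X) \<parallel> transposed Y \<parallel> \<iota> (FO F X)) \<bullet> (?b \<parallel> \<iota> (W \<boxtimes>\<^bsub>D\<^esub> FO F X))"
  have "D.typed ?s" "src ?s = W \<boxtimes>\<^bsub>D\<^esub> FO F X" "tgt ?s = FO F X \<boxtimes>\<^bsub>D\<^esub> W"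
    by (simp_all add: D.diagram)
  then show thesis
    using D.crossing_inverse[OF pair ev_simps(2) transposed_typed[OF X] transposed_typed[OF Y] eva coevb] that by blast
qed

definition inverse_transposed where
  "inverse_transposed X = (SOME s. D.typed s \<and> src s = W \<boxtimes>\<^bsub>D\<^esub> FO F X \<and> tgt s = FO F X \<boxtimes>\<^bsub>D\<^esub> W \<and>
    s \<bullet> transposed X = \<iota> (FO F X \<boxtimes>\<^bsub>D\<^esub> W) \<and> transposed X \<bullet> s = \<iota> (W \<boxtimes>\<^bsub>D\<^esub> FO F X))"

lemma inverse_transposed:
  assumes "X \<in> Obj C"
  shows "D.typed (inverse_transposed X)" "src (inverse_transposed X) = W \<boxtimes>\<^bsub>D\<^esub> FO F X"
    "tgt (inverse_transposed X) = FO F X \<boxtimes>\<^bsub>D\<^esub> W"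
    "inverse_transposed X \<bullet> transposed X = \<iota> (FO F X \<boxtimes>\<^bsub>D\<^esub> W)"
    "transposed X \<bullet> inverse_transposed X = \<iota> (W \<boxtimes>\<^bsub>D\<^esub> FO F X)"
proof -
  have "\<exists>s. D.typed s \<and> src s = W \<boxtimes>\<^bsub>D\<^esub> FO F X \<and> tgt s = FO F X \<boxtimes>\<^bsub>D\<^esub> W \<and>
    s \<bullet> transposed X = \<iota> (FO F X \<boxtimes>\<^bsub>D\<^esub> W) \<and> transposed X \<bullet> s = \<iota> (W \<boxtimes>\<^bsub>D\<^esub> FO F X)"
    by (rule transposed_inverse[OF assms]) blast
  from someI_ex[OF this, folded inverse_transposed_def]
  show "D.typed (inverse_transposed X)" "src (inverse_transposed X) = W \<boxtimes>\<^bsub>D\<^esub> FO F X"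
    "tgt (inverse_transposed X) = FO F X \<boxtimes>\<^bsub>D\<^esub> W"
    "inverse_transposed X \<bullet> transposed X = \<iota> (FO F X \<boxtimes>\<^bsub>D\<^esub> W)"
    "transposed X \<bullet> inverse_transposed X = \<iota> (W \<boxtimes>\<^bsub>D\<^esub> FO F X)" by auto
qed

lemma inverse_transposed_unique:
  assumes X: "X \<in> Obj C" and s: "D.typed s" "src s = W \<boxtimes>\<^bsub>D\<^esub> FO F X" "tgt s = FO F X \<boxtimes>\<^bsub>D\<^esub> W"
    and inv: "s \<bullet> transposed X = \<iota> (FO F X \<boxtimes>\<^bsub>D\<^esub> W)"
  shows "s = inverse_transposed X"
proof -
  note [simp] = s inverse_transposed(1-3)[OF X] transposed_typed[OF X] F.F_obj[OF X] ev_simps(2)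
  have "s = s \<bullet> (transposed X \<bullet> inverse_transposed X)"
    unfolding inverse_transposed(5)[OF X] by (simp add: D.diagram)
  also have "\<dots> = (s \<bullet> transposed X) \<bullet> inverse_transposed X" by (simp add: D.diagram)
  also have "\<dots> = inverse_transposed X" unfolding inv by (simp add: D.diagram)
  finally show ?thesis .
qed

definition dual_braiding where "dual_braiding = (\<lambda>X\<in>Obj C. mor (inverse_transposed X))"

lemma hb_dual_braiding: "X \<in> Obj C \<Longrightarrow> hb (W, dual_braiding) X = inverse_transposed X"
  using inverse_transposed[of X] by (intro D.arrow_eqI) (simp_all add: dual_braiding_def)

lemma inverse_transposed_natural:
  assumes X: "X \<in> Obj C" and Y: "Y \<in> Obj C" and h: "h \<in> arr C X Y"
  shows "(F_arrow X h Y \<parallel> \<iota> W) \<bullet> inverse_transposed X = inverse_transposed Y \<bullet> (\<iota> W \<parallel> F_arrow X h Y)"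
proof -
  note [simp] = F.F_obj[OF X] F.F_obj[OF Y] ev_simps(2) transposed_typed[OF X] transposed_typed[OF Y]
    inverse_transposed(1-3)[OF X] inverse_transposed(1-3)[OF Y] F_arrow_is_typed[OF X Y h]
  have "(F_arrow X h Y \<parallel> \<iota> W) \<bullet> inverse_transposed X =
      (inverse_transposed Y \<bullet> transposed Y) \<bullet> (F_arrow X h Y \<parallel> \<iota> W) \<bullet> inverse_transposed X"
    unfolding inverse_transposed(4)[OF Y] by (simp add: D.diagram)
  also have "\<dots> = inverse_transposed Y \<bullet> (transposed Y \<bullet> (F_arrow X h Y \<parallel> \<iota> W)) \<bullet> inverse_transposed X"
    by (simp add: D.diagram)
  also have "\<dots> = (inverse_transposed Y \<bullet> (\<iota> W \<parallel> F_arrow X h Y)) \<bullet> (transposed X \<bullet> inverse_transposed X)"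
    unfolding transposed_natural[OF X Y h, symmetric] by (simp add: D.diagram)
  also have "\<dots> = inverse_transposed Y \<bullet> (\<iota> W \<parallel> F_arrow X h Y)"
    unfolding inverse_transposed(5)[OF X] by (simp add: D.diagram)
  finally show ?thesis .
qed

lemma inverse_transposed_tens:
  assumes X: "X \<in> Obj C" and Y: "Y \<in> Obj C"
  shows "inverse_transposed (X \<boxtimes>\<^bsub>C\<^esub> Y) = (\<iota> (FO F X) \<parallel> inverse_transposed Y) \<bullet> (inverse_transposed X \<parallel> \<iota> (FO F Y))"
proof (rule inverse_transposed_unique[OF C_tens_obj[OF X Y], symmetric])
  note [simp] = F.F_obj[OF X] F.F_obj[OF Y] ev_simps(2) transposed_typed[OF X] transposed_typed[OF Y]
    inverse_transposed(1-3)[OF X] inverse_transposed(1-3)[OF Y] F.F_tens_obj[OF X Y]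
  let ?s = "(\<iota> (FO F X) \<parallel> inverse_transposed Y) \<bullet> (inverse_transposed X \<parallel> \<iota> (FO F Y))"
  show "D.typed ?s" "src ?s = W \<boxtimes>\<^bsub>D\<^esub> FO F (X \<boxtimes>\<^bsub>C\<^esub> Y)" "tgt ?s = FO F (X \<boxtimes>\<^bsub>C\<^esub> Y) \<boxtimes>\<^bsub>D\<^esub> W"
    by (simp_all add: D.diagram)
  have "?s \<bullet> transposed (X \<boxtimes>\<^bsub>C\<^esub> Y) = (\<iota> (FO F X) \<parallel> inverse_transposed Y) \<bullet>
      ((inverse_transposed X \<bullet> transposed X) \<parallel> \<iota> (FO F Y)) \<bullet> (\<iota> (FO F X) \<parallel> transposed Y)"
    unfolding transposed_tens[OF X Y] by (simp add: D.diagram)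
  also have "\<dots> = \<iota> (FO F X) \<parallel> (inverse_transposed Y \<bullet> transposed Y)"
    unfolding inverse_transposed(4)[OF X] by (simp add: D.diagram)
  also have "\<dots> = \<iota> (FO F (X \<boxtimes>\<^bsub>C\<^esub> Y) \<boxtimes>\<^bsub>D\<^esub> W)"
    unfolding inverse_transposed(4)[OF Y] by (simp add: D.diagram)
  finally show "?s \<bullet> transposed (X \<boxtimes>\<^bsub>C\<^esub> Y) = \<iota> (FO F (X \<boxtimes>\<^bsub>C\<^esub> Y) \<boxtimes>\<^bsub>D\<^esub> W)" .
qed

lemma dual_braiding_central: "central (W, dual_braiding)"
  unfolding central_iff half_braiding_def
proof (intro conjI ballI)
  show "fst (W, dual_braiding) \<in> Obj D" using ev_simps(2) by simp
  show "snd (W, dual_braiding) \<in> extensional (Obj C)" by (simp add: dual_braiding_def)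
next
  fix X assume X: "X \<in> Obj C"
  have "mor (transposed X) \<in> arr D (FO F X \<boxtimes>\<^bsub>D\<^esub> W) (W \<boxtimes>\<^bsub>D\<^esub> FO F X)"
    "mor (inverse_transposed X) \<in> arr D (W \<boxtimes>\<^bsub>D\<^esub> FO F X) (FO F X \<boxtimes>\<^bsub>D\<^esub> W)"
    using D.typed_mor[OF transposed_typed(1)[OF X]] D.typed_mor[OF inverse_transposed(1)[OF X]]
      transposed_typed(2,3)[OF X] inverse_transposed(2,3)[OF X] by simp_all
  moreover have "mor (transposed X) \<cdot>\<^bsub>D\<^esub> mor (inverse_transposed X) = Id D (W \<boxtimes>\<^bsub>D\<^esub> FO F X)"
    "mor (inverse_transposed X) \<cdot>\<^bsub>D\<^esub> mor (transposed X) = Id D (FO F X \<boxtimes>\<^bsub>D\<^esub> W)"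
    using arg_cong[OF inverse_transposed(4)[OF X], of mor] arg_cong[OF inverse_transposed(5)[OF X], of mor] by simp_all
  ultimately show "iso_arr D (fst (W, dual_braiding) \<boxtimes>\<^bsub>D\<^esub> FO F X) (FO F X \<boxtimes>\<^bsub>D\<^esub> fst (W, dual_braiding)) (snd (W, dual_braiding) X)"
    using X by (auto simp: iso_arr_def dual_braiding_def)
  fix Y assume Y: "Y \<in> Obj C"
  show "snd (W, dual_braiding) (X \<boxtimes>\<^bsub>C\<^esub> Y) = (Id D (FO F X) \<star>\<^bsub>D\<^esub> snd (W, dual_braiding) Y) \<cdot>\<^bsub>D\<^esub>
      (snd (W, dual_braiding) X \<star>\<^bsub>D\<^esub> Id D (FO F Y))"
    using arg_cong[OF inverse_transposed_tens[OF X Y], of mor] X Y C_tens_obj[OF X Y] by (simp add: dual_braiding_def)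
  fix h assume h: "h \<in> arr C X Y"
  show "(FA F h \<star>\<^bsub>D\<^esub> Id D (fst (W, dual_braiding))) \<cdot>\<^bsub>D\<^esub> snd (W, dual_braiding) X =
      snd (W, dual_braiding) Y \<cdot>\<^bsub>D\<^esub> (Id D (fst (W, dual_braiding)) \<star>\<^bsub>D\<^esub> FA F h)"
    using arg_cong[OF inverse_transposed_natural[OF X Y h], of mor] X Y by (simp add: dual_braiding_def)
qed

text \<open>The conditions that characterize the dual half-braiding, translated into typed arrows.\<close>

lemma ev_central_iff:
  assumes "central (W, \<rho>)"
  shows "e \<in> arr (centralizer C D F) (V \<boxtimes>\<^bsub>centralizer C D F\<^esub> (W, \<rho>)) \<I> \<longleftrightarrow>
    (\<forall>X\<in>Obj C. (\<iota> (FO F X) \<parallel> ev) \<bullet> (hb V X \<parallel> \<iota> W) \<bullet> (\<iota> (fst V) \<parallel> hb (W, \<rho>) X) = ev \<parallel> \<iota> (FO F X))"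
    (is "?L \<longleftrightarrow> (\<forall>X\<in>Obj C. ?R X)")
proof -
  obtain v \<beta> where Vp: "V = (v, \<beta>)" by (cases V)
  have e: "e \<in> arr D (v \<boxtimes>\<^bsub>D\<^esub> W) (Unit D)" using dual Vp by (simp add: left_dual_def)
  have comp: "?R X \<longleftrightarrow> (Id D (FO F X) \<star>\<^bsub>D\<^esub> e) \<cdot>\<^bsub>D\<^esub> ((\<beta> X \<star>\<^bsub>D\<^esub> Id D W) \<cdot>\<^bsub>D\<^esub> (Id D v \<star>\<^bsub>D\<^esub> \<rho> X)) =
      Id D (FO F X) \<cdot>\<^bsub>D\<^esub> (e \<star>\<^bsub>D\<^esub> Id D (FO F X))" if X: "X \<in> Obj C" for X
  proof -
    note [simp] = F.F_obj[OF X] ev_simps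
    have "ev \<parallel> \<iota> (FO F X) = \<iota> (FO F X) \<bullet> (ev \<parallel> \<iota> (FO F X))"
      by (rule D.seq_ident_left[symmetric]) (simp_all add: D.diagram)
    then have "?R X \<longleftrightarrow> (\<iota> (FO F X) \<parallel> ev) \<bullet> (hb V X \<parallel> \<iota> W) \<bullet> (\<iota> (fst V) \<parallel> hb (W, \<rho>) X) = \<iota> (FO F X) \<bullet> (ev \<parallel> \<iota> (FO F X))"
      by (simp only:)
    also have "\<dots> \<longleftrightarrow> (Id D (FO F X) \<star>\<^bsub>D\<^esub> e) \<cdot>\<^bsub>D\<^esub> ((\<beta> X \<star>\<^bsub>D\<^esub> Id D W) \<cdot>\<^bsub>D\<^esub> (Id D v \<star>\<^bsub>D\<^esub> \<rho> X)) =
      Id D (FO F X) \<cdot>\<^bsub>D\<^esub> (e \<star>\<^bsub>D\<^esub> Id D (FO F X))"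
      using ev_simps(1) Vp
      by (auto simp: D.diagram intro!: D.arrow_eqI dest: arg_cong[where f = mor])
    finally show ?thesis .
  qed
  have "?L \<longleftrightarrow> (\<forall>X\<in>Obj C. (Id D (FO F X) \<star>\<^bsub>D\<^esub> e) \<cdot>\<^bsub>D\<^esub> ((\<beta> X \<star>\<^bsub>D\<^esub> Id D W) \<cdot>\<^bsub>D\<^esub> (Id D v \<star>\<^bsub>D\<^esub> \<rho> X)) =
      Id D (FO F X) \<cdot>\<^bsub>D\<^esub> (e \<star>\<^bsub>D\<^esub> Id D (FO F X)))"
    using e Vp by (simp add: centralizer_def)
  then show ?thesis using comp by simp
qed

lemma coev_central_iff:
  assumes "central (W, \<rho>)"
  shows "c \<in> arr (centralizer C D F) \<I> ((W, \<rho>) \<boxtimes>\<^bsub>centralizer C D F\<^esub> V) \<longleftrightarrow>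
    (\<forall>X\<in>Obj C. (hb (W, \<rho>) X \<parallel> \<iota> (fst V)) \<bullet> (\<iota> W \<parallel> hb V X) \<bullet> (coev \<parallel> \<iota> (FO F X)) = \<iota> (FO F X) \<parallel> coev)"
    (is "?L \<longleftrightarrow> (\<forall>X\<in>Obj C. ?R X)")
proof -
  obtain v \<beta> where Vp: "V = (v, \<beta>)" by (cases V)
  have c: "c \<in> arr D (Unit D) (W \<boxtimes>\<^bsub>D\<^esub> v)" using dual Vp by (simp add: left_dual_def)
  have comp: "?R X \<longleftrightarrow> (Id D (FO F X) \<star>\<^bsub>D\<^esub> c) \<cdot>\<^bsub>D\<^esub> Id D (FO F X) =
      ((\<rho> X \<star>\<^bsub>D\<^esub> Id D v) \<cdot>\<^bsub>D\<^esub> (Id D W \<star>\<^bsub>D\<^esub> \<beta> X)) \<cdot>\<^bsub>D\<^esub> (c \<star>\<^bsub>D\<^esub> Id D (FO F X))" if X: "X \<in> Obj C" for X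
  proof -
    note [simp] = F.F_obj[OF X] ev_simps
    have [simp]: "D.typed (hb (W, \<rho>) X)" "D.typed (hb V X)"
      using D.crossingD(4)[OF hb_crossing[OF assms X]] D.crossingD(4)[OF hb_crossing[OF V X]] .
    have l: "(hb (W, \<rho>) X \<parallel> \<iota> (fst V)) \<bullet> (\<iota> W \<parallel> hb V X) \<bullet> (coev \<parallel> \<iota> (FO F X)) =
        ((hb (W, \<rho>) X \<parallel> \<iota> (fst V)) \<bullet> (\<iota> W \<parallel> hb V X)) \<bullet> (coev \<parallel> \<iota> (FO F X))"
      by (rule D.seq_assoc[symmetric]) (simp_all add: D.diagram)
    have "\<iota> (FO F X) \<parallel> coev = (\<iota> (FO F X) \<parallel> coev) \<bullet> \<iota> (FO F X)"
      by (rule D.seq_ident_right[symmetric]) (simp_all add: D.diagram)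
    then have "?R X \<longleftrightarrow> (\<iota> (FO F X) \<parallel> coev) \<bullet> \<iota> (FO F X) =
        ((hb (W, \<rho>) X \<parallel> \<iota> (fst V)) \<bullet> (\<iota> W \<parallel> hb V X)) \<bullet> (coev \<parallel> \<iota> (FO F X))"
      unfolding l by (simp only: eq_commute)
    also have "\<dots> \<longleftrightarrow> (Id D (FO F X) \<star>\<^bsub>D\<^esub> c) \<cdot>\<^bsub>D\<^esub> Id D (FO F X) =
      ((\<rho> X \<star>\<^bsub>D\<^esub> Id D v) \<cdot>\<^bsub>D\<^esub> (Id D W \<star>\<^bsub>D\<^esub> \<beta> X)) \<cdot>\<^bsub>D\<^esub> (c \<star>\<^bsub>D\<^esub> Id D (FO F X))"
      using ev_simps(1) Vp
      by (auto simp: D.diagram intro!: D.arrow_eqI dest: arg_cong[where f = mor])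
    finally show ?thesis .
  qed
  have "?L \<longleftrightarrow> (\<forall>X\<in>Obj C. (Id D (FO F X) \<star>\<^bsub>D\<^esub> c) \<cdot>\<^bsub>D\<^esub> Id D (FO F X) =
      ((\<rho> X \<star>\<^bsub>D\<^esub> Id D v) \<cdot>\<^bsub>D\<^esub> (Id D W \<star>\<^bsub>D\<^esub> \<beta> X)) \<cdot>\<^bsub>D\<^esub> (c \<star>\<^bsub>D\<^esub> Id D (FO F X)))"
    using c Vp by (simp add: centralizer_def)
  then show ?thesis using comp by simp
qed

abbreviation dualV where "dualV \<equiv> centralizer_left_dual C D F V W e c"

text \<open>The inverse of the transpose satisfies both conditions, and the second condition forces any half-braiding of
  \<open>W\<close> to be this inverse.\<close>

lemma centralizer_left_dual_eq: "dualV = (W, dual_braiding)"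
proof -
  let ?Z = "centralizer C D F"
  let ?P = "\<lambda>\<rho>. (W, \<rho>) \<in> Obj ?Z \<and> e \<in> arr ?Z (V \<boxtimes>\<^bsub>?Z\<^esub> (W, \<rho>)) (Unit ?Z) \<and> c \<in> arr ?Z (Unit ?Z) ((W, \<rho>) \<boxtimes>\<^bsub>?Z\<^esub> V)"
  have "?P dual_braiding"
    unfolding ev_central_iff[OF dual_braiding_central] coev_central_iff[OF dual_braiding_central]
  proof (intro conjI ballI dual_braiding_central)
    fix X assume X: "X \<in> Obj C"
    show "(\<iota> (FO F X) \<parallel> ev) \<bullet> (hb V X \<parallel> \<iota> W) \<bullet> (\<iota> (fst V) \<parallel> hb (W, dual_braiding) X) = ev \<parallel> \<iota> (FO F X)"
      unfolding hb_dual_braiding[OF X]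
      by (rule D.inverse_transpose_bend[OF ev_dual_pair hb_crossing[OF V X] inverse_transposed(1-3)[OF X]
            inverse_transposed(5)[OF X, unfolded transposed_def]])
    show "(hb (W, dual_braiding) X \<parallel> \<iota> (fst V)) \<bullet> (\<iota> W \<parallel> hb V X) \<bullet> (coev \<parallel> \<iota> (FO F X)) = \<iota> (FO F X) \<parallel> coev"
      unfolding hb_dual_braiding[OF X]
      by (rule D.inverse_transpose_cobend[OF ev_dual_pair hb_crossing[OF V X] inverse_transposed(1-3)[OF X]
            inverse_transposed(4)[OF X, unfolded transposed_def]])
  qed
  moreover have "\<rho> = dual_braiding" if "?P \<rho>" for \<rho>
  proof (rule extensionalityI[where A = "Obj C"])
    have cen: "central (W, \<rho>)" using that by blast
    then show "\<rho> \<in> extensional (Obj C)" by (simp add: central_iff half_braiding_def)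
    show "dual_braiding \<in> extensional (Obj C)" by (simp add: dual_braiding_def)
    fix X assume X: "X \<in> Obj C"
    have typed: "D.typed (hb (W, \<rho>) X)" "src (hb (W, \<rho>) X) = W \<boxtimes>\<^bsub>D\<^esub> FO F X" "tgt (hb (W, \<rho>) X) = FO F X \<boxtimes>\<^bsub>D\<^esub> W"
      using D.crossingD(4)[OF hb_crossing[OF cen X]] by simp_all
    have "(hb (W, \<rho>) X \<parallel> \<iota> (fst V)) \<bullet> (\<iota> W \<parallel> hb V X) \<bullet> (coev \<parallel> \<iota> (FO F X)) = \<iota> (FO F X) \<parallel> coev"
      using that X unfolding coev_central_iff[OF cen] by blast
    then have "hb (W, \<rho>) X \<bullet> transposed X = \<iota> (FO F X \<boxtimes>\<^bsub>D\<^esub> W)"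
      unfolding transposed_def by (rule D.cobend_inverse_transpose[OF ev_dual_pair hb_crossing[OF V X] typed])
    then have "hb (W, \<rho>) X = inverse_transposed X" by (rule inverse_transposed_unique[OF X typed])
    then show "\<rho> X = dual_braiding X" using X by (auto simp: dual_braiding_def dest: arg_cong[where f = mor])
  qed
  ultimately have "(THE \<rho>. ?P \<rho>) = dual_braiding" by (rule the_equality)
  then show ?thesis by (simp add: centralizer_left_dual_def Let_def)
qed

lemma dualV_central: "central dualV" and dualV_fst: "fst dualV = W"
  using dual_braiding_central by (simp_all add: centralizer_left_dual_eq)

lemma dualV_bend:
  assumes Xs: "set Xs \<subseteq> Obj C"
  shows "(\<iota> (\<Phi> Xs) \<parallel> ev) \<bullet> (braid V Xs \<parallel> \<iota> W) \<bullet> (\<iota> (fst V) \<parallel> braid dualV Xs) = ev \<parallel> \<iota> (\<Phi> Xs)"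
proof -
  have X: "tens_list C Xs \<in> Obj C" using Xs by simp
  show ?thesis
    unfolding braid_hb[OF Xs] centralizer_left_dual_eq hb_dual_braiding[OF X] F_tens_list[OF Xs, symmetric]
    by (rule D.inverse_transpose_bend[OF ev_dual_pair hb_crossing[OF V X] inverse_transposed(1-3)[OF X]
          inverse_transposed(5)[OF X, unfolded transposed_def]])
qed

end

end

section \<open>The action on Davydov-Yetter cochains\<close>

context monoidal_setting
begin

lemma braid_single_mor: "X \<in> Obj C \<Longrightarrow> mor (braid V [X]) = snd V X"
  by (simp add: C_unit_obj_right)

lemma \<Phi>_single: "X \<in> Obj C \<Longrightarrow> \<Phi> [X] = FO F X"
  by (simp add: D.unit_obj_right F.F_obj)

context
  fixes U V
  assumes U: "central U" and V: "central V"
begin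

lemma DY_differential_eq:
  assumes f: "f \<in> carrier (\<C> U V n)"
  shows "DY_differential C D F U V n f = semi_cosimplicial.diff (\<C> U V) (coface U V) n f"
proof (rule extensionalityI[where A = "tuples C (n + 1)"])
  interpret S: semi_cosimplicial K "\<C> U V" "coface U V" by (rule cochains_semi_cosimplicial[OF U V])
  show "DY_differential C D F U V n f \<in> extensional (tuples C (n + 1))"
    by (simp add: DY_differential_def)
  show "S.diff n f \<in> extensional (tuples C (n + 1))"
    by (rule cochain_extensional[OF U V S.diff_closed[OF f]])
  fix Zs assume Zs: "Zs \<in> tuples C (n + 1)"
  then have Zs': "length Zs = n + 1" "set Zs \<subseteq> Obj C" by (simp_all add: tuples_iff)
  let ?M = "component_space D F U V Zs"
  interpret M: module K ?M by (rule component_module[OF U V Zs'(2)])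
  let ?t = "\<lambda>i. alt_sign ?M i (coface U V n i f Zs)"
  have tc: "?t i \<in> carrier ?M" if "i \<le> n + 1" for i
    using component_closed[OF U V coface_closed[OF U V f that] Zs] by simp
  have "S.diff n f Zs = (\<Oplus>\<^bsub>?M\<^esub>i\<in>{..n + 1}. alt_sign (\<C> U V (n + 1)) i (coface U V n i f) Zs)"
    unfolding S.diff_def using coface_closed[OF U V f]
    by (intro cochains_finsum[OF U V _ _ Zs] S.comp.alt_sign_closed) auto
  also have "\<dots> = (\<Oplus>\<^bsub>?M\<^esub>i\<in>{..n + 1}. ?t i)"
    using tc by (intro M.M.finsum_congI) (auto simp: cochains_alt_sign[OF U V coface_closed[OF U V f] Zs, simplified])
  also have "{..n + 1} = insert 0 (insert (n + 1) {1..n})" by auto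
  also have "(\<Oplus>\<^bsub>?M\<^esub>i\<in>insert 0 (insert (n + 1) {1..n}). ?t i) = ?t 0 \<oplus>\<^bsub>?M\<^esub> (\<Oplus>\<^bsub>?M\<^esub>i\<in>insert (n + 1) {1..n}. ?t i)"
    using tc by (intro M.M.finsum_insert) auto
  also have "(\<Oplus>\<^bsub>?M\<^esub>i\<in>insert (n + 1) {1..n}. ?t i) = ?t (n + 1) \<oplus>\<^bsub>?M\<^esub> (\<Oplus>\<^bsub>?M\<^esub>i\<in>{1..n}. ?t i)"
    using tc by (intro M.M.finsum_insert) auto
  also have "?t 0 \<oplus>\<^bsub>?M\<^esub> (?t (n + 1) \<oplus>\<^bsub>?M\<^esub> (\<Oplus>\<^bsub>?M\<^esub>i\<in>{1..n}. ?t i)) = ?t 0 \<oplus>\<^bsub>?M\<^esub> (\<Oplus>\<^bsub>?M\<^esub>i\<in>{1..n}. ?t i) \<oplus>\<^bsub>?M\<^esub> ?t (n + 1)"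
  proof -
    have "(\<Oplus>\<^bsub>?M\<^esub>i\<in>{1..n}. ?t i) \<in> carrier ?M" using tc by (intro M.M.finsum_closedI) auto
    moreover have "?t 0 \<in> carrier ?M" "?t (n + 1) \<in> carrier ?M" by (rule tc, simp)+
    ultimately show ?thesis by (simp only: M.M.a_ac M.M.a_closed)
  qed
  also have "\<dots> = DY_differential C D F U V n f Zs"
  proof -
    have ne: "Zs \<noteq> []" and objs: "hd Zs \<in> Obj C" "last Zs \<in> Obj C"
      using Zs' hd_in_set[of Zs] last_in_set[of Zs] by (cases "Zs = []"; auto)+
    have first: "?t 0 = (Id D (FO F (hd Zs)) \<star>\<^bsub>D\<^esub> f (tl Zs)) \<cdot>\<^bsub>D\<^esub> (snd U (hd Zs) \<star>\<^bsub>D\<^esub> Id D (\<Phi> (tl Zs)))"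
      using Zs by (simp add: coface_def alt_sign_def D.stack_def \<Phi>_single[OF objs(1)] braid_single_mor[OF objs(1)] del: \<Phi>_simps braid_sel)
    have last: "?t (n + 1) = alt_sign ?M (n + 1)
        ((Id D (\<Phi> (butlast Zs)) \<star>\<^bsub>D\<^esub> snd V (last Zs)) \<cdot>\<^bsub>D\<^esub> (f (butlast Zs) \<star>\<^bsub>D\<^esub> Id D (FO F (last Zs))))"
      using Zs by (simp add: coface_def D.stack_def \<Phi>_single[OF objs(2)] braid_single_mor[OF objs(2)] del: \<Phi>_simps braid_sel)
    have middle: "(\<Oplus>\<^bsub>?M\<^esub>i\<in>{1..n}. ?t i) = (\<Oplus>\<^bsub>?M\<^esub>i\<in>{1..n}. alt_sign ?M i
        (f (take (i - 1) Zs @ (Zs ! (i - 1) \<boxtimes>\<^bsub>C\<^esub> Zs ! i) # drop (i + 1) Zs)))"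
    proof (rule M.M.finsum_cong'[OF refl])
      have eq: "?t i = alt_sign ?M i (f (take (i - 1) Zs @ (Zs ! (i - 1) \<boxtimes>\<^bsub>C\<^esub> Zs ! i) # drop (i + 1) Zs))" if "i \<in> {1..n}" for i
      proof -
        obtain k where "i = Suc k" using \<open>i \<in> {1..n}\<close> by (cases i) auto
        then show ?thesis using \<open>i \<in> {1..n}\<close> Zs by (simp add: coface_def merge_def)
      qed
      then show "?t i = alt_sign ?M i (f (take (i - 1) Zs @ (Zs ! (i - 1) \<boxtimes>\<^bsub>C\<^esub> Zs ! i) # drop (i + 1) Zs))" if "i \<in> {1..n}" for i
        using that by blast
      show "(\<lambda>i. alt_sign ?M i (f (take (i - 1) Zs @ (Zs ! (i - 1) \<boxtimes>\<^bsub>C\<^esub> Zs ! i) # drop (i + 1) Zs))) \<in> {1..n} \<rightarrow> carrier ?M"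
      proof (rule funcsetI)
        fix i assume i: "i \<in> {1..n}"
        then have "?t i \<in> carrier ?M" by (intro tc) simp
        then show "alt_sign ?M i (f (take (i - 1) Zs @ (Zs ! (i - 1) \<boxtimes>\<^bsub>C\<^esub> Zs ! i) # drop (i + 1) Zs)) \<in> carrier ?M"
          unfolding eq[OF i] .
      qed
    qed
    show ?thesis unfolding first last middle using Zs by (simp add: DY_differential_def Let_def \<Phi>_def)
  qed
  finally show "DY_differential C D F U V n f Zs = S.diff n f Zs" by simp
qed

definition action where "action n m f g = alt_sign (\<C> U V (n + m)) (n * m) (cup U V n m f g)"

lemma action_closed:
  assumes "f \<in> carrier (\<C> \<I> \<I> n)" "g \<in> carrier (\<C> U V m)"
  shows "action n m f g \<in> carrier (\<C> U V (n + m))"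
proof -
  interpret module K "\<C> U V (n + m)" by (rule cochains_module[OF U V])
  show ?thesis unfolding action_def using cup_closed[OF U V assms] by simp
qed

lemma action_component:
  assumes f: "f \<in> carrier (\<C> \<I> \<I> n)" and g: "g \<in> carrier (\<C> U V m)"
    and Xs: "length Xs = m" "set Xs \<subseteq> Obj C" and Ys: "length Ys = n" "set Ys \<subseteq> Obj C"
  shows "action n m f g (Xs @ Ys) = alt_sign (component_space D F U V (Xs @ Ys)) (n * m)
    (mor ((\<iota> (\<Phi> Xs) \<parallel> (cell \<I> \<I> f Ys \<parallel> \<iota> (fst V))) \<bullet> (\<iota> (\<Phi> Xs) \<parallel> braid V Ys) \<bullet> (cell U V g Xs \<parallel> \<iota> (\<Phi> Ys))))"
proof -
  have XYs: "Xs @ Ys \<in> tuples C (n + m)" using Xs Ys by (simp add: tuples_iff)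
  have "D.stack (\<Phi> Xs) (\<Phi> Ys) (twist V f Ys) (cell U V g Xs) =
      (\<iota> (\<Phi> Xs) \<parallel> (cell \<I> \<I> f Ys \<parallel> \<iota> (fst V))) \<bullet> (\<iota> (\<Phi> Xs) \<parallel> braid V Ys) \<bullet> (cell U V g Xs \<parallel> \<iota> (\<Phi> Ys))"
    unfolding D.stack_def twist_def
    using Xs Ys V D.crossingD[OF crossing_cell[OF U V g Xs]] cell_unit_crossing(2,3)[OF f Ys]
      D.crossingD(4)[OF cell_unit_crossing(1)[OF f Ys]] by (simp add: D.diagram del: cell_sel)
  then have "cup U V n m f g (Xs @ Ys) =
      mor ((\<iota> (\<Phi> Xs) \<parallel> (cell \<I> \<I> f Ys \<parallel> \<iota> (fst V))) \<bullet> (\<iota> (\<Phi> Xs) \<parallel> braid V Ys) \<bullet> (cell U V g Xs \<parallel> \<iota> (\<Phi> Ys)))"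
    using arg_cong[OF cell_cup[OF U V f g Xs Ys], of mor] by simp
  then show ?thesis unfolding action_def cochains_alt_sign[OF U V cup_closed[OF U V f g] XYs] by simp
qed

end

text \<open>Crossing the unit strand is the identity, so the twist by the unit object does nothing.\<close>

lemma DY_product_eq:
  assumes f: "f \<in> carrier (\<C> \<I> \<I> n)" and g: "g \<in> carrier (\<C> \<I> \<I> m)"
  shows "DY_product C D F \<I> \<I> n m f g = action \<I> \<I> n m f g"
proof (rule extensionalityI[where A = "tuples C (n + m)"])
  show "DY_product C D F \<I> \<I> n m f g \<in> extensional (tuples C (n + m))" by (simp add: DY_product_def)
  show "action \<I> \<I> n m f g \<in> extensional (tuples C (n + m))"
    by (rule cochain_extensional[OF unit_central unit_central action_closed[OF unit_central unit_central f g]])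
  fix Zs assume Zs: "Zs \<in> tuples C (n + m)"
  then have "length Zs = n + m" "set Zs \<subseteq> Obj C" by (simp_all add: tuples_iff)
  then obtain Xs Ys where Z: "Zs = Xs @ Ys" "length Xs = m" "length Ys = n" "set Xs \<subseteq> Obj C" "set Ys \<subseteq> Obj C"
    by (rule tuple_append)
  have "(\<iota> (\<Phi> Xs) \<parallel> (cell \<I> \<I> f Ys \<parallel> \<iota> (fst \<I>))) \<bullet> (\<iota> (\<Phi> Xs) \<parallel> braid \<I> Ys) \<bullet> (cell \<I> \<I> g Xs \<parallel> \<iota> (\<Phi> Ys)) =
      (\<iota> (\<Phi> Xs) \<parallel> cell \<I> \<I> f Ys) \<bullet> (cell \<I> \<I> g Xs \<parallel> \<iota> (\<Phi> Ys))"
    using Z cell_unit_crossing(2,3)[OF f Z(3,5)] cell_unit_crossing(2,3)[OF g Z(2,4)]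
      D.crossingD(4)[OF cell_unit_crossing(1)[OF f Z(3,5)]] D.crossingD(4)[OF cell_unit_crossing(1)[OF g Z(2,4)]]
    by (simp add: D.diagram braid_unit del: cell_sel)
  then show "DY_product C D F \<I> \<I> n m f g Zs = action \<I> \<I> n m f g Zs"
    unfolding Z(1) action_component[OF unit_central unit_central f g Z(2,4,3,5)]
    using Zs Z by (simp add: DY_product_def Let_def \<Phi>_def)
qed

context
  fixes U V W e c
  assumes U: "central U" and V: "central V" and dual: "left_dual D (fst V) W e c"
begin

abbreviation evV where "evV \<equiv> Arrow (fst V \<boxtimes>\<^bsub>D\<^esub> W) e (Unit D)"
abbreviation coevV where "coevV \<equiv> Arrow (Unit D) c (W \<boxtimes>\<^bsub>D\<^esub> fst V)"
abbreviation V' where "V' \<equiv> centralizer_left_dual C D F V W e c"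
abbreviation UV' where "UV' \<equiv> U \<boxtimes>\<^bsub>centralizer C D F\<^esub> V'"

lemmas evV_pair = ev_dual_pair[OF V dual]
lemmas evV_simps = D.dual_simps[OF evV_pair]

definition xi_arrow where
  "xi_arrow g Xs = ((\<iota> (\<Phi> Xs) \<parallel> evV) \<bullet> (cell U V g Xs \<parallel> \<iota> W)) \<bullet> (\<iota> (fst U) \<parallel> braid V' Xs)"

lemma DY_xi_eq: "Xs \<in> tuples C n \<Longrightarrow> DY_xi C D F U V W e c n g Xs = mor (xi_arrow g Xs)"
  by (simp add: DY_xi_def xi_arrow_def \<Phi>_def)

lemma xi_arrow_typed:
  assumes "g \<in> carrier (\<C> U V n)" "length Xs = n" "set Xs \<subseteq> Obj C"
  shows "D.typed (xi_arrow g Xs)" "src (xi_arrow g Xs) = fst U \<boxtimes>\<^bsub>D\<^esub> W \<boxtimes>\<^bsub>D\<^esub> \<Phi> Xs" "tgt (xi_arrow g Xs) = \<Phi> Xs"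
  using cochain_typed[OF U V assms] assms U V dualV_central[OF V dual] dualV_fst[OF V dual] evV_simps
  by (simp_all add: xi_arrow_def D.diagram)

text \<open>The half-braiding of the dual is invertible and bending the strand \<open>V\<close> is reversible.\<close>

lemma xi_inj: "inj_on (DY_xi C D F U V W e c n) (carrier (\<C> U V n))"
proof (rule inj_onI)
  fix g h assume g: "g \<in> carrier (\<C> U V n)" and h: "h \<in> carrier (\<C> U V n)"
    and eq: "DY_xi C D F U V W e c n g = DY_xi C D F U V W e c n h"
  show "g = h"
  proof (rule cochain_eqI[OF U V cochain_extensional[OF U V g] cochain_extensional[OF U V h]])
    fix Xs assume Xs: "length Xs = n" "set Xs \<subseteq> Obj C"
    then have T: "Xs \<in> tuples C n" by (simp add: tuples_iff)
    note [simp] = cochain_typed[OF U V g Xs] cochain_typed[OF U V h Xs] central_obj[OF U] central_obj[OF V]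
      \<Phi>_obj[OF Xs(2)] evV_simps braid_typed[OF dualV_central[OF V dual] Xs(2)] dualV_fst[OF V dual]
    have "xi_arrow g Xs = xi_arrow h Xs"
      using fun_cong[OF eq, of Xs] unfolding DY_xi_eq[OF T]
      using xi_arrow_typed(2,3)[OF g Xs] xi_arrow_typed(2,3)[OF h Xs] by (intro D.arrow_eqI) simp_all
    then have eq': "((\<iota> (\<Phi> Xs) \<parallel> evV) \<bullet> (cell U V g Xs \<parallel> \<iota> W)) \<bullet> (\<iota> (fst U) \<parallel> braid V' Xs) =
        ((\<iota> (\<Phi> Xs) \<parallel> evV) \<bullet> (cell U V h Xs \<parallel> \<iota> W)) \<bullet> (\<iota> (fst U) \<parallel> braid V' Xs)"
      by (simp only: xi_arrow_def)
    obtain s where s: "D.typed s" "src s = \<Phi> Xs \<boxtimes>\<^bsub>D\<^esub> W" "tgt s = W \<boxtimes>\<^bsub>D\<^esub> \<Phi> Xs" "braid V' Xs \<bullet> s = \<iota> (\<Phi> Xs \<boxtimes>\<^bsub>D\<^esub> W)"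
      by (rule hb_inverse[OF dualV_central[OF V dual] tens_list_obj[OF Xs(2)]])
        (simp add: braid_hb[OF Xs(2)] F_tens_list[OF Xs(2)])
    note [simp] = s(1-3)
    have cancel: "(a \<bullet> (\<iota> (fst U) \<parallel> braid V' Xs)) \<bullet> (\<iota> (fst U) \<parallel> s) = a"
      if a: "D.typed a" "src a = fst U \<boxtimes>\<^bsub>D\<^esub> \<Phi> Xs \<boxtimes>\<^bsub>D\<^esub> W" for a
    proof -
      have "(a \<bullet> (\<iota> (fst U) \<parallel> braid V' Xs)) \<bullet> (\<iota> (fst U) \<parallel> s) = a \<bullet> (\<iota> (fst U) \<parallel> (braid V' Xs \<bullet> s))"
        using a by (simp add: D.diagram)
      also have "\<dots> = a" unfolding s(4) using a by (simp add: D.diagram)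
      finally show ?thesis .
    qed
    have bent: "(\<iota> (\<Phi> Xs) \<parallel> evV) \<bullet> (cell U V g Xs \<parallel> \<iota> W) = (\<iota> (\<Phi> Xs) \<parallel> evV) \<bullet> (cell U V h Xs \<parallel> \<iota> W)"
    proof -
      let ?a = "(\<iota> (\<Phi> Xs) \<parallel> evV) \<bullet> (cell U V g Xs \<parallel> \<iota> W)" and ?b = "(\<iota> (\<Phi> Xs) \<parallel> evV) \<bullet> (cell U V h Xs \<parallel> \<iota> W)"
      have a: "D.typed ?a" "src ?a = fst U \<boxtimes>\<^bsub>D\<^esub> \<Phi> Xs \<boxtimes>\<^bsub>D\<^esub> W" and b: "D.typed ?b" "src ?b = fst U \<boxtimes>\<^bsub>D\<^esub> \<Phi> Xs \<boxtimes>\<^bsub>D\<^esub> W"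
        by (simp_all add: D.diagram)
      have "?a = (?a \<bullet> (\<iota> (fst U) \<parallel> braid V' Xs)) \<bullet> (\<iota> (fst U) \<parallel> s)" by (rule cancel[OF a, symmetric])
      also have "\<dots> = (?b \<bullet> (\<iota> (fst U) \<parallel> braid V' Xs)) \<bullet> (\<iota> (fst U) \<parallel> s)" by (simp only: eq')
      also have "\<dots> = ?b" by (rule cancel[OF b])
      finally show ?thesis .
    qed
    show "cell U V g Xs = cell U V h Xs"
      by (rule D.bend_inject_right[OF evV_pair cochain_typed[OF U V g Xs] cell_sel(2) cochain_typed[OF U V h Xs] cell_sel(2) \<Phi>_obj[OF Xs(2)] _ bent])
        (simp only: cell_sel)
  qed
qed

text \<open>An instance of \<open>bend_stack\<close>: evaluation absorbs the crossings of \<open>V\<close> and its dual with the arguments of \<open>f\<close>.\<close>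

lemma xi_arrow_cup:
  assumes f: "f \<in> carrier (\<C> \<I> \<I> n)" and g: "g \<in> carrier (\<C> U V m)"
    and Xs: "length Xs = m" "set Xs \<subseteq> Obj C" and Ys: "length Ys = n" "set Ys \<subseteq> Obj C"
  shows "xi_arrow (cup U V n m f g) (Xs @ Ys) = (\<iota> (\<Phi> Xs) \<parallel> cell \<I> \<I> f Ys) \<bullet> (xi_arrow g Xs \<parallel> \<iota> (\<Phi> Ys))"
proof -
  note V' = dualV_central[OF V dual] and fst = dualV_fst[OF V dual]
  note [simp] = cochain_typed[OF U V g Xs] central_obj[OF U] central_obj[OF V] \<Phi>_obj[OF Xs(2)] \<Phi>_obj[OF Ys(2)]
    evV_simps braid_typed[OF V' Xs(2)] braid_typed[OF V' Ys(2)] fst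
  have XYs: "length (Xs @ Ys) = n + m" "set (Xs @ Ys) \<subseteq> Obj C" using Xs Ys by auto
  have "xi_arrow (cup U V n m f g) (Xs @ Ys) =
      (\<iota> (\<Phi> (Xs @ Ys)) \<parallel> evV) \<bullet> (cell U V (cup U V n m f g) (Xs @ Ys) \<parallel> \<iota> W) \<bullet> (\<iota> (fst U) \<parallel> braid V' (Xs @ Ys))"
    using cochain_typed[OF U V cup_closed[OF U V f g] XYs] braid_typed[OF V' XYs(2)] Xs Ys
    unfolding xi_arrow_def by (simp add: D.diagram)
  also have "\<dots> = (\<iota> (\<Phi> Xs \<boxtimes>\<^bsub>D\<^esub> \<Phi> Ys) \<parallel> evV) \<bullet>
      (D.stack (\<Phi> Xs) (\<Phi> Ys) ((cell \<I> \<I> f Ys \<parallel> \<iota> (fst V)) \<bullet> braid V Ys) (cell U V g Xs) \<parallel> \<iota> W) \<bullet>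
      (\<iota> (fst U) \<parallel> D.stack (\<Phi> Xs) (\<Phi> Ys) (braid V' Ys) (braid V' Xs))"
    unfolding \<Phi>_append[OF Xs(2) Ys(2)] cell_cup[OF U V f g Xs Ys] twist_def braid_stack[OF V' Xs(2) Ys(2)] ..
  also have "\<dots> = (\<iota> (\<Phi> Xs) \<parallel> cell \<I> \<I> f Ys) \<bullet>
      (((\<iota> (\<Phi> Xs) \<parallel> evV) \<bullet> (cell U V g Xs \<parallel> \<iota> W) \<bullet> (\<iota> (fst U) \<parallel> braid V' Xs)) \<parallel> \<iota> (\<Phi> Ys))"
    by (rule D.bend_stack[OF evV_pair crossing_cell[OF U V g Xs] crossing_braid[OF V Ys(2)]
          D.crossingD(4)[OF cell_unit_crossing(1)[OF f Ys]] cell_unit_crossing(2,3)[OF f Ys]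
          crossing_braid[OF V' Xs(2), unfolded fst] crossing_braid[OF V' Ys(2), unfolded fst] dualV_bend[OF V dual Ys(2)]])
  also have "(\<iota> (\<Phi> Xs) \<parallel> evV) \<bullet> (cell U V g Xs \<parallel> \<iota> W) \<bullet> (\<iota> (fst U) \<parallel> braid V' Xs) = xi_arrow g Xs"
    unfolding xi_arrow_def by (simp add: D.diagram)
  finally show ?thesis .
qed

lemma xi_arrow_scale:
  assumes a: "a \<in> carrier K" and g: "g \<in> carrier (\<C> U V n)" and Xs: "length Xs = n" "set Xs \<subseteq> Obj C"
  shows "xi_arrow (a \<odot>\<^bsub>\<C> U V n\<^esub> g) Xs = a \<boxdot> xi_arrow g Xs"
proof -
  note [simp] = cochain_typed[OF U V g Xs] central_obj[OF U] central_obj[OF V] \<Phi>_obj[OF Xs(2)] a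
    evV_simps braid_typed[OF dualV_central[OF V dual] Xs(2)] dualV_fst[OF V dual]
  show ?thesis unfolding xi_arrow_def cell_smult[OF U V Xs] by (simp add: D.linear D.diagram)
qed

text \<open>Signs apart this is \<open>xi_arrow_cup\<close>, that is \<open>bend_stack\<close>.\<close>

lemma xi_action:
  assumes f: "f \<in> carrier (\<C> \<I> \<I> n)" and g: "g \<in> carrier (\<C> U V m)"
  shows "DY_xi C D F U V W e c (n + m) (action U V n m f g) = DY_product C D F UV' \<I> n m f (DY_xi C D F U V W e c m g)"
proof (rule extensionalityI[where A = "tuples C (n + m)"])
  interpret S: module K "\<C> U V (n + m)" by (rule cochains_module[OF U V])
  note fg = cup_closed[OF U V f g]
  let ?s = "if even (n * m) then \<one>\<^bsub>K\<^esub> else \<ominus>\<^bsub>K\<^esub> \<one>\<^bsub>K\<^esub>"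
  have sc: "?s \<in> carrier K" by simp
  fix Zs assume Zs: "Zs \<in> tuples C (n + m)"
  then have Zs': "length Zs = n + m" "set Zs \<subseteq> Obj C" by (simp_all add: tuples_iff)
  then obtain Xs Ys where Z: "Zs = Xs @ Ys" "length Xs = m" "length Ys = n" "set Xs \<subseteq> Obj C" "set Ys \<subseteq> Obj C"
    by (rule tuple_append)
  let ?r = "(\<iota> (\<Phi> Xs) \<parallel> cell \<I> \<I> f Ys) \<bullet> (xi_arrow g Xs \<parallel> \<iota> (\<Phi> Ys))"
  have fst: "fst UV' = fst U \<boxtimes>\<^bsub>D\<^esub> W"
    using dualV_fst[OF V dual] by (simp add: centralizer_def split_beta)
  have W: "W \<in> Obj D" using evV_simps(2) .
  have r: "D.typed ?r" "src ?r = fst UV' \<boxtimes>\<^bsub>D\<^esub> \<Phi> Zs" "tgt ?r = \<Phi> Zs \<boxtimes>\<^bsub>D\<^esub> fst \<I>"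
    using xi_arrow_typed[OF g Z(2,4)] D.crossingD(4)[OF cell_unit_crossing(1)[OF f Z(3,5)]]
      cell_unit_crossing(2,3)[OF f Z(3,5)] Z U W unfolding fst
    by (simp_all add: D.diagram del: cell_sel)
  interpret M: module K "component_space D F UV' \<I> Zs"
    unfolding component_space_eq r(2,3)[symmetric] by (rule D.hom_module[OF D.typed_src[OF r(1)] D.typed_tgt[OF r(1)]])
  have rc: "mor ?r \<in> carrier (component_space D F UV' \<I> Zs)"
    using D.typed_mor[OF r(1)] unfolding component_space_eq r(2,3) .
  have "DY_xi C D F U V W e c (n + m) (action U V n m f g) Zs = mor (xi_arrow (?s \<odot>\<^bsub>\<C> U V (n + m)\<^esub> cup U V n m f g) Zs)"
    unfolding DY_xi_eq[OF Zs] action_def[OF U V] S.alt_sign_as_scalar[OF fg] ..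
  also have "\<dots> = mor (?s \<boxdot> ?r)"
    unfolding xi_arrow_scale[OF sc fg Zs'] unfolding Z(1) xi_arrow_cup[OF f g Z(2,4,3,5)] ..
  also have "\<dots> = alt_sign (component_space D F UV' \<I> Zs) (n * m) (mor ?r)"
    unfolding D.linear_sel r(2,3) component_space_eq[symmetric] by (rule M.alt_sign_as_scalar[OF rc, symmetric])
  also have "\<dots> = DY_product C D F UV' \<I> n m f (DY_xi C D F U V W e c m g) Zs"
    using Zs Z DY_xi_eq[of Xs m g] by (simp add: DY_product_def Let_def \<Phi>_def tuples_iff)
  finally show "DY_xi C D F U V W e c (n + m) (action U V n m f g) Zs =
      DY_product C D F UV' \<I> n m f (DY_xi C D F U V W e c m g) Zs" .
qed (simp_all add: DY_xi_def DY_product_def)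

lemma DY_action_eq:
  assumes f: "f \<in> carrier (\<C> \<I> \<I> n)" and g: "g \<in> carrier (\<C> U V m)"
  shows "DY_action C D F U V W e c n m f g = action U V n m f g"
  unfolding DY_action_def Let_def xi_action[OF f g, symmetric]
  by (rule the_inv_into_f_f[OF xi_inj action_closed[OF U V f g]])

end

end

section \<open>The graded module structures\<close>

context monoidal_setting
begin

lemma DY_product_dg_algebra:
  "dg_action K (\<C> \<I> \<I>) (DY_differential C D F \<I> \<I>) (\<C> \<I> \<I>) (DY_differential C D F \<I> \<I>) (DY_product C D F \<I> \<I>)"
  "graded_algebra_family K (\<C> \<I> \<I>) (DY_product C D F \<I> \<I>) cochain_unit"
proof -
  note I = unit_central
  interpret cup_family K "\<C> \<I> \<I>" "coface \<I> \<I>" "\<C> \<I> \<I>" "coface \<I> \<I>" "cup \<I> \<I>"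
    by (rule cup_is_cup_family[OF I I])
  have eq: "DY_product C D F \<I> \<I> n m f g = signed_cup n m f g"
    if "f \<in> carrier (\<C> \<I> \<I> n)" "g \<in> carrier (\<C> \<I> \<I> m)" for n m f g
    unfolding signed_cup_def DY_product_eq[OF that] action_def[OF I I] ..
  show "dg_action K (\<C> \<I> \<I>) (DY_differential C D F \<I> \<I>) (\<C> \<I> \<I>) (DY_differential C D F \<I> \<I>) (DY_product C D F \<I> \<I>)"
    by (rule dg_action_cong[OF signed_cup_dg_action DY_differential_eq[OF I I] DY_differential_eq[OF I I] eq])
  have act: "graded_action K (\<C> \<I> \<I>) (\<C> \<I> \<I>) signed_cup signed_cup cochain_unit"
    by (rule signed_cup_graded_action[OF cup_family_axioms cup_family_axioms])
      (simp_all add: cup_assoc[OF I I] cochain_unit_closed cup_unit_left[OF I I])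
  show "graded_algebra_family K (\<C> \<I> \<I>) (DY_product C D F \<I> \<I>) cochain_unit"
  proof (intro graded_algebra_family.intro graded_algebra_family_axioms.intro graded_action_cong[OF act eq eq])
    fix f n assume f: "f \<in> carrier (\<C> \<I> \<I> n)"
    show "DY_product C D F \<I> \<I> n 0 f cochain_unit = f"
      unfolding eq[OF f cochain_unit_closed] signed_cup_def cup_unit_right[OF f] by (simp add: alt_sign_def)
  qed
qed

context
  fixes U V W e c
  assumes U: "central U" and V: "central V" and dual: "left_dual D (fst V) W e c"
begin

lemma DY_action_dg_action:
  "dg_action K (\<C> \<I> \<I>) (DY_differential C D F \<I> \<I>) (\<C> U V) (DY_differential C D F U V) (DY_action C D F U V W e c)"
  "graded_action K (\<C> \<I> \<I>) (\<C> U V) (DY_product C D F \<I> \<I>) (DY_action C D F U V W e c) cochain_unit"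
proof -
  note I = unit_central
  interpret alg: cup_family K "\<C> \<I> \<I>" "coface \<I> \<I>" "\<C> \<I> \<I>" "coface \<I> \<I>" "cup \<I> \<I>"
    by (rule cup_is_cup_family[OF I I])
  interpret mod: cup_family K "\<C> \<I> \<I>" "coface \<I> \<I>" "\<C> U V" "coface U V" "cup U V"
    by (rule cup_is_cup_family[OF U V])
  have alg: "DY_product C D F \<I> \<I> n m f g = alg.signed_cup n m f g"
    if "f \<in> carrier (\<C> \<I> \<I> n)" "g \<in> carrier (\<C> \<I> \<I> m)" for n m f g
    unfolding alg.signed_cup_def DY_product_eq[OF that] action_def[OF I I] ..
  have mod: "DY_action C D F U V W e c n m f g = mod.signed_cup n m f g"
    if "f \<in> carrier (\<C> \<I> \<I> n)" "g \<in> carrier (\<C> U V m)" for n m f g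
    unfolding mod.signed_cup_def DY_action_eq[OF U V dual that] action_def[OF U V] ..
  show "dg_action K (\<C> \<I> \<I>) (DY_differential C D F \<I> \<I>) (\<C> U V) (DY_differential C D F U V) (DY_action C D F U V W e c)"
    by (rule dg_action_cong[OF mod.signed_cup_dg_action DY_differential_eq[OF I I] DY_differential_eq[OF U V] mod])
  have "graded_action K (\<C> \<I> \<I>) (\<C> U V) alg.signed_cup mod.signed_cup cochain_unit"
    by (rule signed_cup_graded_action[OF alg.cup_family_axioms mod.cup_family_axioms])
      (simp_all add: cup_assoc[OF U V] cochain_unit_closed cup_unit_left[OF U V])
  then show "graded_action K (\<C> \<I> \<I>) (\<C> U V) (DY_product C D F \<I> \<I>) (DY_action C D F U V W e c) cochain_unit"
    by (rule graded_action_cong[OF _ alg mod])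
qed

lemma DY_action_formula:
  assumes f: "f \<in> carrier (\<C> \<I> \<I> n)" and g: "g \<in> carrier (\<C> U V m)" and Xs: "Xs \<in> tuples C m" and Ys: "Ys \<in> tuples C n"
  shows "DY_action C D F U V W e c n m f g (Xs @ Ys) =
    alt_sign (component_space D F U V (Xs @ Ys)) (m * n)
      ((Id D (tens_F D F Xs) \<star>\<^bsub>D\<^esub> f Ys \<star>\<^bsub>D\<^esub> Id D (fst V)) \<cdot>\<^bsub>D\<^esub>
       (Id D (tens_F D F Xs) \<star>\<^bsub>D\<^esub> snd V (tens_list C Ys)) \<cdot>\<^bsub>D\<^esub>
       (g Xs \<star>\<^bsub>D\<^esub> Id D (tens_F D F Ys)))"
    and "(f Ys \<star>\<^bsub>D\<^esub> Id D (fst V)) \<cdot>\<^bsub>D\<^esub> snd V (tens_list C Ys) = snd V (tens_list C Ys) \<cdot>\<^bsub>D\<^esub> (Id D (fst V) \<star>\<^bsub>D\<^esub> f Ys) \<Longrightarrow>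
    DY_action C D F U V W e c n m f g (Xs @ Ys) =
      alt_sign (component_space D F U V (Xs @ Ys)) (m * n)
        ((Id D (tens_F D F Xs) \<star>\<^bsub>D\<^esub> snd V (tens_list C Ys)) \<cdot>\<^bsub>D\<^esub> (g Xs \<star>\<^bsub>D\<^esub> f Ys))"
proof -
  have X: "length Xs = m" "set Xs \<subseteq> Obj C" and Y: "length Ys = n" "set Ys \<subseteq> Obj C"
    using Xs Ys by (simp_all add: tuples_iff)
  note [simp] = X Y U V cochain_typed[OF U V g X] D.crossingD(4)[OF cell_unit_crossing(1)[OF f Y]] cell_unit_crossing(2,3)[OF f Y]
  let ?fV = "cell \<I> \<I> f Ys \<parallel> \<iota> (fst V)" and ?b = "braid V Ys" and ?g = "cell U V g Xs"
  let ?A = "\<iota> (\<Phi> Xs)" and ?B = "\<iota> (\<Phi> Ys)"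
  note formula = action_component[OF U V f g X Y, folded DY_action_eq[OF U V dual f g]]
  have "(?A \<parallel> ?fV) \<bullet> (?A \<parallel> ?b) \<bullet> (?g \<parallel> ?B) = ((?A \<parallel> ?fV) \<bullet> (?A \<parallel> ?b)) \<bullet> (?g \<parallel> ?B)"
    by (rule D.seq_assoc[symmetric]) (simp_all add: D.diagram)
  then show "DY_action C D F U V W e c n m f g (Xs @ Ys) =
    alt_sign (component_space D F U V (Xs @ Ys)) (m * n)
      ((Id D (tens_F D F Xs) \<star>\<^bsub>D\<^esub> f Ys \<star>\<^bsub>D\<^esub> Id D (fst V)) \<cdot>\<^bsub>D\<^esub>
       (Id D (tens_F D F Xs) \<star>\<^bsub>D\<^esub> snd V (tens_list C Ys)) \<cdot>\<^bsub>D\<^esub>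
       (g Xs \<star>\<^bsub>D\<^esub> Id D (tens_F D F Ys)))"
    unfolding formula by (simp add: \<Phi>_def mult.commute)
  assume commute: "(f Ys \<star>\<^bsub>D\<^esub> Id D (fst V)) \<cdot>\<^bsub>D\<^esub> snd V (tens_list C Ys) = snd V (tens_list C Ys) \<cdot>\<^bsub>D\<^esub> (Id D (fst V) \<star>\<^bsub>D\<^esub> f Ys)"
  \<comment> \<open>If \<open>f\<close> commutes with the half-braiding, it moves below it and stands beside \<open>g\<close>.\<close>
  have commute': "?fV \<bullet> ?b = ?b \<bullet> (\<iota> (fst V) \<parallel> cell \<I> \<I> f Ys)"
    using commute by (intro D.arrow_eqI) (simp_all add: D.unit_obj_left D.unit_obj_right)
  have "(?A \<parallel> ?fV) \<bullet> (?A \<parallel> ?b) \<bullet> (?g \<parallel> ?B) = (?A \<parallel> (?fV \<bullet> ?b)) \<bullet> (?g \<parallel> ?B)"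
    by (simp add: D.diagram)
  also have "\<dots> = (?A \<parallel> ?b) \<bullet> ((\<iota> (tgt ?g) \<parallel> cell \<I> \<I> f Ys) \<bullet> (?g \<parallel> \<iota> (src (cell \<I> \<I> f Ys))))"
    unfolding commute' by (simp add: D.diagram)
  also have "\<dots> = (?A \<parallel> ?b) \<bullet> (?g \<parallel> cell \<I> \<I> f Ys)"
    by (subst D.par_as_seq'[of ?g "cell \<I> \<I> f Ys"]) (simp_all add: D.diagram)
  finally show "DY_action C D F U V W e c n m f g (Xs @ Ys) =
      alt_sign (component_space D F U V (Xs @ Ys)) (m * n)
        ((Id D (tens_F D F Xs) \<star>\<^bsub>D\<^esub> snd V (tens_list C Ys)) \<cdot>\<^bsub>D\<^esub> (g Xs \<star>\<^bsub>D\<^esub> f Ys))"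
    unfolding formula by (simp add: \<Phi>_def mult.commute)
qed

end

end

theorem proposition4p15:
  fixes K :: "'k ring"
    and C :: "('k, 'o, 'm) mon_cat"
    and D :: "('k, 'p, 'n) mon_cat"
    and F :: "('o, 'm, 'p, 'n) func"
    and U V :: "'p \<times> ('o \<Rightarrow> 'n)"
    and W :: 'p and e c :: 'n
  assumes "field K"
    and "finite_strict_tensor_category K C"
    and "finite_strict_tensor_category K D"
    and "strict_monoidal_linear_functor K C D F"
    and "exact_functor C D F"
    and "U \<in> Obj (centralizer C D F)"
    and "V \<in> Obj (centralizer C D F)"
    and "left_dual D (fst V) W e c"
  shows
    "(\<forall>n m. \<forall>f \<in> carrier (DY_cochains C D F (Unit (centralizer C D F)) (Unit (centralizer C D F)) n).
        \<forall>g \<in> carrier (DY_cochains C D F U V m).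
          DY_action C D F U V W e c n m f g \<in> carrier (DY_cochains C D F U V (n + m)) \<and>
          (\<forall>Xs \<in> tuples C m. \<forall>Ys \<in> tuples C n.
             DY_action C D F U V W e c n m f g (Xs @ Ys) =
               alt_sign (component_space D F U V (Xs @ Ys)) (m * n)
                 ((Id D (tens_F D F Xs) \<star>\<^bsub>D\<^esub> f Ys \<star>\<^bsub>D\<^esub> Id D (fst V)) \<cdot>\<^bsub>D\<^esub>
                  (Id D (tens_F D F Xs) \<star>\<^bsub>D\<^esub> snd V (tens_list C Ys)) \<cdot>\<^bsub>D\<^esub>
                  (g Xs \<star>\<^bsub>D\<^esub> Id D (tens_F D F Ys))) \<and>
             ((f Ys \<star>\<^bsub>D\<^esub> Id D (fst V)) \<cdot>\<^bsub>D\<^esub> snd V (tens_list C Ys) =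
                snd V (tens_list C Ys) \<cdot>\<^bsub>D\<^esub> (Id D (fst V) \<star>\<^bsub>D\<^esub> f Ys) \<longrightarrow>
              DY_action C D F U V W e c n m f g (Xs @ Ys) =
                alt_sign (component_space D F U V (Xs @ Ys)) (m * n)
                  ((Id D (tens_F D F Xs) \<star>\<^bsub>D\<^esub> snd V (tens_list C Ys)) \<cdot>\<^bsub>D\<^esub> (g Xs \<star>\<^bsub>D\<^esub> f Ys))))) \<and>
     graded_module K
       (DY_algebra C D F)
       (graded_part (DY_cochains C D F (Unit (centralizer C D F)) (Unit (centralizer C D F))))
       (direct_sum (DY_cochains C D F U V))
       (graded_part (DY_cochains C D F U V))
       (convolution (DY_cochains C D F U V) (DY_action C D F U V W e c)) \<and>
     (\<forall>n m. \<forall>f \<in> DY_cocycles C D F (Unit (centralizer C D F)) (Unit (centralizer C D F)) n.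
        \<forall>g \<in> DY_cocycles C D F U V m.
          DY_action C D F U V W e c n m f g \<in> DY_cocycles C D F U V (n + m) \<and>
          DY_cohomology_action C D F U V W e c n m
            (DY_class C D F (Unit (centralizer C D F)) (Unit (centralizer C D F)) n f)
            (DY_class C D F U V m g)
          = DY_class C D F U V (n + m) (DY_action C D F U V W e c n m f g)) \<and>
     graded_module K
       (DY_cohomology_algebra C D F)
       (graded_part (DY_cohomology C D F (Unit (centralizer C D F)) (Unit (centralizer C D F))))
       (direct_sum (DY_cohomology C D F U V))
       (graded_part (DY_cohomology C D F U V))
       (convolution (DY_cohomology C D F U V) (DY_cohomology_action C D F U V W e c))"
proof -
  interpret monoidal_setting K C D F
    using assms(2-4) by (intro monoidal_setting.intro monoidal_setting_axioms.intro finite_strict_tensor_category.axioms)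
  note U = assms(6) and V = assms(7) and dual = assms(8)
  interpret alg: dg_action K "\<C> \<I> \<I>" "DY_differential C D F \<I> \<I>" "\<C> \<I> \<I>" "DY_differential C D F \<I> \<I>"
    "DY_product C D F \<I> \<I>"
    by (rule DY_product_dg_algebra(1))
  interpret mod: dg_action K "\<C> \<I> \<I>" "DY_differential C D F \<I> \<I>" "\<C> U V" "DY_differential C D F U V"
    "DY_action C D F U V W e c"
    by (rule DY_action_dg_action(1)[OF U V dual])
  note alg_fam = DY_product_dg_algebra(2) and mod_act = DY_action_dg_action(2)[OF U V dual]
  note unit = dg_unit_cocycle[OF alg.dg_action_axioms alg_fam]
  have cocycles: "DY_cocycles C D F \<I> \<I> = alg.A.cocycles" "DY_cocycles C D F U V = mod.M.cocycles"
    by (simp_all add: fun_eq_iff DY_cocycles_def alg.A.cocycles_def mod.M.cocycles_def)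
  have coboundaries: "DY_coboundaries C D F \<I> \<I> = alg.A.coboundaries" "DY_coboundaries C D F U V = mod.M.coboundaries"
    by (simp_all add: fun_eq_iff DY_coboundaries_def alg.A.coboundaries_def mod.M.coboundaries_def)
  have cohomology: "DY_cohomology C D F \<I> \<I> = alg.A.cohomology" "DY_cohomology C D F U V = mod.M.cohomology"
    by (simp_all add: fun_eq_iff DY_cohomology_def alg.A.cohomology_def mod.M.cohomology_def cocycles coboundaries)
  have cls: "DY_class C D F \<I> \<I> = alg.A.cohomology_class" "DY_class C D F U V = mod.M.cohomology_class"
    by (simp_all add: fun_eq_iff DY_class_def alg.A.cohomology_class_def mod.M.cohomology_class_def coboundaries)
  have acts: "DY_cohomology_action C D F U V W e c = mod.cohomology_act"
    by (simp add: fun_eq_iff DY_cohomology_action_def mod.cohomology_act_def coboundaries)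
  have algebra: "DY_algebra C D F = direct_sum_algebra (\<C> \<I> \<I>) (DY_product C D F \<I> \<I>) cochain_unit"
    by (simp add: DY_algebra_def Let_def direct_sum_algebra_def cochain_unit_def)
  have prods: "(\<lambda>n m. coset_op (\<C> \<I> \<I> (n + m)) (DY_coboundaries C D F \<I> \<I> (n + m)) (DY_product C D F \<I> \<I> n m)) = alg.cohomology_act"
    by (simp add: fun_eq_iff alg.cohomology_act_def coboundaries)
  have cohomology_algebra: "DY_cohomology_algebra C D F =
      direct_sum_algebra alg.A.cohomology alg.cohomology_act (alg.A.cohomology_class 0 cochain_unit)"
    unfolding DY_cohomology_algebra_def Let_def prods by (simp add: direct_sum_algebra_def cochain_unit_def cohomology cls)
  have cochain_module: "graded_module K (DY_algebra C D F) (graded_part (\<C> \<I> \<I>)) (direct_sum (\<C> U V)) (graded_part (\<C> U V))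
      (convolution (\<C> U V) (DY_action C D F U V W e c))"
    unfolding algebra by (rule graded_algebra_family.direct_sum_graded_module[OF alg_fam mod_act])
  have cohomology_module: "graded_module K (DY_cohomology_algebra C D F) (graded_part (DY_cohomology C D F \<I> \<I>))
      (direct_sum (DY_cohomology C D F U V)) (graded_part (DY_cohomology C D F U V))
      (convolution (DY_cohomology C D F U V) (DY_cohomology_action C D F U V W e c))"
    unfolding cohomology_algebra cohomology acts
    by (rule graded_algebra_family.direct_sum_graded_module[OF
          cohomology_graded_algebra_family[OF alg.dg_action_axioms alg_fam unit]
          cohomology_graded_action[OF alg.dg_action_axioms mod.dg_action_axioms mod_act unit]])
  show ?thesis
  proof (intro conjI allI ballI impI)
    fix n m f g assume f: "f \<in> carrier (\<C> \<I> \<I> n)" and g: "g \<in> carrier (\<C> U V m)"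
    show "DY_action C D F U V W e c n m f g \<in> carrier (\<C> U V (n + m))"
      by (rule mod.act_closed[OF f g])
    fix Xs Ys assume Xs: "Xs \<in> tuples C m" and Ys: "Ys \<in> tuples C n"
    note formula = DY_action_formula[OF U V dual f g Xs Ys]
    show "DY_action C D F U V W e c n m f g (Xs @ Ys) =
        alt_sign (component_space D F U V (Xs @ Ys)) (m * n)
          ((Id D (tens_F D F Xs) \<star>\<^bsub>D\<^esub> f Ys \<star>\<^bsub>D\<^esub> Id D (fst V)) \<cdot>\<^bsub>D\<^esub>
           (Id D (tens_F D F Xs) \<star>\<^bsub>D\<^esub> snd V (tens_list C Ys)) \<cdot>\<^bsub>D\<^esub>
           (g Xs \<star>\<^bsub>D\<^esub> Id D (tens_F D F Ys)))"
      by (rule formula(1))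
    show "DY_action C D F U V W e c n m f g (Xs @ Ys) =
        alt_sign (component_space D F U V (Xs @ Ys)) (m * n)
          ((Id D (tens_F D F Xs) \<star>\<^bsub>D\<^esub> snd V (tens_list C Ys)) \<cdot>\<^bsub>D\<^esub> (g Xs \<star>\<^bsub>D\<^esub> f Ys))"
      if "(f Ys \<star>\<^bsub>D\<^esub> Id D (fst V)) \<cdot>\<^bsub>D\<^esub> snd V (tens_list C Ys) =
        snd V (tens_list C Ys) \<cdot>\<^bsub>D\<^esub> (Id D (fst V) \<star>\<^bsub>D\<^esub> f Ys)"
      using that by (rule formula(2))
  next
    fix n m f g assume f: "f \<in> DY_cocycles C D F \<I> \<I> n" and g: "g \<in> DY_cocycles C D F U V m"
    show "DY_action C D F U V W e c n m f g \<in> DY_cocycles C D F U V (n + m)"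
      using f g unfolding cocycles by (rule mod.act_cocycles)
    show "DY_cohomology_action C D F U V W e c n m (DY_class C D F \<I> \<I> n f) (DY_class C D F U V m g) =
        DY_class C D F U V (n + m) (DY_action C D F U V W e c n m f g)"
      using f g unfolding cocycles cls acts by (rule mod.cohomology_act_class)
  qed (rule cochain_module cohomology_module)+
qed

end
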